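(* The expected logarithmic energy of the points coming from the harmonic ensemble $\mathfrak{X}^{(N)}$, $N=d_k$, satisfies, as $N\to\infty$ (i.e. $k\to\infty$), $$\mathbb{E}_{x\sim\mathfrak{X}^{(N)}}[E_{\log}(x)]=W_{\log}(\mathrm{Gr}_{2,4})N^2-\frac14N\log N+C_{\log}N+o(N),$$ where $$C_{\log}=\frac{1+2G}{\pi}+\frac14-\gamma+\frac{\log2}{4},$$ $G$ is Catalan's constant and $\gamma$ is the Euler–Mascheroni constant.
   Context: $\mathrm{Gr}_{2,4}$ is the Grassmannian of $2$-dimensional linear subspaces of $\mathbb{R}^4$, with its $\mathrm{O}(4)$-invariant Borel probability measure $\sigma$. For $P,Q\in\mathrm{Gr}_{2,4}$ the principal angles $0\le\theta_1\le\theta_2\le\pi/2$ are such that $\cos\theta_1\ge\cos\theta_2$ are the singular values of $A^{T}B$, where $A,B$ are $4\times2$ matrices with orthonormal columns spanning $P$ and $Q$. Put $\xi_\pm(P,Q)=\cos(\theta_1\pm\theta_2)$ and $d_c(P,Q)=\sqrt{\sin^2\theta_1+\sin^2\theta_2}=\sqrt{1-\xi_+\xi_-}$. For a finite set $x=\{P_1,\dots,P_N\}$, $E_{\log}(x)=-\sum_{i\ne j}\log d_c(P_i,P_j)$; $W_{\log}(\mathrm{Gr}_{2,4})=\inf_\mu\iint-\log d_c(P,Q)\,d\mu(P)d\mu(Q)$ over Borel probability measures $\mu$ on $\mathrm{Gr}_{2,4}$. Harmonic ensemble. For integers $\tau_1\ge\tau_2\ge0$ and $\tau=(\tau_1,\tau_2)$,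 $|\tau|=\tau_1+\tau_2$, let $d_\tau=(2-\delta_{0,\tau_2})(2(\tau_1+\tau_2)+1)(2(\tau_1-\tau_2)+1)$ and $P_\tau(x,y)=\frac12(P_{\tau_1+\tau_2}(x)P_{\tau_1-\tau_2}(y)+P_{\tau_1+\tau_2}(y)P_{\tau_1-\tau_2}(x))$, with $P_n$ (integer index) the Legendre polynomials. For $k\ge1$, $\mathcal{K}_k(P,Q)=\sum_{|\tau|\le k}d_\tau P_\tau(\xi_+(P,Q),\xi_-(P,Q))$ is the reproducing kernel of a subspace $H_k\subset L^2(\mathrm{Gr}_{2,4},\sigma)$ of dimension $d_k=\sum_{|\tau|\le k}d_\tau=\frac12(k+1)^2(k^2+2k+2)$. For $N=d_k$, $\mathfrak{X}^{(N)}$ is the determinantal point process of $N$ points on $\mathrm{Gr}_{2,4}$ with kernel $\mathcal{K}_k$ with respect to $\sigma$, i.e. with joint intensities $\rho_m(P_1,\dots,P_m)=\det(\mathcal{K}_k(P_i,P_j))_{1\le i,j\le m}$. In particular $\mathbb{E}_{x\sim\mathfrak{X}^{(N)}}[E_{\log}(x)]=-\iint(\mathcal{K}_k(P,P)\mathcal{K}_k(Q,Q)-\mathcal{K}_k(P,Q)^2)\log d_c(P,Q)\,d\sigma(P)\,d\sigma(Q)$. *)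

theory Defs
  imports
    "HOL-Probability.Probability"
    "HOL-Computational_Algebra.Polynomial"
    "Jordan_Normal_Form.Determinant"
begin

section \<open>The Grassmannian of planes in four-space\<close>

definition Gr24 :: "(real^4) set set" where
  "Gr24 = {P. subspace P \<and> dim P = 2}"

text \<open>
  For a linear subspace, \<^const>\<open>closest_point\<close> is the orthogonal projection onto it.  The
  Grassmannian carries the topology for which identifying a plane with the matrix of its
  orthogonal projection is a homeomorphism onto the image; these are the Borel sets.
\<close>

definition proj_matrix :: "(real^4) set \<Rightarrow> real^4^4" where
  "proj_matrix P = matrix (closest_point P)"

definition Gr24_borel :: "(real^4) set measure" where
  "Gr24_borel = vimage_algebra Gr24 proj_matrix borel"

definition borel_prob_Gr24 :: "(real^4) set measure \<Rightarrow> bool" where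
  "borel_prob_Gr24 \<mu> \<longleftrightarrow> prob_space \<mu> \<and> sets \<mu> = sets Gr24_borel"

text \<open>
  This characterises exactly one measure, since \<open>O(4)\<close> is compact and acts transitively.
\<close>

definition invariant_prob_Gr24 :: "(real^4) set measure \<Rightarrow> bool" where
  "invariant_prob_Gr24 \<sigma> \<longleftrightarrow> borel_prob_Gr24 \<sigma> \<and>
     (\<forall>U. orthogonal_transformation U \<longrightarrow> distr \<sigma> Gr24_borel (\<lambda>P. U ` P) = \<sigma>)"


section \<open>Principal angles and chordal distance\<close>

text \<open>A matrix of type \<open>real^2^4\<close> has four rows and two columns.\<close>

definition orthonormal_frame :: "(real^4) set \<Rightarrow> real^2^4 \<Rightarrow> bool" where
  "orthonormal_frame P A \<longleftrightarrow>
     transpose A ** A = Finite_Cartesian_Product.mat 1 \<and> span (columns A) = P"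

text \<open>
  The singular values of \<open>M\<close> are the square roots of the eigenvalues of \<open>M\<^sup>T M\<close>, repeated
  according to multiplicity, i.e. of the roots of its characteristic polynomial.
\<close>

definition singular_values :: "real^2^2 \<Rightarrow> real \<Rightarrow> real \<Rightarrow> bool" where
  "singular_values M s1 s2 \<longleftrightarrow> s1 \<ge> s2 \<and> s2 \<ge> 0 \<and>
     (\<forall>t. Determinants.det (Finite_Cartesian_Product.mat t - transpose M ** M)
            = (t - s1\<^sup>2) * (t - s2\<^sup>2))"

text \<open>
  The singular values of \<open>A\<^sup>T B\<close> do not depend on the frames \<open>A\<close>, \<open>B\<close> chosen, so the
  description below is definite for \<open>P, Q \<in> Gr24\<close>.
\<close>

definition principal_angles :: "(real^4) set \<Rightarrow> (real^4) set \<Rightarrow> real \<times> real" where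
  "principal_angles P Q = (THE (\<theta>1, \<theta>2). 0 \<le> \<theta>1 \<and> \<theta>1 \<le> \<theta>2 \<and> \<theta>2 \<le> pi / 2 \<and>
     (\<exists>A B. orthonormal_frame P A \<and> orthonormal_frame Q B \<and>
        singular_values (transpose A ** B) (cos \<theta>1) (cos \<theta>2)))"

definition xi_plus :: "(real^4) set \<Rightarrow> (real^4) set \<Rightarrow> real" where
  "xi_plus P Q = (case principal_angles P Q of (\<theta>1, \<theta>2) \<Rightarrow> cos (\<theta>1 + \<theta>2))"

definition xi_minus :: "(real^4) set \<Rightarrow> (real^4) set \<Rightarrow> real" where
  "xi_minus P Q = (case principal_angles P Q of (\<theta>1, \<theta>2) \<Rightarrow> cos (\<theta>1 - \<theta>2))"

definition chordal_dist :: "(real^4) set \<Rightarrow> (real^4) set \<Rightarrow> real" where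
  "chordal_dist P Q =
     (case principal_angles P Q of (\<theta>1, \<theta>2) \<Rightarrow> sqrt ((sin \<theta>1)\<^sup>2 + (sin \<theta>2)\<^sup>2))"


section \<open>Logarithmic energies\<close>

definition log_energy :: "(real^4) set set \<Rightarrow> real" where
  "log_energy x = - (\<Sum>P\<in>x. \<Sum>Q\<in>x - {P}. ln (chordal_dist P Q))"

text \<open>
  For the continuous energy the kernel has to be infinite on the diagonal, so that e.g. point
  masses have infinite energy; \<^term>\<open>ln (0::real) = 0\<close> would give them energy zero.  As the chordal
  distance is at most \<^term>\<open>sqrt (2::real)\<close>, the negative part of the kernel is bounded, and the
  energy is a well-defined element of \<open>(-\<infinity>, \<infinity>]\<close>.
\<close>

definition log_kernel :: "(real^4) set \<Rightarrow> (real^4) set \<Rightarrow> ereal" where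
  "log_kernel P Q =
     (if chordal_dist P Q = 0 then \<infinity> else ereal (- ln (chordal_dist P Q)))"

definition continuous_log_energy :: "(real^4) set measure \<Rightarrow> ereal" where
  "continuous_log_energy \<mu> =
     enn2ereal (\<integral>\<^sup>+ (P, Q). e2ennreal (log_kernel P Q) \<partial>(\<mu> \<Otimes>\<^sub>M \<mu>))
   - enn2ereal (\<integral>\<^sup>+ (P, Q). e2ennreal (- log_kernel P Q) \<partial>(\<mu> \<Otimes>\<^sub>M \<mu>))"

definition W_log :: real where
  "W_log = real_of_ereal (INF \<mu>\<in>{\<mu>. borel_prob_Gr24 \<mu>}. continuous_log_energy \<mu>)"


section \<open>The kernel of the harmonic ensemble\<close>

text \<open>Legendre polynomials, by Rodrigues' formula.\<close>

definition legendre :: "nat \<Rightarrow> real \<Rightarrow> real" where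
  "legendre n x = poly ((pderiv ^^ n) ([:-1, 0, 1:] ^ n)) x / (2 ^ n * fact n)"

text \<open>Only used for \<open>\<tau>1 \<ge> \<tau>2\<close>, where the subtraction of natural numbers is exact.\<close>

definition d_tau :: "nat \<times> nat \<Rightarrow> nat" where
  "d_tau = (\<lambda>(\<tau>1, \<tau>2).
     (2 - (if \<tau>2 = 0 then 1 else 0)) * (2 * (\<tau>1 + \<tau>2) + 1) * (2 * (\<tau>1 - \<tau>2) + 1))"

definition P_tau :: "nat \<times> nat \<Rightarrow> real \<Rightarrow> real \<Rightarrow> real" where
  "P_tau = (\<lambda>(\<tau>1, \<tau>2) x y.
     (legendre (\<tau>1 + \<tau>2) x * legendre (\<tau>1 - \<tau>2) y
    + legendre (\<tau>1 + \<tau>2) y * legendre (\<tau>1 - \<tau>2) x) / 2)"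

definition taus :: "nat \<Rightarrow> (nat \<times> nat) set" where
  "taus k = {(\<tau>1, \<tau>2). \<tau>2 \<le> \<tau>1 \<and> \<tau>1 + \<tau>2 \<le> k}"

definition harmonic_kernel :: "nat \<Rightarrow> (real^4) set \<Rightarrow> (real^4) set \<Rightarrow> real" where
  "harmonic_kernel k P Q =
     (\<Sum>\<tau>\<in>taus k. real (d_tau \<tau>) * P_tau \<tau> (xi_plus P Q) (xi_minus P Q))"

definition harmonic_dim :: "nat \<Rightarrow> nat" where
  "harmonic_dim k = (\<Sum>\<tau>\<in>taus k. d_tau \<tau>)"


section \<open>Determinantal point processes\<close>

text \<open>
  Simple point processes on the (compact) Grassmannian are laws of random finite subsets, the
  events being generated by the numbers of points in Borel sets.
\<close>

definition config_space :: "(real^4) set set measure" where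
  "config_space = sigma {x. finite x \<and> x \<subseteq> Gr24}
     {{x. finite x \<and> x \<subseteq> Gr24 \<and> card (x \<inter> A) = n} | A n. A \<in> sets Gr24_borel}"

definition point_process :: "(real^4) set set measure \<Rightarrow> bool" where
  "point_process \<X> \<longleftrightarrow> prob_space \<X> \<and> sets \<X> = sets config_space"

definition joint_intensity ::
    "(real^4) set measure \<Rightarrow> (real^4) set set measure \<Rightarrow> nat \<Rightarrow> ((nat \<Rightarrow> (real^4) set) \<Rightarrow> real) \<Rightarrow> bool" where
  "joint_intensity \<sigma> \<X> m \<rho> \<longleftrightarrow>
     (\<forall>A. (\<forall>i<m. A i \<in> sets Gr24_borel) \<longrightarrow> disjoint_family_on A {..<m} \<longrightarrow>
        (\<integral>x. (\<Prod>i<m. real (card (x \<inter> A i))) \<partial>\<X>)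
      = (LINT p:(\<Pi>\<^sub>E i\<in>{..<m}. A i)|(\<Pi>\<^sub>M i\<in>{..<m}. \<sigma>). \<rho> p))"

definition harmonic_ensemble ::
    "(real^4) set measure \<Rightarrow> nat \<Rightarrow> (real^4) set set measure \<Rightarrow> bool" where
  "harmonic_ensemble \<sigma> k \<X> \<longleftrightarrow> point_process \<X> \<and>
     (AE x in \<X>. card x = harmonic_dim k) \<and>
     (\<forall>m. joint_intensity \<sigma> \<X> m
        (\<lambda>p. Determinant.det (Matrix.mat m m (\<lambda>(i, j). harmonic_kernel k (p i) (p j)))))"


section \<open>Catalan's constant\<close>

definition catalan_const :: real where
  "catalan_const = (\<Sum>n. (-1) ^ n / (2 * real n + 1)\<^sup>2)"

end

theory Submission
  imports Defs "HOL-Real_Asymp.Real_Asymp"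
begin

text \<open>
  A plane with orthonormal basis \<open>g, h\<close> is described, up to a common sign, by the pair of unit vectors in
  \<open>\<real>\<^sup>3\<close> formed by the self-dual and anti-self-dual parts of \<open>g \<and> h\<close>; for two planes, the inner products
  \<open>x, y\<close> of these vectors are \<open>\<xi>\<^sub>+, \<xi>\<^sub>-\<close> up to order and a common sign.  By invariance and Archimedes'
  theorem, \<open>(x, y)\<close> is uniform on \<open>[-1, 1]\<^sup>2\<close> under \<open>\<sigma>\<close>.  As \<open>(xy) ^ m\<close> is a positive definite kernel,
  \<open>\<sigma>\<close> minimises the energy of \<open>- ln (1 - xy) / 2\<close>, and the expected energy is \<open>W N\<^sup>2\<close> plus half the integral
  of \<open>K\<^sup>2 ln (1 - xy)\<close>.

  The kernel factorises: \<open>K = (S x S y + S (-x) S (-y)) / 2\<close> with \<open>S\<close> the Christoffel--Darboux kernel of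
  the first \<open>n = k + 1\<close> Legendre polynomials, with one argument 1.  The cross term is negligible, and \<open>S\<^sup>2\<close> is, up to its mass \<open>2 n\<^sup>2\<close> (in \<open>dx\<close>), a
  probability density concentrating at 1 on the scale \<open>n\<^sup>-\<^sup>2\<close>.  The rescaled laws of \<open>1 - x\<close> converge in the
  sense of Laplace transforms, so the expectation of \<open>ln (1 - xy)\<close>, which is asymptotically that of
  \<open>ln ((1 - x) + (1 - y))\<close>, follows from Frullani's formula; the limiting constant produces \<open>\<gamma>\<close> and
  Catalan's constant.
\<close>

no_notation vec_index (infixl "$" 100)
hide_const (open) module.smult
no_notation Matrix.scalar_prod (infix "\<bullet>" 70)
hide_const (open) Matrix.orthogonal

section \<open>Legendre polynomials\<close>

text \<open>Laplace transforms converging at each fixed argument are not enough: the Frullani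
  integral needs bounds uniform in \<open>n\<close> at both ends. The rescaled density decays only
  like s^(-3/2), so the limit law has infinite mean and a first moment is of no help at 0. The tail
  bound of order R^(-1/2) comes from the reproducing property instead, tested on normalised Fejer
  polynomials; at infinity the bound |\<open>cd_scaled\<close>| \<le> 1 suffices.

  Squaring the limiting Bessel series by Vandermonde's identity produces Catalan numbers, up to
  powers of 4 the moments of (sin x)^2 under the density (4 / pi) (cos x)^2; so the limit transform
  is 1 - A (1 / (2 u)) with A the transform of 2 (sin x)^2. Since v \<mapsto> 1 / (2 v) preserves dv
  / v, its square unfolds to 1 - 2 A + A^2, that is, to logarithmic means for one and for two
  independent angles. A cutoff before and one after the inversion each cost -\<gamma>; Catalan's
  constant is the integral of arsinh (sin x).

  Joint intensities are prescribed on products of disjoint sets, so the expected energy is reached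
  by tiling the off-diagonal pairs with countably many rectangles.\<close>

definition legendre_poly :: "nat \<Rightarrow> real poly" where
  "legendre_poly n = smult (1 / (2 ^ n * fact n)) ((pderiv ^^ n) ([:-1, 0, 1:] ^ n))"

lemma poly_legendre_poly: "poly (legendre_poly n) x = legendre n x"
  by (simp add: legendre_poly_def legendre_def)

lemma funpow_pderiv_smult: "(pderiv ^^ n) (smult c p) = smult c ((pderiv ^^ n) p)"
  by (induction n) (auto simp: pderiv_smult)

lemma funpow_pderiv_add: "(pderiv ^^ n) (p + q) = (pderiv ^^ n) p + (pderiv ^^ n) q"
  by (induction n) (auto simp: pderiv_add)

text \<open>Leibniz's rule: the factor \<open>[:0, 1:]\<close> has no nonzero derivative beyond the
  first, so two terms survive.\<close>

lemma funpow_pderiv_times_X: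
  fixes f :: "real poly"
  shows "(pderiv ^^ Suc m) ([:0, 1:] * f) = [:0, 1:] * (pderiv ^^ Suc m) f + smult (real (Suc m)) ((pderiv ^^ m) f)"
proof (induction m)
  case 0
  show ?case by (simp add: pderiv_mult pderiv_pCons)
next
  case (Suc m)
  have "(pderiv ^^ Suc (Suc m)) ([:0, 1:] * f) = pderiv ([:0, 1:] * (pderiv ^^ Suc m) f + smult (real (Suc m)) ((pderiv ^^ m) f))"
    using Suc by simp
  also have "\<dots> = [:0, 1:] * (pderiv ^^ Suc (Suc m)) f + smult (real (Suc (Suc m))) ((pderiv ^^ Suc m) f)"
    by (rule poly_ext) (simp add: pderiv_add pderiv_mult pderiv_smult pderiv_pCons algebra_simps)
  finally show ?case .
qed

lemma pderiv_quad_power: "pderiv ([:-1, 0, 1::real:] ^ Suc l) = smult (2 * real (Suc l)) ([:0, 1:] * [:-1, 0, 1:] ^ l)"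
proof -
  have "pderiv [:-1, 0, 1::real:] = smult 2 [:0,1:]" by (simp add: pderiv_pCons)
  thus ?thesis by (subst pderiv_power_Suc) (simp add: mult.commute)
qed

text \<open>The first of the l + 2 derivatives in Rodrigues' formula turns (x^2 - 1)^(l + 1) into 2
  (l + 1) x (x^2 - 1)^l; Leibniz's rule for the factor x handles the other l + 1.\<close>

lemma legendre_poly_deriv_Suc:
  "pderiv (legendre_poly (Suc l)) = [:0, 1:] * pderiv (legendre_poly l) + smult (real (Suc l)) (legendre_poly l)"
proof -
  define u where "u = [:-1, 0, 1::real:] ^ l"
  have "(pderiv ^^ Suc (Suc l)) ([:-1, 0, 1::real:] ^ Suc l) = (pderiv ^^ Suc l) (smult (2 * real (Suc l)) ([:0, 1:] * u))"
    unfolding u_def by (subst funpow_Suc_right) (simp only: o_apply pderiv_quad_power)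
  also have "\<dots> = smult (2 * real (Suc l)) ([:0, 1:] * (pderiv ^^ Suc l) u + smult (real (Suc l)) ((pderiv ^^ l) u))"
    by (simp only: funpow_pderiv_smult funpow_pderiv_times_X)
  finally have *: "(pderiv ^^ Suc (Suc l)) ([:-1, 0, 1::real:] ^ Suc l) = \<dots>" .
  have "pderiv (legendre_poly (Suc l)) = smult (1 / (2 ^ Suc l * fact (Suc l))) ((pderiv ^^ Suc (Suc l)) ([:-1, 0, 1::real:] ^ Suc l))"
    by (simp add: legendre_poly_def pderiv_smult del: power_Suc fact_Suc)
  also have "\<dots> = smult (1 / (2 ^ l * fact l)) ([:0, 1:] * (pderiv ^^ Suc l) u + smult (real (Suc l)) ((pderiv ^^ l) u))"
    unfolding * by (simp add: divide_simps del: of_nat_Suc)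
  also have "\<dots> = [:0, 1:] * pderiv (legendre_poly l) + smult (real (Suc l)) (legendre_poly l)"
    by (simp add: legendre_poly_def pderiv_smult u_def smult_add_right mult.commute del: of_nat_Suc)
  finally show ?thesis .
qed

text \<open>Two derivatives of (x^2 - 1)^(k + 2) produce a factor x^2. Writing it as (x^2 - 1) + 1
  leaves a combination of (x^2 - 1)^(k + 1) and (x^2 - 1)^k, whose derivatives of order k + 1 are
  multiples of P_(k+1) and of the derivative of P_k.\<close>

lemma legendre_poly_deriv_Suc_Suc:
  "pderiv (legendre_poly (Suc (Suc k))) = smult (2 * real k + 3) (legendre_poly (Suc k)) + pderiv (legendre_poly k)"
proof -
  define u where "u = [:-1, 0, 1::real:] ^ k"
  define c where "c = 2 * real (Suc (Suc k))"
  have X: "[:0, 1::real:] * [:0, 1:] = [:-1, 0, 1:] + 1" by (simp add: one_pCons)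
  have "pderiv (pderiv ([:-1, 0, 1::real:] ^ Suc (Suc k))) = smult c (pderiv ([:0, 1:] * [:-1, 0, 1:] ^ Suc k))"
    by (subst pderiv_quad_power) (simp only: pderiv_smult c_def)
  also have "pderiv ([:0, 1:] * [:-1, 0, 1:] ^ Suc k) = [:-1, 0, 1:] ^ Suc k + [:0,1:] * smult (2 * real (Suc k)) ([:0, 1:] * u)"
    by (simp only: pderiv_mult pderiv_quad_power u_def) (simp add: pderiv_pCons)
  also have "[:0,1:] * smult (2 * real (Suc k)) ([:0, 1:] * u) = smult (2 * real (Suc k)) (([:0,1:] * [:0, 1:]) * u)"
    by (simp only: mult_smult_right mult.assoc)
  also have "\<dots> = smult (2 * real (Suc k)) ([:-1, 0, 1:] ^ Suc k + u)"
    unfolding X by (simp add: u_def algebra_simps)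
  finally have "pderiv (pderiv ([:-1, 0, 1::real:] ^ Suc (Suc k))) =
     smult c (smult (2 * real k + 3) ([:-1, 0, 1:] ^ Suc k) + smult (2 * real (Suc k)) u)"
    by (simp only:) (rule poly_ext, simp add: algebra_simps)
  hence "(pderiv ^^ Suc (Suc (Suc k))) ([:-1, 0, 1::real:] ^ Suc (Suc k)) =
     (pderiv ^^ Suc k) (smult c (smult (2 * real k + 3) ([:-1, 0, 1:] ^ Suc k) + smult (2 * real (Suc k)) u))"
    by (simp add: funpow_swap1 del: power_Suc)
  also have "\<dots> = smult c (smult (2 * real k + 3) ((pderiv ^^ Suc k) ([:-1, 0, 1:] ^ Suc k)) + smult (2 * real (Suc k)) ((pderiv ^^ Suc k) u))"
    by (simp only: funpow_pderiv_smult funpow_pderiv_add)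
  finally have *: "(pderiv ^^ Suc (Suc (Suc k))) ([:-1, 0, 1::real:] ^ Suc (Suc k)) = \<dots>" .
  have "pderiv (legendre_poly (Suc (Suc k))) = smult (1 / (2 ^ Suc (Suc k) * fact (Suc (Suc k)))) ((pderiv ^^ Suc (Suc (Suc k))) ([:-1, 0, 1::real:] ^ Suc (Suc k)))"
    by (simp add: legendre_poly_def pderiv_smult del: power_Suc fact_Suc)
  also have "\<dots> = smult (1 / (2 ^ Suc k * fact (Suc k))) (smult (2 * real k + 3) ((pderiv ^^ Suc k) ([:-1, 0, 1:] ^ Suc k)) + smult (2 * real (Suc k)) ((pderiv ^^ Suc k) u))"
    unfolding * c_def by (simp add: divide_simps mult_ac del: of_nat_Suc)
  also have "\<dots> = smult (2 * real k + 3) (legendre_poly (Suc k)) + pderiv (legendre_poly k)"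
    by (simp add: legendre_poly_def pderiv_smult u_def smult_add_right field_simps del: of_nat_Suc)
  finally show ?thesis .
qed

lemma legendre_poly_0 [simp]: "legendre_poly 0 = 1"
  by (simp add: legendre_poly_def)

lemma legendre_poly_1: "legendre_poly (Suc 0) = [:0, 1:]"
  by (simp add: legendre_poly_def pderiv_pCons)

abbreviation legendre' :: "nat \<Rightarrow> real \<Rightarrow> real" where
  "legendre' n x \<equiv> poly (pderiv (legendre_poly n)) x"

lemma legendre'_Suc: "legendre' (Suc l) x = x * legendre' l x + real (Suc l) * legendre l x"
  by (simp add: legendre_poly_deriv_Suc poly_legendre_poly del: of_nat_Suc)

text \<open>Eliminates the derivative of P_(l+2) between the two recurrences above. Together with
  \<open>legendre'_Suc\<close> it is a first-order linear system from which the closed forms,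
  Bonnet's recurrence and the differential equation follow.\<close>

lemma legendre'_pred: "legendre' l x = x * legendre' (Suc l) x - real (Suc l) * legendre (Suc l) x"
  using legendre'_Suc[of "Suc l" x] arg_cong[OF legendre_poly_deriv_Suc_Suc[of l], of "\<lambda>p. poly p x"]
  by (simp add: poly_legendre_poly algebra_simps)

lemma legendre_deriv: "(legendre n has_real_derivative legendre' n x) (at x within A)"
  using has_field_derivative_at_within[OF poly_DERIV[of "legendre_poly n" x]] by (simp add: poly_legendre_poly)

lemma legendre'_Suc_closed: "(1 - x\<^sup>2) * legendre' (Suc k) x = real (Suc k) * (legendre k x - x * legendre (Suc k) x)"
proof -
  have "legendre' (Suc k) x = x * (x * legendre' (Suc k) x - real (Suc k) * legendre (Suc k) x) + real (Suc k) * legendre k x"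
    using legendre'_Suc[of k x] legendre'_pred[of k x] by simp
  thus ?thesis by (simp add: power2_eq_square algebra_simps)
qed

lemma legendre'_closed: "(1 - x\<^sup>2) * legendre' k x = real (Suc k) * (x * legendre k x - legendre (Suc k) x)"
proof -
  have "legendre' k x = x * (x * legendre' k x + real (Suc k) * legendre k x) - real (Suc k) * legendre (Suc k) x"
    using legendre'_Suc[of k x] legendre'_pred[of k x] by simp
  thus ?thesis by (simp add: power2_eq_square algebra_simps)
qed

lemma legendre_0 [simp]: "legendre 0 x = 1"
  by (simp add: legendre_def)

lemma legendre_Suc_0: "legendre (Suc 0) x = x"
  by (simp flip: poly_legendre_poly add: legendre_poly_1)

text \<open>Equates the two closed forms of (1 - x^2) times the derivative of P_(k+1).\<close>

lemma legendre_Bonnet: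
  "real (k + 2) * legendre (k + 2) x = (2 * real k + 3) * x * legendre (k + 1) x - real (k + 1) * legendre k x"
  using legendre'_closed[of x "Suc k"] legendre'_Suc_closed[of x k] by (simp add: algebra_simps)

lemma legendre_minus: "legendre n (- x) = (- 1) ^ n * legendre n x"
proof (induction n rule: less_induct)
  case (less n)
  consider "n = 0" | "n = 1" | k where "n = k + 2"
    by (metis One_nat_def add_2_eq_Suc' not0_implies_Suc)
  thus ?case
  proof cases
    case (3 k)
    have "real (k + 2) * legendre n (- x) = (-1) ^ k * ((2 * real k + 3) * x * legendre (k + 1) x - real (k + 1) * legendre k x)"
      unfolding 3 legendre_Bonnet[of k "-x"] using less.IH[of k] less.IH[of "k+1"] 3 by (simp add: algebra_simps)
    also have "\<dots> = real (k + 2) * ((-1) ^ n * legendre n x)"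
      unfolding legendre_Bonnet[of k x, symmetric] 3 by simp
    finally have "real (k + 2) * legendre n (- x) = real (k + 2) * ((-1) ^ n * legendre n x)" .
    thus ?thesis by simp
  qed (auto simp: legendre_Suc_0)
qed

lemma legendre_at_1 [simp]: "legendre n 1 = 1"
proof (induction n)
  case (Suc n)
  have "real (Suc n) * legendre (Suc n) 1 = real (Suc n) * legendre n 1"
    using legendre'_Suc[of n 1] legendre'_pred[of n 1] by simp
  with Suc show ?case by (simp del: of_nat_Suc)
qed simp

lemma legendre_at_minus_1 [simp]: "legendre n (-1) = (-1) ^ n"
  using legendre_minus[of n 1] by simp

text \<open>Differentiates the closed form of (1 - x^2) P_n' and removes the derivative of P_(n-1)
  with \<open>legendre'_pred\<close>.\<close>

lemma legendre_ODE: "(1 - x\<^sup>2) * poly (pderiv (pderiv (legendre_poly n))) x = 2 * x * legendre' n x - real n * real (n + 1) * legendre n x"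
proof (cases n)
  case (Suc k)
  have "poly (pderiv ([:1, 0, -1:] * pderiv (legendre_poly n))) x = poly (pderiv (smult (real n) (legendre_poly k - [:0,1:] * legendre_poly n))) x"
    by (rule arg_cong[where f = "\<lambda>p. poly (pderiv p) x"], rule poly_ext)
       (use legendre'_Suc_closed[of _ k] in \<open>auto simp: Suc poly_legendre_poly power2_eq_square algebra_simps\<close>)
  hence "(1 - x\<^sup>2) * poly (pderiv (pderiv (legendre_poly n))) x - 2 * x * legendre' n x =
      real n * (legendre' k x - legendre n x - x * legendre' n x)"
    by (simp add: pderiv_mult pderiv_smult pderiv_diff pderiv_add pderiv_minus pderiv_pCons poly_legendre_poly power2_eq_square algebra_simps)
  also have "\<dots> = real n * (- real n * legendre n x - legendre n x)"
    unfolding legendre'_pred[of k x] using Suc by (simp add: algebra_simps)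
  finally show ?thesis by (simp add: algebra_simps)
qed (simp add: pderiv_1)

text \<open>Sonin's argument: \<open>P\<^sup>2 + (1 - x\<^sup>2) P'\<^sup>2 / (n (n + 1))\<close> is increasing on \<open>[0, 1]\<close>.\<close>

lemma legendre_abs_le_1:
  assumes "\<bar>x\<bar> \<le> 1"
  shows "\<bar>legendre n x\<bar> \<le> 1"
proof (cases "n = 0")
  case False
  have main: "(legendre n x)\<^sup>2 \<le> 1" if x: "0 \<le> x" "x \<le> 1" for x
  proof -
    define c where "c = real n * real (n + 1)"
    have c: "c > 0" using False by (simp add: c_def)
    define f where "f = (\<lambda>x. (legendre n x)\<^sup>2 + (1 - x\<^sup>2) * (legendre' n x)\<^sup>2 / c)"
    have "f x \<le> f 1"
    proof (rule DERIV_nonneg_imp_nondecreasing[OF x(2)])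
      fix y assume y: "x \<le> y" "y \<le> 1"
      let ?P = "legendre n y" and ?P' = "legendre' n y" and ?P'' = "poly (pderiv (pderiv (legendre_poly n))) y"
      have "(f has_real_derivative (2 * ?P * ?P' + ((-2 * y) * ?P'\<^sup>2 + (1 - y\<^sup>2) * (2 * ?P' * ?P'')) / c)) (at y)"
        unfolding f_def using c
        by (auto intro!: derivative_eq_intros legendre_deriv poly_DERIV simp: field_simps)
      also have "2 * ?P * ?P' + ((-2 * y) * ?P'\<^sup>2 + (1 - y\<^sup>2) * (2 * ?P' * ?P'')) / c
        = 2 * ?P * ?P' + ((-2 * y) * ?P'\<^sup>2 + 2 * ?P' * ((1 - y\<^sup>2) * ?P'')) / c" by (simp add: algebra_simps)
      also have "\<dots> = 2 * y * ?P'\<^sup>2 / c"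
        unfolding legendre_ODE c_def[symmetric] using c by (simp add: field_simps power2_eq_square)
      finally show "\<exists>D. (f has_real_derivative D) (at y) \<and> D \<ge> 0"
        using c y x by (intro exI[of _ "2 * y * ?P'\<^sup>2 / c"] conjI) auto
    qed
    moreover have "f 1 = 1" by (simp add: f_def)
    moreover have "(legendre n x)\<^sup>2 \<le> f x"
      using c x by (simp add: f_def power_le_one abs_square_le_1)
    ultimately show ?thesis by simp
  qed
  have "(legendre n x)\<^sup>2 = (legendre n \<bar>x\<bar>)\<^sup>2"
    using legendre_minus[of n x] by (auto simp: abs_if power_mult_distrib simp flip: power_mult)
  with main[of "\<bar>x\<bar>"] assms show ?thesis by (simp flip: abs_square_le_1)
qed simp

section \<open>Integration over [-1, 1] and orthogonality of the Legendre polynomials\<close>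

definition pint :: "real poly \<Rightarrow> real" where
  "pint p = integral {-1..1} (poly p)"

lemma poly_integrable: "poly p integrable_on {a..b::real}"
  by (intro integrable_continuous_interval continuous_at_imp_continuous_on ballI poly_isCont)

lemma pint_add: "pint (p + q) = pint p + pint q"
  unfolding pint_def poly_add by (intro integral_add poly_integrable)

lemma pint_diff: "pint (p - q) = pint p - pint q"
  unfolding pint_def poly_diff by (intro integral_diff poly_integrable)

lemma pint_smult: "pint (smult c p) = c * pint p"
  unfolding pint_def poly_smult by simp

lemma pint_0 [simp]: "pint 0 = 0"
  using pint_smult[of 0 0] by simp

lemma pint_nonneg: "(\<And>x. -1 \<le> x \<Longrightarrow> x \<le> 1 \<Longrightarrow> poly p x \<ge> 0) \<Longrightarrow> pint p \<ge> 0"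
  unfolding pint_def by (intro integral_nonneg poly_integrable) auto

lemma pint_pderiv: "pint (pderiv p) = poly p 1 - poly p (-1)"
  unfolding pint_def
  by (intro integral_unique fundamental_theorem_of_calculus)
     (auto simp: poly_DERIV simp flip: has_real_derivative_iff_has_vector_derivative
           intro: has_field_derivative_at_within)

text \<open>Each derivative costs one order of vanishing at the endpoints; this is what kills the
  boundary terms in repeated integration by parts.\<close>

lemma quad_power_dvd_pderiv:
  assumes "[:-1, 0, 1::real:] ^ Suc m dvd f"
  shows "[:-1, 0, 1:] ^ m dvd pderiv f"
proof -
  from assms obtain h where h: "f = [:-1, 0, 1:] ^ Suc m * h" by (rule dvdE)
  let ?p = "[:-1, 0, 1::real:]"
  have "pderiv f = ?p ^ m * (?p * pderiv h + smult (real (Suc m)) (h * pderiv ?p))"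
    unfolding h pderiv_mult pderiv_power_Suc by (rule poly_ext) (simp add: algebra_simps)
  thus ?thesis by (simp only: dvd_triv_left)
qed

lemma quad_power_dvd_funpow_pderiv:
  "j \<le> n \<Longrightarrow> [:-1, 0, 1::real:] ^ (n - j) dvd (pderiv ^^ j) ([:-1, 0, 1:] ^ n)"
proof (induction j)
  case (Suc j)
  hence "[:-1, 0, 1::real:] ^ Suc (n - Suc j) dvd (pderiv ^^ j) ([:-1, 0, 1:] ^ n)"
    by (simp add: Suc_diff_Suc)
  thus ?case by (simp add: quad_power_dvd_pderiv del: power_Suc)
qed simp

text \<open>Integration by parts moves the derivatives onto \<open>q\<close> one at a time. Every
  boundary term vanishes because fewer than \<open>n\<close> derivatives leave a factor
  \<open>[:-1, 0, 1:]\<close>, and the degree condition makes \<open>q\<close> disappear in the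
  end.\<close>

lemma pint_rodrigues:
  "j \<le> n \<Longrightarrow> degree q < j \<or> q = 0 \<Longrightarrow> pint ((pderiv ^^ j) ([:-1, 0, 1:] ^ n) * q) = 0"
proof (induction j arbitrary: q)
  case (Suc j)
  let ?u = "(pderiv ^^ j) ([:-1, 0, 1::real:] ^ n)"
  have "[:-1, 0, 1::real:] ^ Suc (n - Suc j) dvd ?u"
    using quad_power_dvd_funpow_pderiv[of j n] Suc.prems by (simp add: Suc_diff_Suc)
  hence "[:-1, 0, 1::real:] dvd ?u" by (rule dvd_trans[rotated]) (simp only: power_Suc dvd_triv_left)
  then obtain h where h: "?u = [:-1, 0, 1:] * h" by (rule dvdE)
  have "degree (pderiv q) < j \<or> pderiv q = 0"
    using Suc.prems by (cases "degree q = 0") (auto simp: degree_pderiv pderiv_eq_0_iff)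
  hence "pint (?u * pderiv q) = 0" using Suc by auto
  moreover have "pint (pderiv (?u * q)) = 0"
    unfolding pint_pderiv by (simp add: h)
  ultimately show ?case by (simp add: pderiv_mult pint_add mult.commute)
qed auto

lemma legendre_orthogonal: "degree q < n \<or> q = 0 \<Longrightarrow> pint (legendre_poly n * q) = 0"
  using pint_rodrigues[of n n q] by (simp add: legendre_poly_def pint_smult)

lemma degree_funpow_pderiv: "degree ((pderiv ^^ j) (p :: real poly)) = degree p - j"
  by (induction j) (auto simp: degree_pderiv)

lemma degree_legendre_poly: "degree (legendre_poly n) \<le> n"
proof -
  have "degree ([:-1, 0, 1::real:] ^ n) \<le> 2 * n"
    using degree_power_le[of "[:-1, 0, 1::real:]" n] by simp
  thus ?thesis unfolding legendre_poly_def
    using degree_smult_le[of "1 / (2 ^ n * fact n)" "(pderiv ^^ n) ([:-1, 0, 1::real:] ^ n)"]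
    by (simp add: degree_funpow_pderiv)
qed

text \<open>The Christoffel--Darboux kernel of the Legendre polynomials with one argument equal to 1.\<close>

definition cd :: "nat \<Rightarrow> real poly" where
  "cd n = (\<Sum>l<n. smult (2 * real l + 1) (legendre_poly l))"

text \<open>Telescoping: by \<open>legendre_poly_deriv_Suc_Suc\<close>, (2 k + 3) P_(k+1) is the
  difference of the derivatives of P_(k+2) and P_k.\<close>

lemma cd_Suc: "cd (Suc k) = pderiv (legendre_poly (Suc k) + legendre_poly k)"
proof (induction k)
  case 0
  show ?case by (simp add: cd_def legendre_poly_1 pderiv_pCons one_pCons)
next
  case (Suc k)
  have "cd (Suc (Suc k)) = cd (Suc k) + smult (2 * real k + 3) (legendre_poly (Suc k))"
    by (simp add: cd_def algebra_simps)
  thus ?case unfolding Suc by (simp add: pderiv_add legendre_poly_deriv_Suc_Suc)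
qed

lemma degree_cd: "degree (cd (Suc k)) \<le> k"
  unfolding cd_def
  by (intro degree_sum_le) (auto intro!: order.trans[OF degree_smult_le] order.trans[OF degree_legendre_poly])

text \<open>The reproducing property at 1, by parts from \<open>cd_Suc\<close>. The derivative of
  \<open>q\<close> is orthogonal to P_k and P_(k+1); the boundary term at -1 drops out because P_k +
  P_(k+1) vanishes there, and at 1 this sum equals 2.\<close>

lemma pint_cd_mult:
  assumes "degree q \<le> k"
  shows "pint (cd (Suc k) * q) = 2 * poly q 1"
proof -
  let ?L = "legendre_poly (Suc k) + legendre_poly k"
  have d: "degree (pderiv q) < k \<or> pderiv q = 0"
    using assms by (cases "degree q = 0") (auto simp: degree_pderiv pderiv_eq_0_iff)
  have "pint (?L * pderiv q) = 0"
    using d legendre_orthogonal[of "pderiv q" k] legendre_orthogonal[of "pderiv q" "Suc k"]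
    by (auto simp: ring_distribs pint_add)
  moreover have "pint (pderiv (?L * q)) = 2 * poly q 1"
    unfolding pint_pderiv by (simp add: poly_legendre_poly)
  moreover have "pderiv (?L * q) = cd (Suc k) * q + ?L * pderiv q"
    unfolding cd_Suc pderiv_mult by (simp add: mult.commute)
  ultimately show ?thesis by (simp add: pint_add)
qed

lemma sum_odd_real: "(\<Sum>l<n. 2 * real l + 1) = (real n)\<^sup>2"
  by (induction n) (auto simp: power2_eq_square algebra_simps)

lemma cd_at_1: "poly (cd n) 1 = (real n)\<^sup>2"
  by (simp add: cd_def poly_sum poly_legendre_poly sum_odd_real)

lemma cd_at_minus_1: "(poly (cd n) (-1))\<^sup>2 = (real n)\<^sup>2"
proof -
  have "poly (cd n) (-1) = (- 1) ^ Suc n * real n"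
    by (induction n) (auto simp: cd_def poly_sum poly_legendre_poly algebra_simps)
  thus ?thesis by (simp add: power_mult_distrib flip: power_mult)
qed

lemma pint_cd_square: "pint (cd (Suc k) * cd (Suc k)) = 2 * (real (Suc k))\<^sup>2"
  by (simp add: pint_cd_mult degree_cd cd_at_1)

lemma cd_abs_le: "\<bar>x\<bar> \<le> 1 \<Longrightarrow> \<bar>poly (cd n) x\<bar> \<le> (real n)\<^sup>2"
proof -
  assume x: "\<bar>x\<bar> \<le> 1"
  have "\<bar>poly (cd n) x\<bar> \<le> (\<Sum>l<n. \<bar>(2 * real l + 1) * legendre l x\<bar>)"
    unfolding cd_def by (simp add: poly_sum poly_legendre_poly del: abs_mult)
  also have "\<dots> \<le> (\<Sum>l<n. 2 * real l + 1)"
    using legendre_abs_le_1[OF x] by (intro sum_mono) (auto simp: abs_mult intro!: mult_left_le)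
  finally show ?thesis by (simp add: sum_odd_real)
qed

lemma poly_cd_minus: "poly (cd n) (- x) = (\<Sum>l<n. (-1) ^ l * ((2 * real l + 1) * legendre l x))"
  by (simp add: cd_def poly_sum poly_legendre_poly legendre_minus algebra_simps)

text \<open>The Christoffel-Darboux formula with second argument 1, read off from
  \<open>cd_Suc\<close> and the two first-order recurrences.\<close>

lemma one_minus_times_cd: "(1 - x) * poly (cd (Suc k)) x = real (Suc k) * (legendre k x - legendre (Suc k) x)"
proof -
  have "(1 - x) * (legendre' (Suc k) x + legendre' k x) =
      (legendre' (Suc k) x - x * legendre' k x) + (legendre' k x - x * legendre' (Suc k) x)"
    by (simp add: algebra_simps)
  also have "legendre' (Suc k) x - x * legendre' k x = real (Suc k) * legendre k x"
    by (subst legendre'_Suc) simp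
  also have "legendre' k x - x * legendre' (Suc k) x = - (real (Suc k) * legendre (Suc k) x)"
    by (subst legendre'_pred) simp
  finally show ?thesis by (simp add: cd_Suc pderiv_add algebra_simps)
qed

text \<open>Away from 1 the kernel has order \<open>n\<close> instead of n^2, since dividing by 1 -
  x costs nothing when x \<le> 0. This gain makes both the cross term and the corner (-1, -1)
  negligible.\<close>

lemma cd_abs_le_neg:
  assumes "-1 \<le> x" "x \<le> 0"
  shows "\<bar>poly (cd n) x\<bar> \<le> 2 * real n"
proof (cases n)
  case (Suc k)
  have "\<bar>poly (cd n) x\<bar> \<le> (1 - x) * \<bar>poly (cd n) x\<bar>"
    using assms mult_right_mono[of 1 "1 - x" "\<bar>poly (cd n) x\<bar>"] by simp
  also have "\<dots> = \<bar>(1 - x) * poly (cd n) x\<bar>" using assms by (simp add: abs_mult)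
  also have "\<dots> = real n * \<bar>legendre k x - legendre (Suc k) x\<bar>"
    unfolding Suc one_minus_times_cd by (simp add: abs_mult)
  also have "\<dots> \<le> real n * 2"
    using legendre_abs_le_1[of x k] legendre_abs_le_1[of x "Suc k"] assms
    by (intro mult_left_mono) auto
  finally show ?thesis by simp
qed (simp add: cd_def)

section \<open>Factorisation of the harmonic kernel and the dimension\<close>

text \<open>When the products are expanded, the sign (-1)^(l + m) of the reflected term keeps
  exactly the pairs with l + m even, and these are (l, m) = (\<tau>1 + \<tau>2, \<tau>1 - \<tau>2)
  up to order. Off-diagonal pairs come in mirror images, which accounts for the factor 2 in
  \<open>d_tau\<close> and the symmetrisation in \<open>P_tau\<close>.\<close>

lemma harmonic_sum_factor:
  "(\<Sum>\<tau>\<in>taus k. real (d_tau \<tau>) * P_tau \<tau> x y) =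
   (poly (cd (Suc k)) x * poly (cd (Suc k)) y + poly (cd (Suc k)) (-x) * poly (cd (Suc k)) (-y)) / 2"
proof -
  define h where "h = (\<lambda>l m. (2 * real l + 1) * (2 * real m + 1) * legendre l x * legendre m y)"
  define g where "g = (\<lambda>(l, m). if even (l + m) then h l m else 0)"
  define D where "D = {(l, m). m \<le> l \<and> l \<le> k}"
  \<comment> \<open>The pairs on the other side of the diagonal are the reflections of
    \<open>D'\<close>; the diagonal itself, where \<tau>2 = 0, has no partner.\<close>
  define D' where "D' = {(l, m). m < l \<and> l \<le> k}"
  have finD: "finite D" unfolding D_def by (rule finite_subset[of _ "{..k} \<times> {..k}"]) auto
  have D': "D' \<subseteq> D" by (auto simp: D_def D'_def)
  have "(poly (cd (Suc k)) x * poly (cd (Suc k)) y + poly (cd (Suc k)) (-x) * poly (cd (Suc k)) (-y)) / 2 =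
      (\<Sum>l\<le>k. \<Sum>m\<le>k. g (l, m))"
    unfolding poly_cd_minus unfolding cd_def poly_sum lessThan_Suc_atMost sum_product sum.distrib[symmetric] sum_divide_distrib
    by (intro sum.cong refl) (auto simp: g_def h_def poly_legendre_poly power_add[symmetric] algebra_simps)
  also have "\<dots> = (\<Sum>p\<in>{..k} \<times> {..k}. g p)" by (simp add: sum.cartesian_product)
  also have "{..k} \<times> {..k} = D \<union> prod.swap ` D'"
    by (auto simp: D_def D'_def image_iff)
  also have "(\<Sum>p\<in>\<dots>. g p) = (\<Sum>p\<in>D. g p) + (\<Sum>p\<in>prod.swap ` D'. g p)"
    using finD finite_subset[OF D' finD] by (intro sum.union_disjoint) (auto simp: D_def D'_def)
  also have "(\<Sum>p\<in>prod.swap ` D'. g p) = (\<Sum>p\<in>D'. g (prod.swap p))"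
    by (subst sum.reindex) (auto intro!: inj_onI)
  also have "\<dots> = (\<Sum>p\<in>D. if p \<in> D' then g (prod.swap p) else 0)"
    using D' finD by (simp add: sum.inter_restrict[symmetric] Int_absorb1)
  also have "(\<Sum>p\<in>D. g p) + \<dots> = (\<Sum>p\<in>D. g p + (if p \<in> D' then g (prod.swap p) else 0))"
    by (simp add: sum.distrib)
  also have "\<dots> = (\<Sum>p\<in>{p\<in>D. even (fst p + snd p)}. g p + (if p \<in> D' then g (prod.swap p) else 0))"
    using finD by (intro sum.mono_neutral_right) (auto simp: g_def split: if_splits)
  also have "\<dots> = (\<Sum>\<tau>\<in>taus k. real (d_tau \<tau>) * P_tau \<tau> x y)"
  proof (rule sum.reindex_bij_witness[where i = "\<lambda>(t1, t2). (t1 + t2, t1 - t2)" and j = "\<lambda>(l, m). ((l + m) div 2, (l - m) div 2)"])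
    fix p assume "p \<in> {p\<in>D. even (fst p + snd p)}"
    then obtain l m where p: "p = (l, m)" "m \<le> l" "l \<le> k" "even (l + m)" by (auto simp: D_def)
    then obtain e where e: "l = m + 2 * e" by (metis add_diff_inverse_nat evenE even_diff_nat le_iff_add not_le add.commute)
    have j: "(\<lambda>(l, m). ((l + m) div 2, (l - m) div 2)) p = (m + e, e)" by (simp add: p(1) e)
    show "(\<lambda>(t1, t2). (t1 + t2, t1 - t2)) ((\<lambda>(l, m). ((l + m) div 2, (l - m) div 2)) p) = p"
      unfolding j by (simp add: p(1) e)
    show "(\<lambda>(l, m). ((l + m) div 2, (l - m) div 2)) p \<in> taus k"
      unfolding j using p e by (auto simp: taus_def)
    show "real (d_tau ((\<lambda>(l, m). ((l + m) div 2, (l - m) div 2)) p)) * P_tau ((\<lambda>(l, m). ((l + m) div 2, (l - m) div 2)) p) x y = g p + (if p \<in> D' then g (prod.swap p) else 0)"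
    proof -
      have l: "m + e + e = l" "m + e - e = m" using e by auto
      have "p \<in> D' \<longleftrightarrow> e \<noteq> 0" using p(3) e by (auto simp: p(1) D'_def)
      thus ?thesis
        unfolding j d_tau_def P_tau_def prod.case l
        using p(4) by (cases "e = 0") (auto simp: p(1) g_def h_def field_simps e)
    qed
  next
    fix \<tau> assume "\<tau> \<in> taus k"
    then obtain t1 t2 where t: "\<tau> = (t1, t2)" "t2 \<le> t1" "t1 + t2 \<le> k" by (auto simp: taus_def)
    then obtain e where e: "t1 = t2 + e" using le_iff_add by auto
    show "(\<lambda>(l, m). ((l + m) div 2, (l - m) div 2)) ((\<lambda>(t1, t2). (t1 + t2, t1 - t2)) \<tau>) = \<tau>"
      by (simp add: t(1) e)
    show "(\<lambda>(t1, t2). (t1 + t2, t1 - t2)) \<tau> \<in> {p \<in> D. even (fst p + snd p)}"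
      using t(3) by (cases "even t2"; cases "even e") (auto simp: t(1) e D_def)
  qed
  finally show ?thesis by simp
qed

lemma P_tau_at_1: "P_tau \<tau> 1 1 = 1"
  by (auto simp: P_tau_def split: prod.splits)

text \<open>Every \<open>P_tau\<close> equals 1 at (1, 1), so the dimension is the value of the
  kernel there. The two products contribute n^4 and n^2 with n = k + 1.\<close>

lemma harmonic_dim_eq: "real (harmonic_dim k) = (real (Suc k))\<^sup>2 * ((real (Suc k))\<^sup>2 + 1) / 2"
proof -
  have "real (harmonic_dim k) = (\<Sum>\<tau>\<in>taus k. real (d_tau \<tau>) * P_tau \<tau> 1 1)"
    by (simp add: harmonic_dim_def P_tau_at_1)
  also have "\<dots> = ((real (Suc k))\<^sup>2 * (real (Suc k))\<^sup>2 + (poly (cd (Suc k)) (-1))\<^sup>2) / 2"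
    unfolding harmonic_sum_factor by (simp add: cd_at_1 power2_eq_square del: of_nat_Suc)
  also have "\<dots> = ((real (Suc k))\<^sup>2 * (real (Suc k))\<^sup>2 + (real (Suc k))\<^sup>2) / 2"
    by (simp only: cd_at_minus_1)
  finally show ?thesis by (simp add: algebra_simps)
qed

section \<open>Power series of the Christoffel-Darboux kernel at 1\<close>

text \<open>The coefficient of z^j in the hypergeometric polynomial 2F1 (1 - n, 1 + n; 2; z),
  divided by n^(2 j) so that it converges as n grows. The product vanishes for j \<ge> n >
  0.\<close>

definition cd_coeff :: "nat \<Rightarrow> nat \<Rightarrow> real" where
  "cd_coeff n j = (-1) ^ j * (\<Prod>i=1..j. 1 - (real i / real n)\<^sup>2) / (fact j * fact (Suc j))"

lemma pderiv_pcompose_affine: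
  "pderiv (pcompose f [:1, -2:]) = smult (-2) (pcompose (pderiv f) [:1, -2::real:])"
  by (simp add: pderiv_pcompose pderiv_pCons)

text \<open>The sum and the difference of P_k and P_(k+1) form a first-order system with
  \<open>cd n\<close>. Eliminating them in the variable z = (1 - x) / 2 gives ((1 - z) (z R)')' = -
  n^2 R, hence a two-term recurrence for the coefficients of R.\<close>

lemma coeff_cd_pcompose:
  assumes "n > 0"
  shows "coeff (pcompose (cd n) [:1, -2:]) j = (real n)\<^sup>2 * ((real n)\<^sup>2) ^ j * cd_coeff n j"
proof -
  obtain k where k: "n = Suc k" using assms by (cases n) auto
  define R where "R = pcompose (cd n) [:1, -2:]"
  define d e where "d = legendre_poly k - legendre_poly (Suc k)" and "e = legendre_poly (Suc k) + legendre_poly k"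
  have 1: "[:1, -1:] * cd n = smult (real n) d"
    by (rule poly_ext) (use one_minus_times_cd[of _ k] in \<open>simp add: k d_def poly_legendre_poly algebra_simps\<close>)
  have 2: "cd n = pderiv e" by (simp add: k e_def cd_Suc)
  have 3: "[:1, 1:] * pderiv d = smult (- real n) e"
  proof (rule poly_ext)
    fix x
    have "(1 + x) * (legendre' k x - legendre' (Suc k) x) =
        (legendre' k x - x * legendre' (Suc k) x) - (legendre' (Suc k) x - x * legendre' k x)"
      by (simp add: algebra_simps)
    also have "legendre' (Suc k) x - x * legendre' k x = real (Suc k) * legendre k x"
      by (subst legendre'_Suc) simp
    also have "legendre' k x - x * legendre' (Suc k) x = - (real (Suc k) * legendre (Suc k) x)"
      by (subst legendre'_pred) simp
    finally show "poly ([:1, 1:] * pderiv d) x = poly (smult (- real n) e) x"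
      by (simp add: k d_def e_def pderiv_diff poly_legendre_poly algebra_simps)
  qed
  have "[:0, 1:] * R = smult (real n / 2) (pcompose d [:1, -2:])"
  proof (rule poly_ext)
    fix z
    show "poly ([:0, 1:] * R) z = poly (smult (real n / 2) (pcompose d [:1, -2:])) z"
      using arg_cong[OF 1, of "\<lambda>p. poly p (1 - 2 * z)"] by (simp add: R_def poly_pcompose algebra_simps)
  qed
  hence "pderiv ([:0, 1:] * R) = smult (- real n) (pcompose (pderiv d) [:1, -2:])"
    by (simp add: pderiv_smult pderiv_pcompose_affine del: mult_pCons_left)
  moreover have "[:1, -1:] * pcompose (pderiv d) [:1, -2:] = smult (- real n / 2) (pcompose e [:1, -2:])"
  proof -
    have "smult 2 ([:1, -1:] * pcompose (pderiv d) [:1, -2:]) = pcompose ([:1, 1:] * pderiv d) [:1, -2:]"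
      by (rule poly_ext) (simp add: poly_pcompose algebra_simps)
    also have "\<dots> = smult (- real n) (pcompose e [:1, -2:])"
      unfolding 3 by (simp add: pcompose_smult pcompose_uminus)
    finally have "smult (1/2) (smult 2 ([:1, -1:] * pcompose (pderiv d) [:1, -2:])) = smult (1/2) \<dots>" by simp
    thus ?thesis by simp
  qed
  ultimately have "[:1, -1:] * pderiv ([:0, 1:] * R) = smult ((real n)\<^sup>2 / 2) (pcompose e [:1, -2:])"
    by (simp only: mult_smult_right) (simp add: power2_eq_square)
  hence "pderiv ([:1, -1:] * pderiv ([:0, 1:] * R)) = smult (- (real n)\<^sup>2) R"
    by (simp add: pderiv_smult pderiv_pcompose_affine R_def 2 del: mult_pCons_left)
  hence "coeff (pderiv ([:1, -1:] * pderiv ([:0, 1:] * R))) j = - (real n)\<^sup>2 * coeff R j" for j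
    by simp
  hence rec: "real (Suc j) * (real (j + 2) * coeff R (Suc j) - real (Suc j) * coeff R j) = - (real n)\<^sup>2 * coeff R j" for j
    by (simp add: coeff_pderiv algebra_simps)
  show ?thesis
    unfolding R_def[symmetric]
  proof (induction j)
    case 0
    show ?case by (simp add: R_def cd_at_1 cd_coeff_def)
  next
    case (Suc j)
    have n: "real n \<noteq> 0" using assms by simp
    have "real (Suc j) * real (j + 2) * coeff R (Suc j) = ((real (Suc j))\<^sup>2 - (real n)\<^sup>2) * coeff R j"
      using rec[of j] by (simp add: power2_eq_square algebra_simps)
    also have "\<dots> = - ((real n)\<^sup>2 * (1 - (real (Suc j) / real n)\<^sup>2)) * coeff R j"
      using n by (simp add: field_simps)
    also have "\<dots> = real (Suc j) * real (j + 2) * ((real n)\<^sup>2 * ((real n)\<^sup>2) ^ Suc j * cd_coeff n (Suc j))"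
    proof -
      have "real (Suc j) * real (j + 2) * cd_coeff n (Suc j) = - (1 - (real (Suc j) / real n)\<^sup>2) * cd_coeff n j"
        unfolding cd_coeff_def by (simp add: divide_simps del: of_nat_Suc)
      hence eq: "real (Suc j) * real (j + 2) * ((real n)\<^sup>2 * ((real n)\<^sup>2) ^ Suc j * cd_coeff n (Suc j)) =
          (real n)\<^sup>2 * ((real n)\<^sup>2) ^ Suc j * (- (1 - (real (Suc j) / real n)\<^sup>2) * cd_coeff n j)"
        by (metis mult.assoc mult.commute)
      show ?thesis unfolding Suc.IH eq by (simp only: power_Suc mult_minus_left mult_minus_right mult_ac)
    qed
    finally show ?case by simp
  qed
qed

text \<open>For j < n every factor of the product lies in [0, 1]; for j \<ge> n the factor with i =
  n vanishes. The bound is uniform in \<open>n\<close>, as Tannery's theorem requires.\<close>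

lemma cd_coeff_abs_le:
  assumes "n > 0"
  shows "\<bar>cd_coeff n j\<bar> \<le> 1 / (fact j * fact (Suc j))"
proof -
  have "\<bar>\<Prod>i=1..j. 1 - (real i / real n)\<^sup>2\<bar> \<le> 1"
  proof (cases "j < n")
    case True
    have *: "\<bar>1 - (real i / real n)\<^sup>2\<bar> \<le> 1" if "i \<le> j" for i
    proof -
      have "(real i / real n)\<^sup>2 \<le> 1" using that True by (intro power_le_one) auto
      thus ?thesis using zero_le_power2[of "real i / real n"] by linarith
    qed
    have "(\<Prod>i=1..j. \<bar>1 - (real i / real n)\<^sup>2\<bar>) \<le> 1"
    proof (rule prod_le_1)
      fix i assume "i \<in> {1..j}"
      thus "0 \<le> \<bar>1 - (real i / real n)\<^sup>2\<bar> \<and> \<bar>1 - (real i / real n)\<^sup>2\<bar> \<le> 1" using * by simp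
    qed
    thus ?thesis by (simp only: abs_prod)
  next
    case False
    hence "(\<Prod>i=1..j. 1 - (real i / real n)\<^sup>2) = 0" using assms
      by (intro prod_zero bexI[of _ n]) auto
    thus ?thesis by (simp only: abs_zero zero_le_one)
  qed
  hence "\<bar>\<Prod>i=1..j. 1 - (real i / real n)\<^sup>2\<bar> / (fact j * fact (Suc j)) \<le> 1 / (fact j * fact (Suc j))"
    by (rule divide_right_mono) simp
  moreover have "\<bar>cd_coeff n j\<bar> = \<bar>\<Prod>i=1..j. 1 - (real i / real n)\<^sup>2\<bar> / (fact j * fact (Suc j))"
    unfolding cd_coeff_def abs_divide abs_mult power_abs by (simp only: abs_minus_cancel abs_one power_one mult_1 abs_of_pos fact_gt_zero)
  ultimately show ?thesis by (simp only:)
qed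

text \<open>The polynomial is written as an infinite series in the rescaled variable, z = s / (4
  n^2), so that it can be compared termwise with the Bessel series.\<close>

lemma cd_sums:
  assumes "n > 0"
  shows "(\<lambda>j. cd_coeff n j * (s / 4) ^ j) sums (poly (cd n) (1 - s / (2 * (real n)\<^sup>2)) / (real n)\<^sup>2)"
proof -
  define z where "z = s / (4 * (real n)\<^sup>2)"
  define R where "R = pcompose (cd n) [:1, -2:]"
  have n: "real n \<noteq> 0" using assms by simp
  have "poly (cd n) (1 - s / (2 * (real n)\<^sup>2)) = poly R z"
    by (simp add: R_def poly_pcompose z_def)
  also have "\<dots> = (\<Sum>j\<le>degree R. coeff R j * z ^ j)" by (rule poly_altdef)
  finally have *: "poly (cd n) (1 - s / (2 * (real n)\<^sup>2)) = \<dots>" .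
  have "(\<lambda>j. coeff R j * z ^ j) sums poly (cd n) (1 - s / (2 * (real n)\<^sup>2))"
    unfolding * by (rule sums_finite) (auto simp: coeff_eq_0)
  hence "(\<lambda>j. coeff R j * z ^ j / (real n)\<^sup>2) sums (poly (cd n) (1 - s / (2 * (real n)\<^sup>2)) / (real n)\<^sup>2)"
    by (rule sums_divide)
  moreover have "coeff R j * z ^ j / (real n)\<^sup>2 = cd_coeff n j * (s / 4) ^ j" for j
  proof -
    have "((real n)\<^sup>2) ^ j * z ^ j = (s / 4) ^ j"
      unfolding power_mult_distrib[symmetric] using n by (simp add: z_def)
    thus ?thesis unfolding R_def coeff_cd_pcompose[OF assms] using n by (simp add: mult_ac)
  qed
  ultimately show ?thesis by simp
qed

section \<open>Christoffel--Darboux measures and their Laplace transforms\<close>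

lemma lborel_integral_poly: "(\<integral>x. indicator {-1..1} x * poly p x \<partial>lborel) = pint p"
  and lborel_integrable_poly: "integrable lborel (\<lambda>x. indicator {-1..1} x * poly p (x::real))"
proof -
  have "set_integrable lborel {-1..1} (poly p)"
    by (intro borel_integrable_atLeastAtMost' continuous_at_imp_continuous_on ballI poly_isCont)
  from set_borel_integral_eq_integral(2)[OF this] this
  show "(\<integral>x. indicator {-1..1} x * poly p x \<partial>lborel) = pint p"
    and "integrable lborel (\<lambda>x. indicator {-1..1} x * poly p (x::real))"
    by (simp_all add: set_integrable_def set_lebesgue_integral_def pint_def)
qed

lemma poly_borel_measurable [measurable]: "poly (p :: real poly) \<in> borel_measurable borel"
  by (intro borel_measurable_continuous_onI continuous_at_imp_continuous_on ballI poly_isCont)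

definition cd_dens :: "nat \<Rightarrow> real \<Rightarrow> real" where
  "cd_dens n x = indicator {-1..1} x * ((poly (cd n) x)\<^sup>2 / (2 * (real n)\<^sup>2))"

definition cd_measure :: "nat \<Rightarrow> real measure" where
  "cd_measure n = density lborel (\<lambda>x. ennreal (cd_dens n x))"

lemma cd_dens_nonneg: "cd_dens n x \<ge> 0"
  by (simp add: cd_dens_def)

lemma cd_dens_measurable [measurable]: "cd_dens n \<in> borel_measurable borel"
  unfolding cd_dens_def by measurable

lemma sets_cd_measure [measurable_cong, simp]: "sets (cd_measure n) = sets borel"
  by (simp add: cd_measure_def)

lemma space_cd_measure [simp]: "space (cd_measure n) = UNIV"
  by (simp add: cd_measure_def)

lemma cd_measure_integral:
  fixes f :: "real \<Rightarrow> real"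
  assumes [measurable]: "f \<in> borel_measurable borel"
  shows "(\<integral>x. f x \<partial>cd_measure n) = (\<integral>x. cd_dens n x * f x \<partial>lborel)"
  unfolding cd_measure_def by (subst integral_density) (auto simp: cd_dens_nonneg)

lemma cd_measure_AE: "AE x in cd_measure n. -1 \<le> x \<and> x \<le> 1"
  unfolding cd_measure_def by (subst AE_density) (auto simp: cd_dens_def indicator_def)

lemma cd_measure_integral_poly:
  "(\<integral>x. poly q x \<partial>cd_measure n) = pint (cd n * cd n * q) / (2 * (real n)\<^sup>2)"
proof -
  have "(\<integral>x. poly q x \<partial>cd_measure n) = (\<integral>x. indicator {-1..1} x * poly (cd n * cd n * q) x / (2 * (real n)\<^sup>2) \<partial>lborel)"
    by (subst cd_measure_integral) (auto intro!: Bochner_Integration.integral_cong simp: cd_dens_def power2_eq_square)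
  thus ?thesis by (simp add: lborel_integral_poly del: poly_mult)
qed

lemma prob_space_cd_measure:
  assumes "n > 0"
  shows "prob_space (cd_measure n)"
proof
  have c: "cd_dens n = (\<lambda>x. indicator {-1..1} x * poly (cd n * cd n) x / (2 * (real n)\<^sup>2))"
    by (auto simp: cd_dens_def power2_eq_square)
  obtain k where k: "n = Suc k" using assms by (cases n) auto
  have "emeasure (cd_measure n) (space (cd_measure n)) = (\<integral>\<^sup>+x. ennreal (cd_dens n x) \<partial>lborel)"
    by (simp add: cd_measure_def emeasure_density)
  also have "\<dots> = ennreal (\<integral>x. cd_dens n x \<partial>lborel)"
    by (intro nn_integral_eq_integral)
       (auto simp: cd_dens_nonneg, auto simp: c intro!: integrable_divide lborel_integrable_poly simp del: poly_mult)
  also have "(\<integral>x. cd_dens n x \<partial>lborel) = 1"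
    unfolding c by (simp add: lborel_integral_poly k pint_cd_square del: poly_mult of_nat_Suc)
  finally show "emeasure (cd_measure n) (space (cd_measure n)) = 1" by simp
qed

lemma cd_measure_integrable:
  assumes "n > 0" "f \<in> borel_measurable borel" "\<And>x. -1 \<le> x \<Longrightarrow> x \<le> 1 \<Longrightarrow> \<bar>f x\<bar> \<le> (B :: real)"
  shows "integrable (cd_measure n) f"
proof -
  interpret prob_space "cd_measure n" by (rule prob_space_cd_measure) fact
  have "AE x in cd_measure n. norm (f x) \<le> B"
    using cd_measure_AE[of n] by eventually_elim (use assms in simp)
  thus ?thesis using assms(2) by (intro integrable_const_bound[where B = B]) auto
qed

lemma poly_bounded_Icc: "\<exists>B. \<forall>x. -1 \<le> x \<longrightarrow> x \<le> (1::real) \<longrightarrow> \<bar>poly p x\<bar> \<le> B"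
proof -
  have "bounded (poly p ` {-1..1})"
    by (intro compact_imp_bounded compact_continuous_image continuous_at_imp_continuous_on ballI poly_isCont) auto
  thus ?thesis unfolding bounded_iff by (metis atLeastAtMost_iff image_eqI real_norm_def)
qed

lemma cd_measure_integrable_poly: "n > 0 \<Longrightarrow> integrable (cd_measure n) (poly p)"
  using poly_bounded_Icc[of p] by (auto intro: cd_measure_integrable)

text \<open>\<open>cd n * q\<close> is tested against \<open>cd (n - d)\<close>, which reproduces the value at 1 of all factors involved.\<close>

lemma cd_measure_integral_square_ge:
  assumes "n > 0" "degree q \<le> d" "poly q 1 = 1"
  shows "(\<integral>x. (poly q x)\<^sup>2 \<partial>cd_measure n) \<ge> 1 - 2 * real d / real n"
proof (cases "d < n")
  case True
  define p where "p = cd (n - d)"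
  obtain k where k: "n = Suc k" using assms by (cases n) auto
  obtain k' where k': "n - d = Suc k'" using True by (cases "n - d") auto
  define N where "N = (real (n - d))\<^sup>2"
  have pp: "pint (p * p) = 2 * N" by (simp add: p_def k' pint_cd_square N_def del: of_nat_Suc)
  have "degree (q * p) \<le> d + k'"
    using degree_mult_le[of q p] degree_cd[of k'] assms(2) by (simp add: p_def k')
  hence "degree (q * p) \<le> k" using k k' True by linarith
  hence "pint (cd n * (q * p)) = 2 * N"
    unfolding k by (subst pint_cd_mult) (simp_all add: assms p_def cd_at_1 N_def)
  \<comment> \<open>The square of \<open>cd n * q - p\<close> has nonnegative integral. The
    integrals of \<open>cd n * (q * p)\<close> and of \<open>p * p\<close> are both 2 N, so what
    remains is the lower bound 2 N.\<close>
  moreover have "0 \<le> pint (cd n * cd n * (q * q)) - 2 * pint (cd n * (q * p)) + pint (p * p)"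
  proof -
    have "(cd n * q - p) * (cd n * q - p) = cd n * cd n * (q * q) - smult 2 (cd n * (q * p)) + p * p"
      by (rule poly_ext) (simp add: algebra_simps)
    moreover have "pint ((cd n * q - p) * (cd n * q - p)) \<ge> 0"
      by (rule pint_nonneg) simp
    ultimately show ?thesis by (simp only: pint_add pint_diff pint_smult)
  qed
  ultimately have "pint (cd n * cd n * (q * q)) \<ge> 2 * N"
    using pp by linarith
  hence "N / (real n)\<^sup>2 \<le> pint (cd n * cd n * (q * q)) / (2 * (real n)\<^sup>2)"
    using assms(1) by (simp add: field_simps)
  also have "\<dots> = (\<integral>x. (poly q x)\<^sup>2 \<partial>cd_measure n)"
    using cd_measure_integral_poly[where q = "q * q" and n = n] by (simp only: poly_mult power2_eq_square)
  finally have "N / (real n)\<^sup>2 \<le> (\<integral>x. (poly q x)\<^sup>2 \<partial>cd_measure n)" .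
  moreover have "N / (real n)\<^sup>2 = (1 - real d / real n)\<^sup>2"
  proof -
    have "1 - real d / real n = real (n - d) / real n"
      using True assms(1) by (simp add: of_nat_diff diff_divide_distrib)
    thus ?thesis by (simp only: N_def power_divide)
  qed
  moreover have "(1 - real d / real n)\<^sup>2 \<ge> 1 - 2 * real d / real n"
    by (simp add: power2_diff)
  ultimately show ?thesis by linarith
next
  case False
  hence "1 - 2 * real d / real n \<le> 0" using assms(1) by (simp add: field_simps)
  also have "0 \<le> (\<integral>x. (poly q x)\<^sup>2 \<partial>cd_measure n)" by (rule integral_nonneg_AE) simp
  finally show ?thesis .
qed

text \<open>Quantitative concentration at 1: a polynomial of degree much smaller than
  \<open>n\<close> cannot fall noticeably below its value at 1 in mean square. The estimates below
  arise from suitable choices of \<open>q\<close>.\<close>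

lemma cd_measure_integral_one_minus_square_le:
  assumes "n > 0" "degree q \<le> d" "poly q 1 = 1"
  shows "(\<integral>x. 1 - (poly q x)\<^sup>2 \<partial>cd_measure n) \<le> 2 * real d / real n"
proof -
  interpret prob_space "cd_measure n" by (rule prob_space_cd_measure) fact
  have "(\<lambda>x. (poly q x)\<^sup>2) = poly (q * q)" by (rule ext) (simp add: power2_eq_square)
  hence "integrable (cd_measure n) (\<lambda>x. (poly q x)\<^sup>2)"
    using cd_measure_integrable_poly[OF assms(1)] by (simp only:)
  hence "(\<integral>x. 1 - (poly q x)\<^sup>2 \<partial>cd_measure n) = 1 - (\<integral>x. (poly q x)\<^sup>2 \<partial>cd_measure n)"
    using prob_space by (subst Bochner_Integration.integral_diff) simp_all
  thus ?thesis using cd_measure_integral_square_ge[OF assms] by linarith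
qed

text \<open>The choice q = (1 + x) / 2, for which 1 - q^2 \<ge> 1 - q. The order 1 / n is coarser
  than the scale n^(-2) but sufficient for error terms.\<close>

lemma cd_measure_expectation_one_minus:
  assumes "n > 0"
  shows "(\<integral>x. 1 - x \<partial>cd_measure n) \<le> 4 / real n"
proof -
  have i: "integrable (cd_measure n) (\<lambda>x. poly p x)" for p
    using cd_measure_integrable_poly[OF assms, of p] by simp
  have "(\<integral>x. (1 - x) / 2 \<partial>cd_measure n) \<le> (\<integral>x. 1 - (poly [:1/2, 1/2:] x)\<^sup>2 \<partial>cd_measure n)"
  proof (rule integral_mono_AE)
    show "integrable (cd_measure n) (\<lambda>x. (1 - x) / 2)" using i[of "[:1/2, -1/2:]"] by (simp add: field_simps)
    show "integrable (cd_measure n) (\<lambda>x. 1 - (poly [:1/2, 1/2:] x)\<^sup>2)"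
      using i[of "1 - [:1/2, 1/2:] * [:1/2, 1/2:]"] by (simp only: poly_diff poly_1 poly_mult power2_eq_square)
    show "AE x in cd_measure n. (1 - x) / 2 \<le> 1 - (poly [:1/2, 1/2:] x)\<^sup>2"
      using cd_measure_AE
    proof eventually_elim
      case (elim x)
      have "((1 + x) / 2)\<^sup>2 \<le> ((1 + x) / 2) * 1"
        unfolding power2_eq_square using elim by (intro mult_left_mono) auto
      thus ?case by (simp add: field_simps)
    qed
  qed
  also have "\<dots> \<le> 2 * real 1 / real n"
    by (rule cd_measure_integral_one_minus_square_le) (use assms in auto)
  finally show ?thesis by simp
qed

section \<open>Fejer polynomials and tails of the Christoffel-Darboux measures\<close>

text \<open>The polynomial in cos t that represents (1 - cos (m t)) / (1 - cos t), a multiple of the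
  Fejer kernel. Divided by m^2 it has value 1 at 1, stays in [0, 1] and decays beyond the scale
  m^(-2), with a degree of only m - 1.\<close>

fun fejer :: "nat \<Rightarrow> real poly" where
  "fejer 0 = 0"
| "fejer (Suc 0) = 1"
| "fejer (Suc (Suc m)) = [:0, 2:] * fejer (Suc m) - fejer m + [:2:]"

lemma fejer_cos: "(1 - cos t) * poly (fejer m) (cos t) = 1 - cos (real m * t)"
proof (induction m rule: fejer.induct)
  case (3 m)
  have "cos (real (Suc (Suc m)) * t) + cos (real m * t) = 2 * cos t * cos (real (Suc m) * t)"
    using cos_add[of "real (Suc m) * t" t] cos_diff[of "real (Suc m) * t" t] by (simp add: algebra_simps)
  moreover have "(1 - cos t) * poly (fejer (Suc (Suc m))) (cos t) =
      2 * cos t * ((1 - cos t) * poly (fejer (Suc m)) (cos t)) - (1 - cos t) * poly (fejer m) (cos t) + 2 * (1 - cos t)"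
    by (simp add: algebra_simps)
  ultimately show ?case unfolding 3 by (simp add: algebra_simps)
qed auto

lemma fejer_at_1: "poly (fejer m) 1 = (real m)\<^sup>2"
  by (induction m rule: fejer.induct) (auto simp: power2_eq_square algebra_simps)

lemma degree_fejer: "degree (fejer m) \<le> m - 1"
proof (induction m rule: fejer.induct)
  case (3 m)
  have "degree ([:0, 2:] * fejer (Suc m)) \<le> Suc m"
    using degree_mult_le[of "[:0, 2::real:]" "fejer (Suc m)"] 3(1) by simp
  moreover have "degree (fejer m) \<le> Suc m" using 3(2) by simp
  ultimately show ?case
    unfolding fejer.simps by (intro degree_add_le degree_diff_le) auto
qed auto

lemma abs_sin_mult_le: "\<bar>sin (real m * t)\<bar> \<le> real m * \<bar>sin t\<bar>"
proof (induction m)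
  case (Suc m)
  have "\<bar>sin (real (Suc m) * t)\<bar> \<le> \<bar>sin (real m * t)\<bar> * \<bar>cos t\<bar> + \<bar>cos (real m * t)\<bar> * \<bar>sin t\<bar>"
    using abs_triangle_ineq[of "sin (real m * t) * cos t" "cos (real m * t) * sin t"]
    by (simp add: algebra_simps sin_add abs_mult)
  also have "\<dots> \<le> \<bar>sin (real m * t)\<bar> * 1 + 1 * \<bar>sin t\<bar>"
    by (intro add_mono mult_mono) auto
  finally show ?case using Suc by (simp add: algebra_simps)
qed simp

text \<open>With x = cos t all three bounds concern 1 - cos (m t); the upper bound m^2 is the
  inequality |sin (m t / 2)| \<le> m |sin (t / 2)|, squared.\<close>

lemma fejer_bounds:
  assumes "-1 \<le> x" "x \<le> 1"
  shows "0 \<le> poly (fejer m) x" "poly (fejer m) x \<le> (real m)\<^sup>2" "(1 - x) * poly (fejer m) x \<le> 2"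
proof -
  define t where "t = arccos x"
  have x: "x = cos t" using assms by (simp add: t_def cos_arccos)
  have eq: "(1 - x) * poly (fejer m) x = 1 - cos (real m * t)" by (simp add: x fejer_cos)
  show "(1 - x) * poly (fejer m) x \<le> 2" unfolding eq using cos_ge_minus_one[of "real m * t"] by linarith
  have dbl: "1 - cos y = 2 * (sin (y / 2))\<^sup>2" for y :: real
    using cos_double_sin[of "y / 2"] by simp
  have "1 - cos (real m * t) \<le> (real m)\<^sup>2 * (1 - cos t)"
  proof -
    have "\<bar>sin (real m * (t / 2))\<bar>\<^sup>2 \<le> (real m * \<bar>sin (t / 2)\<bar>)\<^sup>2"
      by (intro power_mono abs_sin_mult_le) auto
    thus ?thesis unfolding dbl by (simp add: power_mult_distrib)
  qed
  hence le: "(1 - x) * poly (fejer m) x \<le> (1 - x) * (real m)\<^sup>2" unfolding eq by (simp only: x mult.commute)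
  have ge: "(1 - x) * 0 \<le> (1 - x) * poly (fejer m) x" unfolding eq by simp
  have pos: "0 < 1 - x" if "x \<noteq> 1" using that assms by simp
  show "0 \<le> poly (fejer m) x"
    using mult_left_le_imp_le[OF ge pos] by (cases "x = 1") (simp_all add: fejer_at_1)
  show "poly (fejer m) x \<le> (real m)\<^sup>2"
    using mult_left_le_imp_le[OF le pos] by (cases "x = 1") (simp_all add: fejer_at_1)
qed

text \<open>Where 1 - x \<ge> 4 / m^2, the normalised Fejer polynomial is at most 2 / (m^2 (1 - x))
  \<le> 1 / 2, so 1 - q^2 \<ge> 3 / 4. Markov's argument turns this into the factor 4 / 3.\<close>

lemma cd_measure_tail_nat:
  assumes "n > 0" "m > 0"
  shows "measure (cd_measure n) {x. 1 - x \<ge> 4 / (real m)\<^sup>2} \<le> 8 / 3 * (real m - 1) / real n"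
proof -
  interpret prob_space "cd_measure n" by (rule prob_space_cd_measure) fact
  define q where "q = smult (1 / (real m)\<^sup>2) (fejer m)"
  let ?A = "{x. 1 - x \<ge> 4 / (real m)\<^sup>2}"
  have "(\<integral>x. 3 / 4 * indicat_real ?A x \<partial>cd_measure n) \<le> (\<integral>x. 1 - (poly q x)\<^sup>2 \<partial>cd_measure n)"
  proof (rule integral_mono_AE)
    show "integrable (cd_measure n) (\<lambda>x. 3 / 4 * indicat_real ?A x)"
      by (rule cd_measure_integrable[where B = 1]) (use assms in \<open>auto simp: indicator_def\<close>)
    show "integrable (cd_measure n) (\<lambda>x. 1 - (poly q x)\<^sup>2)"
    proof -
      have "(\<lambda>x. 1 - (poly q x)\<^sup>2) = poly (1 - q * q)" by (rule ext) (simp add: power2_eq_square)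
      thus ?thesis using cd_measure_integrable_poly[OF assms(1)] by (simp only:)
    qed
    show "AE x in cd_measure n. 3 / 4 * indicat_real ?A x \<le> 1 - (poly q x)\<^sup>2"
      using cd_measure_AE
    proof eventually_elim
      case (elim x)
      have q01: "0 \<le> poly q x" "poly q x \<le> 1"
        using fejer_bounds[of x m] elim assms by (auto simp: q_def field_simps)
      show ?case
      proof (cases "x \<in> ?A")
        case True
        have "4 / (real m)\<^sup>2 * poly (fejer m) x \<le> (1 - x) * poly (fejer m) x"
          using True fejer_bounds[of x m] elim by (intro mult_right_mono) auto
        hence "poly q x \<le> 1 / 2"
          using fejer_bounds(3)[of x m] elim by (simp add: q_def)
        hence "(poly q x)\<^sup>2 \<le> (1 / 2)\<^sup>2" using q01 by (intro power_mono)
        thus ?thesis using True by (simp add: power2_eq_square)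
      next
        case False
        thus ?thesis using q01 by (simp add: power_le_one)
      qed
    qed
  qed
  also have "\<dots> \<le> 2 * real (m - 1) / real n"
    using assms degree_fejer[of m]
    by (intro cd_measure_integral_one_minus_square_le) (auto simp: q_def fejer_at_1)
  finally show ?thesis using assms by (simp add: of_nat_diff field_simps)
qed

lemma cd_measure_tail:
  assumes "n > 0" "R > 0"
  shows "measure (cd_measure n) {x. 2 * (real n)\<^sup>2 * (1 - x) \<ge> R} \<le> 8 / sqrt R"
proof -
  interpret prob_space "cd_measure n" by (rule prob_space_cd_measure) fact
  \<comment> \<open>Chosen so that 4 / a^2 = R / (2 n^2). Rounding up to \<open>m\<close> costs less
    than 1, which the term m - 1 of the tail bound absorbs.\<close>
  define a where "a = sqrt 8 * real n / sqrt R"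
  define m where "m = nat \<lceil>a\<rceil>"
  have a: "a > 0" using assms by (simp add: a_def)
  have m: "m > 0" "real m \<ge> a" "real m < a + 1"
    using a by (auto simp: m_def) linarith
  have asq: "a\<^sup>2 = 8 * (real n)\<^sup>2 / R" using assms by (simp add: a_def power_mult_distrib power_divide)
  have "a\<^sup>2 \<le> (real m)\<^sup>2" using m a by (intro power_mono) auto
  hence "4 / (real m)\<^sup>2 \<le> 4 / a\<^sup>2" using a by (intro divide_left_mono) auto
  hence le: "4 / (real m)\<^sup>2 \<le> R / (2 * (real n)\<^sup>2)" unfolding asq using assms by (simp add: field_simps)
  have "measure (cd_measure n) {x. 2 * (real n)\<^sup>2 * (1 - x) \<ge> R} \<le> measure (cd_measure n) {x. 1 - x \<ge> 4 / (real m)\<^sup>2}"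
  proof (intro finite_measure_mono subsetI CollectI)
    fix x assume "x \<in> {x. 2 * (real n)\<^sup>2 * (1 - x) \<ge> R}"
    hence "R / (2 * (real n)\<^sup>2) \<le> 1 - x" using assms by (simp add: pos_divide_le_eq mult.commute)
    with le show "1 - x \<ge> 4 / (real m)\<^sup>2" by linarith
  qed simp
  also have "\<dots> \<le> 8 / 3 * (real m - 1) / real n" by (rule cd_measure_tail_nat) (use assms m in auto)
  also have "\<dots> \<le> 8 / 3 * a / real n" using m by (intro divide_right_mono mult_left_mono) auto
  also have "\<dots> = (8 / 3 * sqrt 8) / sqrt R" using assms by (simp add: a_def)
  also have "\<dots> \<le> 8 / sqrt R"
  proof -
    have "sqrt 8 \<le> sqrt (3\<^sup>2)" by (intro real_sqrt_le_mono) simp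
    hence "sqrt 8 \<le> 3" by simp
    thus ?thesis using assms by (intro divide_right_mono) auto
  qed
  finally show ?thesis .
qed

section \<open>The Bessel limit of the rescaled kernel\<close>

lemma has_bochner_integral_power_exp:
  fixes u :: real
  assumes "u > 0"
  shows "has_bochner_integral lborel (\<lambda>s. indicat_real {0..} s * (s ^ j * exp (- (u * s)))) (fact j / u ^ Suc j)"
proof -
  have "has_bochner_integral lborel (\<lambda>s. indicat_real {0..} s * (s ^ j * exp (- s))) (fact j)"
    by (rule has_bochner_integral_nn_integral)
       (use nn_intergal_power_times_exp_Ici[of j] in
         \<open>auto simp: indicator_def intro!: nn_integral_cong elim: trans[rotated]\<close>)
  hence "has_bochner_integral lborel (\<lambda>s. indicat_real {0..} (0 + u * s) * ((0 + u * s) ^ j * exp (- (0 + u * s)))) (fact j /\<^sub>R \<bar>u\<bar>)"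
    using assms by (subst lborel_has_bochner_integral_real_affine_iff[symmetric]) auto
  hence "has_bochner_integral lborel (\<lambda>s. (1 / u ^ j) * (indicat_real {0..} (0 + u * s) * ((0 + u * s) ^ j * exp (- (0 + u * s))))) ((1 / u ^ j) * (fact j /\<^sub>R \<bar>u\<bar>))"
    by (rule has_bochner_integral_mult_right)
  moreover have "(1 / u ^ j) * (fact j /\<^sub>R \<bar>u\<bar>) = fact j / u ^ Suc j" using assms by (simp add: field_simps)
  moreover have "(1 / u ^ j) * (indicat_real {0..} (0 + u * s) * ((0 + u * s) ^ j * exp (- (0 + u * s)))) = indicat_real {0..} s * (s ^ j * exp (- (u * s)))" for s
    using assms by (auto simp: indicator_def power_mult_distrib zero_le_mult_iff)
  ultimately show ?thesis by simp
qed

lemma power_over_fact_le_exp: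
  assumes "0 \<le> (x :: real)"
  shows "x ^ j / fact j \<le> exp x"
proof -
  have "(\<Sum>i\<in>{j}. x ^ i /\<^sub>R fact i) \<le> (\<Sum>i. x ^ i /\<^sub>R fact i)"
    using assms exp_converges[of x] by (intro sum_le_suminf) (auto simp: sums_iff)
  thus ?thesis using exp_converges[of x] by (simp add: sums_iff divide_inverse mult.commute)
qed

lemma exp_sums_divide_fact: "(\<lambda>j. x ^ j / fact j) sums exp (x :: real)"
proof -
  have "(\<lambda>j. x ^ j / fact j) = (\<lambda>j. x ^ j /\<^sub>R fact j)" by (auto simp: field_simps)
  thus ?thesis using exp_converges[of x] by simp
qed

definition cd_scaled :: "nat \<Rightarrow> real \<Rightarrow> real" where
  "cd_scaled n s = poly (cd n) (1 - s / (2 * (real n)\<^sup>2)) / (real n)\<^sup>2"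

text \<open>In terms of Bessel functions, \<open>cd_limit s = 2 J\<^sub>1(\<surd>s) / \<surd>s\<close>.\<close>

definition cd_limit :: "real \<Rightarrow> real" where
  "cd_limit s = (\<Sum>j. (-1) ^ j / (fact j * fact (Suc j)) * (s / 4) ^ j)"

lemma cd_scaled_measurable [measurable]: "cd_scaled n \<in> borel_measurable borel"
  unfolding cd_scaled_def by measurable

lemma cd_limit_measurable [measurable]: "cd_limit \<in> borel_measurable borel"
  unfolding cd_limit_def by measurable

text \<open>Splitting (s / 4)^j into (e s)^j and (1 / (4 e))^j allows any growth rate e > 0. The
  freedom matters because the squared series must be integrated against exp (- u s) for every u >
  0.\<close>

lemma bessel_term_le:
  assumes a: "\<bar>a\<bar> \<le> 1 / (fact j * fact (Suc j))" and "s \<ge> 0" "e > 0"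
  shows "\<bar>a * (s / 4) ^ j\<bar> \<le> exp (e * s) * ((1 / (4 * e)) ^ j / fact j :: real)"
proof -
  have "\<bar>a * (s / 4) ^ j\<bar> = \<bar>a\<bar> * (s / 4) ^ j" using assms by (simp add: abs_mult)
  also have "\<dots> \<le> 1 / (fact j * fact (Suc j)) * (s / 4) ^ j"
    using assms by (intro mult_right_mono) auto
  also have "\<dots> = ((e * s) ^ j / fact j) * ((1 / (4 * e)) ^ j / fact (Suc j))"
  proof -
    have "(s / 4) ^ j = (e * s) ^ j * (1 / (4 * e)) ^ j"
      unfolding power_mult_distrib[symmetric] using assms by simp
    thus ?thesis by simp
  qed
  also have "\<dots> \<le> exp (e * s) * ((1 / (4 * e)) ^ j / fact j)"
    using assms power_over_fact_le_exp[of "e * s" j] fact_mono[of j "Suc j", where 'a = real]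
    by (intro mult_mono divide_left_mono) auto
  finally show ?thesis .
qed

lemma bessel_series_bound:
  assumes a: "\<And>j. \<bar>a j\<bar> \<le> 1 / (fact j * fact (Suc j))" and "s \<ge> 0" "e > 0"
  shows "summable (\<lambda>j. \<bar>a j * (s / 4) ^ j\<bar>)"
    and "\<bar>\<Sum>j. a j * (s / 4) ^ j\<bar> \<le> exp (e * s) * exp (1 / (4 * e) :: real)"
proof -
  have e: "(\<lambda>j. exp (e * s) * ((1 / (4 * e)) ^ j / fact j)) sums (exp (e * s) * exp (1 / (4 * e)))"
    by (intro sums_mult exp_sums_divide_fact)
  note b = bessel_term_le[OF a assms(2,3)]
  show "summable (\<lambda>j. \<bar>a j * (s / 4) ^ j\<bar>)"
    by (rule summable_comparison_test'[OF sums_summable[OF e], of 0]) (use b in auto)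
  have "norm (\<Sum>j. a j * (s / 4) ^ j) \<le> (\<Sum>j. exp (e * s) * ((1 / (4 * e)) ^ j / fact j))"
    by (rule norm_suminf_le[OF _ sums_summable[OF e]]) (use b in auto)
  thus "\<bar>\<Sum>j. a j * (s / 4) ^ j\<bar> \<le> exp (e * s) * exp (1 / (4 * e) :: real)"
    using e by (simp add: sums_iff)
qed

lemma cd_scaled_eq: "n > 0 \<Longrightarrow> cd_scaled n s = (\<Sum>j. cd_coeff n j * (s / 4) ^ j)"
  using cd_sums[of n s] by (simp add: sums_iff cd_scaled_def)

lemma cd_limit_coeff_abs: "\<bar>(-1) ^ j / (fact j * fact (Suc j))\<bar> \<le> 1 / (fact j * fact (Suc j) :: real)"
  by (simp add: abs_mult power_abs)

lemma cd_scaled_bound: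
  assumes "n > 0" "s \<ge> 0" "e > 0"
  shows "\<bar>cd_scaled n s\<bar> \<le> exp (e * s) * exp (1 / (4 * e))"
  unfolding cd_scaled_eq[OF assms(1)]
  by (rule bessel_series_bound(2)) (use assms cd_coeff_abs_le in auto)

text \<open>Tannery's theorem: the coefficients converge one by one, and
  \<open>bessel_term_le\<close> supplies a summable majorant uniform in \<open>n\<close>.\<close>

lemma cd_scaled_tendsto:
  assumes "s \<ge> 0"
  shows "(\<lambda>k. cd_scaled (Suc k) s) \<longlonglongrightarrow> cd_limit s"
proof -
  have lim: "(\<lambda>k. cd_coeff (Suc k) j * (s / 4) ^ j) \<longlonglongrightarrow> (-1) ^ j / (fact j * fact (Suc j)) * (s / 4) ^ j" for j
  proof -
    have "(\<lambda>k. 1 - (real i / real (Suc k))\<^sup>2) \<longlonglongrightarrow> 1 - 0\<^sup>2" for i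
      by (intro tendsto_intros LIMSEQ_Suc lim_const_over_n)
    hence P: "(\<lambda>k. \<Prod>i=1..j. 1 - (real i / real (Suc k))\<^sup>2) \<longlonglongrightarrow> (\<Prod>i=1..j. 1 - 0\<^sup>2)"
      by (intro tendsto_prod)
    have "(\<lambda>k. (-1) ^ j * (\<Prod>i=1..j. 1 - (real i / real (Suc k))\<^sup>2) / (fact j * fact (Suc j)) * (s / 4) ^ j)
        \<longlonglongrightarrow> (-1) ^ j * (\<Prod>i=1..j. 1 - 0\<^sup>2) / (fact j * fact (Suc j)) * (s / 4) ^ j"
      by (rule tendsto_mult[OF tendsto_divide[OF tendsto_mult[OF tendsto_const P] tendsto_const] tendsto_const])
         (simp del: fact_Suc)
    thus ?thesis by (simp add: cd_coeff_def)
  qed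
  have "\<forall>\<^sub>F (j, k) in at_top \<times>\<^sub>F sequentially. norm (cd_coeff (Suc k) j * (s / 4) ^ j) \<le> exp (1 * s) * ((1 / (4 * 1)) ^ j / fact j)"
    using bessel_term_le[OF cd_coeff_abs_le[OF zero_less_Suc] assms, of 1] by (intro always_eventually) auto
  moreover have "summable (\<lambda>j. exp (1 * s) * ((1 / (4 * 1)) ^ j / fact j))"
    by (intro summable_mult sums_summable[OF exp_sums_divide_fact])
  ultimately have "(\<lambda>k. \<Sum>j. cd_coeff (Suc k) j * (s / 4) ^ j) \<longlonglongrightarrow> cd_limit s"
    unfolding cd_limit_def using tannerys_theorem[OF lim] by auto
  thus ?thesis by (simp add: cd_scaled_eq)
qed

section \<open>Laplace transforms of the rescaled measures and their limit\<close>

definition cd_laplace :: "nat \<Rightarrow> real \<Rightarrow> real" where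
  "cd_laplace n u = (\<integral>x. exp (- (u * (2 * (real n)\<^sup>2 * (1 - x)))) \<partial>cd_measure n)"

lemma cd_laplace_nonneg: "cd_laplace n u \<ge> 0"
  unfolding cd_laplace_def by (rule integral_nonneg_AE) simp

lemma cd_laplace_integrable:
  assumes "n > 0" "u \<ge> 0"
  shows "integrable (cd_measure n) (\<lambda>x. exp (- (u * (2 * (real n)\<^sup>2 * (1 - x)))))"
  by (rule cd_measure_integrable[where B = 1]) (use assms in auto)

lemma cd_laplace_le_1:
  assumes "n > 0" "u \<ge> 0"
  shows "cd_laplace n u \<le> 1"
proof -
  interpret prob_space "cd_measure n" by (rule prob_space_cd_measure) fact
  have "cd_laplace n u \<le> (\<integral>x. 1 \<partial>cd_measure n)"
    unfolding cd_laplace_def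
  proof (rule integral_mono_AE)
    show "AE x in cd_measure n. exp (- (u * (2 * (real n)\<^sup>2 * (1 - x)))) \<le> 1"
      using cd_measure_AE[of n] by eventually_elim (use assms in auto)
  qed (use assms cd_laplace_integrable in auto)
  thus ?thesis using prob_space by simp
qed

text \<open>Substitution s = 2 n^2 (1 - x), under which the density \<open>cd_dens\<close> becomes
  one quarter of the square of \<open>cd_scaled\<close>.\<close>

lemma cd_laplace_eq:
  assumes "n > 0"
  shows "cd_laplace n u = (\<integral>s. indicator {0..4 * (real n)\<^sup>2} s * (exp (- (u * s)) * ((cd_scaled n s)\<^sup>2 / 4)) \<partial>lborel)"
proof -
  define f where "f = (\<lambda>x. cd_dens n x * exp (- (u * (2 * (real n)\<^sup>2 * (1 - x)))))"
  define c where "c = - (1 / (2 * (real n)\<^sup>2))"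
  have n: "(real n)\<^sup>2 > 0" using assms by simp
  have c: "c \<noteq> 0" "\<bar>c\<bar> = 1 / (2 * (real n)\<^sup>2)" using n by (auto simp: c_def)
  have "cd_laplace n u = (\<integral>x. f x \<partial>lborel)"
    unfolding cd_laplace_def f_def by (subst cd_measure_integral) auto
  also have "\<dots> = \<bar>c\<bar> *\<^sub>R (\<integral>s. f (1 + c * s) \<partial>lborel)"
    by (rule lborel_integral_real_affine) (use c in auto)
  also have "\<dots> = (\<integral>s. \<bar>c\<bar> * f (1 + c * s) \<partial>lborel)" by simp
  also have "\<dots> = (\<integral>s. indicator {0..4 * (real n)\<^sup>2} s * (exp (- (u * s)) * ((cd_scaled n s)\<^sup>2 / 4)) \<partial>lborel)"
  proof (intro Bochner_Integration.integral_cong refl)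
    fix s
    have 1: "1 + c * s = 1 - s / (2 * (real n)\<^sup>2)" by (simp add: c_def)
    have 2: "2 * (real n)\<^sup>2 * (1 - (1 + c * s)) = s" using n by (simp add: c_def)
    have 3: "indicator {-1..1} (1 + c * s) = indicat_real {0..4 * (real n)\<^sup>2} s"
      unfolding 1 using n by (auto simp: indicator_def field_simps)
    have 4: "(poly (cd n) (1 + c * s))\<^sup>2 = (cd_scaled n s)\<^sup>2 * ((real n)\<^sup>2)\<^sup>2"
      unfolding 1 cd_scaled_def power_divide using n by simp
    have "f (1 + c * s) = indicat_real {0..4 * (real n)\<^sup>2} s * ((cd_scaled n s)\<^sup>2 * ((real n)\<^sup>2)\<^sup>2 / (2 * (real n)\<^sup>2)) * exp (- (u * s))"
      unfolding f_def cd_dens_def 2 3 4 ..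
    moreover have "1 / (2 * N) * (I * (p * N\<^sup>2 / (2 * N)) * E) = I * (E * (p / 4))" if "N > 0" for N I p E :: real
      using that by (simp add: field_simps power2_eq_square)
    ultimately show "\<bar>c\<bar> * f (1 + c * s) = indicator {0..4 * (real n)\<^sup>2} s * (exp (- (u * s)) * ((cd_scaled n s)\<^sup>2 / 4))"
      unfolding c(2) using n by (simp only:)
  qed
  finally show ?thesis .
qed

lemma cd_scaled_abs_le_1:
  assumes "n > 0" "0 \<le> s" "s \<le> 4 * (real n)\<^sup>2"
  shows "\<bar>cd_scaled n s\<bar> \<le> 1"
proof -
  have n: "(real n)\<^sup>2 > 0" using assms by simp
  have "\<bar>1 - s / (2 * (real n)\<^sup>2)\<bar> \<le> 1" using assms n by (simp add: abs_le_iff field_simps)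
  from cd_abs_le[OF this] show ?thesis using n by (simp add: cd_scaled_def abs_divide)
qed

text \<open>The rescaled density is at most 1 / 4 because |\<open>cd n\<close>| is largest at 1. The
  resulting decay dominates the Frullani integral at infinity.\<close>

lemma cd_laplace_le_inverse:
  assumes "n > 0" "u > 0"
  shows "cd_laplace n u \<le> 1 / (4 * u)"
proof -
  have h: "has_bochner_integral lborel (\<lambda>s. 1 / 4 * (indicator {0..} s * (s ^ 0 * exp (- (u * s))))) (1 / 4 * (fact 0 / u ^ Suc 0))"
    by (intro has_bochner_integral_mult_right has_bochner_integral_power_exp assms)
  have "cd_laplace n u \<le> (\<integral>s. 1 / 4 * (indicator {0..} s * (s ^ 0 * exp (- (u * s)))) \<partial>lborel)"
    unfolding cd_laplace_eq[OF assms(1)]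
  proof (rule integral_mono')
    show "integrable lborel (\<lambda>s. 1 / 4 * (indicator {0..} s * (s ^ 0 * exp (- (u * s)))))"
      using h by (rule integrable.intros)
    fix s :: real
    have "(cd_scaled n s)\<^sup>2 \<le> 1" if "s \<in> {0..4 * (real n)\<^sup>2}"
      using cd_scaled_abs_le_1[OF assms(1)] that by (simp add: abs_square_le_1)
    thus "indicator {0..4 * (real n)\<^sup>2} s * (exp (- (u * s)) * ((cd_scaled n s)\<^sup>2 / 4)) \<le> 1 / 4 * (indicator {0..} s * (s ^ 0 * exp (- (u * s))))"
      by (auto simp: indicator_def)
  qed (auto simp: indicator_def)
  also have "\<dots> = 1 / (4 * u)" using has_bochner_integral_integral_eq[OF h] by simp
  finally show ?thesis .
qed

text \<open>Cut at R = u^(-1/2): below R the integrand 1 - exp (- u s) is at most u R = sqrt u,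
  above R the tail bound 8 / sqrt R = 8 u^(1/4) applies. A positive power of u makes the quotient by
  u integrable at 0.\<close>

lemma one_minus_cd_laplace_le:
  assumes "n > 0" "0 < u" "u \<le> 1"
  shows "1 - cd_laplace n u \<le> 9 * sqrt (sqrt u)"
proof -
  interpret prob_space "cd_measure n" by (rule prob_space_cd_measure) fact
  define R where "R = 1 / sqrt u"
  define A where "A = {x. 2 * (real n)\<^sup>2 * (1 - x) \<ge> R}"
  have R: "R > 0" using assms by (simp add: R_def)
  have [measurable]: "A \<in> sets borel" unfolding A_def by measurable
  have "1 - cd_laplace n u = (\<integral>x. 1 - exp (- (u * (2 * (real n)\<^sup>2 * (1 - x)))) \<partial>cd_measure n)"
    unfolding cd_laplace_def using prob_space cd_laplace_integrable[OF assms(1), of u] assms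
    by (subst Bochner_Integration.integral_diff) auto
  also have "\<dots> \<le> (\<integral>x. u * R + indicator A x \<partial>cd_measure n)"
  proof (rule integral_mono_AE)
    show "integrable (cd_measure n) (\<lambda>x. 1 - exp (- (u * (2 * (real n)\<^sup>2 * (1 - x)))))"
      using cd_laplace_integrable[OF assms(1), of u] assms by auto
    show "integrable (cd_measure n) (\<lambda>x. u * R + indicator A x)"
      by (rule cd_measure_integrable[where B = "u * R + 1"]) (use assms R in \<open>auto simp: indicator_def\<close>)
    show "AE x in cd_measure n. 1 - exp (- (u * (2 * (real n)\<^sup>2 * (1 - x)))) \<le> u * R + indicator A x"
      using cd_measure_AE[of n]
    proof eventually_elim
      case (elim x)
      let ?s = "2 * (real n)\<^sup>2 * (1 - x)"
      have "1 - exp (- (u * ?s)) \<le> u * ?s" using exp_ge_add_one_self[of "- (u * ?s)"] by linarith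
      moreover have "u * ?s \<le> u * R" if "x \<notin> A"
        using that assms by (intro mult_left_mono) (auto simp: A_def)
      moreover have "1 - exp (- (u * ?s)) \<le> 1" by simp
      moreover have "0 \<le> u * R" using assms R by simp
      ultimately show ?case by (cases "x \<in> A") (auto simp del: exp_ge_zero)
    qed
  qed
  also have "\<dots> = u * R + prob A"
  proof -
    have "integrable (cd_measure n) (indicat_real A)"
      by (rule cd_measure_integrable[where B = 1]) (use assms in \<open>auto simp: indicator_def\<close>)
    thus ?thesis using prob_space by (subst Bochner_Integration.integral_add) auto
  qed
  finally have main: "1 - cd_laplace n u \<le> u * R + prob A" .
  have "prob A \<le> 8 / sqrt R" unfolding A_def by (rule cd_measure_tail) (use assms R in auto)
  also have "8 / sqrt R = 8 * sqrt (sqrt u)" by (simp add: R_def real_sqrt_divide)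
  finally have 1: "prob A \<le> 8 * sqrt (sqrt u)" .
  have "u * R = sqrt u" using assms by (simp add: R_def real_div_sqrt)
  also have "sqrt u \<le> sqrt (sqrt u)"
    using assms by (intro real_sqrt_le_mono) (simp add: real_le_rsqrt power2_eq_square mult_left_le)
  finally show ?thesis using main 1 by simp
qed

definition laplace_limit :: "real \<Rightarrow> real" where
  "laplace_limit u = (\<integral>s. indicator {0..} s * (exp (- (u * s)) * ((cd_limit s)\<^sup>2 / 4)) \<partial>lborel)"

lemma cd_laplace_tendsto:
  assumes u: "u > 0"
  shows "(\<lambda>k. cd_laplace (Suc k) u) \<longlonglongrightarrow> laplace_limit u"
proof -
  have u2: "u / 2 > 0" using u by simp
  define w where "w = (\<lambda>s. exp (2 / u) / 4 * (indicator {0..} s * (s ^ 0 * exp (- (u / 2 * s)))))"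
  have w: "integrable lborel w"
    unfolding w_def by (intro integrable_mult_right integrable.intros[OF has_bochner_integral_power_exp[OF u2]])
  have "(\<lambda>k. \<integral>s. indicator {0..4 * (real (Suc k))\<^sup>2} s * (exp (- (u * s)) * ((cd_scaled (Suc k) s)\<^sup>2 / 4)) \<partial>lborel)
     \<longlonglongrightarrow> laplace_limit u"
    unfolding laplace_limit_def
  proof (rule integral_dominated_convergence[where w = w])
    show "AE s in lborel. (\<lambda>k. indicator {0..4 * (real (Suc k))\<^sup>2} s * (exp (- (u * s)) * ((cd_scaled (Suc k) s)\<^sup>2 / 4)))
         \<longlonglongrightarrow> indicator {0..} s * (exp (- (u * s)) * ((cd_limit s)\<^sup>2 / 4))"
    proof (intro AE_I2)
      fix s :: real
      show "(\<lambda>k. indicator {0..4 * (real (Suc k))\<^sup>2} s * (exp (- (u * s)) * ((cd_scaled (Suc k) s)\<^sup>2 / 4)))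
         \<longlonglongrightarrow> indicator {0..} s * (exp (- (u * s)) * ((cd_limit s)\<^sup>2 / 4))"
      proof (cases "s \<ge> 0")
        case True
        have "filterlim (\<lambda>k. 4 * (real (Suc k))\<^sup>2) at_top sequentially" by real_asymp
        hence "eventually (\<lambda>k. 4 * (real (Suc k))\<^sup>2 \<ge> s) sequentially" by (simp add: filterlim_at_top)
        hence "eventually (\<lambda>k. indicat_real {0..} s = indicator {0..4 * (real (Suc k))\<^sup>2} s) sequentially"
          by eventually_elim (use True in \<open>auto simp: indicator_def\<close>)
        hence "(\<lambda>k. indicator {0..4 * (real (Suc k))\<^sup>2} s) \<longlonglongrightarrow> indicat_real {0..} s"
          by (rule tendsto_eventually[OF eventually_mono]) auto
        thus ?thesis by (intro tendsto_intros cd_scaled_tendsto True) auto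
      qed auto
    qed
    show "AE s in lborel. norm (indicator {0..4 * (real (Suc k))\<^sup>2} s * (exp (- (u * s)) * ((cd_scaled (Suc k) s)\<^sup>2 / 4))) \<le> w s" for k
    proof (intro AE_I2)
      fix s :: real
      show "norm (indicator {0..4 * (real (Suc k))\<^sup>2} s * (exp (- (u * s)) * ((cd_scaled (Suc k) s)\<^sup>2 / 4))) \<le> w s"
      proof (cases "s \<ge> 0")
        case True
        \<comment> \<open>The growth rate u / 4 makes the square grow like exp (u s / 2), so that
          exp (- u s / 2) remains in the majorant.\<close>
        have "\<bar>cd_scaled (Suc k) s\<bar> \<le> exp (u / 4 * s) * exp (1 / (4 * (u / 4)))"
          by (rule cd_scaled_bound) (use True u in auto)
        hence "\<bar>cd_scaled (Suc k) s\<bar>\<^sup>2 \<le> (exp (u / 4 * s) * exp (1 / (4 * (u / 4))))\<^sup>2"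
          by (intro power_mono) auto
        also have "\<dots> = exp (u / 2 * s) * exp (2 / u)"
          by (simp add: power2_eq_square field_simps flip: exp_add)
        finally have "exp (- (u * s)) * ((cd_scaled (Suc k) s)\<^sup>2 / 4) \<le> exp (- (u * s)) * (exp (u / 2 * s) * exp (2 / u) / 4)"
          by (intro mult_left_mono divide_right_mono) auto
        also have "\<dots> = w s" using True by (simp add: w_def field_simps flip: exp_add)
        finally have *: "exp (- (u * s)) * ((cd_scaled (Suc k) s)\<^sup>2 / 4) \<le> w s" .
        have "0 \<le> w s" by (simp add: w_def)
        with * True show ?thesis by (simp add: indicator_def)
      qed (simp add: w_def)
    qed
  qed (use w in auto)
  thus ?thesis by (simp only: cd_laplace_eq zero_less_Suc)
qed

text \<open>Each product of reciprocal factorials is a product of binomial coefficients with upper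
  indices k and k + 2, divided by k! (k + 2)!; the sum is then Vandermonde's convolution.\<close>

lemma bessel_square_coeff:
  "(\<Sum>i\<le>k. 1 / (fact i * fact (Suc i)) * (1 / (fact (k - i) * fact (Suc (k - i))))) =
    real ((2 * k + 2) choose (k + 1)) / (fact k * fact (k + 2))"
proof -
  have "(\<Sum>i\<le>k. 1 / (fact i * fact (Suc i)) * (1 / (fact (k - i) * fact (Suc (k - i))))) =
      (\<Sum>i\<le>k. real (k choose i) * real ((k + 2) choose (k + 1 - i)) / (fact k * fact (k + 2)))"
  proof (intro sum.cong refl)
    fix i assume "i \<in> {..k}"
    hence i: "i \<le> k" by simp
    have 1: "real (k choose i) = fact k / (fact i * fact (k - i))" by (rule binomial_fact) fact
    have "real ((k + 2) choose (k + 1 - i)) = fact (k + 2) / (fact (k + 1 - i) * fact (k + 2 - (k + 1 - i)))"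
      using i by (intro binomial_fact) simp
    moreover have d: "k + 1 - i = Suc (k - i)" "k + 2 - Suc (k - i) = Suc i" using i by auto
    ultimately have 2: "real ((k + 2) choose Suc (k - i)) = fact (k + 2) / (fact (Suc (k - i)) * fact (Suc i))" by (simp only:)
    show "1 / (fact i * fact (Suc i)) * (1 / (fact (k - i) * fact (Suc (k - i)))) =
        real (k choose i) * real ((k + 2) choose (k + 1 - i)) / (fact k * fact (k + 2))"
      unfolding 1 d(1) 2 by (simp del: fact_Suc)
  qed
  also have "\<dots> = real (\<Sum>i\<le>k. (k choose i) * ((k + 2) choose (k + 1 - i))) / (fact k * fact (k + 2))"
    by (simp add: sum_divide_distrib)
  also have "(\<Sum>i\<le>k. (k choose i) * ((k + 2) choose (k + 1 - i))) = (\<Sum>i\<le>k+1. (k choose i) * ((k + 2) choose (k + 1 - i)))"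
    by simp
  also have "\<dots> = (2 * k + 2) choose (k + 1)"
    using vandermonde[of k "k + 2" "k + 1"] by (simp add: mult_2)
  finally show ?thesis .
qed

lemma cd_limit_square_sums:
  assumes "s \<ge> 0"
  shows "(\<lambda>k. (-1) ^ k * (real ((2 * k + 2) choose (k + 1)) / (fact k * fact (k + 2))) * (s / 4) ^ k) sums (cd_limit s)\<^sup>2"
proof -
  define b where "b = (\<lambda>j. (-1) ^ j / (fact j * fact (Suc j)) * (s / 4) ^ j)"
  have "summable (\<lambda>j. norm (b j))"
    unfolding b_def real_norm_def
    by (rule bessel_series_bound(1)[where e = 1]) (rule cd_limit_coeff_abs, rule assms, simp)
  hence "(\<lambda>k. \<Sum>i\<le>k. b i * b (k - i)) sums ((\<Sum>k. b k) * (\<Sum>k. b k))" by (intro Cauchy_product_sums)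
  moreover have "(\<Sum>i\<le>k. b i * b (k - i)) = (-1) ^ k * (real ((2 * k + 2) choose (k + 1)) / (fact k * fact (k + 2))) * (s / 4) ^ k" for k
  proof -
    have "b i * b (k - i) = (-1) ^ k * (s / 4) ^ k * (1 / (fact i * fact (Suc i)) * (1 / (fact (k - i) * fact (Suc (k - i)))))"
      if "i \<le> k" for i
    proof -
      have "(-1 :: real) ^ k = (-1) ^ i * (-1) ^ (k - i)" "(s / 4) ^ k = (s / 4) ^ i * (s / 4) ^ (k - i)"
        using that by (simp_all flip: power_add)
      thus ?thesis by (simp add: b_def)
    qed
    hence "(\<Sum>i\<le>k. b i * b (k - i)) = (-1) ^ k * (s / 4) ^ k * (\<Sum>i\<le>k. 1 / (fact i * fact (Suc i)) * (1 / (fact (k - i) * fact (Suc (k - i)))))"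
      by (simp add: sum_distrib_left)
    thus ?thesis unfolding bessel_square_coeff by (simp add: mult_ac)
  qed
  moreover have "cd_limit s = (\<Sum>k. b k)" by (simp add: cd_limit_def b_def)
  ultimately show ?thesis by (simp add: power2_eq_square)
qed

lemma binomial_central_le: "real ((2 * k + 2) choose (k + 1)) \<le> 4 ^ Suc k"
proof -
  have "(2 * k + 2) choose (k + 1) \<le> 2 ^ (2 * k + 2)" by (rule binomial_le_pow2)
  also have "\<dots> = 4 ^ Suc k" using power_mult[of "2 :: nat" 2 "Suc k"] by simp
  finally show ?thesis by (metis of_nat_le_iff of_nat_numeral of_nat_power)
qed

text \<open>Termwise integration of the squared Bessel series. The series of absolute values
  converges because the central binomials grow at most like 4^(k + 1) against a factorial.\<close>

lemma laplace_limit_series: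
  assumes u: "u > 0"
  shows "laplace_limit u = (\<Sum>k. (-1) ^ k * (real ((2 * k + 2) choose (k + 1)) / fact (k + 2)) / (4 * u) ^ Suc k)"
proof -
  define c where "c = (\<lambda>k. real ((2 * k + 2) choose (k + 1)) / (fact k * fact (k + 2)))"
  define f where "f = (\<lambda>k s. (-1) ^ k * c k / 4 ^ Suc k * (indicator {0..} s * (s ^ k * exp (- (u * s)))))"
  have c0: "c k \<ge> 0" for k by (simp add: c_def)
  have hf: "has_bochner_integral lborel (f k) ((-1) ^ k * c k / 4 ^ Suc k * (fact k / u ^ Suc k))" for k
    unfolding f_def by (intro has_bochner_integral_mult_right has_bochner_integral_power_exp u)
  have nf: "norm (f k s) = c k / 4 ^ Suc k * (indicator {0..} s * (s ^ k * exp (- (u * s))))" for k s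
    using c0[of k] by (auto simp: f_def abs_mult power_abs indicator_def)
  have hnf: "has_bochner_integral lborel (\<lambda>s. norm (f k s)) (c k / 4 ^ Suc k * (fact k / u ^ Suc k))" for k
    unfolding nf by (intro has_bochner_integral_mult_right has_bochner_integral_power_exp u)
  have val: "c k / 4 ^ Suc k * (fact k / u ^ Suc k) = real ((2 * k + 2) choose (k + 1)) / fact (k + 2) / (4 * u) ^ Suc k" for k
    by (simp add: c_def power_mult_distrib del: fact_Suc power_Suc binomial_Suc_Suc)
  have sumf: "f k s = indicator {0..} s * (exp (- (u * s)) * (((-1) ^ k * c k * (s / 4) ^ k) / 4))" for k s
    by (simp add: f_def power_divide mult_ac)
  have "laplace_limit u = (\<integral>s. (\<Sum>k. f k s) \<partial>lborel)"
    unfolding laplace_limit_def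
  proof (intro Bochner_Integration.integral_cong refl)
    fix s :: real
    show "indicator {0..} s * (exp (- (u * s)) * ((cd_limit s)\<^sup>2 / 4)) = (\<Sum>k. f k s)"
    proof (cases "s \<ge> 0")
      case True
      have "(\<lambda>k. f k s) sums (indicator {0..} s * (exp (- (u * s)) * ((cd_limit s)\<^sup>2 / 4)))"
        unfolding sumf c_def by (intro sums_mult sums_divide cd_limit_square_sums True)
      thus ?thesis by (simp add: sums_iff)
    qed (simp add: f_def)
  qed
  also have "\<dots> = (\<Sum>k. \<integral>s. f k s \<partial>lborel)"
  proof (rule integral_suminf)
    show "integrable lborel (f k)" for k using hf by (rule integrable.intros)
    show "AE s in lborel. summable (\<lambda>k. norm (f k s))"
    proof (intro AE_I2)
      fix s :: real
      show "summable (\<lambda>k. norm (f k s))"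
      proof (cases "s \<ge> 0")
        case True
        show ?thesis
        proof (rule summable_comparison_test'[OF sums_summable[OF sums_mult[OF exp_sums_divide_fact[of s], of "exp (- (u * s))"]], of 0])
          fix k :: nat
          have "c k / 4 ^ Suc k \<le> 1 / fact k"
          proof -
            have "c k \<le> 4 ^ Suc k / (fact k * 1)"
              unfolding c_def by (intro frac_le binomial_central_le mult_left_mono) (auto simp del: fact_Suc)
            thus ?thesis by (simp add: field_simps)
          qed
          hence "c k / 4 ^ Suc k * (s ^ k * exp (- (u * s))) \<le> 1 / fact k * (s ^ k * exp (- (u * s)))"
            using True by (intro mult_right_mono) auto
          also have "\<dots> = exp (- (u * s)) * (s ^ k / fact k)" by simp
          finally have "norm (f k s) \<le> exp (- (u * s)) * (s ^ k / fact k)"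
            unfolding nf using True by (simp add: indicator_def)
          thus "norm (norm (f k s)) \<le> exp (- (u * s)) * (s ^ k / fact k)" by (simp only: real_norm_def abs_idempotent)
        qed
      qed (simp add: f_def)
    qed
    show "summable (\<lambda>k. \<integral>s. norm (f k s) \<partial>lborel)"
      unfolding has_bochner_integral_integral_eq[OF hnf] val
    proof (rule summable_comparison_test')
      have "summable (\<lambda>k. (1 / u) ^ k / fact k)" using exp_sums_divide_fact by (rule sums_summable)
      thus "summable (\<lambda>k. (1 / u) ^ Suc k / fact (Suc k))" by (subst summable_Suc_iff)
      fix k :: nat
      have "real ((2 * k + 2) choose (k + 1)) / fact (k + 2) \<le> 4 ^ Suc k / fact (Suc k)"
        by (intro frac_le binomial_central_le fact_mono) auto
      hence "real ((2 * k + 2) choose (k + 1)) / fact (k + 2) / (4 * u) ^ Suc k \<le> 4 ^ Suc k / fact (Suc k) / (4 * u) ^ Suc k"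
        using u by (intro divide_right_mono) auto
      also have "\<dots> = (1 / u) ^ Suc k / fact (Suc k)"
        by (simp add: power_mult_distrib power_divide del: fact_Suc power_Suc)
      finally show "norm (real ((2 * k + 2) choose (k + 1)) / fact (k + 2) / (4 * u) ^ Suc k) \<le> (1 / u) ^ Suc k / fact (Suc k)"
        using u by simp
    qed
  qed
  also have "\<dots> = (\<Sum>k. (-1) ^ k * (real ((2 * k + 2) choose (k + 1)) / fact (k + 2)) / (4 * u) ^ Suc k)"
  proof (intro suminf_cong)
    fix k
    have "(\<integral>s. f k s \<partial>lborel) = (-1) ^ k * (c k / 4 ^ Suc k * (fact k / u ^ Suc k))"
      using has_bochner_integral_integral_eq[OF hf] by (simp add: mult.assoc)
    thus "(\<integral>s. f k s \<partial>lborel) = (-1) ^ k * (real ((2 * k + 2) choose (k + 1)) / fact (k + 2)) / (4 * u) ^ Suc k"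
      unfolding val by simp
  qed
  finally show ?thesis .
qed

section \<open>The limiting law and its logarithmic moments\<close>

text \<open>The arcsine-type law \<open>(4/\<pi>) cos\<^sup>2 x dx\<close> on \<open>[0, \<pi>/2]\<close> mixes the exponentials in the limiting Laplace transform.\<close>

definition arc_dens :: "real \<Rightarrow> real" where
  "arc_dens x = indicator {0..pi/2} x * (4 / pi * (cos x)\<^sup>2)"

definition arc_law :: "real measure" where
  "arc_law = density lborel (\<lambda>x. ennreal (arc_dens x))"

lemma arc_dens_nonneg: "arc_dens x \<ge> 0"
  by (simp add: arc_dens_def)

lemma arc_dens_measurable [measurable]: "arc_dens \<in> borel_measurable borel"
  unfolding arc_dens_def by measurable

lemma sets_arc [measurable_cong, simp]: "sets arc_law = sets borel"
  by (simp add: arc_law_def)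

lemma space_arc [simp]: "space arc_law = UNIV"
  by (simp add: arc_law_def)

lemma arc_integral:
  fixes f :: "real \<Rightarrow> real"
  assumes [measurable]: "f \<in> borel_measurable borel"
  shows "(\<integral>x. f x \<partial>arc_law) = (\<integral>x. arc_dens x * f x \<partial>lborel)"
  unfolding arc_law_def by (subst integral_density) (auto simp: arc_dens_nonneg)

lemma arc_AE: "AE x in arc_law. 0 < x \<and> x < pi / 2"
proof -
  have "AE x in lborel. x \<noteq> (0::real)" "AE x in lborel. x \<noteq> pi / 2" by (rule AE_lborel_singleton)+
  thus ?thesis unfolding arc_law_def
    by (subst AE_density) (auto simp: arc_dens_def indicator_def elim!: eventually_elim2)
qed

text \<open>Reduces a mean under \<open>arc_law\<close> to an antiderivative of (cos x)^2 f; the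
  explicit evaluations below exhibit such an \<open>F\<close>.\<close>

lemma arc_integral_FTC:
  fixes f F :: "real \<Rightarrow> real"
  assumes [measurable]: "f \<in> borel_measurable borel" and c: "continuous_on {0..pi/2} f"
    and F: "\<And>x. 0 \<le> x \<Longrightarrow> x \<le> pi / 2 \<Longrightarrow> (F has_real_derivative (cos x)\<^sup>2 * f x) (at x within {0..pi/2})"
  shows "(\<integral>x. f x \<partial>arc_law) = 4 / pi * (F (pi / 2) - F 0)"
proof -
  have "(\<integral>x. f x \<partial>arc_law) = (\<integral>x. 4 / pi * (indicator {0..pi/2} x *\<^sub>R ((cos x)\<^sup>2 * f x)) \<partial>lborel)"
    by (subst arc_integral) (measurable, intro Bochner_Integration.integral_cong refl, simp add: arc_dens_def)
  also have "\<dots> = 4 / pi * (\<integral>x. indicator {0..pi/2} x *\<^sub>R ((cos x)\<^sup>2 * f x) \<partial>lborel)"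
    by (rule integral_mult_right_zero)
  also have "(\<integral>x. indicator {0..pi/2} x *\<^sub>R ((cos x)\<^sup>2 * f x) \<partial>lborel) = F (pi / 2) - F 0"
    by (rule integral_FTC_atLeastAtMost)
       (use F c in \<open>auto intro!: continuous_intros simp: has_real_derivative_iff_has_vector_derivative\<close>)
  finally show ?thesis .
qed

lemma prob_space_arc: "prob_space arc_law"
proof
  have "(\<integral>x. (1::real) \<partial>arc_law) = 4 / pi * ((pi / 2 / 2 + sin (pi / 2) * cos (pi / 2) / 2) - (0 / 2 + sin 0 * cos 0 / 2))"
  proof (rule arc_integral_FTC[where F = "\<lambda>x. x / 2 + sin x * cos x / 2"])
    fix x :: real
    have "(sin x)\<^sup>2 = 1 - (cos x)\<^sup>2" using sin_squared_eq by blast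
    hence "1 / 2 + (cos x * cos x + sin x * (- sin x)) / 2 = (cos x)\<^sup>2 * 1"
      by (simp add: power2_eq_square field_simps)
    moreover have "((\<lambda>x. x / 2 + sin x * cos x / 2) has_real_derivative 1 / 2 + (cos x * cos x + sin x * (- sin x)) / 2) (at x within {0..pi/2})"
      by (auto intro!: derivative_eq_intros simp: field_simps)
    ultimately show "((\<lambda>x. x / 2 + sin x * cos x / 2) has_real_derivative (cos x)\<^sup>2 * 1) (at x within {0..pi/2})"
      by simp
  qed auto
  also have "\<dots> = 1" by simp
  finally have "(\<integral>x. (1::real) \<partial>arc_law) = 1" .
  hence "(\<integral>x. arc_dens x \<partial>lborel) = 1" by (subst (asm) arc_integral) auto
  moreover have "integrable lborel arc_dens"
  proof -
    have "set_integrable lborel {0..pi/2} (\<lambda>x. 4 / pi * (cos x)\<^sup>2)"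
      by (intro borel_integrable_atLeastAtMost' continuous_intros)
    thus ?thesis by (simp add: set_integrable_def arc_dens_def[abs_def])
  qed
  moreover have "emeasure arc_law (space arc_law) = (\<integral>\<^sup>+x. ennreal (arc_dens x) \<partial>lborel)"
    by (simp add: arc_law_def emeasure_density)
  ultimately show "emeasure arc_law (space arc_law) = 1"
    by (simp add: nn_integral_eq_integral arc_dens_nonneg)
qed

lemma arc_integrable:
  assumes "f \<in> borel_measurable borel" "\<And>x. 0 < x \<Longrightarrow> x < pi / 2 \<Longrightarrow> \<bar>f x\<bar> \<le> (B :: real)"
  shows "integrable arc_law f"
proof -
  interpret prob_space arc_law by (rule prob_space_arc)
  have "AE x in arc_law. norm (f x) \<le> B"
    using arc_AE by eventually_elim (use assms in simp)
  thus ?thesis using assms(1) by (intro integrable_const_bound[where B = B]) auto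
qed

text \<open>The moments are Catalan numbers divided by 4^m, the numbers that also occur in
  \<open>laplace_limit_series\<close>. Their recurrence comes from the derivative of (sin x)^(2 m +
  1) (cos x)^3, a function that vanishes at both endpoints.\<close>

lemma arc_moment: "(\<integral>x. (sin x) ^ (2 * m) \<partial>arc_law) = real ((2 * m) choose m) / (real (m + 1) * 4 ^ m)"
proof (induction m)
  case 0
  interpret prob_space arc_law by (rule prob_space_arc)
  show ?case using prob_space by simp
next
  case (Suc m)
  have i: "integrable arc_law (\<lambda>x. (sin x) ^ (2 * m))" for m
    by (rule arc_integrable[where B = 1]) (auto simp: power_abs power_le_one)
  have "(\<integral>x. real (2 * m + 1) * (sin x) ^ (2 * m) - real (2 * m + 4) * (sin x) ^ (2 * Suc m) \<partial>arc_law)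
     = 4 / pi * ((sin (pi / 2)) ^ (2 * m + 1) * (cos (pi / 2)) ^ 3 - (sin 0) ^ (2 * m + 1) * (cos 0) ^ 3)"
  proof (rule arc_integral_FTC[where F = "\<lambda>x. (sin x) ^ (2 * m + 1) * (cos x) ^ 3"])
    fix x :: real
    have s: "(cos x)\<^sup>2 = 1 - (sin x)\<^sup>2" using cos_squared_eq by blast
    have "((\<lambda>x. (sin x) ^ (2 * m + 1) * (cos x) ^ 3) has_real_derivative
        (real (2 * m + 1) * (sin x) ^ (2 * m) * cos x * (cos x) ^ 3 + (sin x) ^ (2 * m + 1) * (3 * (cos x)\<^sup>2 * (- sin x)))) (at x within {0..pi/2})"
      by (rule derivative_eq_intros refl)+ (simp add: algebra_simps)
    also have "real (2 * m + 1) * (sin x) ^ (2 * m) * cos x * (cos x) ^ 3 + (sin x) ^ (2 * m + 1) * (3 * (cos x)\<^sup>2 * (- sin x))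
       = (cos x)\<^sup>2 * (real (2 * m + 1) * (sin x) ^ (2 * m) * (cos x)\<^sup>2 - 3 * (sin x)\<^sup>2 * (sin x) ^ (2 * m))"
      by (simp add: power2_eq_square power3_eq_cube algebra_simps)
    also have "real (2 * m + 1) * (sin x) ^ (2 * m) * (cos x)\<^sup>2 - 3 * (sin x)\<^sup>2 * (sin x) ^ (2 * m) =
        real (2 * m + 1) * (sin x) ^ (2 * m) - real (2 * m + 4) * (sin x) ^ (2 * Suc m)"
      unfolding s by (simp add: power2_eq_square algebra_simps)
    finally show "((\<lambda>x. (sin x) ^ (2 * m + 1) * (cos x) ^ 3) has_real_derivative
        (cos x)\<^sup>2 * (real (2 * m + 1) * (sin x) ^ (2 * m) - real (2 * m + 4) * (sin x) ^ (2 * Suc m))) (at x within {0..pi/2})" .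
  qed (auto intro!: continuous_intros)
  hence rec: "real (2 * m + 1) * (\<integral>x. (sin x) ^ (2 * m) \<partial>arc_law) - real (2 * m + 4) * (\<integral>x. (sin x) ^ (2 * Suc m) \<partial>arc_law) = 0"
    using i[of m] i[of "Suc m"] by (subst (asm) Bochner_Integration.integral_diff) auto
  have "(\<integral>x. (sin x) ^ (2 * Suc m) \<partial>arc_law) = real (2 * m + 1) / real (2 * m + 4) * (real ((2 * m) choose m) / (real (m + 1) * 4 ^ m))"
  proof -
    have "D = a / b * X" if "a * X - b * D = 0" "b \<noteq> 0" for a b X D :: real
      using that by (simp add: field_simps)
    from this[OF rec] show ?thesis by (simp add: Suc.IH del: binomial_Suc_Suc)
  qed
  also have "\<dots> = real ((2 * Suc m) choose Suc m) / (real (Suc m + 1) * 4 ^ Suc m)"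
  proof -
    \<comment> \<open>Two absorption identities take the central binomial coefficient from m to m +
      1.\<close>
    have "real (Suc m) * real (Suc m) * real ((2 * Suc m) choose Suc m) = real (Suc m) * real (2 * Suc m) * real (Suc (2 * m) choose m)"
    proof -
      have e: "2 * Suc m = Suc (Suc (2 * m))" by simp
      have "real (2 * Suc m) * real (Suc (2 * m) choose m) = real ((2 * Suc m) choose Suc m) * real (Suc m)"
        unfolding e using arg_cong[OF Suc_times_binomial_eq[of "Suc (2 * m)" m], of real] by (simp only: of_nat_mult)
      thus ?thesis by (metis mult.assoc mult.commute)
    qed
    also have "real (Suc m) * real (Suc (2 * m) choose m) = real (2 * m + 1) * real ((2 * m) choose m)"
    proof -
      have "Suc (2 * m) choose m = Suc (2 * m) choose Suc m"
        by (subst binomial_symmetric) auto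
      hence "Suc m * (Suc (2 * m) choose m) = Suc (2 * m) * ((2 * m) choose m)"
        using Suc_times_binomial_eq[of "2 * m" m] by (simp only: mult.commute)
      thus ?thesis by (metis Suc_eq_plus1 of_nat_mult)
    qed
    hence "real (Suc m) * real (2 * Suc m) * real (Suc (2 * m) choose m) = real (2 * Suc m) * (real (2 * m + 1) * real ((2 * m) choose m))"
      by (metis mult.assoc mult.commute)
    finally have fin: "real (Suc m) * real (Suc m) * real ((2 * Suc m) choose Suc m) =
        real (2 * Suc m) * (real (2 * m + 1) * real ((2 * m) choose m))" .
    have "B = 2 * Y / a" if "a * a * B = c * Y" "c = 2 * a" "a \<noteq> 0" for a B c Y :: real
      using that by (simp add: field_simps)
    from this[OF fin] have c: "real ((2 * Suc m) choose Suc m) = 2 * (real (2 * m + 1) * real ((2 * m) choose m)) / real (Suc m)"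
      by simp
    have alg: "p / (2 * b) * (X / (a * Q)) = (2 * (p * X) / a) / (b * (4 * Q))" if "a > 0" "b > 0" "Q > 0" for p b X a Q :: real
      using that by (simp add: divide_simps)
    have e: "real (2 * m + 4) = 2 * real (Suc m + 1)" "real (m + 1) = real (Suc m)" "(4::real) ^ Suc m = 4 * 4 ^ m" by simp_all
    show ?thesis unfolding c e by (rule alg) simp_all
  qed
  finally show ?case .
qed

definition arc_laplace :: "real \<Rightarrow> real" where
  "arc_laplace w = (\<integral>x. exp (- (w * (2 * (sin x)\<^sup>2))) \<partial>arc_law)"

lemma arc_laplace_sums:
  "(\<lambda>m. (- (2 * w)) ^ m / fact m * (real ((2 * m) choose m) / (real (m + 1) * 4 ^ m))) sums arc_laplace w"
proof -
  define f where "f = (\<lambda>m x. (- (2 * w)) ^ m / fact m * (sin x) ^ (2 * m))"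
  have i: "integrable arc_law (f m)" for m
    unfolding f_def
    by (intro integrable_mult_right arc_integrable[where B = 1]) (auto simp: power_abs power_le_one)
  have b: "norm (f m x) \<le> \<bar>2 * w\<bar> ^ m / fact m" for m x
  proof -
    have "\<bar>sin x\<bar> ^ (2 * m) \<le> 1" by (intro power_le_one) auto
    thus ?thesis by (simp add: f_def abs_mult power_abs divide_right_mono mult_left_le)
  qed
  have "(\<lambda>m. integral\<^sup>L arc_law (f m)) sums (\<integral>x. (\<Sum>m. f m x) \<partial>arc_law)"
  proof (rule sums_integral[OF i])
    show "AE x in arc_law. summable (\<lambda>m. norm (f m x))"
      by (intro AE_I2 summable_comparison_test'[OF sums_summable[OF exp_sums_divide_fact[of "\<bar>2 * w\<bar>"]], of 0])
         (use b in auto)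
    show "summable (\<lambda>m. \<integral>x. norm (f m x) \<partial>arc_law)"
    proof (rule summable_comparison_test'[OF sums_summable[OF exp_sums_divide_fact[of "\<bar>2 * w\<bar>"]], of 0])
      interpret prob_space arc_law by (rule prob_space_arc)
      fix m :: nat
      have "(\<integral>x. norm (f m x) \<partial>arc_law) \<le> (\<integral>x. \<bar>2 * w\<bar> ^ m / fact m \<partial>arc_law)"
        using i[of m] b by (intro integral_mono) auto
      thus "norm (\<integral>x. norm (f m x) \<partial>arc_law) \<le> \<bar>2 * w\<bar> ^ m / fact m"
        using prob_space by simp
    qed
  qed
  moreover have "(\<Sum>m. f m x) = exp (- (w * (2 * (sin x)\<^sup>2)))" for x
  proof -
    have "f m x = (- (w * (2 * (sin x)\<^sup>2))) ^ m / fact m" for m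
    proof -
      have "(- (w * (2 * (sin x)\<^sup>2))) ^ m = (- (2 * w) * (sin x)\<^sup>2) ^ m" by (simp add: mult_ac)
      thus ?thesis by (simp only: f_def power_mult_distrib power_mult) simp
    qed
    thus ?thesis using exp_sums_divide_fact[of "- (w * (2 * (sin x)\<^sup>2))"] by (simp add: sums_iff)
  qed
  moreover have "integral\<^sup>L arc_law (f m) = (- (2 * w)) ^ m / fact m * (real ((2 * m) choose m) / (real (m + 1) * 4 ^ m))" for m
    unfolding f_def by (simp only: integral_mult_right_zero arc_moment)
  ultimately show ?thesis by (simp only: arc_laplace_def)
qed

text \<open>Both sides are power series in 1 / u. The series of \<open>arc_laplace\<close> starts
  with the term 1; once this is removed, the index shift m = k + 1 matches its Catalan numbers with
  the coefficients of \<open>laplace_limit_series\<close>, with opposite sign.\<close>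

lemma laplace_limit_eq:
  assumes "u > 0"
  shows "laplace_limit u = 1 - arc_laplace (1 / (2 * u))"
proof -
  define t where "t = (\<lambda>m. (- (2 * (1 / (2 * u)))) ^ m / fact m * (real ((2 * m) choose m) / (real (m + 1) * 4 ^ m)))"
  have "(\<lambda>k. - t (Suc k)) sums (- (arc_laplace (1 / (2 * u)) - t 0))"
    using arc_laplace_sums[of "1 / (2 * u)"] sums_Suc_iff[of t "arc_laplace (1 / (2 * u)) - t 0"]
    unfolding t_def[symmetric] by (intro sums_minus) simp
  moreover have "- t (Suc k) = (-1) ^ k * (real ((2 * k + 2) choose (k + 1)) / fact (k + 2)) / (4 * u) ^ Suc k" for k
  proof -
    have 1: "2 * Suc k = 2 * k + 2" "Suc k = k + 1" by simp_all
    have "(- (2 * (1 / (2 * u)))) ^ Suc k = - ((-1) ^ k / u ^ Suc k)"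
      using assms by (simp add: power_minus' divide_simps power_minus[of "inverse u"])
    moreover have "fact (k + 2) = real (Suc k + 1) * fact (Suc k)" by (simp add: algebra_simps)
    ultimately show ?thesis
      unfolding t_def by (simp only: power_mult_distrib 1(1)) (simp del: binomial_Suc_Suc fact_Suc power_Suc of_nat_Suc)
  qed
  moreover have "t 0 = 1" by (simp add: t_def)
  ultimately show ?thesis
    using laplace_limit_series[OF assms] by (simp add: sums_iff)
qed

section \<open>Frullani integrals, Euler's constant and inversion of the argument\<close>

abbreviation (input) pos :: "real \<Rightarrow> real" where
  "pos \<equiv> indicator {0<..}"

lemma AE_lborel_pos_nonneg: "AE v::real in lborel. indicat_real {0<..} v = indicat_real {0..} v"
  by (rule eventually_mono[OF AE_lborel_singleton[of "0::real"]]) (auto simp: indicator_def)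

text \<open>The integrand is the integral of exp (- c v) over c from a to b; by Tonelli the integral
  over v may be taken first and gives 1 / c.\<close>

lemma frullani_nn_integral:
  assumes "0 < a" "a \<le> b"
  shows "(\<integral>\<^sup>+v. ennreal (pos v * ((exp (- (a * v)) - exp (- (b * v))) / v)) \<partial>lborel) = ennreal (ln b - ln a)"
proof -
  have "(\<integral>\<^sup>+v. ennreal (pos v * ((exp (- (a * v)) - exp (- (b * v))) / v)) \<partial>lborel) =
      (\<integral>\<^sup>+v. (\<integral>\<^sup>+c. ennreal (pos v * exp (- (c * v))) * indicator {a..b} c \<partial>lborel) \<partial>lborel)"
  proof (intro nn_integral_cong)
    fix v :: real
    show "ennreal (pos v * ((exp (- (a * v)) - exp (- (b * v))) / v)) =
        (\<integral>\<^sup>+c. ennreal (pos v * exp (- (c * v))) * indicator {a..b} c \<partial>lborel)"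
    proof (cases "v > 0")
      case True
      have "(\<integral>\<^sup>+c. ennreal (exp (- (c * v))) * indicator {a..b} c \<partial>lborel) =
          ennreal (- exp (- (b * v)) / v - (- exp (- (a * v)) / v))"
        by (rule nn_integral_FTC_Icc[where F = "\<lambda>c. - exp (- (c * v)) / v"])
           (use True assms in \<open>auto intro!: derivative_eq_intros\<close>)
      thus ?thesis using True by (simp add: diff_divide_distrib)
    qed auto
  qed
  also have "\<dots> = (\<integral>\<^sup>+c. (\<integral>\<^sup>+v. ennreal (pos v * exp (- (c * v))) * indicator {a..b} c \<partial>lborel) \<partial>lborel)"
    by (rule lborel_pair.Fubini') measurable
  also have "\<dots> = (\<integral>\<^sup>+c. ennreal (1 / c) * indicator {a..b} c \<partial>lborel)"
  proof (intro nn_integral_cong)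
    fix c :: real
    show "(\<integral>\<^sup>+v. ennreal (pos v * exp (- (c * v))) * indicator {a..b} c \<partial>lborel) = ennreal (1 / c) * indicator {a..b} c"
    proof (cases "c \<in> {a..b}")
      case True
      hence c: "c > 0" using assms by auto
      have "(\<integral>\<^sup>+v. ennreal (pos v * exp (- (c * v))) \<partial>lborel) = (\<integral>\<^sup>+v. ennreal (indicat_real {0..} v * (v ^ 0 * exp (- (c * v)))) \<partial>lborel)"
        by (intro nn_integral_cong_AE) (use AE_lborel_pos_nonneg in eventually_elim, simp)
      also have "\<dots> = ennreal (1 / c)"
        using has_bochner_integral_power_exp[OF c, of 0]
        by (subst nn_integral_eq_integral) (auto simp: has_bochner_integral_iff)
      finally show ?thesis using True by simp
    qed auto
  qed
  also have "\<dots> = ennreal (ln b - ln a)"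
    by (rule nn_integral_FTC_Icc) (use assms in \<open>auto intro!: derivative_eq_intros\<close>)
  finally show ?thesis .
qed

text \<open>For fixed \<open>a\<close> the kernel has constant sign, so the integral of its absolute
  value is |ln a|, and integrability over a random \<open>a\<close> becomes integrability of the
  logarithm.\<close>

definition frullani_kernel :: "real \<Rightarrow> real \<Rightarrow> real" where
  "frullani_kernel a v = pos v * ((exp (- v) - exp (- (a * v))) / v)"

lemma frullani_kernel_measurable [measurable]:
  "case_prod frullani_kernel \<in> borel_measurable (borel \<Otimes>\<^sub>M borel)"
  unfolding frullani_kernel_def by measurable

lemma frullani_kernel_abs_nn_integral:
  assumes "a > 0"
  shows "(\<integral>\<^sup>+v. ennreal \<bar>frullani_kernel a v\<bar> \<partial>lborel) = ennreal \<bar>ln a\<bar>"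
proof (cases "a \<ge> 1")
  case True
  have "\<bar>frullani_kernel a v\<bar> = pos v * ((exp (- (1 * v)) - exp (- (a * v))) / v)" for v
    using True by (auto simp: frullani_kernel_def indicator_def)
  thus ?thesis using frullani_nn_integral[of 1 a] True by simp
next
  case False
  have "\<bar>frullani_kernel a v\<bar> = pos v * ((exp (- (a * v)) - exp (- (1 * v))) / v)" for v
    using False by (auto simp: frullani_kernel_def indicator_def divide_simps) (simp add: algebra_simps)
  thus ?thesis using frullani_nn_integral[of a 1] False assms by simp
qed

lemma frullani_kernel_integral:
  assumes "a > 0"
  shows "integrable lborel (frullani_kernel a)" "(\<integral>v. frullani_kernel a v \<partial>lborel) = ln a"
    and "(\<integral>v. \<bar>frullani_kernel a v\<bar> \<partial>lborel) = \<bar>ln a\<bar>"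
proof -
  have m: "frullani_kernel a \<in> borel_measurable lborel" unfolding frullani_kernel_def by measurable
  show i: "integrable lborel (frullani_kernel a)"
    using m frullani_kernel_abs_nn_integral[OF assms] by (intro integrableI_bounded) auto
  show abs: "(\<integral>v. \<bar>frullani_kernel a v\<bar> \<partial>lborel) = \<bar>ln a\<bar>"
    using frullani_kernel_abs_nn_integral[OF assms] m by (subst integral_eq_nn_integral) auto
  show "(\<integral>v. frullani_kernel a v \<partial>lborel) = ln a"
  proof (cases "a \<ge> 1")
    case True
    have "(\<integral>v. frullani_kernel a v \<partial>lborel) = (\<integral>v. \<bar>frullani_kernel a v\<bar> \<partial>lborel)"
      using True by (intro Bochner_Integration.integral_cong) (auto simp: frullani_kernel_def indicator_def)
    thus ?thesis using abs True by simp
  next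
    case False
    have "(\<integral>v. frullani_kernel a v \<partial>lborel) = (\<integral>v. - \<bar>frullani_kernel a v\<bar> \<partial>lborel)"
      using False by (intro Bochner_Integration.integral_cong) (auto simp: frullani_kernel_def indicator_def divide_simps)
    thus ?thesis using abs False assms by simp
  qed
qed

text \<open>Fubini for the kernel over \<open>M\<close> and v. Its absolute value integrates in v to
  |ln (c x)|, so the hypothesis on ln (c x) is what permits the exchange.\<close>

lemma frullani_expectation:
  fixes c :: "'a \<Rightarrow> real"
  assumes "prob_space M" and [measurable]: "c \<in> borel_measurable M"
    and pos_c: "AE x in M. c x > 0" and int: "integrable M (\<lambda>x. ln (c x))"
  shows "integrable lborel (\<lambda>v. pos v * ((exp (- v) - (\<integral>x. exp (- (c x * v)) \<partial>M)) / v))"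
    and "(\<integral>v. pos v * ((exp (- v) - (\<integral>x. exp (- (c x * v)) \<partial>M)) / v) \<partial>lborel) = (\<integral>x. ln (c x) \<partial>M)"
proof -
  interpret prob_space M by fact
  interpret P: pair_sigma_finite M "lborel :: real measure" ..
  define f where "f = (\<lambda>(x, v). frullani_kernel (c x) v)"
  have fm [measurable]: "f \<in> borel_measurable (M \<Otimes>\<^sub>M lborel)"
    unfolding f_def by measurable
  have fint: "integrable (M \<Otimes>\<^sub>M lborel) f"
  proof (rule P.Fubini_integrable[OF fm])
    have "AE x in M. (\<integral>v. norm (f (x, v)) \<partial>lborel) = \<bar>ln (c x)\<bar>"
      using pos_c by eventually_elim (simp add: f_def frullani_kernel_integral)
    thus "integrable M (\<lambda>x. \<integral>v. norm (f (x, v)) \<partial>lborel)"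
      using int by (subst integrable_cong_AE[where g = "\<lambda>x. \<bar>ln (c x)\<bar>"]) auto
    show "AE x in M. integrable lborel (\<lambda>v. f (x, v))"
      using pos_c by eventually_elim (simp add: f_def frullani_kernel_integral)
  qed
  have inner: "(\<integral>x. f (x, v) \<partial>M) = pos v * ((exp (- v) - (\<integral>x. exp (- (c x * v)) \<partial>M)) / v)" for v
  proof (cases "v > 0")
    case True
    have "AE x in M. norm (exp (- (c x * v))) \<le> 1" using pos_c by eventually_elim (use True in auto)
    hence "integrable M (\<lambda>x. exp (- (c x * v)))" by (intro integrable_const_bound[where B = 1]) auto
    hence "(\<integral>x. exp (- v) - exp (- (c x * v)) \<partial>M) = exp (- v) - (\<integral>x. exp (- (c x * v)) \<partial>M)"
      using prob_space by (subst Bochner_Integration.integral_diff) auto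
    moreover have "f (x, v) = (exp (- v) - exp (- (c x * v))) / v" for x
      using True by (simp add: f_def frullani_kernel_def)
    ultimately show ?thesis using True by simp
  qed (simp add: f_def frullani_kernel_def)
  have f': "integrable (M \<Otimes>\<^sub>M lborel) (case_prod (\<lambda>x v. f (x, v)))" using fint by simp
  show "integrable lborel (\<lambda>v. pos v * ((exp (- v) - (\<integral>x. exp (- (c x * v)) \<partial>M)) / v))"
    using P.integrable_snd[OF f'] unfolding inner .
  have "(\<integral>v. pos v * ((exp (- v) - (\<integral>x. exp (- (c x * v)) \<partial>M)) / v) \<partial>lborel) = (\<integral>x. (\<integral>v. f (x, v) \<partial>lborel) \<partial>M)"
    using P.Fubini_integral[OF f'] unfolding inner .
  also have "\<dots> = (\<integral>x. ln (c x) \<partial>M)"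
  proof (rule integral_cong_AE)
    show "AE x in M. (\<integral>v. f (x, v) \<partial>lborel) = ln (c x)"
      using pos_c by eventually_elim (simp add: f_def frullani_kernel_integral)
  qed auto
  finally show "(\<integral>v. pos v * ((exp (- v) - (\<integral>x. exp (- (c x * v)) \<partial>M)) / v) \<partial>lborel) = (\<integral>x. ln (c x) \<partial>M)" .
qed

lemma has_bochner_integral_of_has_integral:
  fixes f :: "real \<Rightarrow> real"
  assumes "f \<in> borel_measurable borel" "S \<in> sets borel" "\<And>x. x \<in> S \<Longrightarrow> 0 \<le> f x" "(f has_integral I) S"
  shows "has_bochner_integral lborel (\<lambda>x. indicator S x * f x) I"
proof (rule has_bochner_integral_nn_integral)
  show "0 \<le> I" using has_integral_nonneg[OF assms(4,3)] .
  show "(\<integral>\<^sup>+x. ennreal (indicator S x * f x) \<partial>lborel) = ennreal I"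
    using nn_integral_has_integral_lebesgue[OF assms(3,4)] by simp
  show "AE x in lborel. 0 \<le> indicator S x * f x" using assms(3) by (auto simp: indicator_def)
qed (use assms in measurable)

text \<open>Replacing 1 / v by v^(z - 1) gives Gamma z - 1 / z = (Gamma (1 + z) - 1) / z, a
  difference quotient that tends to the derivative of Gamma at 1 along z = 1 / (k + 1).\<close>

lemma exp_integral_regularized:
  "integrable lborel (\<lambda>v. pos v * ((exp (- v) - indicator {..<1} v) / v))"
  "(\<integral>v. pos v * ((exp (- v) - indicator {..<1} v) / v) \<partial>lborel) = - euler_mascheroni"
proof -
  define z where "z = (\<lambda>k. 1 / real (Suc k))"
  define f where "f = (\<lambda>k v. pos v * (v powr (z k - 1) * (exp (- v) - indicator {..<1} v)))"
  define g where "g = (\<lambda>v. pos v * ((exp (- v) - indicator {..<1} v) / v))"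
  define w where "w = (\<lambda>v. indicat_real {0..1} v + indicat_real {0..} v * (v ^ 0 * exp (- (1 * v))))"
  have z: "0 < z k" "z k \<le> 1" for k by (auto simp: z_def)
  have val: "has_bochner_integral lborel (f k) ((Gamma (1 + z k) - 1) / z k)" for k
  proof -
    have 1: "has_bochner_integral lborel (\<lambda>v. indicator {0..} v * (v powr (z k - 1) / exp v)) (Gamma (z k))"
      by (rule has_bochner_integral_of_has_integral[OF _ _ _ Gamma_integral_real[OF z(1)]]) auto
    have 2: "has_bochner_integral lborel (\<lambda>v. indicator {0..1} v * (v powr (z k - 1))) (1 powr (z k - 1 + 1) / (z k - 1 + 1))"
      by (rule has_bochner_integral_of_has_integral[OF _ _ _ has_integral_powr_from_0]) (use z[of k] in auto)
    have "has_bochner_integral lborel (f k) (Gamma (z k) - 1 powr (z k - 1 + 1) / (z k - 1 + 1)) \<longleftrightarrow>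
        has_bochner_integral lborel (\<lambda>v. indicator {0..} v * (v powr (z k - 1) / exp v) - indicator {0..1} v * (v powr (z k - 1))) (Gamma (z k) - 1 powr (z k - 1 + 1) / (z k - 1 + 1))"
    proof (rule has_bochner_integral_cong_AE)
      have "AE v in lborel. v \<noteq> (0::real)" "AE v in lborel. v \<noteq> (1::real)" by (rule AE_lborel_singleton)+
      thus "AE v in lborel. f k v = indicator {0..} v * (v powr (z k - 1) / exp v) - indicator {0..1} v * (v powr (z k - 1))"
        by eventually_elim (auto simp: f_def indicator_def exp_minus field_simps)
    qed (auto simp: f_def)
    with has_bochner_integral_diff[OF 1 2] have "has_bochner_integral lborel (f k) (Gamma (z k) - 1 powr (z k - 1 + 1) / (z k - 1 + 1))"
      by simp
    moreover have "Gamma (1 + z k) = z k * Gamma (z k)"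
      using z[of k] Gamma_plus1[of "z k"] by (simp add: add.commute nonpos_Ints_def not_less)
    ultimately show ?thesis using z[of k] by (simp add: diff_divide_distrib)
  qed
  have w: "integrable lborel w"
    unfolding w_def using has_bochner_integral_power_exp[of 1 0]
    by (intro Bochner_Integration.integrable_add) (auto simp: has_bochner_integral_iff)
  have lim: "AE v in lborel. (\<lambda>k. f k v) \<longlonglongrightarrow> g v"
  proof (intro AE_I2)
    fix v :: real
    show "(\<lambda>k. f k v) \<longlonglongrightarrow> g v"
    proof (cases "v > 0")
      case True
      have zl: "(\<lambda>k. z k - 1) \<longlonglongrightarrow> 0 - 1" unfolding z_def by (intro tendsto_intros LIMSEQ_inverse_real_of_nat[unfolded inverse_eq_divide])
      have "(\<lambda>k. pos v * (v powr (z k - 1) * (exp (- v) - indicator {..<1} v))) \<longlonglongrightarrow> pos v * (v powr (0 - 1) * (exp (- v) - indicator {..<1} v))"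
        using True by (intro tendsto_mult tendsto_const tendsto_powr zl) auto
      thus ?thesis using True by (simp add: f_def g_def powr_minus_divide)
    qed (simp add: f_def g_def)
  qed
  have bound: "AE v in lborel. norm (f k v) \<le> w v" for k
  proof (intro AE_I2)
    fix v :: real
    consider "v \<le> 0" | "0 < v" "v < 1" | "v \<ge> 1" by linarith
    thus "norm (f k v) \<le> w v"
    proof cases
      case 1
      thus ?thesis by (simp add: f_def w_def indicator_def)
    next
      case 2
      have "1 - exp (- v) \<le> v" using exp_ge_add_one_self[of "- v"] by simp
      hence "v powr (z k - 1) * (1 - exp (- v)) \<le> v powr (z k - 1) * v" by (intro mult_left_mono) auto
      also have "\<dots> = v powr (z k)" using 2 powr_add[of v "z k - 1" 1] by simp
      also have "\<dots> \<le> 1" using 2 z[of k] by (intro powr_le1) auto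
      finally have "\<bar>v powr (z k - 1) * (exp (- v) - 1)\<bar> \<le> 1" using 2 by (simp add: abs_mult)
      thus ?thesis using 2 by (simp add: f_def w_def) (smt (verit) exp_ge_zero)
    next
      case 3
      have "v powr (z k - 1) * exp (- v) \<le> 1 * exp (- v)"
      proof (intro mult_right_mono)
        have "v powr (z k - 1) \<le> v powr 0" using 3 z[of k] by (intro powr_mono) auto
        thus "v powr (z k - 1) \<le> 1" using 3 by simp
      qed auto
      thus ?thesis using 3 by (auto simp: f_def w_def indicator_def abs_mult)
    qed
  qed
  have meas: "f k \<in> borel_measurable lborel" "g \<in> borel_measurable lborel" for k
    unfolding f_def g_def by measurable
  note dct = integral_dominated_convergence[OF meas(2,1) w lim bound]
    integrable_dominated_convergence[OF meas(2,1) w lim bound]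
  show "integrable lborel (\<lambda>v. pos v * ((exp (- v) - indicator {..<1} v) / v))"
    using dct(2) by (simp only: g_def)
  have "(\<lambda>k. integral\<^sup>L lborel (f k)) = (\<lambda>k. (Gamma (1 + z k) - Gamma 1) / z k)"
    using has_bochner_integral_integral_eq[OF val] by (simp add: fun_eq_iff)
  moreover have "(\<lambda>k. (Gamma (1 + z k) - Gamma 1) / z k) \<longlonglongrightarrow> - euler_mascheroni"
  proof -
    have "(Gamma has_real_derivative Gamma 1 * Digamma 1) (at 1)"
      by (rule has_field_derivative_Gamma) auto
    hence "((\<lambda>h. (Gamma (1 + h) - Gamma 1) / h) \<longlongrightarrow> - euler_mascheroni) (at (0::real))"
      by (simp add: DERIV_def)
    moreover have "filterlim z (at 0) sequentially"
      unfolding filterlim_at using z(1)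
      by (auto simp: z_def intro!: always_eventually LIMSEQ_inverse_real_of_nat[unfolded inverse_eq_divide, simplified])
    ultimately show ?thesis by (rule filterlim_compose)
  qed
  ultimately have "integral\<^sup>L lborel g = - euler_mascheroni"
    using dct(1) LIMSEQ_unique by metis
  thus "(\<integral>v. pos v * ((exp (- v) - indicator {..<1} v) / v) \<partial>lborel) = - euler_mascheroni"
    by (simp only: g_def)
qed

text \<open>The cutoff 1 / 2 is the image of the cutoff 1 under v \<mapsto> 1 / (2 v). Moving the
  cutoff adds the integral of 1 / v from 1 / 2 to 1.\<close>

lemma exp_integral_regularized_half:
  "integrable lborel (\<lambda>v. pos v * ((exp (- v) - indicator {..1/2} v) / v))" (is ?A)
  "(\<integral>v. pos v * ((exp (- v) - indicator {..1/2} v) / v) \<partial>lborel) = - euler_mascheroni + ln 2" (is ?B)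
proof -
  have h: "has_bochner_integral lborel (\<lambda>v::real. indicator {1/2..1} v * (1 / v)) (ln 1 - ln (1/2))"
  proof (rule has_bochner_integral_of_has_integral)
    show "((\<lambda>v. 1 / v) has_integral ln 1 - ln (1/2)) {1/2..1::real}"
      by (rule fundamental_theorem_of_calculus)
         (auto intro!: derivative_eq_intros simp flip: has_real_derivative_iff_has_vector_derivative)
  qed auto
  have "has_bochner_integral lborel (\<lambda>v. pos v * ((exp (- v) - indicator {..1/2} v) / v)) (- euler_mascheroni + (ln 1 - ln (1/2))) \<longleftrightarrow>
      has_bochner_integral lborel (\<lambda>v. pos v * ((exp (- v) - indicator {..<1} v) / v) + indicator {1/2..1} v * (1 / v)) (- euler_mascheroni + (ln 1 - ln (1/2)))"
  proof (rule has_bochner_integral_cong_AE)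
    have "AE v in lborel. v \<noteq> (1/2::real)" "AE v in lborel. v \<noteq> (1::real)" by (rule AE_lborel_singleton)+
    thus "AE v in lborel. pos v * ((exp (- v) - indicator {..1/2} v) / v) = pos v * ((exp (- v) - indicator {..<1} v) / v) + indicator {1/2..1} v * (1 / v)"
      by eventually_elim (auto simp: indicator_def field_simps)
  qed measurable
  moreover have "has_bochner_integral lborel (\<lambda>v. pos v * ((exp (- v) - indicator {..<1} v) / v) + indicator {1/2..1} v * (1 / v)) (- euler_mascheroni + (ln 1 - ln (1/2)))"
    using exp_integral_regularized by (intro has_bochner_integral_add h) (simp add: has_bochner_integral_iff)
  ultimately have "has_bochner_integral lborel (\<lambda>v. pos v * ((exp (- v) - indicator {..1/2} v) / v)) (- euler_mascheroni + (ln 1 - ln (1/2)))"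
    by blast
  thus ?A ?B by (simp_all add: has_bochner_integral_iff ln_div)
qed

text \<open>The measure dv / v on the half-line is invariant under v \<mapsto> 1 / (2 v).\<close>

lemma integral_inversion:
  fixes h :: "real \<Rightarrow> real"
  assumes [measurable]: "h \<in> borel_measurable borel"
    and int: "integrable lborel (\<lambda>w. pos w * (h w / w))"
  shows "integrable lborel (\<lambda>v. pos v * (h (1 / (2 * v)) / v))"
    and "(\<integral>v. pos v * (h (1 / (2 * v)) / v) \<partial>lborel) = (\<integral>w. pos w * (h w / w) \<partial>lborel)"
proof -
  define S :: "real set" where "S = {0<..}"
  define f where "f = (\<lambda>w. h w / w)"
  define g where "g = (\<lambda>v::real. 1 / (2 * v))"
  have gS: "g ` S = S"
  proof (intro equalityI subsetI)
    fix w assume "w \<in> S"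
    thus "w \<in> g ` S" by (intro image_eqI[of _ _ "1 / (2 * w)"]) (auto simp: S_def g_def)
  qed (auto simp: S_def g_def)
  \<comment> \<open>Translates between absolute integrability on the half-line, in which the
    substitution rule is formulated, and Bochner integrals over \<open>lborel\<close>.\<close>
  have conv: "k absolutely_integrable_on S \<longleftrightarrow> integrable lborel (\<lambda>x. pos x * k x)"
    "k absolutely_integrable_on S \<Longrightarrow> integral S k = (\<integral>x. pos x * k x \<partial>lborel)"
    if "k \<in> borel_measurable borel" for k :: "real \<Rightarrow> real"
  proof -
    have m: "(\<lambda>x. indicator S x *\<^sub>R k x) \<in> borel_measurable lborel" using that by (simp add: S_def)
    show "k absolutely_integrable_on S \<longleftrightarrow> integrable lborel (\<lambda>x. pos x * k x)"
      unfolding set_integrable_def using integrable_completion[OF m] by (simp add: S_def)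
    assume "k absolutely_integrable_on S"
    hence "integral S k = (LINT x:S|lebesgue. k x)" by (simp add: set_lebesgue_integral_eq_integral(2))
    thus "integral S k = (\<integral>x. pos x * k x \<partial>lborel)"
      unfolding set_lebesgue_integral_def using integral_completion[OF m] by (simp add: S_def)
  qed
  have fm: "f \<in> borel_measurable borel" unfolding f_def by measurable
  define k where "k = (\<lambda>v. \<bar>- (1 / (2 * v\<^sup>2))\<bar> * f (g v))"
  have km: "k \<in> borel_measurable borel" unfolding k_def f_def g_def by measurable
  have "f absolutely_integrable_on g ` S \<and> integral (g ` S) f = integral S f"
    using int conv(1)[OF fm] by (simp add: f_def gS)
  moreover have "(g has_real_derivative - (1 / (2 * v\<^sup>2))) (at v within S)" if "v \<in> S" for v
    using that unfolding g_def S_def by (auto intro!: derivative_eq_intros simp: power2_eq_square field_simps)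
  moreover have "inj_on g S" by (auto simp: inj_on_def g_def S_def)
  ultimately have "k absolutely_integrable_on S \<and> integral S k = integral S f"
    unfolding k_def by (subst has_absolute_integral_change_of_variables_1') (auto simp: S_def)
  moreover have "pos v * k v = pos v * (h (1 / (2 * v)) / v)" for v
    by (auto simp: k_def f_def g_def indicator_def power2_eq_square)
  ultimately show "integrable lborel (\<lambda>v. pos v * (h (1 / (2 * v)) / v))"
    "(\<integral>v. pos v * (h (1 / (2 * v)) / v) \<partial>lborel) = (\<integral>w. pos w * (h w / w) \<partial>lborel)"
    using conv[OF km] conv[OF fm] int by (simp_all add: f_def)
qed

lemma arc_laplace_measurable [measurable]: "arc_laplace \<in> borel_measurable borel"
proof -
  interpret prob_space arc_law by (rule prob_space_arc)
  have "(\<lambda>w. \<integral>x. exp (- (w * (2 * (sin x)\<^sup>2))) \<partial>arc_law) \<in> borel_measurable borel"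
    by (rule borel_measurable_lebesgue_integral) measurable
  thus ?thesis by (simp add: arc_laplace_def[abs_def])
qed

text \<open>By \<open>laplace_limit_eq\<close> the squared transform is (1 - A (1 / (2 v)))^2 with A
  = \<open>arc_laplace\<close>. Trading exp (- v) for the indicator of v < 1 costs -\<gamma> and
  prepares the inversion. Afterwards (1 - A)^2 is expanded; A and A^2 are the Laplace transforms of
  2 (sin x)^2 and of the sum of two independent copies, to which Frullani's formula applies.\<close>

lemma laplace_limit_square_integral:
  assumes int1: "integrable arc_law (\<lambda>x. ln (2 * (sin x)\<^sup>2))"
    and int2: "integrable (arc_law \<Otimes>\<^sub>M arc_law) (\<lambda>(x, y). ln (2 * (sin x)\<^sup>2 + 2 * (sin y)\<^sup>2))"
  shows "(\<integral>v. pos v * ((exp (- v) - (laplace_limit v)\<^sup>2) / v) \<partial>lborel) =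
    - 2 * euler_mascheroni + ln 2 - 2 * (\<integral>x. ln (2 * (sin x)\<^sup>2) \<partial>arc_law)
    + (\<integral>(x, y). ln (2 * (sin x)\<^sup>2 + 2 * (sin y)\<^sup>2) \<partial>(arc_law \<Otimes>\<^sub>M arc_law))"
proof -
  interpret A: prob_space arc_law by (rule prob_space_arc)
  interpret AA: pair_prob_space arc_law arc_law ..
  have sin_pos: "sin x > 0" if "0 < x \<and> x < pi / 2" for x :: real using that by (intro sin_gt_zero) auto
  define E1 where "E1 = (\<integral>x. ln (2 * (sin x)\<^sup>2) \<partial>arc_law)"
  define E2 where "E2 = (\<integral>z. ln (2 * (sin (fst z))\<^sup>2 + 2 * (sin (snd z))\<^sup>2) \<partial>(arc_law \<Otimes>\<^sub>M arc_law))"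
  have fst_pos: "AE z in arc_law \<Otimes>\<^sub>M arc_law. 2 * (sin (fst z))\<^sup>2 > 0"
  proof (rule AA.AE_pair_measure)
    show "{z \<in> space (arc_law \<Otimes>\<^sub>M arc_law). 0 < 2 * (sin (fst z))\<^sup>2} \<in> sets (arc_law \<Otimes>\<^sub>M arc_law)"
      by measurable
    show "AE x in arc_law. AE y in arc_law. 0 < 2 * (sin (fst (x, y)))\<^sup>2"
      using arc_AE by eventually_elim (use sin_pos in fastforce)
  qed
  have "AE x in arc_law. 2 * (sin x)\<^sup>2 > 0" using arc_AE by eventually_elim (use sin_pos in fastforce)
  note f1 = frullani_expectation[OF prob_space_arc _ this int1, simplified]
  have "AE z in arc_law \<Otimes>\<^sub>M arc_law. 2 * (sin (fst z))\<^sup>2 + 2 * (sin (snd z))\<^sup>2 > 0"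
    using fst_pos by eventually_elim (simp add: add_pos_nonneg)
  note f2 = frullani_expectation[OF AA.prob_space_axioms _ this]
  have g1: "(\<integral>x. exp (- (2 * (sin x)\<^sup>2 * w)) \<partial>arc_law) = arc_laplace w" for w
    by (simp add: arc_laplace_def mult_ac)
  have g2: "(\<integral>z. exp (- ((2 * (sin (fst z))\<^sup>2 + 2 * (sin (snd z))\<^sup>2) * w)) \<partial>(arc_law \<Otimes>\<^sub>M arc_law)) = (arc_laplace w)\<^sup>2" if "w > 0" for w
  proof -
    have i: "integrable (arc_law \<Otimes>\<^sub>M arc_law) (\<lambda>(x, y). exp (- (w * (2 * (sin x)\<^sup>2))) * exp (- (w * (2 * (sin y)\<^sup>2))))"
      using that by (intro AA.P.integrable_const_bound[where B = 1]) (auto intro!: AE_I2 mult_le_one)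
    have "(\<integral>z. exp (- ((2 * (sin (fst z))\<^sup>2 + 2 * (sin (snd z))\<^sup>2) * w)) \<partial>(arc_law \<Otimes>\<^sub>M arc_law)) =
       (\<integral>(x, y). exp (- (w * (2 * (sin x)\<^sup>2))) * exp (- (w * (2 * (sin y)\<^sup>2))) \<partial>(arc_law \<Otimes>\<^sub>M arc_law))"
      by (intro Bochner_Integration.integral_cong refl) (auto simp: algebra_simps simp flip: exp_add)
    also have "\<dots> = (\<integral>x. (\<integral>y. exp (- (w * (2 * (sin x)\<^sup>2))) * exp (- (w * (2 * (sin y)\<^sup>2))) \<partial>arc_law) \<partial>arc_law)"
      by (rule AA.integral_fst[symmetric]) (rule i)
    also have "\<dots> = (arc_laplace w)\<^sup>2" by (simp add: arc_laplace_def power2_eq_square)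
    finally show ?thesis .
  qed
  \<comment> \<open>The indicator of v < 1 becomes that of w > 1 / 2 for w = 1 / (2 v). Combining
    the regularised integrals with weights 1, -2, 1 cancels exp (- w) and leaves h w / w.\<close>
  define h where "h = (\<lambda>w. indicator {1/2<..} w - (1 - arc_laplace w)\<^sup>2)"
  have hm [measurable]: "h \<in> borel_measurable borel" unfolding h_def by measurable
  have e1: "has_bochner_integral lborel (\<lambda>v. pos v * ((exp (- v) - arc_laplace v) / v)) E1"
    using f1 unfolding g1 E1_def by (simp add: has_bochner_integral_iff)
  have "has_bochner_integral lborel (\<lambda>v. pos v * ((exp (- v) - (\<integral>z. exp (- ((2 * (sin (fst z))\<^sup>2 + 2 * (sin (snd z))\<^sup>2) * v)) \<partial>(arc_law \<Otimes>\<^sub>M arc_law))) / v)) E2"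
    using f2 int2 unfolding E2_def by (simp add: has_bochner_integral_iff case_prod_beta')
  moreover have "pos v * ((exp (- v) - (\<integral>z. exp (- ((2 * (sin (fst z))\<^sup>2 + 2 * (sin (snd z))\<^sup>2) * v)) \<partial>(arc_law \<Otimes>\<^sub>M arc_law))) / v)
      = pos v * ((exp (- v) - (arc_laplace v)\<^sup>2) / v)" for v
    using g2[of v] by (cases "v > 0") auto
  ultimately have e2: "has_bochner_integral lborel (\<lambda>v. pos v * ((exp (- v) - (arc_laplace v)\<^sup>2) / v)) E2"
    by (simp only:)
  have e0: "has_bochner_integral lborel (\<lambda>v. pos v * ((exp (- v) - indicator {..1/2} v) / v)) (- euler_mascheroni + ln 2)"
    using exp_integral_regularized_half by (simp add: has_bochner_integral_iff)
  have "has_bochner_integral lborel (\<lambda>v. 1 * (pos v * ((exp (- v) - indicator {..1/2} v) / v)) - 2 * (pos v * ((exp (- v) - arc_laplace v) / v))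
      + pos v * ((exp (- v) - (arc_laplace v)\<^sup>2) / v)) (1 * (- euler_mascheroni + ln 2) - 2 * E1 + E2)"
    by (intro has_bochner_integral_add has_bochner_integral_diff has_bochner_integral_mult_right e0 e1 e2)
  moreover have "1 * (pos v * ((exp (- v) - indicator {..1/2} v) / v)) - 2 * (pos v * ((exp (- v) - arc_laplace v) / v))
      + pos v * ((exp (- v) - (arc_laplace v)\<^sup>2) / v) = pos v * (h v / v)" for v
    by (cases "v > 0") (auto simp: h_def indicator_def power2_eq_square field_simps)
  ultimately have hh: "has_bochner_integral lborel (\<lambda>v. pos v * (h v / v)) (- euler_mascheroni + ln 2 - 2 * E1 + E2)"
    by simp
  have inv: "has_bochner_integral lborel (\<lambda>v. pos v * (h (1 / (2 * v)) / v)) (- euler_mascheroni + ln 2 - 2 * E1 + E2)"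
    using integral_inversion[OF hm] hh by (simp add: has_bochner_integral_iff)
  have "has_bochner_integral lborel (\<lambda>v. pos v * ((exp (- v) - indicator {..<1} v) / v) + pos v * (h (1 / (2 * v)) / v))
      (- euler_mascheroni + (- euler_mascheroni + ln 2 - 2 * E1 + E2))"
    using exp_integral_regularized by (intro has_bochner_integral_add inv) (simp add: has_bochner_integral_iff)
  moreover have "pos v * ((exp (- v) - indicator {..<1} v) / v) + pos v * (h (1 / (2 * v)) / v) = pos v * ((exp (- v) - (laplace_limit v)\<^sup>2) / v)" for v
  proof (cases "v > 0")
    case True
    have "indicat_real {1/2<..} (1 / (2 * v)) = indicator {..<1} v"
      using True by (auto simp: indicator_def field_simps)
    thus ?thesis using True by (simp add: h_def laplace_limit_eq field_simps)
  qed auto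
  ultimately have "(\<integral>v. pos v * ((exp (- v) - (laplace_limit v)\<^sup>2) / v) \<partial>lborel) = - euler_mascheroni + (- euler_mascheroni + ln 2 - 2 * E1 + E2)"
    by (simp add: has_bochner_integral_iff)
  thus ?thesis by (simp add: E1_def E2_def case_prod_beta')
qed

section \<open>Logarithmic means under the arcsine-type law\<close>

lemma arsinh_measurable [measurable]: "(arsinh :: real \<Rightarrow> real) \<in> borel_measurable borel"
  by (rule borel_measurable_continuous_onI[OF continuous_on_arsinh])

text \<open>The density is proportional to 1 + cos (2 x), so among the functions cos (2 n x) with n
  > 0 only the first has a nonzero mean.\<close>

lemma arc_cos_moment:
  assumes "n > 0"
  shows "(\<integral>x. cos (real n * (2 * x)) \<partial>arc_law) = (if n = 1 then 1 / 2 else 0)"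
proof (cases "n = 1")
  case True
  have "(\<integral>x. cos (2 * x) \<partial>arc_law) = 4 / pi * ((pi / 2 / 4 + sin (2 * (pi / 2)) / 4 + sin (4 * (pi / 2)) / 16) - (0 / 4 + sin (2 * 0) / 4 + sin (4 * 0) / 16))"
  proof (rule arc_integral_FTC[where F = "\<lambda>x. x / 4 + sin (2 * x) / 4 + sin (4 * x) / 16"])
    fix x :: real
    have 1: "cos (4 * x) = 2 * (cos (2 * x))\<^sup>2 - 1" using cos_double_cos[of "2 * x"] by simp
    have 2: "cos (2 * x) = 2 * (cos x)\<^sup>2 - 1" by (rule cos_double_cos)
    have "((\<lambda>x. x / 4 + sin (2 * x) / 4 + sin (4 * x) / 16) has_real_derivative (1 / 4 + cos (2 * x) / 2 + cos (4 * x) / 4)) (at x within {0..pi/2})"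
      by (auto intro!: derivative_eq_intros)
    also have "1 / 4 + cos (2 * x) / 2 + cos (4 * x) / 4 = (cos x)\<^sup>2 * cos (2 * x)"
      unfolding 1 2 by (simp add: power2_eq_square field_simps)
    finally show "((\<lambda>x. x / 4 + sin (2 * x) / 4 + sin (4 * x) / 16) has_real_derivative (cos x)\<^sup>2 * cos (2 * x)) (at x within {0..pi/2})" .
  qed (auto intro!: continuous_intros)
  also have "sin (4 * (pi / 2)) = 0" using sin_npi[of 2] by (simp add: mult.commute)
  finally show ?thesis using True by simp
next
  case False
  \<comment> \<open>The product with cos (2 x) has the frequencies a + 2 and a - 2; the latter is
    positive because n is at least 2 here.\<close>
  define a where "a = 2 * real n"
  have a: "a > 2" using assms False by (simp add: a_def)
  define b where "b = a + 2"
  define d where "d = a - 2"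
  have bd: "b > 0" "d > 0" using a by (auto simp: b_def d_def)
  define F where "F = (\<lambda>x. sin (a * x) / (2 * a) + sin (b * x) / (4 * b) + sin (d * x) / (4 * d))"
  have "(\<integral>x. cos (a * x) \<partial>arc_law) = 4 / pi * (F (pi / 2) - F 0)"
  proof (rule arc_integral_FTC[where F = F])
    fix x :: real
    have 2: "cos (2 * x) = 2 * (cos x)\<^sup>2 - 1" by (rule cos_double_cos)
    have 3: "cos (b * x) + cos (d * x) = 2 * (cos (a * x) * cos (2 * x))"
      by (simp add: b_def d_def ring_distribs cos_add cos_diff left_diff_distrib)
    have "(F has_real_derivative (cos (a * x) / 2 + cos (b * x) / 4 + cos (d * x) / 4)) (at x within {0..pi/2})"
      unfolding F_def using a bd by (auto intro!: derivative_eq_intros)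
    also have "cos (a * x) / 2 + cos (b * x) / 4 + cos (d * x) / 4 = cos (a * x) / 2 + (2 * (cos (a * x) * cos (2 * x))) / 4"
      unfolding 3[symmetric] by (simp add: field_simps)
    also have "\<dots> = (cos x)\<^sup>2 * cos (a * x)" unfolding 2 by (simp add: field_simps)
    finally show "(F has_real_derivative (cos x)\<^sup>2 * cos (a * x)) (at x within {0..pi/2})" .
  qed (auto intro!: continuous_intros)
  also have "F (pi / 2) = 0"
  proof -
    obtain m where m: "n = Suc m" using assms by (cases n) auto
    have "a * (pi / 2) = real n * pi" "b * (pi / 2) = real (Suc n) * pi" "d * (pi / 2) = real m * pi"
      by (simp_all add: b_def d_def a_def m field_simps)
    thus ?thesis unfolding F_def by (simp only: sin_npi)
  qed
  also have "F 0 = 0" by (simp add: F_def)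
  finally have "(\<integral>x. cos (a * x) \<partial>arc_law) = 0" by simp
  moreover have "real n * (2 * x) = a * x" for x by (simp add: a_def)
  ultimately show ?thesis using False by (simp only: if_False)
qed

text \<open>Twice the real part of the series of the complex logarithm at 1 - r exp (i t).\<close>

lemma log_cos_sums:
  assumes "0 \<le> r" "r < 1"
  shows "(\<lambda>n. - (2 * r ^ n * cos (real n * t) / real n)) sums ln (1 - 2 * r * cos t + r\<^sup>2)"
proof -
  define z where "z = - (of_real r * cis t)"
  have nz: "norm z < 1" using assms by (simp add: z_def norm_mult)
  have ne: "1 + z \<noteq> 0"
  proof
    assume "1 + z = 0"
    hence "z = - 1" by (simp add: add_eq_0_iff)
    thus False using nz by simp
  qed
  have "(\<lambda>n. Re (- ((- z) ^ n) / of_nat n)) sums Re (ln (1 + z))"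
    by (intro sums_Re Ln_series' nz)
  hence "(\<lambda>n. 2 * Re (- ((- z) ^ n) / of_nat n)) sums (2 * Re (ln (1 + z)))"
    by (rule sums_mult)
  moreover have "2 * Re (- ((- z) ^ n) / of_nat n) = - (2 * r ^ n * cos (real n * t) / real n)" for n
  proof -
    have "(- z) ^ n = of_real (r ^ n) * cis (real n * t)"
      by (simp add: z_def power_mult_distrib Complex.DeMoivre)
    thus ?thesis by (simp add: Re_divide_of_nat)
  qed
  moreover have "2 * Re (ln (1 + z)) = ln (1 - 2 * r * cos t + r\<^sup>2)"
  proof -
    have "(norm (1 + z))\<^sup>2 = (1 - r * cos t)\<^sup>2 + (r * sin t)\<^sup>2"
      by (simp add: cmod_power2 z_def)
    also have "\<dots> = 1 - 2 * r * cos t + ((r * cos t)\<^sup>2 + (r * sin t)\<^sup>2)"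
      by (simp add: power2_diff)
    also have "(r * cos t)\<^sup>2 + (r * sin t)\<^sup>2 = r\<^sup>2 * ((cos t)\<^sup>2 + (sin t)\<^sup>2)"
      by (simp only: power_mult_distrib distrib_left)
    also have "(cos t)\<^sup>2 + (sin t)\<^sup>2 = 1" by simp
    finally have "(norm (1 + z))\<^sup>2 = 1 - 2 * r * cos t + r\<^sup>2 * 1" .
    hence "(norm (1 + z))\<^sup>2 = 1 - 2 * r * cos t + r\<^sup>2" by simp
    moreover have "ln ((norm (1 + z))\<^sup>2) = 2 * ln (norm (1 + z))" using ne by (subst ln_realpow) auto
    ultimately show ?thesis using ne by simp
  qed
  ultimately show ?thesis by (simp only:)
qed

text \<open>The Fourier series of the logarithm is integrated term by term; by
  \<open>arc_cos_moment\<close> only the coefficient of cos (2 x), which is - 2 r,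
  contributes.\<close>

lemma arc_log_cos:
  assumes "0 < r" "r < 1"
  shows "(\<integral>x. ln (1 - 2 * r * cos (2 * x) + r\<^sup>2) \<partial>arc_law) = - r"
proof -
  define f where "f = (\<lambda>n x. - (2 * r ^ n * cos (real n * (2 * x)) / real n))"
  have b: "norm (f n x) \<le> 2 * r ^ n" for n x
  proof (cases "n = 0")
    case False
    have "\<bar>cos (real n * (2 * x))\<bar> / real n \<le> 1"
    proof -
      have "\<bar>cos (real n * (2 * x))\<bar> \<le> 1" "1 \<le> real n" using False by auto
      hence "\<bar>cos (real n * (2 * x))\<bar> \<le> real n" by linarith
      thus ?thesis using False by (simp add: divide_le_eq_1)
    qed
    hence "2 * r ^ n * (\<bar>cos (real n * (2 * x))\<bar> / real n) \<le> 2 * r ^ n * 1"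
      using assms by (intro mult_left_mono) auto
    thus ?thesis using assms by (simp add: f_def abs_mult)
  qed (use assms in \<open>simp add: f_def\<close>)
  have i: "integrable arc_law (f n)" for n
    by (rule arc_integrable[where B = "2 * r ^ n"]) (use b[of n] in \<open>auto simp: f_def\<close>)
  have sr: "summable (\<lambda>n. 2 * r ^ n)" using assms by (intro summable_mult summable_geometric) auto
  interpret prob_space arc_law by (rule prob_space_arc)
  have "(\<lambda>n. integral\<^sup>L arc_law (f n)) sums (\<integral>x. (\<Sum>n. f n x) \<partial>arc_law)"
  proof (rule sums_integral[OF i])
    show "AE x in arc_law. summable (\<lambda>n. norm (f n x))"
      by (intro AE_I2 summable_comparison_test'[OF sr, of 0]) (use b in auto)
    show "summable (\<lambda>n. \<integral>x. norm (f n x) \<partial>arc_law)"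
    proof (rule summable_comparison_test'[OF sr, of 0])
      fix n :: nat
      have "(\<integral>x. norm (f n x) \<partial>arc_law) \<le> (\<integral>x. 2 * r ^ n \<partial>arc_law)"
        using i[of n] b by (intro integral_mono) auto
      thus "norm (\<integral>x. norm (f n x) \<partial>arc_law) \<le> 2 * r ^ n" using prob_space by simp
    qed
  qed
  moreover have "(\<Sum>n. f n x) = ln (1 - 2 * r * cos (2 * x) + r\<^sup>2)" for x
    using log_cos_sums[of r "2 * x"] assms by (simp add: f_def sums_iff)
  moreover have "integral\<^sup>L arc_law (f n) = (if n = 1 then - r else 0)" for n
  proof -
    have "integral\<^sup>L arc_law (f n) = (\<integral>x. - (2 * r ^ n / real n) * cos (real n * (2 * x)) \<partial>arc_law)"
      by (intro Bochner_Integration.integral_cong) (auto simp: f_def)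
    also have "\<dots> = - (2 * r ^ n / real n) * (\<integral>x. cos (real n * (2 * x)) \<partial>arc_law)"
      by (rule integral_mult_right_zero)
    also have "\<dots> = (if n = 1 then - r else 0)"
      using arc_cos_moment[of n] by (cases "n = 0") auto
    finally show ?thesis .
  qed
  ultimately have "(\<lambda>n. if n = 1 then - r else 0) sums (\<integral>x. ln (1 - 2 * r * cos (2 * x) + r\<^sup>2) \<partial>arc_law)"
    by simp
  moreover have "(\<lambda>n::nat. if n = 1 then - r else 0) sums (- r)" by (rule sums_single)
  ultimately show ?thesis by (rule sums_unique2)
qed

text \<open>\<open>r\<close> is the root below 1 of r^2 - 2 (1 + t) r + 1 = 0, which makes 2 r (t +
  2 (sin x)^2) equal to 1 - 2 r cos (2 x) + r^2.\<close>

lemma arc_log_shift: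
  assumes "t > 0"
  defines "r \<equiv> 1 + t - sqrt (t\<^sup>2 + 2 * t)"
  shows "0 < r" "r < 1" and "integrable arc_law (\<lambda>x. ln (t + 2 * (sin x)\<^sup>2))"
    and "(\<integral>x. ln (t + 2 * (sin x)\<^sup>2) \<partial>arc_law) = - ln 2 - ln r - r"
proof -
  define q where "q = sqrt (t\<^sup>2 + 2 * t)"
  have q2: "q\<^sup>2 = t\<^sup>2 + 2 * t" using assms by (simp add: q_def)
  have "q < sqrt ((1 + t)\<^sup>2)" unfolding q_def by (rule real_sqrt_less_mono) (simp add: power2_eq_square algebra_simps)
  thus r0: "0 < r" using assms by (simp add: r_def q_def)
  have "sqrt (t\<^sup>2) < q" unfolding q_def by (rule real_sqrt_less_mono) (use assms in auto)
  thus r1: "r < 1" using assms by (simp add: r_def q_def)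
  have rq: "r = 1 + t - q" by (simp add: r_def q_def)
  have "1 + r\<^sup>2 = 1 + (1 + t)\<^sup>2 + q\<^sup>2 - 2 * (1 + t) * q" unfolding rq by (simp add: power2_eq_square algebra_simps)
  also have "\<dots> = 2 * r * (1 + t)" unfolding q2 unfolding rq by (simp add: power2_eq_square algebra_simps)
  finally have key: "1 + r\<^sup>2 = 2 * r * (1 + t)" .
  have pos: "t + 2 * (sin x)\<^sup>2 > 0" for x using assms by (intro add_pos_nonneg) auto
  have eq: "1 - 2 * r * cos (2 * x) + r\<^sup>2 = 2 * r * (t + 2 * (sin x)\<^sup>2)" for x
  proof -
    have "1 - 2 * r * cos (2 * x) + r\<^sup>2 = (1 + r\<^sup>2) - 2 * r * cos (2 * x)" by simp
    also have "\<dots> = 2 * r * (t + 2 * (sin x)\<^sup>2)" unfolding key cos_double_sin by (simp add: algebra_simps)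
    finally show ?thesis .
  qed
  interpret prob_space arc_law by (rule prob_space_arc)
  show i: "integrable arc_law (\<lambda>x. ln (t + 2 * (sin x)\<^sup>2))"
  proof (rule arc_integrable)
    show "\<bar>ln (t + 2 * (sin x)\<^sup>2)\<bar> \<le> \<bar>ln t\<bar> + \<bar>ln (t + 2)\<bar>" for x
    proof -
      have "(sin x)\<^sup>2 \<le> 1" by (simp add: abs_square_le_1)
      hence "ln t \<le> ln (t + 2 * (sin x)\<^sup>2)" "ln (t + 2 * (sin x)\<^sup>2) \<le> ln (t + 2)"
        using assms pos[of x] by (auto intro!: ln_mono)
      thus ?thesis by linarith
    qed
  qed auto
  have "- r = (\<integral>x. ln (2 * r) + ln (t + 2 * (sin x)\<^sup>2) \<partial>arc_law)"
    using arc_log_cos[OF r0 r1] r0 pos unfolding eq by (simp add: ln_mult_pos)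
  also have "\<dots> = ln (2 * r) + (\<integral>x. ln (t + 2 * (sin x)\<^sup>2) \<partial>arc_law)"
    using i prob_space by (subst Bochner_Integration.integral_add) auto
  finally show "(\<integral>x. ln (t + 2 * (sin x)\<^sup>2) \<partial>arc_law) = - ln 2 - ln r - r"
    using r0 by (simp add: ln_mult_pos)
qed

text \<open>The limit t -> 0 of \<open>arc_log_shift\<close>, where r tends to 1. The logarithms are
  monotone in t, so monotone convergence yields integrability together with the value.\<close>

lemma arc_log_sin:
  "integrable arc_law (\<lambda>x. ln (2 * (sin x)\<^sup>2))"
  "(\<integral>x. ln (2 * (sin x)\<^sup>2) \<partial>arc_law) = - ln 2 - 1"
proof -
  define t where "t = (\<lambda>k. 1 / real (Suc k))"
  define r where "r = (\<lambda>k. 1 + t k - sqrt ((t k)\<^sup>2 + 2 * t k))"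
  have t: "t k > 0" for k by (simp add: t_def)
  have sin_pos: "0 < 2 * (sin x)\<^sup>2" if "0 < x \<and> x < pi / 2" for x :: real
    using sin_gt_zero[of x] that by auto
  have t0: "t \<longlonglongrightarrow> 0" unfolding t_def by (rule LIMSEQ_inverse_real_of_nat[unfolded inverse_eq_divide])
  have r1: "r \<longlonglongrightarrow> 1 + 0 - sqrt (0\<^sup>2 + 2 * 0)" unfolding r_def by (intro tendsto_intros t0)
  have "(\<lambda>k. ln 2 + ln (r k) + r k) \<longlonglongrightarrow> ln 2 + ln (1 + 0 - sqrt (0\<^sup>2 + 2 * 0)) + (1 + 0 - sqrt (0\<^sup>2 + 2 * 0))"
    by (intro tendsto_add tendsto_const tendsto_ln r1) auto
  moreover have "(\<integral>x. - ln (t k + 2 * (sin x)\<^sup>2) \<partial>arc_law) = ln 2 + ln (r k) + r k" for k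
    using arc_log_shift(4)[OF t[of k]] by (simp add: r_def)
  ultimately have lim: "(\<lambda>k. \<integral>x. - ln (t k + 2 * (sin x)\<^sup>2) \<partial>arc_law) \<longlonglongrightarrow> ln 2 + 1"
    by simp
  have mono: "AE x in arc_law. mono (\<lambda>k. - ln (t k + 2 * (sin x)\<^sup>2))"
    using arc_AE
  proof eventually_elim
    case (elim x)
    show ?case
    proof (rule monoI)
      fix i j :: nat assume "i \<le> j"
      hence "t j \<le> t i" by (auto simp: t_def intro!: divide_left_mono)
      thus "- ln (t i + 2 * (sin x)\<^sup>2) \<le> - ln (t j + 2 * (sin x)\<^sup>2)"
        using t[of j] by (simp add: ln_mono add_pos_nonneg)
    qed
  qed
  have ptw: "AE x in arc_law. (\<lambda>k. - ln (t k + 2 * (sin x)\<^sup>2)) \<longlonglongrightarrow> - ln (2 * (sin x)\<^sup>2)"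
    using arc_AE
  proof eventually_elim
    case (elim x)
    have "(\<lambda>k. - ln (t k + 2 * (sin x)\<^sup>2)) \<longlonglongrightarrow> - ln (0 + 2 * (sin x)\<^sup>2)"
      by (intro tendsto_intros t0) (use sin_pos[OF elim] in auto)
    thus ?case by simp
  qed
  have "has_bochner_integral arc_law (\<lambda>x. - ln (2 * (sin x)\<^sup>2)) (ln 2 + 1)"
    by (rule has_bochner_integral_monotone_convergence[OF _ mono ptw lim]) (use arc_log_shift(3)[OF t] in auto)
  hence "has_bochner_integral arc_law (\<lambda>x. - (- ln (2 * (sin x)\<^sup>2))) (- (ln 2 + 1))"
    by (rule has_bochner_integral_minus)
  thus "integrable arc_law (\<lambda>x. ln (2 * (sin x)\<^sup>2))" "(\<integral>x. ln (2 * (sin x)\<^sup>2) \<partial>arc_law) = - ln 2 - 1"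
    by (simp_all add: has_bochner_integral_iff)
qed

text \<open>With w = sqrt (1 + t^2) one has (t sin x)^2 + 1 = w^2 - (t cos x)^2, so the substitution
  by cos x leads to an arcsine.\<close>

lemma integral_arsinh_derivative:
  assumes "0 < t"
  shows "integral {0..pi/2} (\<lambda>x. sin x / sqrt ((t * sin x)\<^sup>2 + 1)) = arctan t / t"
proof -
  define w where "w = sqrt (1 + t\<^sup>2)"
  have w: "w > 0" "w\<^sup>2 = 1 + t\<^sup>2" "w > t"
  proof -
    show "w > 0" by (simp add: w_def add_pos_nonneg)
    show "w\<^sup>2 = 1 + t\<^sup>2" by (simp add: w_def)
    have "sqrt (t\<^sup>2) < w" unfolding w_def by (rule real_sqrt_less_mono) simp
    thus "w > t" using assms by simp
  qed
  define F where "F = (\<lambda>x. - (1 / t) * arcsin (t * cos x / w))"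
  have "((\<lambda>x. sin x / sqrt ((t * sin x)\<^sup>2 + 1)) has_integral (F (pi / 2) - F 0)) {0..pi/2}"
  proof (rule fundamental_theorem_of_calculus[where f = F])
    fix x :: real
    have "\<bar>t * cos x / w\<bar> < 1"
    proof -
      have "\<bar>t * cos x\<bar> \<le> t * 1" unfolding abs_mult using assms by (intro mult_mono) auto
      thus ?thesis using w by (simp add: abs_divide)
    qed
    hence lt: "- 1 < t * cos x / w" "t * cos x / w < 1" by linarith+
    have sq: "sqrt (1 - (t * cos x / w)\<^sup>2) = sqrt ((t * sin x)\<^sup>2 + 1) / w"
    proof -
      have "1 - (t * cos x / w)\<^sup>2 = (w\<^sup>2 - (t * cos x)\<^sup>2) / w\<^sup>2" using w(1) by (simp add: power_divide diff_divide_distrib)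
      also have "w\<^sup>2 - (t * cos x)\<^sup>2 = (t * sin x)\<^sup>2 + 1"
        unfolding w(2) power_mult_distrib cos_squared_eq by (simp add: algebra_simps)
      finally show ?thesis using w(1) by (simp add: real_sqrt_divide)
    qed
    have "((\<lambda>x. arcsin (t * cos x / w)) has_real_derivative inverse (sqrt (1 - (t * cos x / w)\<^sup>2)) * (t * (- sin x) / w)) (at x within {0..pi/2})"
    proof (rule DERIV_chain2[where f = arcsin and g = "\<lambda>x. t * cos x / w"])
      show "(arcsin has_real_derivative inverse (sqrt (1 - (t * cos x / w)\<^sup>2))) (at (t * cos x / w))"
        by (rule DERIV_arcsin) (use lt in auto)
      show "((\<lambda>x. t * cos x / w) has_real_derivative t * (- sin x) / w) (at x within {0..pi/2})"
        using w(1) by (auto intro!: derivative_eq_intros)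
    qed
    hence "(F has_real_derivative - (1 / t) * (inverse (sqrt (1 - (t * cos x / w)\<^sup>2)) * (t * (- sin x) / w))) (at x within {0..pi/2})"
      unfolding F_def by (rule DERIV_cmult)
    also have "- (1 / t) * (inverse (sqrt (1 - (t * cos x / w)\<^sup>2)) * (t * (- sin x) / w)) = sin x / sqrt ((t * sin x)\<^sup>2 + 1)"
      unfolding sq using w(1) assms by (simp add: field_simps)
    finally show "(F has_vector_derivative sin x / sqrt ((t * sin x)\<^sup>2 + 1)) (at x within {0..pi/2})"
      by (simp add: has_real_derivative_iff_has_vector_derivative)
  qed simp
  moreover have "arcsin (t / w) = arctan t"
    unfolding w_def sin_arctan[symmetric]
    using arctan_bounded[of t] by (intro arcsin_sin) auto
  ultimately show ?thesis by (simp add: F_def integral_unique)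
qed

text \<open>A parameter is inserted: the integral of arsinh (t sin x) and the power series
  \<open>T\<close> of the inverse tangent integral both have derivative arctan t / t on (0, 1) and
  vanish at t = 0; at t = 1 the series is Catalan's.\<close>

lemma integral_arsinh_sin: "integral {0..pi/2} (\<lambda>x. arsinh (sin x)) = catalan_const"
proof -
  define I where "I = (\<lambda>t. integral (cbox 0 (pi/2)) (\<lambda>x. arsinh (t * sin x)))"
  define f where "f = (\<lambda>n t. (-1) ^ n * t ^ (2 * n + 1) / (2 * real n + 1)\<^sup>2)"
  define f' where "f' = (\<lambda>n t. (-1) ^ n * t ^ (2 * n) / (2 * real n + 1))"
  define T where "T = (\<lambda>t. \<Sum>n. f n t)"
  have dI: "(I has_real_derivative integral (cbox 0 (pi/2)) (\<lambda>x. sin x / sqrt ((t * sin x)\<^sup>2 + 1))) (at t within {0..1})" if "t \<in> {0..1}" for t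
    unfolding I_def
  proof (rule leibniz_rule_field_derivative[where U = "{0..1}"])
    show "((\<lambda>t. arsinh (t * sin x)) has_real_derivative sin x / sqrt ((t * sin x)\<^sup>2 + 1)) (at t within {0..1})" for t x
    proof -
      have "((\<lambda>t. arsinh (t * sin x)) has_real_derivative 1 / sqrt ((t * sin x)\<^sup>2 + 1) * sin x) (at t within {0..1})"
        by (rule DERIV_chain2[OF arsinh_real_has_field_derivative]) (auto intro!: derivative_eq_intros)
      thus ?thesis by simp
    qed
    have nz: "(a * sin b)\<^sup>2 + 1 \<noteq> 0" for a b :: real using zero_le_power2[of "a * sin b"] by linarith
    show "continuous_on ({0..1} \<times> cbox 0 (pi / 2)) (\<lambda>(t, x). sin x / sqrt ((t * sin x)\<^sup>2 + 1))"
      unfolding case_prod_beta by (intro continuous_intros) (use nz in auto)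
    show "(\<lambda>x. arsinh (t * sin x)) integrable_on cbox 0 (pi / 2)" for t
      by (intro integrable_continuous continuous_on_arsinh' continuous_intros)
  qed (use that in auto)
  have sumf: "summable (\<lambda>n. 1 / (real n + 1)\<^sup>2)"
    using inverse_squares_sums by (simp add: sums_iff add.commute)
  have boundf: "norm (f n t) \<le> 1 / (real n + 1)\<^sup>2" if "t \<in> {0..1}" for n t
  proof -
    have "\<bar>f n t\<bar> = t ^ (2 * n + 1) / (2 * real n + 1)\<^sup>2" using that by (simp add: f_def abs_mult power_abs)
    also have "\<dots> \<le> 1 / (real n + 1)\<^sup>2"
      using that by (intro frac_le power_le_one power_mono) auto
    finally show ?thesis by simp
  qed
  \<comment> \<open>Uniform convergence up to t = 1, so that the identity on the open interval
    extends to the endpoint where Catalan's series appears.\<close>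
  have contT: "continuous_on {0..1} T"
    unfolding T_def
  proof (rule uniform_limit_theorem)
    show "uniform_limit {0..1} (\<lambda>n x. \<Sum>i<n. f i x) (\<lambda>x. \<Sum>i. f i x) sequentially"
      by (rule Weierstrass_m_test[OF boundf sumf])
    show "\<forall>\<^sub>F n in sequentially. continuous_on {0..1} (\<lambda>x. \<Sum>i<n. f i x)"
      unfolding f_def by (intro always_eventually allI continuous_intros) auto
  qed auto
  have dT: "(T has_real_derivative arctan t / t) (at t)" if t: "0 < t" "t < 1" for t
  proof -
    define \<rho> where "\<rho> = (1 + t) / 2"
    have \<rho>: "t < \<rho>" "\<rho> < 1" "0 < \<rho>" using t by (auto simp: \<rho>_def)
    have "(T has_real_derivative (\<Sum>n. f' n t)) (at t)"
      unfolding T_def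
    proof (rule has_field_derivative_series'(2)[where S = "{0<..<\<rho>}" and x0 = t])
      show "(f n has_real_derivative f' n x) (at x within {0<..<\<rho>})" if "x \<in> {0<..<\<rho>}" for n x
      proof -
        have "(f n has_real_derivative (-1) ^ n * (real (2 * n + 1) * x ^ (2 * n)) / (2 * real n + 1)\<^sup>2) (at x within {0<..<\<rho>})"
          unfolding f_def by (intro DERIV_cdivide DERIV_cmult DERIV_cong[OF DERIV_pow]) simp
        also have "(-1) ^ n * (real (2 * n + 1) * x ^ (2 * n)) / (2 * real n + 1)\<^sup>2 = f' n x"
        proof -
          have "s * (m * y) / (m * m) = s * y / m" if "m \<noteq> 0" for s m y :: real using that by simp
          moreover have "2 * real n + 1 \<noteq> 0" by linarith
          moreover have "real (2 * n + 1) = 2 * real n + 1" by simp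
          ultimately show ?thesis by (simp only: f'_def power2_eq_square)
        qed
        finally show ?thesis .
      qed
      show "uniformly_convergent_on {0<..<\<rho>} (\<lambda>n x. \<Sum>i<n. f' i x)"
      proof (rule Weierstrass_m_test')
        show "norm (f' n x) \<le> (\<rho>\<^sup>2) ^ n" if "x \<in> {0<..<\<rho>}" for n x
        proof -
          have "\<bar>f' n x\<bar> = x ^ (2 * n) / (2 * real n + 1)" using that by (simp add: f'_def abs_mult power_abs)
          also have "\<dots> \<le> \<rho> ^ (2 * n) / 1" using that by (intro frac_le power_mono) auto
          finally show ?thesis by (simp add: power_mult)
        qed
        show "summable (\<lambda>n. (\<rho>\<^sup>2) ^ n)"
          using \<rho> by (intro summable_geometric) (simp add: power_less_one_iff abs_square_less_1)
      qed
      show "summable (\<lambda>n. f n t)"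
        using boundf[of t] t by (intro summable_comparison_test'[OF sumf, of 0]) auto
    qed (use \<rho> t in auto)
    also have "(\<Sum>n. f' n t) = arctan t / t"
    proof -
      have "(\<lambda>k. (-1) ^ k * (1 / real (k * 2 + 1) * t ^ (k * 2 + 1))) sums arctan t"
        using summable_arctan_series[of t] arctan_series[of t] t by (simp add: sums_iff)
      hence "(\<lambda>k. (-1) ^ k * (1 / real (k * 2 + 1) * t ^ (k * 2 + 1)) / t) sums (arctan t / t)"
        by (rule sums_divide)
      moreover have "(-1) ^ k * (1 / real (k * 2 + 1) * t ^ (k * 2 + 1)) / t = f' k t" for k
        using t by (simp add: f'_def mult.commute)
      ultimately show ?thesis by (simp add: sums_iff)
    qed
    finally show ?thesis .
  qed
  have "I 1 - T 1 = I 0 - T 0"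
  proof (rule DERIV_isconst_end[where f = "\<lambda>t. I t - T t"])
    show "continuous_on {0..1} (\<lambda>t. I t - T t)"
    proof (intro continuous_intros contT)
      show "continuous_on {0..1} I" using dI by (intro DERIV_continuous_on) auto
    qed
    fix t :: real assume t: "0 < t" "t < 1"
    have "(I has_real_derivative arctan t / t) (at t within {0..1})"
      using dI[of t] integral_arsinh_derivative[of t] t by simp
    hence "(I has_real_derivative arctan t / t) (at t)"
      using t by (simp add: at_within_Icc_at)
    from DERIV_diff[OF this dT[OF t]] show "((\<lambda>t. I t - T t) has_real_derivative 0) (at t)" by simp
  qed simp
  moreover have "I 0 = 0" "T 0 = 0" by (simp_all add: I_def T_def f_def)
  moreover have "T 1 = catalan_const" by (simp add: T_def f_def catalan_const_def)
  ultimately show ?thesis by (simp add: I_def)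
qed

text \<open>From 2 (cos x)^2 = 1 + cos (2 x): the constant part gives Catalan's constant, the other
  is integrated by parts, and the remainder sin x (cos x)^2 / sqrt (1 + (sin x)^2) is treated by the
  substitution c = cos x.\<close>

lemma arc_arsinh: "(\<integral>x. 2 * arsinh (sin x) \<partial>arc_law) = 4 / pi * (catalan_const - pi / 4 + 1 / 2)"
proof -
  define H where "H = (\<lambda>x::real. integral {0..x} (\<lambda>y. arsinh (sin y)))"
  \<comment> \<open>An antiderivative of c^2 / sqrt (2 - c^2); at c = cos x the radicand is 1 + (sin
    x)^2.\<close>
  define Q where "Q = (\<lambda>c. arcsin (c / sqrt 2) - c / 2 * sqrt (2 - c\<^sup>2))"
  define F where "F = (\<lambda>x. H x + (sin (2 * x) / 2 * arsinh (sin x) + Q (cos x)))"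
  have s2: "1 < sqrt 2" by simp
  have dQ: "(Q has_real_derivative c\<^sup>2 / sqrt (2 - c\<^sup>2)) (at c)" if "\<bar>c\<bar> \<le> 1" for c
  proof -
    have c2: "c\<^sup>2 \<le> 1" using that by (simp add: abs_square_le_1)
    have p: "2 - c\<^sup>2 > 0" using c2 by linarith
    have "\<bar>c\<bar> < sqrt 2" using that s2 by linarith
    hence "\<bar>c / sqrt 2\<bar> < 1" by (simp add: abs_divide)
    hence lt: "- 1 < c / sqrt 2" "c / sqrt 2 < 1" by linarith+
    have sq: "sqrt (1 - (c / sqrt 2)\<^sup>2) = sqrt (2 - c\<^sup>2) / sqrt 2"
    proof -
      have "1 - (c / sqrt 2)\<^sup>2 = (2 - c\<^sup>2) / 2" by (simp add: power_divide diff_divide_distrib)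
      thus ?thesis by (simp only: real_sqrt_divide)
    qed
    have "((\<lambda>c. arcsin (c / sqrt 2)) has_real_derivative inverse (sqrt (1 - (c / sqrt 2)\<^sup>2)) * (1 / sqrt 2)) (at c)"
      by (rule DERIV_chain2[OF DERIV_arcsin], rule lt, rule lt, rule DERIV_cdivide, rule DERIV_ident)
    moreover have "((\<lambda>c. c / 2 * sqrt (2 - c\<^sup>2)) has_real_derivative (sqrt (2 - c\<^sup>2) / 2 + c / 2 * (inverse (sqrt (2 - c\<^sup>2)) / 2 * (- 2 * c)))) (at c)"
      using p by (auto intro!: derivative_eq_intros)
    ultimately have "(Q has_real_derivative (inverse (sqrt (1 - (c / sqrt 2)\<^sup>2)) * (1 / sqrt 2)
        - (sqrt (2 - c\<^sup>2) / 2 + c / 2 * (inverse (sqrt (2 - c\<^sup>2)) / 2 * (- 2 * c))))) (at c)"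
      unfolding Q_def by (rule DERIV_diff)
    also have "(inverse (sqrt (1 - (c / sqrt 2)\<^sup>2)) * (1 / sqrt 2)
        - (sqrt (2 - c\<^sup>2) / 2 + c / 2 * (inverse (sqrt (2 - c\<^sup>2)) / 2 * (- 2 * c)))) = c\<^sup>2 / sqrt (2 - c\<^sup>2)"
    proof -
      define k where "k = sqrt (2 - c\<^sup>2)"
      have k: "k > 0" "k * k = 2 - c\<^sup>2" using p by (auto simp: k_def)
      have k1: "inverse (k / sqrt 2) * (1 / sqrt 2) = 1 / k" by (simp only: inverse_divide) simp
      have "1 / k - (k / 2 + c / 2 * (inverse k / 2 * (- 2 * c))) = (2 - k * k + c\<^sup>2) / (2 * k)"
        using k(1) by (simp add: field_simps power2_eq_square)
      also have "\<dots> = c\<^sup>2 / k" unfolding k(2) using k(1) by (simp add: field_simps)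
      finally show ?thesis unfolding sq k_def[symmetric] k1 .
    qed
    finally show ?thesis .
  qed
  have "(\<integral>x. 2 * arsinh (sin x) \<partial>arc_law) = 4 / pi * (F (pi / 2) - F 0)"
  proof (rule arc_integral_FTC)
    fix x :: real assume x: "0 \<le> x" "x \<le> pi / 2"
    have k: "2 - (cos x)\<^sup>2 = (sin x)\<^sup>2 + 1" by (simp add: cos_squared_eq)
    have kp: "sqrt ((sin x)\<^sup>2 + 1) > 0" by (simp add: add_nonneg_pos)
    have "(H has_real_derivative arsinh (sin x)) (at x within {0..pi/2})"
      unfolding H_def using x by (intro integral_has_real_derivative continuous_on_arsinh' continuous_intros) auto
    moreover have "((\<lambda>x. arsinh (sin x)) has_real_derivative 1 / sqrt ((sin x)\<^sup>2 + 1) * cos x) (at x within {0..pi/2})"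
      by (rule DERIV_chain2[OF arsinh_real_has_field_derivative]) (auto intro!: derivative_eq_intros)
    moreover have "((\<lambda>x. sin (2 * x) / 2) has_real_derivative cos (2 * x)) (at x within {0..pi/2})"
      by (auto intro!: derivative_eq_intros)
    moreover have "((\<lambda>x. Q (cos x)) has_real_derivative (cos x)\<^sup>2 / sqrt (2 - (cos x)\<^sup>2) * (- sin x)) (at x within {0..pi/2})"
      by (rule DERIV_chain2[OF dQ]) (auto intro!: derivative_eq_intros)
    ultimately have "(F has_real_derivative arsinh (sin x) + ((cos (2 * x) * arsinh (sin x) + 1 / sqrt ((sin x)\<^sup>2 + 1) * cos x * (sin (2 * x) / 2))
        + (cos x)\<^sup>2 / sqrt (2 - (cos x)\<^sup>2) * (- sin x))) (at x within {0..pi/2})"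
      unfolding F_def by (intro DERIV_add DERIV_mult)
    also have "arsinh (sin x) + ((cos (2 * x) * arsinh (sin x) + 1 / sqrt ((sin x)\<^sup>2 + 1) * cos x * (sin (2 * x) / 2))
        + (cos x)\<^sup>2 / sqrt (2 - (cos x)\<^sup>2) * (- sin x)) = (cos x)\<^sup>2 * (2 * arsinh (sin x))"
      unfolding k cos_double_cos sin_double using kp by (simp add: power2_eq_square field_simps)
    finally show "(F has_real_derivative (cos x)\<^sup>2 * (2 * arsinh (sin x))) (at x within {0..pi/2})" .
  qed (auto intro!: continuous_intros continuous_on_arsinh' borel_measurable_continuous_onI)
  also have "F (pi / 2) = catalan_const"
    by (simp add: F_def H_def Q_def integral_arsinh_sin)
  also have "F 0 = pi / 4 - 1 / 2"
  proof -
    have "arcsin (1 / sqrt 2) = pi / 4"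
    proof -
      have "1 / sqrt 2 = sin (pi / 4)" by (simp add: sin_45 field_simps)
      thus ?thesis using arcsin_sin[of "pi / 4"] by (simp only:) simp
    qed
    thus ?thesis by (simp add: F_def H_def Q_def)
  qed
  finally show ?thesis by (simp add: algebra_simps)
qed

text \<open>The square expands to 1 + 2 (sin x)^2 - 2 sin x sqrt ((sin x)^2 + 1). The trigonometric
  part is elementary; \<open>T\<close>, an antiderivative of 2 c^2 sqrt (2 - c^2), takes care of the
  root through c = cos x.\<close>

lemma arc_exp_arsinh: "(\<integral>x. (sqrt ((sin x)\<^sup>2 + 1) - sin x)\<^sup>2 \<partial>arc_law) = 1 / 2"
proof -
  define T where "T = (\<lambda>c. arcsin (c / sqrt 2) - c * sqrt (2 - c\<^sup>2) * (1 - c\<^sup>2) / 2)"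
  define F where "F = (\<lambda>x. x / 2 + sin (2 * x) / 4 + (x / 4 - sin (4 * x) / 16) + T (cos x))"
  have s2: "1 < sqrt 2" by simp
  have dT: "(T has_real_derivative 2 * c\<^sup>2 * sqrt (2 - c\<^sup>2)) (at c)" if "\<bar>c\<bar> \<le> 1" for c
  proof -
    have c2: "c\<^sup>2 \<le> 1" using that by (simp add: abs_square_le_1)
    have p: "2 - c\<^sup>2 > 0" using c2 by linarith
    have "\<bar>c\<bar> < sqrt 2" using that s2 by linarith
    hence "\<bar>c / sqrt 2\<bar> < 1" by (simp add: abs_divide)
    hence lt: "- 1 < c / sqrt 2" "c / sqrt 2 < 1" by linarith+
    have sq: "sqrt (1 - (c / sqrt 2)\<^sup>2) = sqrt (2 - c\<^sup>2) / sqrt 2"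
    proof -
      have "1 - (c / sqrt 2)\<^sup>2 = (2 - c\<^sup>2) / 2" by (simp add: power_divide diff_divide_distrib)
      thus ?thesis by (simp only: real_sqrt_divide)
    qed
    have "((\<lambda>c. arcsin (c / sqrt 2)) has_real_derivative inverse (sqrt (1 - (c / sqrt 2)\<^sup>2)) * (1 / sqrt 2)) (at c)"
      by (rule DERIV_chain2[OF DERIV_arcsin], rule lt, rule lt, rule DERIV_cdivide, rule DERIV_ident)
    moreover have "((\<lambda>c. c * sqrt (2 - c\<^sup>2) * (1 - c\<^sup>2) / 2) has_real_derivative
        ((sqrt (2 - c\<^sup>2) + c * (inverse (sqrt (2 - c\<^sup>2)) / 2 * (- 2 * c))) * (1 - c\<^sup>2) + c * sqrt (2 - c\<^sup>2) * (- 2 * c)) / 2) (at c)"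
    proof -
      have ds: "((\<lambda>c. sqrt (2 - c\<^sup>2)) has_real_derivative inverse (sqrt (2 - c\<^sup>2)) / 2 * (- 2 * c)) (at c)"
        using p by (auto intro!: derivative_eq_intros)
      have dd: "((\<lambda>c. 1 - c\<^sup>2) has_real_derivative - 2 * c) (at c)" by (auto intro!: derivative_eq_intros)
      show ?thesis
        by (intro DERIV_cong[OF DERIV_cdivide[OF DERIV_mult[OF DERIV_mult[OF DERIV_ident ds] dd]]]) (simp add: mult_ac)
    qed
    ultimately have "(T has_real_derivative (inverse (sqrt (1 - (c / sqrt 2)\<^sup>2)) * (1 / sqrt 2)
        - ((sqrt (2 - c\<^sup>2) + c * (inverse (sqrt (2 - c\<^sup>2)) / 2 * (- 2 * c))) * (1 - c\<^sup>2) + c * sqrt (2 - c\<^sup>2) * (- 2 * c)) / 2)) (at c)"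
      unfolding T_def by (rule DERIV_diff)
    also have "(inverse (sqrt (1 - (c / sqrt 2)\<^sup>2)) * (1 / sqrt 2)
        - ((sqrt (2 - c\<^sup>2) + c * (inverse (sqrt (2 - c\<^sup>2)) / 2 * (- 2 * c))) * (1 - c\<^sup>2) + c * sqrt (2 - c\<^sup>2) * (- 2 * c)) / 2) = 2 * c\<^sup>2 * sqrt (2 - c\<^sup>2)"
    proof -
      define k where "k = sqrt (2 - c\<^sup>2)"
      have k: "k > 0" "c * c = 2 - k * k" using p by (auto simp: k_def power2_eq_square)
      have k1: "inverse (k / sqrt 2) * (1 / sqrt 2) = 1 / k" by (simp only: inverse_divide) simp
      have "1 / k - ((k + c * (inverse k / 2 * (- 2 * c))) * (1 - c\<^sup>2) + c * k * (- 2 * c)) / 2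
          = (2 - (k * k - c * c) * (1 - c * c) + 2 * (c * c) * (k * k)) / (2 * k)"
        using k(1) by (simp add: field_simps power2_eq_square)
      also have "\<dots> = 2 * c\<^sup>2 * k" unfolding power2_eq_square k(2) using k(1) by (simp add: field_simps)
      finally show ?thesis unfolding sq k_def[symmetric] k1 .
    qed
    finally show ?thesis .
  qed
  have "(\<integral>x. (sqrt ((sin x)\<^sup>2 + 1) - sin x)\<^sup>2 \<partial>arc_law) = 4 / pi * (F (pi / 2) - F 0)"
  proof (rule arc_integral_FTC)
    fix x :: real
    have k: "2 - (cos x)\<^sup>2 = (sin x)\<^sup>2 + 1" by (simp add: cos_squared_eq)
    have s: "(sin x)\<^sup>2 = 1 - (cos x)\<^sup>2" by (rule sin_squared_eq)
    have "((\<lambda>x. x / 2 + sin (2 * x) / 4) has_real_derivative 1 / 2 + cos (2 * x) / 2) (at x within {0..pi/2})"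
      by (auto intro!: derivative_eq_intros)
    moreover have "((\<lambda>x. x / 4 - sin (4 * x) / 16) has_real_derivative 1 / 4 - cos (4 * x) / 4) (at x within {0..pi/2})"
      by (auto intro!: derivative_eq_intros)
    moreover have "((\<lambda>x. T (cos x)) has_real_derivative 2 * (cos x)\<^sup>2 * sqrt (2 - (cos x)\<^sup>2) * (- sin x)) (at x within {0..pi/2})"
      by (rule DERIV_chain2[OF dT]) (auto intro!: derivative_eq_intros)
    ultimately have "(F has_real_derivative (1 / 2 + cos (2 * x) / 2 + (1 / 4 - cos (4 * x) / 4) + 2 * (cos x)\<^sup>2 * sqrt (2 - (cos x)\<^sup>2) * (- sin x))) (at x within {0..pi/2})"
      unfolding F_def by (rule DERIV_add[OF DERIV_add])
    also have "1 / 2 + cos (2 * x) / 2 + (1 / 4 - cos (4 * x) / 4) + 2 * (cos x)\<^sup>2 * sqrt (2 - (cos x)\<^sup>2) * (- sin x)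
        = (cos x)\<^sup>2 * ((sin x)\<^sup>2 + 1 + (sin x)\<^sup>2 - 2 * sqrt ((sin x)\<^sup>2 + 1) * sin x)"
    proof -
      have 1: "cos (4 * x) = 2 * (cos (2 * x))\<^sup>2 - 1" using cos_double_cos[of "2 * x"] by simp
      have 2: "cos (2 * x) = 2 * (cos x)\<^sup>2 - 1" by (rule cos_double_cos)
      have "1 / 2 + cos (2 * x) / 2 + (1 / 4 - cos (4 * x) / 4) = (cos x)\<^sup>2 * ((1 - (cos x)\<^sup>2) + 1 + (1 - (cos x)\<^sup>2))"
        unfolding 1 2 by (simp add: power2_eq_square field_simps)
      hence "1 / 2 + cos (2 * x) / 2 + (1 / 4 - cos (4 * x) / 4) = (cos x)\<^sup>2 * ((sin x)\<^sup>2 + 1 + (sin x)\<^sup>2)"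
        by (simp only: s)
      thus ?thesis unfolding k by (simp add: algebra_simps)
    qed
    also have "(sin x)\<^sup>2 + 1 + (sin x)\<^sup>2 - 2 * sqrt ((sin x)\<^sup>2 + 1) * sin x = (sqrt ((sin x)\<^sup>2 + 1) - sin x)\<^sup>2"
      by (simp add: power2_diff)
    finally show "(F has_real_derivative (cos x)\<^sup>2 * (sqrt ((sin x)\<^sup>2 + 1) - sin x)\<^sup>2) (at x within {0..pi/2})" .
  qed (auto intro!: continuous_intros)
  also have "F (pi / 2) = 3 * pi / 8"
    using sin_npi[of 2] by (simp add: F_def T_def mult.commute)
  also have "F 0 = pi / 4"
  proof -
    have "arcsin (1 / sqrt 2) = pi / 4"
    proof -
      have "1 / sqrt 2 = sin (pi / 4)" by (simp add: sin_45 field_simps)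
      thus ?thesis using arcsin_sin[of "pi / 4"] by (simp only:) simp
    qed
    thus ?thesis by (simp add: F_def T_def)
  qed
  finally show ?thesis by (simp add: field_simps)
qed

text \<open>Integrating in y first is \<open>arc_log_shift\<close> with t = 2 s^2, s = sin x. Its
  root r is then the perfect square (sqrt (s^2 + 1) - s)^2 = exp (- 2 arsinh s). Since the sum lies
  between 2 s^2 and 4, a majorant in the first variable gives integrability.\<close>

lemma arc_pair_log:
  "integrable (arc_law \<Otimes>\<^sub>M arc_law) (\<lambda>(x, y). ln (2 * (sin x)\<^sup>2 + 2 * (sin y)\<^sup>2))"
  "(\<integral>(x, y). ln (2 * (sin x)\<^sup>2 + 2 * (sin y)\<^sup>2) \<partial>(arc_law \<Otimes>\<^sub>M arc_law)) =
     - ln 2 + 4 / pi * (catalan_const - pi / 4 + 1 / 2) - 1 / 2"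
proof -
  interpret A: prob_space arc_law by (rule prob_space_arc)
  interpret AA: pair_prob_space arc_law arc_law ..
  have sin_pos: "0 < sin x" if "0 < x \<and> x < pi / 2" for x :: real
    using sin_gt_zero[of x] that by auto
  have sin1: "(sin x)\<^sup>2 \<le> 1" for x :: real by (simp add: abs_square_le_1)
  have fst_pos: "AE z in arc_law \<Otimes>\<^sub>M arc_law. 0 < 2 * (sin (fst z))\<^sup>2"
  proof (rule AA.AE_pair_measure)
    show "{z \<in> space (arc_law \<Otimes>\<^sub>M arc_law). 0 < 2 * (sin (fst z))\<^sup>2} \<in> sets (arc_law \<Otimes>\<^sub>M arc_law)"
      by measurable
    show "AE x in arc_law. AE y in arc_law. 0 < 2 * (sin (fst (x, y)))\<^sup>2"
      using arc_AE by eventually_elim (use sin_pos in fastforce)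
  qed
  have dom: "integrable (arc_law \<Otimes>\<^sub>M arc_law) (\<lambda>z. ln 4 + \<bar>ln (2 * (sin (fst z))\<^sup>2)\<bar>)"
  proof (intro Bochner_Integration.integrable_add)
    have "integrable (arc_law \<Otimes>\<^sub>M arc_law) (\<lambda>z. \<bar>ln (2 * (sin (fst z))\<^sup>2)\<bar>) \<longleftrightarrow> integrable (distr (arc_law \<Otimes>\<^sub>M arc_law) arc_law fst) (\<lambda>x. \<bar>ln (2 * (sin x)\<^sup>2)\<bar>)"
      by (subst integrable_distr_eq) auto
    also have "distr (arc_law \<Otimes>\<^sub>M arc_law) arc_law fst = arc_law"
      by (rule A.distr_pair_fst)
    finally show "integrable (arc_law \<Otimes>\<^sub>M arc_law) (\<lambda>z. \<bar>ln (2 * (sin (fst z))\<^sup>2)\<bar>)"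
      using arc_log_sin(1) by simp
  qed simp
  show int: "integrable (arc_law \<Otimes>\<^sub>M arc_law) (\<lambda>(x, y). ln (2 * (sin x)\<^sup>2 + 2 * (sin y)\<^sup>2))"
  proof (rule Bochner_Integration.integrable_bound[OF dom])
    show "AE z in arc_law \<Otimes>\<^sub>M arc_law. norm (case z of (x, y) \<Rightarrow> ln (2 * (sin x)\<^sup>2 + 2 * (sin y)\<^sup>2)) \<le> norm (ln 4 + \<bar>ln (2 * (sin (fst z))\<^sup>2)\<bar>)"
      using fst_pos
    proof eventually_elim
      case (elim z)
      obtain x y where z: "z = (x, y)" by (cases z)
      have "ln (2 * (sin x)\<^sup>2) \<le> ln (2 * (sin x)\<^sup>2 + 2 * (sin y)\<^sup>2)"
        using elim by (intro ln_mono) (auto simp: z add_pos_nonneg)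
      moreover have "ln (2 * (sin x)\<^sup>2 + 2 * (sin y)\<^sup>2) \<le> ln 4"
        using elim sin1[of x] sin1[of y] by (intro ln_mono) (auto simp: z add_pos_nonneg)
      moreover have "0 \<le> ln (4::real)" by simp
      ultimately show ?case unfolding z prod.case fst_conv real_norm_def by linarith
    qed
  qed measurable
  have "(\<integral>(x, y). ln (2 * (sin x)\<^sup>2 + 2 * (sin y)\<^sup>2) \<partial>(arc_law \<Otimes>\<^sub>M arc_law)) = (\<integral>x. (\<integral>y. ln (2 * (sin x)\<^sup>2 + 2 * (sin y)\<^sup>2) \<partial>arc_law) \<partial>arc_law)"
    by (rule AA.integral_fst[symmetric]) (rule int)
  also have "\<dots> = (\<integral>x. - ln 2 + 2 * arsinh (sin x) - (sqrt ((sin x)\<^sup>2 + 1) - sin x)\<^sup>2 \<partial>arc_law)"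
  proof (rule integral_cong_AE)
    show "AE x in arc_law. (\<integral>y. ln (2 * (sin x)\<^sup>2 + 2 * (sin y)\<^sup>2) \<partial>arc_law) = - ln 2 + 2 * arsinh (sin x) - (sqrt ((sin x)\<^sup>2 + 1) - sin x)\<^sup>2"
      using arc_AE
    proof eventually_elim
      case (elim x)
      define s where "s = sin x"
      define q where "q = sqrt (s\<^sup>2 + 1)"
      have s: "s > 0" using sin_pos[OF elim] by (simp add: s_def)
      have q: "q > 0" "q\<^sup>2 = s\<^sup>2 + 1" by (auto simp: q_def add_nonneg_pos)
      have "sqrt ((2 * s\<^sup>2)\<^sup>2 + 2 * (2 * s\<^sup>2)) = sqrt ((2 * s * q)\<^sup>2)"
        by (rule arg_cong[where f = sqrt]) (simp only: power_mult_distrib q(2), simp add: power2_eq_square algebra_simps)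
      also have "\<dots> = 2 * s * q" using s q by simp
      finally have r: "1 + 2 * s\<^sup>2 - sqrt ((2 * s\<^sup>2)\<^sup>2 + 2 * (2 * s\<^sup>2)) = (q - s)\<^sup>2"
        by (simp add: power2_diff q(2))
      have prod1: "(q - s) * (q + s) = 1" using q(2) by (simp add: power2_eq_square algebra_simps)
      hence qs: "q - s > 0" using q s zero_less_mult_pos2[of "q - s" "q + s"] by simp
      have "ln (q - s) + ln (q + s) = 0" using prod1 qs q s by (subst ln_mult_pos[symmetric]) auto
      moreover have "arsinh s = ln (q + s)" by (simp add: arsinh_real_def q_def add.commute)
      moreover have "ln ((q - s)\<^sup>2) = 2 * ln (q - s)" using qs by (subst ln_realpow) auto
      ultimately have "ln ((q - s)\<^sup>2) = - 2 * arsinh s" by linarith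
      thus ?case
        using arc_log_shift(4)[of "2 * s\<^sup>2"] s unfolding r by (simp add: s_def q_def)
    qed
  qed measurable
  also have "\<dots> = - ln 2 + (\<integral>x. 2 * arsinh (sin x) \<partial>arc_law) - (\<integral>x. (sqrt ((sin x)\<^sup>2 + 1) - sin x)\<^sup>2 \<partial>arc_law)"
  proof -
    have i1: "integrable arc_law (\<lambda>x. 2 * arsinh (sin x))"
    proof (rule arc_integrable[where B = "2 * arsinh 1"])
      fix x :: real assume "0 < x" "x < pi / 2"
      hence "0 \<le> sin x" "sin x \<le> 1" using sin_pos[of x] by auto
      hence "arsinh 0 \<le> arsinh (sin x)" "arsinh (sin x) \<le> arsinh 1" by (simp_all only: not_less[symmetric] arsinh_less_iff_real not_False_eq_True)
      thus "\<bar>2 * arsinh (sin x)\<bar> \<le> 2 * arsinh 1" by (simp add: abs_le_iff)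
    qed measurable
    have i2: "integrable arc_law (\<lambda>x. (sqrt ((sin x)\<^sup>2 + 1) - sin x)\<^sup>2)"
    proof (rule arc_integrable[where B = 9])
      fix x :: real
      have "sqrt ((sin x)\<^sup>2 + 1) \<le> sqrt 4" using sin1[of x] by (intro real_sqrt_le_mono) auto
      moreover have "0 \<le> sqrt ((sin x)\<^sup>2 + 1)" "sqrt 4 = (2::real)" by simp_all
      ultimately have "\<bar>sqrt ((sin x)\<^sup>2 + 1) - sin x\<bar> \<le> 3" using sin_ge_minus_one[of x] sin_le_one[of x] by linarith
      hence "\<bar>sqrt ((sin x)\<^sup>2 + 1) - sin x\<bar>\<^sup>2 \<le> 3\<^sup>2" by (intro power_mono) auto
      thus "\<bar>(sqrt ((sin x)\<^sup>2 + 1) - sin x)\<^sup>2\<bar> \<le> 9" by simp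
    qed measurable
    show ?thesis using i1 i2 A.prob_space
      by (subst Bochner_Integration.integral_diff, simp, simp, subst Bochner_Integration.integral_add) auto
  qed
  finally show "(\<integral>(x, y). ln (2 * (sin x)\<^sup>2 + 2 * (sin y)\<^sup>2) \<partial>(arc_law \<Otimes>\<^sub>M arc_law)) =
     - ln 2 + 4 / pi * (catalan_const - pi / 4 + 1 / 2) - 1 / 2"
    unfolding arc_arsinh arc_exp_arsinh .
qed

theorem laplace_limit_square_integral_value:
  "(\<integral>v. indicator {0<..} v * ((exp (- v) - (laplace_limit v)\<^sup>2) / v) \<partial>lborel) =
    2 * (1 + 2 * catalan_const) / pi + 1 / 2 - 2 * euler_mascheroni + 2 * ln 2"
  unfolding laplace_limit_square_integral[OF arc_log_sin(1) arc_pair_log(1)] arc_log_sin(2) arc_pair_log(2)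
  by (simp add: field_simps)

section \<open>The logarithmic integral of the squared kernel\<close>

definition unif :: "real measure" where
  "unif = density lborel (\<lambda>x. ennreal (indicator {-1..1} x / 2))"

lemma sets_unif [measurable_cong, simp]: "sets unif = sets borel"
  by (simp add: unif_def)

lemma space_unif [simp]: "space unif = UNIV"
  by (simp add: unif_def)

lemma unif_has_bochner_integral:
  fixes f :: "real \<Rightarrow> real"
  assumes "f \<in> borel_measurable borel"
  shows "has_bochner_integral unif f I \<longleftrightarrow> has_bochner_integral lborel (\<lambda>x. indicator {-1..1} x / 2 * f x) I"
  using assms unfolding unif_def has_bochner_integral_iff
  by (subst integrable_density, simp_all, subst integral_density, simp_all)

lemma prob_space_unif: "prob_space unif"
proof
  have "emeasure unif (space unif) = (\<integral>\<^sup>+x. ennreal (1 / 2) * indicator {-1..1::real} x \<partial>lborel)"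
    by (auto simp: unif_def emeasure_density indicator_def intro!: nn_integral_cong)
  also have "\<dots> = ennreal (1 / 2) * ennreal 2"
    by (subst nn_integral_cmult_indicator) auto
  also have "\<dots> = 1" by (subst ennreal_mult[symmetric]) auto
  finally show "emeasure unif (space unif) = 1" .
qed

interpretation unif: prob_space unif by (rule prob_space_unif)
interpretation unif2: pair_prob_space unif unif ..

abbreviation unif2 :: "(real \<times> real) measure" where "unif2 \<equiv> unif \<Otimes>\<^sub>M unif"

lemma unif_AE: "AE x in unif. \<bar>x\<bar> < 1"
proof -
  have "AE x in lborel. x \<noteq> (-1::real)" "AE x in lborel. x \<noteq> (1::real)" by (rule AE_lborel_singleton)+
  thus ?thesis unfolding unif_def
    by (subst AE_density) (auto simp: indicator_def elim!: eventually_elim2)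
qed

lemma unif2_AE: "AE z in unif2. \<bar>fst z\<bar> < 1 \<and> \<bar>snd z\<bar> < 1"
proof (rule unif2.AE_pair_measure)
  show "AE x in unif. AE y in unif. \<bar>fst (x, y)\<bar> < 1 \<and> \<bar>snd (x, y)\<bar> < 1"
    using unif_AE
  proof eventually_elim
    case (elim x)
    show ?case using unif_AE by eventually_elim (use elim in simp)
  qed
qed measurable

lemma distr_unif_uminus: "distr unif unif uminus = unif"
proof (rule measure_eqI)
  fix A assume "A \<in> sets (distr unif unif uminus)"
  hence A [measurable]: "A \<in> sets borel" by simp
  have "emeasure (distr unif unif uminus) A = (\<integral>\<^sup>+x. ennreal (indicator {-1..1} x / 2) * indicator A (- x) \<partial>lborel)"
    by (subst emeasure_distr) (auto simp: unif_def emeasure_density indicator_def vimage_def intro!: nn_integral_cong)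
  also have "\<dots> = (\<integral>\<^sup>+x. ennreal (indicator {-1..1} (- x) / 2) * indicator A x \<partial>lborel)"
    by (subst nn_integral_real_affine[where c = "-1" and t = 0]) auto
  also have "\<dots> = emeasure unif A"
    by (auto simp: unif_def emeasure_density indicator_def intro!: nn_integral_cong)
  finally show "emeasure (distr unif unif uminus) A = emeasure unif A" .
qed simp

lemma unif_integral_uminus:
  fixes f :: "real \<Rightarrow> real"
  assumes [measurable]: "f \<in> borel_measurable borel"
  shows "(\<integral>x. f (- x) \<partial>unif) = (\<integral>x. f x \<partial>unif)" "integrable unif (\<lambda>x. f (- x)) \<longleftrightarrow> integrable unif f"
proof -
  show "(\<integral>x. f (- x) \<partial>unif) = (\<integral>x. f x \<partial>unif)"
    by (subst (2) distr_unif_uminus[symmetric], subst integral_distr) auto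
  show "integrable unif (\<lambda>x. f (- x)) \<longleftrightarrow> integrable unif f"
    by (subst (2) distr_unif_uminus[symmetric], subst integrable_distr_eq) auto
qed

lemma distr_unif2_uminus: "distr unif2 unif2 (\<lambda>(x, y). (- x, - y)) = unif2"
proof -
  have "distr unif unif uminus \<Otimes>\<^sub>M distr unif unif uminus = distr unif2 unif2 (\<lambda>(x, y). (- x, - y))"
    by (rule pair_measure_distr) (auto simp: distr_unif_uminus unif.sigma_finite_measure_axioms)
  thus ?thesis by (simp add: distr_unif_uminus)
qed

lemma unif2_integral_uminus:
  fixes f :: "real \<times> real \<Rightarrow> real"
  assumes [measurable]: "f \<in> borel_measurable (borel \<Otimes>\<^sub>M borel)"
  shows "(\<integral>z. f (- fst z, - snd z) \<partial>unif2) = (\<integral>z. f z \<partial>unif2)" "integrable unif2 (\<lambda>z. f (- fst z, - snd z)) \<longleftrightarrow> integrable unif2 f"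
proof -
  have m: "(\<lambda>(x, y). (- x, - y)) \<in> unif2 \<rightarrow>\<^sub>M unif2" by measurable
  show "(\<integral>z. f (- fst z, - snd z) \<partial>unif2) = (\<integral>z. f z \<partial>unif2)"
    by (subst (2) distr_unif2_uminus[symmetric], subst integral_distr[OF m]) (auto simp: case_prod_beta')
  show "integrable unif2 (\<lambda>z. f (- fst z, - snd z)) \<longleftrightarrow> integrable unif2 f"
    by (subst (2) distr_unif2_uminus[symmetric], subst integrable_distr_eq[OF m]) (auto simp: case_prod_beta')
qed

section \<open>An integrable majorant for the logarithmic singularities\<close>

text \<open>Dominates logarithms at both endpoints. Since |x y| \<le> |x|, a function of
  \<open>x\<close> alone also controls ln (1 - x y).\<close>

definition edge :: "real \<Rightarrow> real" where
  "edge x = (1 - \<bar>x\<bar>) powr (-1/2)"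

lemma edge_measurable [measurable]: "edge \<in> borel_measurable borel"
  unfolding edge_def by measurable

lemma edge_nonneg: "edge x \<ge> 0"
  by (simp add: edge_def)

lemma edge_integral: "integrable unif edge" "(\<integral>x. edge x \<partial>unif) \<le> 3"
proof -
  define g where "g = (\<lambda>x::real. (1 - x) powr (-1/2))"
  have gm [measurable]: "g \<in> borel_measurable borel" unfolding g_def by measurable
  have "has_bochner_integral lborel (\<lambda>v::real. indicator {0..2} v * v powr (-1/2)) (2 powr (-1/2 + 1) / (-1/2 + 1))"
    by (rule has_bochner_integral_of_has_integral[OF _ _ _ has_integral_powr_from_0]) auto
  hence "has_bochner_integral lborel (\<lambda>v::real. 1 / 2 * (indicator {0..2} v * v powr (-1/2))) (1 / 2 * (2 powr (-1/2 + 1) / (-1/2 + 1)))"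
    by (rule has_bochner_integral_mult_right)
  hence "has_bochner_integral lborel (\<lambda>v::real. 1 / 2 * (indicator {0..2} v * v powr (-1/2))) (sqrt 2)"
    by (simp add: powr_half_sqrt)
  hence "has_bochner_integral lborel (\<lambda>x::real. 1 / 2 * (indicator {0..2} (1 + (-1) * x) * (1 + (-1) * x) powr (-1/2))) (sqrt 2 /\<^sub>R \<bar>-1\<bar>)"
    by (subst lborel_has_bochner_integral_real_affine_iff[where c = "-1" and t = 1, symmetric]) auto
  moreover have "1 / 2 * (indicator {0..2} (1 + (-1) * x) * (1 + (-1) * x) powr (-1/2)) = indicator {-1..1} x / 2 * g x" for x
    by (auto simp: indicator_def g_def)
  ultimately have "has_bochner_integral lborel (\<lambda>x::real. indicator {-1..1} x / 2 * g x) (sqrt 2)"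
    by simp
  hence g: "integrable unif g" "(\<integral>x. g x \<partial>unif) = sqrt 2"
    unfolding unif_has_bochner_integral[OF gm, symmetric] by (auto simp: has_bochner_integral_iff)
  have g': "integrable unif (\<lambda>x. g (- x))" "(\<integral>x. g (- x) \<partial>unif) = sqrt 2"
    using g unif_integral_uminus[OF gm] by auto
  have le: "edge x \<le> g x + g (- x)" for x
    by (cases "x \<ge> 0") (auto simp: edge_def g_def)
  have gg: "integrable unif (\<lambda>x. g x + g (- x))" using g g' by auto
  show i: "integrable unif edge"
    by (rule Bochner_Integration.integrable_bound[OF gg]) (use le edge_nonneg in \<open>auto simp: g_def\<close>)
  have "(\<integral>x. edge x \<partial>unif) \<le> (\<integral>x. g x + g (- x) \<partial>unif)" by (rule integral_mono[OF i gg le])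
  also have "\<dots> = 2 * sqrt 2" using g g' by simp
  also have "\<dots> \<le> 3" by (rule power2_le_imp_le) (auto simp: power_mult_distrib)
  finally show "(\<integral>x. edge x \<partial>unif) \<le> 3" .
qed

text \<open>This is ln y \<le> y / 2 at y = 1 / sqrt ((1 - |x|) M). The parameter trades the
  additive ln M against the factor 1 / sqrt M in front of \<open>edge\<close>: M = 1 serves for
  plain integrability, M = n^4 for the cross term.\<close>

lemma minus_ln_le_edge: "\<bar>x\<bar> < 1 \<Longrightarrow> M > 0 \<Longrightarrow> - ln (1 - \<bar>x\<bar>) \<le> ln M + edge x / sqrt M"
proof -
  assume x: "\<bar>x\<bar> < 1" and M: "M > 0"
  define v where "v = 1 - \<bar>x\<bar>"
  have v: "v > 0" using x by (simp add: v_def)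
  have "ln (sqrt (1 / (v * M))) \<le> sqrt (1 / (v * M)) / 2"
  proof -
    define y where "y = sqrt (1 / (v * M))"
    have y: "y > 0" using v M by (simp add: y_def)
    have "ln (y / 2) \<le> y / 2 - 1" using y by (intro ln_le_minus_one) auto
    hence "ln y \<le> y / 2 - 1 + ln 2" using y by (simp add: ln_div)
    moreover have "ln 2 \<le> (1::real)" using ln_le_minus_one[of 2] by simp
    ultimately show ?thesis by (simp add: y_def)
  qed
  moreover have "ln (sqrt (1 / (v * M))) = (- ln v - ln M) / 2"
    using v M by (simp add: ln_sqrt ln_div ln_mult_pos)
  moreover have "sqrt (1 / (v * M)) = edge x / sqrt M"
    using v M by (simp add: edge_def v_def[symmetric] powr_minus_divide powr_half_sqrt real_sqrt_divide real_sqrt_mult)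
  ultimately show ?thesis by (simp add: v_def)
qed

lemma abs_ln_one_minus_mult_le:
  fixes x y :: real
  assumes "\<bar>x\<bar> < 1" "\<bar>y\<bar> < 1"
  shows "\<bar>ln (1 - x * y)\<bar> \<le> 1 - ln (1 - \<bar>x\<bar>)"
proof -
  have "\<bar>x * y\<bar> \<le> \<bar>x\<bar> * 1" unfolding abs_mult using assms by (intro mult_left_mono) auto
  hence xy: "1 - \<bar>x\<bar> \<le> 1 - x * y" "1 - x * y \<le> 2" using assms by auto
  have "ln (1 - \<bar>x\<bar>) \<le> ln (1 - x * y)" using xy assms by (intro ln_mono) auto
  moreover have "ln (1 - x * y) \<le> ln 2" using xy assms by (intro ln_mono) auto
  moreover have "ln 2 \<le> (1::real)" using ln_le_minus_one[of 2] by simp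
  moreover have "ln (1 - \<bar>x\<bar>) \<le> 0" using assms by simp
  ultimately show ?thesis by linarith
qed

lemma integrable_edge_fst: "integrable unif2 (\<lambda>z. a + b * edge (fst z))"
proof -
  have "integrable unif2 (\<lambda>z. edge (fst z)) \<longleftrightarrow> integrable (distr unif2 unif fst) edge"
    by (subst integrable_distr_eq) auto
  also have "distr unif2 unif fst = unif" by (rule unif.distr_pair_fst)
  finally show ?thesis using edge_integral(1) by auto
qed

lemma unif2_integrable_bound:
  fixes f :: "real \<times> real \<Rightarrow> real"
  assumes "f \<in> borel_measurable (borel \<Otimes>\<^sub>M borel)"
    and "\<And>x y. \<bar>x\<bar> < 1 \<Longrightarrow> \<bar>y\<bar> < 1 \<Longrightarrow> \<bar>f (x, y)\<bar> \<le> a + b * edge x"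
  shows "integrable unif2 f"
proof (rule Bochner_Integration.integrable_bound[OF integrable_edge_fst[of a b]])
  show "AE z in unif2. norm (f z) \<le> norm (a + b * edge (fst z))"
    using unif2_AE by eventually_elim (use assms(2) in \<open>fastforce\<close>)
qed (use assms(1) in measurable)

lemma cd_measure_density:
  "cd_measure n = density unif (\<lambda>x. ennreal ((poly (cd n) x)\<^sup>2 / (real n)\<^sup>2))"
  unfolding unif_def cd_measure_def
  by (subst density_density_eq, measurable, intro density_cong, measurable)
     (auto simp: cd_dens_def indicator_def ennreal_mult[symmetric] intro!: AE_I2)

section \<open>Product measures and the mean of ln (2 - x - y)\<close>

definition cd_measure2 :: "nat \<Rightarrow> (real \<times> real) measure" where
  "cd_measure2 n = cd_measure n \<Otimes>\<^sub>M cd_measure n"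

lemma sets_cd_measure2 [measurable_cong, simp]: "sets (cd_measure2 n) = sets (borel \<Otimes>\<^sub>M borel)"
  unfolding cd_measure2_def by (intro sets_pair_measure_cong) auto

lemma cd_measure2_density:
  assumes "n > 0"
  shows "cd_measure2 n = density unif2 (\<lambda>z. ennreal ((poly (cd n) (fst z))\<^sup>2 / (real n)\<^sup>2 * ((poly (cd n) (snd z))\<^sup>2 / (real n)\<^sup>2)))"
proof -
  interpret C: prob_space "cd_measure n" by (rule prob_space_cd_measure) fact
  have "cd_measure2 n = density unif2 (\<lambda>(x, y). ennreal ((poly (cd n) x)\<^sup>2 / (real n)\<^sup>2) * ennreal ((poly (cd n) y)\<^sup>2 / (real n)\<^sup>2))"
    unfolding cd_measure2_def cd_measure_density
    by (rule pair_measure_density)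
       (use C.sigma_finite_measure_axioms in \<open>auto simp: cd_measure_density[symmetric] unif.sigma_finite_measure_axioms\<close>)
  thus ?thesis by (simp add: ennreal_mult[symmetric] case_prod_beta')
qed

lemma cd_measure2_integral:
  fixes f :: "real \<times> real \<Rightarrow> real"
  assumes "n > 0" "f \<in> borel_measurable (borel \<Otimes>\<^sub>M borel)"
  shows "(\<integral>z. f z \<partial>cd_measure2 n) = (\<integral>z. (poly (cd n) (fst z))\<^sup>2 * (poly (cd n) (snd z))\<^sup>2 / (real n) ^ 4 * f z \<partial>unif2)"
    and "integrable (cd_measure2 n) f \<longleftrightarrow> integrable unif2 (\<lambda>z. (poly (cd n) (fst z))\<^sup>2 * (poly (cd n) (snd z))\<^sup>2 / (real n) ^ 4 * f z)"
proof -
  have e: "(poly (cd n) (fst z))\<^sup>2 / (real n)\<^sup>2 * ((poly (cd n) (snd z))\<^sup>2 / (real n)\<^sup>2) = (poly (cd n) (fst z))\<^sup>2 * (poly (cd n) (snd z))\<^sup>2 / (real n) ^ 4" for z :: "real \<times> real"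
    by (simp flip: power_add)
  have fm: "f \<in> borel_measurable unif2" using assms(2) by measurable
  show "(\<integral>z. f z \<partial>cd_measure2 n) = (\<integral>z. (poly (cd n) (fst z))\<^sup>2 * (poly (cd n) (snd z))\<^sup>2 / (real n) ^ 4 * f z \<partial>unif2)"
    unfolding cd_measure2_density[OF assms(1)] e using fm by (subst integral_density) auto
  show "integrable (cd_measure2 n) f \<longleftrightarrow> integrable unif2 (\<lambda>z. (poly (cd n) (fst z))\<^sup>2 * (poly (cd n) (snd z))\<^sup>2 / (real n) ^ 4 * f z)"
    unfolding cd_measure2_density[OF assms(1)] e using fm by (subst integrable_density) auto
qed

text \<open>For fixed \<open>n\<close> the density with respect to \<open>unif2\<close> is bounded
  by n^4, so a bound by \<open>edge\<close> suffices.\<close>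

lemma cd_measure2_integrable_bound:
  fixes f :: "real \<times> real \<Rightarrow> real"
  assumes "n > 0" and fm [measurable]: "f \<in> borel_measurable (borel \<Otimes>\<^sub>M borel)"
    and b: "\<And>x y. \<bar>x\<bar> < 1 \<Longrightarrow> \<bar>y\<bar> < 1 \<Longrightarrow> \<bar>f (x, y)\<bar> \<le> a + b * edge x"
  shows "integrable (cd_measure2 n) f"
proof -
  have n: "real n > 0" using assms by simp
  show ?thesis
    unfolding cd_measure2_integral(2)[OF assms(1,2)]
  proof (rule unif2_integrable_bound)
    fix x y :: real assume xy: "\<bar>x\<bar> < 1" "\<bar>y\<bar> < 1"
    have sq: "(poly (cd n) x)\<^sup>2 \<le> (real n) ^ 4" if "\<bar>x\<bar> < 1" for x
    proof -
      have "\<bar>poly (cd n) x\<bar>\<^sup>2 \<le> ((real n)\<^sup>2)\<^sup>2" using that by (intro power_mono cd_abs_le) auto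
      thus ?thesis by (simp flip: power_mult)
    qed
    have "(poly (cd n) x)\<^sup>2 * (poly (cd n) y)\<^sup>2 / (real n) ^ 4 \<le> (real n) ^ 4 * (real n) ^ 4 / (real n) ^ 4"
      using sq[OF xy(1)] sq[OF xy(2)] by (intro divide_right_mono mult_mono) auto
    also have "\<dots> = (real n) ^ 4" by (rule nonzero_mult_div_cancel_right) (use n in simp)
    finally have le: "(poly (cd n) x)\<^sup>2 * (poly (cd n) y)\<^sup>2 / (real n) ^ 4 \<le> (real n) ^ 4" .
    have "\<bar>(poly (cd n) x)\<^sup>2 * (poly (cd n) y)\<^sup>2 / (real n) ^ 4 * f (x, y)\<bar> = (poly (cd n) x)\<^sup>2 * (poly (cd n) y)\<^sup>2 / (real n) ^ 4 * \<bar>f (x, y)\<bar>"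
      by (simp add: abs_mult)
    also have "\<dots> \<le> (real n) ^ 4 * (a + b * edge x)"
      using le b[OF xy] by (intro mult_mono) auto
    finally show "\<bar>(poly (cd n) (fst (x, y)))\<^sup>2 * (poly (cd n) (snd (x, y)))\<^sup>2 / (real n) ^ 4 * f (x, y)\<bar> \<le> (real n) ^ 4 * a + (real n) ^ 4 * b * edge x"
      by (simp add: algebra_simps)
  qed measurable
qed

lemma cd_measure2_AE: "n > 0 \<Longrightarrow> AE z in cd_measure2 n. \<bar>fst z\<bar> < 1 \<and> \<bar>snd z\<bar> < 1"
  unfolding cd_measure2_density by (subst AE_density) (use unif2_AE in \<open>auto elim: eventually_mono\<close>)

lemma prob_space_cd_measure2: "n > 0 \<Longrightarrow> prob_space (cd_measure2 n)"
  unfolding cd_measure2_def by (intro prob_space_pair prob_space_cd_measure)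

lemma cd_measure2_ln_sum_bound:
  assumes "\<bar>x\<bar> < 1" "\<bar>y\<bar> < 1"
  shows "\<bar>ln (2 - x - y)\<bar> \<le> 2 + 1 * edge x"
proof -
  have "ln (1 - \<bar>x\<bar>) \<le> ln (2 - x - y)" using assms by (intro ln_mono) auto
  moreover have "- ln (1 - \<bar>x\<bar>) \<le> ln 1 + edge x / sqrt 1" using assms by (intro minus_ln_le_edge) auto
  moreover have "ln (2 - x - y) \<le> ln 4" using assms by (intro ln_mono) auto
  moreover have "ln 4 = 2 * ln (2::real)" using ln_realpow[of 2 2] by simp
  moreover have "ln 2 \<le> (1::real)" using ln_le_minus_one[of 2] by simp
  moreover have "0 \<le> edge x" by (rule edge_nonneg)
  ultimately show ?thesis by simp
qed

text \<open>Frullani's formula for the sum of two independent copies of 2 n^2 (1 - x), whose Laplace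
  transform is the square of \<open>cd_laplace\<close>.\<close>

lemma cd_measure2_ln_sum:
  assumes "n > 0"
  shows "(\<integral>z. ln (2 * (real n)\<^sup>2 * (2 - fst z - snd z)) \<partial>cd_measure2 n) =
    (\<integral>v. indicator {0<..} v * ((exp (- v) - (cd_laplace n v)\<^sup>2) / v) \<partial>lborel)"
proof -
  interpret C: prob_space "cd_measure n" by (rule prob_space_cd_measure) fact
  interpret CC: pair_prob_space "cd_measure n" "cd_measure n" ..
  interpret C2: prob_space "cd_measure2 n" by (rule prob_space_cd_measure2) fact
  have n: "(real n)\<^sup>2 > 0" using assms by simp
  define c where "c = (\<lambda>z :: real \<times> real. 2 * (real n)\<^sup>2 * (2 - fst z - snd z))"
  have cm [measurable]: "c \<in> borel_measurable (cd_measure2 n)" unfolding c_def by measurable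
  have cpos: "AE z in cd_measure2 n. c z > 0"
    using cd_measure2_AE[OF assms] by eventually_elim (use n in \<open>auto simp: c_def\<close>)
  have i: "integrable (cd_measure2 n) (\<lambda>z. ln (2 * (real n)\<^sup>2) + ln (2 - fst z - snd z))"
    by (intro Bochner_Integration.integrable_add C2.integrable_const cd_measure2_integrable_bound[OF assms, where a = 2 and b = 1])
       (use cd_measure2_ln_sum_bound in auto)
  have ci: "integrable (cd_measure2 n) (\<lambda>z. ln (c z))"
  proof (subst integrable_cong_AE)
    show "AE z in cd_measure2 n. ln (c z) = ln (2 * (real n)\<^sup>2) + ln (2 - fst z - snd z)"
      using cd_measure2_AE[OF assms] by eventually_elim (use n in \<open>auto simp: c_def ln_mult_pos\<close>)
  qed (use i in auto)
  have "(\<integral>z. exp (- (c z * v)) \<partial>cd_measure2 n) = (cd_laplace n v)\<^sup>2" if "v > 0" for v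
  proof -
    have AEC: "AE z in cd_measure n \<Otimes>\<^sub>M cd_measure n. \<bar>fst z\<bar> < 1 \<and> \<bar>snd z\<bar> < 1"
      using cd_measure2_AE[OF assms] unfolding cd_measure2_def .
    have ii: "integrable (cd_measure n \<Otimes>\<^sub>M cd_measure n) (\<lambda>(x, y). exp (- (v * (2 * (real n)\<^sup>2 * (1 - x)))) * exp (- (v * (2 * (real n)\<^sup>2 * (1 - y)))))"
    proof (rule CC.P.integrable_const_bound[where B = 1])
      show "AE z in cd_measure n \<Otimes>\<^sub>M cd_measure n. norm (case z of (x, y) \<Rightarrow> exp (- (v * (2 * (real n)\<^sup>2 * (1 - x)))) * exp (- (v * (2 * (real n)\<^sup>2 * (1 - y))))) \<le> 1"
        using AEC by eventually_elim (use that in \<open>auto intro!: mult_le_one\<close>)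
    qed measurable
    have "(\<integral>z. exp (- (c z * v)) \<partial>cd_measure2 n) = (\<integral>(x, y). exp (- (v * (2 * (real n)\<^sup>2 * (1 - x)))) * exp (- (v * (2 * (real n)\<^sup>2 * (1 - y)))) \<partial>(cd_measure n \<Otimes>\<^sub>M cd_measure n))"
      unfolding cd_measure2_def
      by (intro Bochner_Integration.integral_cong refl) (auto simp: c_def algebra_simps simp flip: exp_add)
    also have "\<dots> = (\<integral>x. (\<integral>y. exp (- (v * (2 * (real n)\<^sup>2 * (1 - x)))) * exp (- (v * (2 * (real n)\<^sup>2 * (1 - y)))) \<partial>cd_measure n) \<partial>cd_measure n)"
      by (rule CC.integral_fst[symmetric]) (rule ii)
    also have "\<dots> = (cd_laplace n v)\<^sup>2" by (simp add: cd_laplace_def power2_eq_square)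
    finally show ?thesis .
  qed
  hence "indicator {0<..} v * ((exp (- v) - (\<integral>z. exp (- (c z * v)) \<partial>cd_measure2 n)) / v) = indicator {0<..} v * ((exp (- v) - (cd_laplace n v)\<^sup>2) / v)" for v
    by (cases "v > 0") auto
  thus ?thesis
    using frullani_expectation(2)[OF C2.prob_space_axioms cm cpos ci] by (simp only: c_def)
qed

lemma cd_laplace_measurable [measurable]: "cd_laplace n \<in> borel_measurable borel"
proof -
  have "(\<lambda>u. \<integral>x. cd_dens n x * exp (- (u * (2 * (real n)\<^sup>2 * (1 - x)))) \<partial>lborel) \<in> borel_measurable borel"
    by (rule lborel.borel_measurable_lebesgue_integral) measurable
  thus ?thesis by (simp add: cd_laplace_def[abs_def] cd_measure_integral)
qed

text \<open>Dominated convergence in the Frullani integral. Near 0 the majorant comes from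
  \<open>one_minus_cd_laplace_le\<close>, which leaves v^(-3/4) after division by v; beyond 1 it
  comes from \<open>cd_laplace_le_inverse\<close>.\<close>

lemma cd_measure2_ln_sum_tendsto:
  "(\<lambda>k. \<integral>z. ln (2 * (real (Suc k))\<^sup>2 * (2 - fst z - snd z)) \<partial>cd_measure2 (Suc k)) \<longlonglongrightarrow>
    2 * (1 + 2 * catalan_const) / pi + 1 / 2 - 2 * euler_mascheroni + 2 * ln 2"
proof -
  define w :: "real \<Rightarrow> real" where "w = (\<lambda>v. indicator {0..1} v * 1 + 18 * (indicator {0..1} v * v powr (-3/4)) + indicator {0..} v * (v ^ 0 * exp (- (1 * v))) + indicator {1..} v * v powr (-2))"
  have w1: "integrable lborel (\<lambda>v::real. indicator {0..1} v * v powr (-3/4))"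
    by (rule integrable.intros, rule has_bochner_integral_of_has_integral[OF _ _ _ has_integral_powr_from_0]) auto
  have w2: "integrable lborel (\<lambda>v::real. indicator {1..} v * v powr (-2))"
    by (rule integrable.intros, rule has_bochner_integral_of_has_integral[OF _ _ _ has_integral_powr_to_inf]) auto
  have w3: "integrable lborel (\<lambda>v::real. indicator {0..} v * (v ^ 0 * exp (- (1 * v))))"
    by (rule integrable.intros, rule has_bochner_integral_power_exp) auto
  have w: "integrable lborel w"
    unfolding w_def using w1 w2 w3 by (intro Bochner_Integration.integrable_add integrable_mult_right) auto
  have bound: "norm (indicator {0<..} v * ((exp (- v) - (cd_laplace (Suc k) v)\<^sup>2) / v)) \<le> w v" for k and v :: real
  proof -
    define p where "p = cd_laplace (Suc k) v"
    consider "v \<le> 0" | "0 < v" "v < 1" | "1 \<le> v" by linarith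
    thus ?thesis
    proof cases
      case 1
      thus ?thesis by (auto simp: w_def indicator_def)
    next
      case 2
      have p: "0 \<le> p" "p \<le> 1" "1 - p \<le> 9 * sqrt (sqrt v)"
        unfolding p_def using cd_laplace_nonneg cd_laplace_le_1[of "Suc k" v] one_minus_cd_laplace_le[of "Suc k" v] 2 by auto
      have ev: "1 - exp (- v) \<le> v" using exp_ge_add_one_self[of "- v"] by simp
      have p1: "1 - p\<^sup>2 \<le> 2 * (1 - p)"
        using zero_le_power2[of "1 - p"] by (simp add: power2_eq_square algebra_simps)
      have p2: "p\<^sup>2 \<le> 1" using p by (simp add: power_le_one)
      have e1: "exp (- v) \<le> 1" using 2 by simp
      have s0: "0 \<le> sqrt (sqrt v)" using 2 by simp
      have "\<bar>exp (- v) - p\<^sup>2\<bar> \<le> v + 18 * sqrt (sqrt v)"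
      proof (rule abs_leI)
        have "exp (- v) - p\<^sup>2 \<le> 1 - p\<^sup>2" using e1 by simp
        also note p1
        also have "2 * (1 - p) \<le> 2 * (9 * sqrt (sqrt v))" using p(3) by (intro mult_left_mono) auto
        also have "\<dots> \<le> v + 18 * sqrt (sqrt v)" using 2 by simp
        finally show "exp (- v) - p\<^sup>2 \<le> v + 18 * sqrt (sqrt v)" .
        show "- (exp (- v) - p\<^sup>2) \<le> v + 18 * sqrt (sqrt v)" using ev p2 s0 by linarith
      qed
      hence "\<bar>exp (- v) - p\<^sup>2\<bar> / v \<le> (v + 18 * sqrt (sqrt v)) / v" using 2 by (intro divide_right_mono) auto
      also have "\<dots> = 1 + 18 * v powr (-3/4)"
      proof -
        have "sqrt (sqrt v) = v powr (1/4)" using 2 by (simp add: powr_half_sqrt[symmetric] powr_powr)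
        also have "\<dots> / v = v powr (1/4 - 1)" using 2 by (subst powr_diff) simp
        also have "1/4 - 1 = (-3/4 :: real)" by simp
        finally show ?thesis using 2 by (simp add: add_divide_distrib)
      qed
      also have "\<dots> \<le> w v" using 2 by (simp add: w_def)
      finally show ?thesis using 2 by (simp add: p_def abs_divide)
    next
      case 3
      have p: "0 \<le> p" "p \<le> 1 / (4 * v)"
        unfolding p_def using cd_laplace_nonneg cd_laplace_le_inverse[of "Suc k" v] 3 by auto
      have "p\<^sup>2 \<le> (1 / (4 * v))\<^sup>2" using p by (intro power_mono) auto
      also have "\<dots> \<le> (1 / v)\<^sup>2" using 3 by (intro power_mono divide_left_mono) auto
      also have "\<dots> = v powr (-2)" using 3 by (simp add: powr_minus_divide power_divide)
      finally have "\<bar>exp (- v) - p\<^sup>2\<bar> \<le> exp (- v) + v powr (-2)"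
        using exp_ge_zero[of "- v"] zero_le_power2[of p] by linarith
      hence "\<bar>exp (- v) - p\<^sup>2\<bar> / v \<le> (exp (- v) + v powr (-2)) / 1" using 3 by (intro frac_le) auto
      also have "\<dots> \<le> w v" using 3 by (auto simp: w_def indicator_def)
      finally show ?thesis using 3 by (simp add: p_def abs_divide)
    qed
  qed
  have lm: "laplace_limit \<in> borel_measurable borel"
  proof -
    have "(\<lambda>u. \<integral>s. indicator {0..} s * (exp (- (u * s)) * ((cd_limit s)\<^sup>2 / 4)) \<partial>lborel) \<in> borel_measurable borel"
      by (rule lborel.borel_measurable_lebesgue_integral) measurable
    thus ?thesis by (simp add: laplace_limit_def[abs_def])
  qed
  have "(\<lambda>k. \<integral>v. indicator {0<..} v * ((exp (- v) - (cd_laplace (Suc k) v)\<^sup>2) / v) \<partial>lborel) \<longlonglongrightarrow>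
      (\<integral>v. indicator {0<..} v * ((exp (- v) - (laplace_limit v)\<^sup>2) / v) \<partial>lborel)"
  proof (rule integral_dominated_convergence[where w = w])
    show "AE v in lborel. (\<lambda>k. indicator {0<..} v * ((exp (- v) - (cd_laplace (Suc k) v)\<^sup>2) / v)) \<longlonglongrightarrow> indicator {0<..} v * ((exp (- v) - (laplace_limit v)\<^sup>2) / v)"
    proof (intro AE_I2)
      fix v :: real
      show "(\<lambda>k. indicator {0<..} v * ((exp (- v) - (cd_laplace (Suc k) v)\<^sup>2) / v)) \<longlonglongrightarrow> indicator {0<..} v * ((exp (- v) - (laplace_limit v)\<^sup>2) / v)"
      proof (cases "v > 0")
        case True
        thus ?thesis by (intro tendsto_intros cd_laplace_tendsto) auto
      qed auto
    qed
  qed (use w bound lm in auto)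
  thus ?thesis by (simp only: cd_measure2_ln_sum zero_less_Suc laplace_limit_square_integral_value)
qed

section \<open>Replacing ln (1 - x y) by ln (2 - x - y)\<close>

lemma cd_measure_integral_unif:
  fixes f :: "real \<Rightarrow> real"
  assumes "f \<in> borel_measurable borel"
  shows "(\<integral>x. f x \<partial>cd_measure n) = (\<integral>x. (poly (cd n) x)\<^sup>2 / (real n)\<^sup>2 * f x \<partial>unif)"
    "integrable (cd_measure n) f \<longleftrightarrow> integrable unif (\<lambda>x. (poly (cd n) x)\<^sup>2 / (real n)\<^sup>2 * f x)"
proof -
  have fm: "f \<in> borel_measurable unif" using assms by measurable
  show "(\<integral>x. f x \<partial>cd_measure n) = (\<integral>x. (poly (cd n) x)\<^sup>2 / (real n)\<^sup>2 * f x \<partial>unif)"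
    unfolding cd_measure_density using fm by (subst integral_density) auto
  show "integrable (cd_measure n) f \<longleftrightarrow> integrable unif (\<lambda>x. (poly (cd n) x)\<^sup>2 / (real n)\<^sup>2 * f x)"
    unfolding cd_measure_density using fm by (subst integrable_density) auto
qed

lemma cd_measure_nonpos_le:
  assumes "n > 0"
  shows "(\<integral>x. indicator {..0} x \<partial>cd_measure n) \<le> 4 / real n"
proof -
  have "(\<integral>x. indicat_real {..0} x \<partial>cd_measure n) \<le> (\<integral>x. 1 - x \<partial>cd_measure n)"
  proof (rule integral_mono_AE)
    show "AE x in cd_measure n. indicat_real {..0} x \<le> 1 - x"
      using cd_measure_AE[of n] by eventually_elim (auto simp: indicator_def)
    show "integrable (cd_measure n) (indicat_real {..0})"
      by (rule cd_measure_integrable[OF assms, where B = 1]) (auto simp: indicator_def)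
    show "integrable (cd_measure n) (\<lambda>x. 1 - x)"
      by (rule cd_measure_integrable[OF assms, where B = 2]) auto
  qed
  also have "\<dots> \<le> 4 / real n" by (rule cd_measure_expectation_one_minus) fact
  finally show ?thesis .
qed

lemma cd_square_le_4:
  assumes "n > 0" "-1 < x" "x \<le> 0"
  shows "(poly (cd n) x)\<^sup>2 / (real n)\<^sup>2 \<le> 4"
proof -
  have "\<bar>poly (cd n) x\<bar>\<^sup>2 \<le> (2 * real n)\<^sup>2"
    using assms by (intro power_mono cd_abs_le_neg) auto
  thus ?thesis using assms(1) by (simp add: power_mult_distrib field_simps)
qed

text \<open>On the negative half the density with respect to \<open>unif\<close> is at most 4, by
  \<open>cd_abs_le_neg\<close>, so the singularity at -1 is integrable uniformly in
  \<open>n\<close>; the bound is 4 times that of \<open>edge_integral\<close>.\<close>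

lemma cd_measure_edge_neg:
  assumes "n > 0"
  shows "integrable (cd_measure n) (\<lambda>x. indicator {..0} x * edge x)"
    "(\<integral>x. indicator {..0} x * edge x \<partial>cd_measure n) \<le> 12"
proof -
  have le: "AE x in unif. (poly (cd n) x)\<^sup>2 / (real n)\<^sup>2 * (indicator {..0} x * edge x) \<le> 4 * edge x"
    using unif_AE
  proof eventually_elim
    case (elim x)
    show ?case
    proof (cases "x \<le> 0")
      case True
      have "(poly (cd n) x)\<^sup>2 / (real n)\<^sup>2 * edge x \<le> 4 * edge x"
        using cd_square_le_4[OF assms, of x] edge_nonneg[of x] elim True by (intro mult_right_mono) auto
      thus ?thesis using True by simp
    qed (simp add: edge_nonneg)
  qed
  have i: "integrable unif (\<lambda>x. (poly (cd n) x)\<^sup>2 / (real n)\<^sup>2 * (indicator {..0} x * edge x))"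
  proof (rule Bochner_Integration.integrable_bound)
    show "integrable unif (\<lambda>x. 4 * edge x)" using edge_integral(1) by simp
    show "AE x in unif. norm ((poly (cd n) x)\<^sup>2 / (real n)\<^sup>2 * (indicator {..0} x * edge x)) \<le> norm (4 * edge x)"
      using le by eventually_elim (use edge_nonneg in \<open>auto simp: abs_mult\<close>)
  qed measurable
  show "integrable (cd_measure n) (\<lambda>x. indicator {..0} x * edge x)"
    using i by (subst cd_measure_integral_unif(2)) auto
  have "(\<integral>x. indicator {..0} x * edge x \<partial>cd_measure n) = (\<integral>x. (poly (cd n) x)\<^sup>2 / (real n)\<^sup>2 * (indicator {..0} x * edge x) \<partial>unif)"
    by (rule cd_measure_integral_unif(1)) measurable
  also have "\<dots> \<le> (\<integral>x. 4 * edge x \<partial>unif)"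
    by (rule integral_mono_AE[OF i _ le]) (use edge_integral(1) in simp)
  also have "\<dots> \<le> 12" using edge_integral(2) by simp
  finally show "(\<integral>x. indicator {..0} x * edge x \<partial>cd_measure n) \<le> 12" .
qed

lemma minus_ln_one_minus_le:
  fixes z :: real
  assumes "0 \<le> z" "z \<le> 1 / 2"
  shows "- ln (1 - z) \<le> 2 * z"
proof -
  have "- ln (1 - z) = ln (1 / (1 - z))" using assms by (simp add: ln_div)
  also have "\<dots> \<le> 1 / (1 - z) - 1" using assms by (intro ln_le_minus_one) auto
  also have "\<dots> = z / (1 - z)" using assms by (simp add: field_simps)
  also have "\<dots> \<le> z / (1 / 2)" using assms by (intro divide_left_mono) auto
  finally show ?thesis by simp
qed

text \<open>With p = 1 - x and q = 1 - y one has 1 - x y = (p + q) (1 - p q / (p + q)), and for x, y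
  \<ge> 0 the correction is of order p + q, small in mean. If x or y is negative, then 2 - x - y
  \<ge> 1 and crude bounds suffice, except that ln (1 - x y) can be very negative when both are;
  \<open>edge\<close> covers that corner.\<close>

lemma abs_ln_ratio_le:
  assumes "\<bar>x\<bar> < 1" "\<bar>y\<bar> < 1"
  shows "\<bar>ln (1 - x * y) - ln (2 - x - y)\<bar> \<le> 3 * (2 - x - y) + indicator {..0} y * (indicator {..0} x * edge x)"
proof -
  have xy1: "\<bar>x * y\<bar> < 1" using mult_strict_mono'[of "\<bar>x\<bar>" 1 "\<bar>y\<bar>" 1] assms by (simp add: abs_mult)
  have "ln 2 \<le> (1::real)" using ln_le_minus_one[of 2] by simp
  moreover have "ln 4 = 2 * ln (2::real)" using ln_realpow[of 2 2] by simp
  ultimately have l2: "ln 2 \<le> (1::real)" and l4: "ln 4 \<le> (2::real)" by auto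
  define t where "t = indicator {..0} y * (indicator {..0} x * edge x)"
  have nn: "0 \<le> t" using edge_nonneg[of x] by (simp add: t_def)
  show ?thesis
  proof (cases "x \<ge> 0 \<and> y \<ge> 0")
    case True
    define p q where "p = 1 - x" and "q = 1 - y"
    have pq: "0 < p" "p \<le> 1" "0 < q" "q \<le> 1" using assms True by (auto simp: p_def q_def)
    define z where "z = p * q / (p + q)"
    have z0: "0 \<le> z" using pq by (simp add: z_def)
    \<comment> \<open>The inequality of arithmetic and geometric means bounds z by (p + q) / 4,
      which is at most 1 / 2 as p and q are at most 1.\<close>
    have "4 * (p * q) \<le> (p + q) * (p + q)" using zero_le_power2[of "p - q"] by (simp add: power2_eq_square algebra_simps)
    hence "z \<le> (p + q) / 4" using pq by (simp add: z_def divide_simps mult_ac)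
    moreover have "(p + q) / 4 \<le> 1 / 2" using pq by simp
    ultimately have z: "z \<le> (p + q) / 4" "z \<le> 1 / 2" by auto
    have "1 - x * y = (p + q) * (1 - z)" using pq by (simp add: z_def p_def q_def field_simps)
    moreover have "2 - x - y = p + q" by (simp add: p_def q_def)
    ultimately have "ln (1 - x * y) - ln (2 - x - y) = ln (1 - z)" using pq z by (simp add: ln_mult_pos)
    moreover have "ln (1 - z) \<le> 0" using z z0 by simp
    moreover have "- ln (1 - z) \<le> 2 * z" by (rule minus_ln_one_minus_le) (use z z0 in auto)
    ultimately have "\<bar>ln (1 - x * y) - ln (2 - x - y)\<bar> \<le> 2 * z" by linarith
    also have "\<dots> \<le> 3 * (2 - x - y)" using z pq \<open>2 - x - y = p + q\<close> by simp
    finally show ?thesis unfolding t_def[symmetric] using nn by linarith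
  next
    case False
    hence s1: "1 \<le> 2 - x - y" using assms by auto
    have "ln (2 - x - y) \<le> ln 4" using assms s1 by (intro ln_mono) auto
    hence a2: "ln (2 - x - y) \<le> 2" using l4 by linarith
    have a1: "0 \<le> ln (2 - x - y)" using s1 by simp
    have b1: "ln (1 - x * y) \<le> ln 2" using xy1 by (intro ln_mono) auto
    have b2: "- ln (1 - x * y) \<le> t"
    proof (cases "x * y \<le> 0")
      case True
      hence "0 \<le> ln (1 - x * y)" by simp
      thus ?thesis using nn by linarith
    next
      case xy: False
      hence neg: "x < 0" "y < 0" using False by (auto simp: mult_le_0_iff not_le)
      have "\<bar>x * y\<bar> \<le> \<bar>x\<bar> * 1" unfolding abs_mult using assms by (intro mult_left_mono) auto
      hence "ln (1 - \<bar>x\<bar>) \<le> ln (1 - x * y)" using assms by (intro ln_mono) auto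
      moreover have "- ln (1 - \<bar>x\<bar>) \<le> ln 1 + edge x / sqrt 1" using assms by (intro minus_ln_le_edge) auto
      ultimately show ?thesis using neg by (simp add: t_def)
    qed
    have lin: "\<bar>u - v\<bar> \<le> 3 * s + r" if "0 \<le> v" "v \<le> 2" "u \<le> 1" "- u \<le> r" "1 \<le> s" "0 \<le> r" for u v r s :: real
      using that by linarith
    show ?thesis
      unfolding t_def[symmetric] by (rule lin[OF a1 a2 order.trans[OF b1 l2] b2 s1 nn])
  qed
qed

lemma cd_measure2_ln:
  assumes "n > 0"
  shows "\<bar>(\<integral>z. ln (1 - fst z * snd z) \<partial>cd_measure2 n) -
     (- ln (2 * (real n)\<^sup>2) + (\<integral>z. ln (2 * (real n)\<^sup>2 * (2 - fst z - snd z)) \<partial>cd_measure2 n))\<bar> \<le> 72 / real n"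
proof -
  interpret C: prob_space "cd_measure n" by (rule prob_space_cd_measure) fact
  interpret CC: pair_prob_space "cd_measure n" "cd_measure n" ..
  interpret C2: prob_space "cd_measure2 n" by (rule prob_space_cd_measure2) fact
  have n: "(real n)\<^sup>2 > 0" using assms by simp
  have i1: "integrable (cd_measure2 n) (\<lambda>z. ln (1 - fst z * snd z))"
  proof (rule cd_measure2_integrable_bound[OF assms, where a = 1 and b = 1])
    fix x y :: real assume xy: "\<bar>x\<bar> < 1" "\<bar>y\<bar> < 1"
    show "\<bar>ln (1 - fst (x, y) * snd (x, y))\<bar> \<le> 1 + 1 * edge x"
      using abs_ln_one_minus_mult_le[OF xy] minus_ln_le_edge[OF xy(1), of 1] by simp
  qed measurable
  have i2: "integrable (cd_measure2 n) (\<lambda>z. ln (2 - fst z - snd z))"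
    by (rule cd_measure2_integrable_bound[OF assms, where a = 2 and b = 1]) (use cd_measure2_ln_sum_bound in auto)
  have "(\<integral>z. ln (2 * (real n)\<^sup>2 * (2 - fst z - snd z)) \<partial>cd_measure2 n) = (\<integral>z. ln (2 * (real n)\<^sup>2) + ln (2 - fst z - snd z) \<partial>cd_measure2 n)"
  proof (rule integral_cong_AE)
    show "AE z in cd_measure2 n. ln (2 * (real n)\<^sup>2 * (2 - fst z - snd z)) = ln (2 * (real n)\<^sup>2) + ln (2 - fst z - snd z)"
      using cd_measure2_AE[OF assms] by eventually_elim (use n in \<open>auto simp: ln_mult_pos\<close>)
  qed measurable
  also have "\<dots> = ln (2 * (real n)\<^sup>2) + (\<integral>z. ln (2 - fst z - snd z) \<partial>cd_measure2 n)"
    using i2 C2.prob_space by (subst Bochner_Integration.integral_add) auto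
  finally have e: "(\<integral>z. ln (1 - fst z * snd z) \<partial>cd_measure2 n) -
     (- ln (2 * (real n)\<^sup>2) + (\<integral>z. ln (2 * (real n)\<^sup>2 * (2 - fst z - snd z)) \<partial>cd_measure2 n)) =
     (\<integral>z. ln (1 - fst z * snd z) - ln (2 - fst z - snd z) \<partial>cd_measure2 n)"
    using i1 i2 by simp
  define h where "h = (\<lambda>x y. 3 * (2 - x - y) + indicator {..0} y * (indicator {..0} x * edge x))"
  have hi: "integrable (cd_measure2 n) (\<lambda>z. h (fst z) (snd z))"
  proof (rule cd_measure2_integrable_bound[OF assms, where a = 12 and b = 1])
    fix x y :: real assume "\<bar>x\<bar> < 1" "\<bar>y\<bar> < 1"
    hence "0 \<le> 2 - x - y" "2 - x - y \<le> 4" by auto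
    moreover define t where "t = indicator {..0} y * (indicator {..0} x * edge x)"
    moreover have "0 \<le> t" "t \<le> edge x"
      using edge_nonneg[of x] by (auto simp: t_def indicator_def)
    ultimately have "\<bar>3 * (2 - x - y) + t\<bar> \<le> 12 + 1 * edge x"
      by (intro abs_leI) simp_all
    thus "\<bar>h (fst (x, y)) (snd (x, y))\<bar> \<le> 12 + 1 * edge x"
      unfolding h_def fst_conv snd_conv t_def .
  qed (simp add: h_def)
  have "\<bar>\<integral>z. ln (1 - fst z * snd z) - ln (2 - fst z - snd z) \<partial>cd_measure2 n\<bar> \<le> (\<integral>z. h (fst z) (snd z) \<partial>cd_measure2 n)"
  proof (rule order.trans[OF integral_abs_bound])
    show "(\<integral>z. \<bar>ln (1 - fst z * snd z) - ln (2 - fst z - snd z)\<bar> \<partial>cd_measure2 n) \<le> (\<integral>z. h (fst z) (snd z) \<partial>cd_measure2 n)"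
    proof (rule integral_mono_AE)
      show "AE z in cd_measure2 n. \<bar>ln (1 - fst z * snd z) - ln (2 - fst z - snd z)\<bar> \<le> h (fst z) (snd z)"
        using cd_measure2_AE[OF assms] by eventually_elim (simp only: h_def abs_ln_ratio_le)
    qed (use i1 i2 hi in auto)
  qed
  also have "\<dots> = (\<integral>x. (\<integral>y. h x y \<partial>cd_measure n) \<partial>cd_measure n)"
    using CC.integral_fst[of h] hi by (simp add: cd_measure2_def case_prod_beta')
  also have "\<dots> \<le> 72 / real n"
  proof -
    define P where "P = (\<integral>x. indicat_real {..0} x \<partial>cd_measure n)"
    define m where "m = (\<integral>x. 1 - x \<partial>cd_measure n)"
    have im: "integrable (cd_measure n) (\<lambda>x. 1 - x)"
      by (rule cd_measure_integrable[OF assms, where B = 2]) auto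
    have iP: "integrable (cd_measure n) (indicat_real {..0})"
      by (rule cd_measure_integrable[OF assms, where B = 1]) (auto simp: indicator_def)
    note ie = cd_measure_edge_neg[OF assms]
    have "(\<integral>y. h x y \<partial>cd_measure n) = 3 * (1 - x) + 3 * m + P * (indicator {..0} x * edge x)" for x
    proof -
      have "(\<integral>y. h x y \<partial>cd_measure n) = (\<integral>y. 3 * (1 - x) + 3 * (1 - y) + indicator {..0} y * (indicator {..0} x * edge x) \<partial>cd_measure n)"
        by (intro Bochner_Integration.integral_cong) (auto simp: h_def)
      also have "\<dots> = 3 * (1 - x) + 3 * m + P * (indicator {..0} x * edge x)"
      proof (rule has_bochner_integral_integral_eq, intro has_bochner_integral_add)
        show "has_bochner_integral (cd_measure n) (\<lambda>y. 3 * (1 - x)) (3 * (1 - x))"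
          using C.prob_space by (simp add: has_bochner_integral_iff)
        show "has_bochner_integral (cd_measure n) (\<lambda>y. 3 * (1 - y)) (3 * m)"
          unfolding m_def by (intro has_bochner_integral_mult_right has_bochner_integral_integrable im)
        show "has_bochner_integral (cd_measure n) (\<lambda>y. indicator {..0} y * (indicator {..0} x * edge x)) (P * (indicator {..0} x * edge x))"
          unfolding P_def by (intro has_bochner_integral_mult_left has_bochner_integral_integrable iP)
      qed
      finally show ?thesis .
    qed
    hence "(\<integral>x. (\<integral>y. h x y \<partial>cd_measure n) \<partial>cd_measure n) = (\<integral>x. 3 * (1 - x) + 3 * m + P * (indicator {..0} x * edge x) \<partial>cd_measure n)"
      by simp
    also have "\<dots> = 3 * m + 3 * m + P * (\<integral>x. indicator {..0} x * edge x \<partial>cd_measure n)"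
    proof (rule has_bochner_integral_integral_eq, intro has_bochner_integral_add)
      show "has_bochner_integral (cd_measure n) (\<lambda>x. 3 * (1 - x)) (3 * m)"
        unfolding m_def by (intro has_bochner_integral_mult_right has_bochner_integral_integrable im)
      show "has_bochner_integral (cd_measure n) (\<lambda>x. 3 * m) (3 * m)"
        using C.prob_space by (simp add: has_bochner_integral_iff)
      show "has_bochner_integral (cd_measure n) (\<lambda>x. P * (indicator {..0} x * edge x)) (P * (\<integral>x. indicator {..0} x * edge x \<partial>cd_measure n))"
        by (intro has_bochner_integral_mult_right has_bochner_integral_integrable ie(1))
    qed
    \<comment> \<open>Each mean of 1 - x contributes 12 / n. The corner term factorises into the
      probability of y \<le> 0, at most 4 / n, and the mean of \<open>edge\<close> over x \<le> 0,
      at most 12.\<close>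
    also have "\<dots> \<le> 3 * (4 / real n) + 3 * (4 / real n) + (4 / real n) * 12"
      using cd_measure_expectation_one_minus[OF assms] cd_measure_nonpos_le[OF assms] ie(2)
      unfolding m_def P_def
      by (intro add_mono mult_mono)
        (auto intro!: Bochner_Integration.integral_nonneg integral_nonneg_AE eventually_mono[OF cd_measure_AE] simp: edge_nonneg)
    finally show ?thesis by simp
  qed
  finally show ?thesis unfolding e .
qed

section \<open>The square of the kernel: main part, cross term and asymptotics\<close>

definition harm_kernel :: "nat \<Rightarrow> real \<Rightarrow> real \<Rightarrow> real" where
  "harm_kernel n x y = (poly (cd n) x * poly (cd n) y + poly (cd n) (-x) * poly (cd n) (-y)) / 2"

text \<open>The mixed product in the square of \<open>harm_kernel\<close> is one half of such a
  function of x times the same function of y.\<close>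

definition cd_cross :: "nat \<Rightarrow> real \<Rightarrow> real" where
  "cd_cross n x = poly (cd n) x * poly (cd n) (- x)"

lemma cd_cross_measurable [measurable]: "cd_cross n \<in> borel_measurable borel"
  unfolding cd_cross_def by measurable

lemma integrable_times_ln:
  fixes f :: "real \<times> real \<Rightarrow> real"
  assumes fm [measurable]: "f \<in> borel_measurable (borel \<Otimes>\<^sub>M borel)" and b: "\<And>x y. \<bar>x\<bar> < 1 \<Longrightarrow> \<bar>y\<bar> < 1 \<Longrightarrow> \<bar>f (x, y)\<bar> \<le> B"
  shows "integrable unif2 (\<lambda>z. f z * ln (1 - fst z * snd z))"
proof (rule unif2_integrable_bound)
  fix x y :: real assume xy: "\<bar>x\<bar> < 1" "\<bar>y\<bar> < 1"
  have "\<bar>ln (1 - x * y)\<bar> \<le> 1 + edge x"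
    using abs_ln_one_minus_mult_le[OF xy] minus_ln_le_edge[OF xy(1), of 1] by simp
  hence "\<bar>f (x, y)\<bar> * \<bar>ln (1 - x * y)\<bar> \<le> B * (1 + edge x)"
    using b[OF xy] by (intro mult_mono) auto
  thus "\<bar>f (x, y) * ln (1 - fst (x, y) * snd (x, y))\<bar> \<le> B + B * edge x"
    by (simp add: abs_mult algebra_simps)
qed measurable

lemma cd_cross_abs_le:
  assumes "\<bar>x\<bar> < 1"
  shows "\<bar>cd_cross n x\<bar> \<le> (real n)\<^sup>2 * (2 * real n)"
proof (cases "x \<le> 0")
  case True
  have "\<bar>poly (cd n) x\<bar> * \<bar>poly (cd n) (- x)\<bar> \<le> (2 * real n) * (real n)\<^sup>2"
    using assms True by (intro mult_mono cd_abs_le cd_abs_le_neg) auto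
  thus ?thesis by (simp add: cd_cross_def abs_mult mult_ac)
next
  case False
  have "\<bar>poly (cd n) x\<bar> * \<bar>poly (cd n) (- x)\<bar> \<le> (real n)\<^sup>2 * (2 * real n)"
    using assms False by (intro mult_mono cd_abs_le cd_abs_le_neg) auto
  thus ?thesis by (simp add: cd_cross_def abs_mult)
qed

text \<open>One of x and - x is nonpositive, and there the squared kernel has integral at most 4 n
  instead of n^2. Young's inequality with weight sqrt n balances the two and reaches the order n
  sqrt n of the Cauchy-Schwarz bound.\<close>

lemma cd_cross_integral:
  assumes "n > 0"
  shows "integrable unif (\<lambda>x. \<bar>cd_cross n x\<bar>)" "(\<integral>x. \<bar>cd_cross n x\<bar> \<partial>unif) \<le> 5 * (real n * sqrt (real n))"
proof -
  define r where "r = sqrt (real n)"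
  have r: "r > 0" "r * r = real n" using assms by (auto simp: r_def)
  define g where "g = (\<lambda>x. (poly (cd n) x)\<^sup>2)"
  define g0 where "g0 = (\<lambda>x. indicator {..0} x * (poly (cd n) x)\<^sup>2)"
  have gm [measurable]: "g \<in> borel_measurable borel" "g0 \<in> borel_measurable borel"
    unfolding g_def g0_def by measurable
  interpret C: prob_space "cd_measure n" by (rule prob_space_cd_measure) fact
  have n: "(real n)\<^sup>2 > 0" using assms by simp
  have conv: "g x = (real n)\<^sup>2 * ((poly (cd n) x)\<^sup>2 / (real n)\<^sup>2 * 1)"
    "g0 x = (real n)\<^sup>2 * ((poly (cd n) x)\<^sup>2 / (real n)\<^sup>2 * indicator {..0} x)" for x
    using n by (auto simp: g_def g0_def)
  have "integrable unif (\<lambda>x. (poly (cd n) x)\<^sup>2 / (real n)\<^sup>2 * 1)"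
    by (subst cd_measure_integral_unif(2)[symmetric]) auto
  hence "integrable unif (\<lambda>x. (real n)\<^sup>2 * ((poly (cd n) x)\<^sup>2 / (real n)\<^sup>2 * 1))"
    by (rule integrable_mult_right)
  hence gi: "integrable unif g" by (simp only: conv(1)[symmetric])
  have "(\<integral>x. (1::real) \<partial>cd_measure n) = 1" using C.prob_space by simp
  moreover have "(\<integral>x. g x \<partial>unif) = (real n)\<^sup>2 * (\<integral>x. (1::real) \<partial>cd_measure n)"
    unfolding conv(1) by (subst cd_measure_integral_unif(1)) (simp, rule integral_mult_right_zero)
  ultimately have gv: "(\<integral>x. g x \<partial>unif) = (real n)\<^sup>2" by simp
  have "integrable (cd_measure n) (indicat_real {..0})"
    by (rule cd_measure_integrable[OF assms, where B = 1]) (auto simp: indicator_def)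
  hence "integrable unif (\<lambda>x. (poly (cd n) x)\<^sup>2 / (real n)\<^sup>2 * indicator {..0} x)"
    by (subst cd_measure_integral_unif(2)[symmetric]) auto
  hence "integrable unif (\<lambda>x. (real n)\<^sup>2 * ((poly (cd n) x)\<^sup>2 / (real n)\<^sup>2 * indicator {..0} x))"
    by (rule integrable_mult_right)
  hence g0i: "integrable unif g0" by (simp only: conv(2)[symmetric])
  have "(\<integral>x. g0 x \<partial>unif) = (real n)\<^sup>2 * (\<integral>x. indicat_real {..0} x \<partial>cd_measure n)"
    unfolding conv by (subst cd_measure_integral_unif(1)) auto
  also have "\<dots> \<le> (real n)\<^sup>2 * (4 / real n)"
    using cd_measure_nonpos_le[OF assms] by (intro mult_left_mono) auto
  also have "\<dots> = 4 * real n" using assms by (simp add: power2_eq_square)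
  finally have g0v: "(\<integral>x. g0 x \<partial>unif) \<le> 4 * real n" .
  note refl = unif_integral_uminus[OF gm(1)] unif_integral_uminus[OF gm(2)]
  define H where "H = (\<lambda>x. r / 2 * (g0 x + g0 (- x)) + 1 / (2 * r) * (g x + g (- x)))"
  have Hi: "integrable unif H"
    unfolding H_def using gi g0i refl by (intro Bochner_Integration.integrable_add integrable_mult_right) auto
  have Hv: "(\<integral>x. H x \<partial>unif) = r / 2 * ((\<integral>x. g0 x \<partial>unif) + (\<integral>x. g0 x \<partial>unif)) + 1 / (2 * r) * ((real n)\<^sup>2 + (real n)\<^sup>2)"
    unfolding H_def using gi g0i refl gv by (subst Bochner_Integration.integral_add) auto
  have young: "\<bar>a * b\<bar> \<le> r / 2 * a\<^sup>2 + 1 / (2 * r) * b\<^sup>2" for a b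
  proof -
    have "0 \<le> (r * \<bar>a\<bar> - \<bar>b\<bar>)\<^sup>2 / (2 * r)" using r by simp
    also have "\<dots> = r / 2 * a\<^sup>2 + 1 / (2 * r) * b\<^sup>2 - \<bar>a * b\<bar>"
      using r by (simp add: power2_diff power_mult_distrib field_simps power2_eq_square abs_mult)
    finally show ?thesis by simp
  qed
  have le: "\<bar>cd_cross n x\<bar> \<le> H x" for x
  proof (cases "x \<le> 0")
    case True
    have "\<bar>cd_cross n x\<bar> \<le> r / 2 * g0 x + 1 / (2 * r) * g (- x)"
      unfolding cd_cross_def using young[of "poly (cd n) x" "poly (cd n) (-x)"] True by (simp add: g_def g0_def)
    also have "\<dots> \<le> H x"
      unfolding H_def using r by (intro add_mono mult_left_mono) (auto simp: g_def g0_def)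
    finally show ?thesis .
  next
    case False
    have "\<bar>cd_cross n x\<bar> \<le> r / 2 * g0 (- x) + 1 / (2 * r) * g x"
      unfolding cd_cross_def using young[of "poly (cd n) (-x)" "poly (cd n) x"] False by (simp add: g_def g0_def mult.commute)
    also have "\<dots> \<le> H x"
      unfolding H_def using r by (intro add_mono mult_left_mono) (auto simp: g_def g0_def)
    finally show ?thesis .
  qed
  show i: "integrable unif (\<lambda>x. \<bar>cd_cross n x\<bar>)"
    by (rule Bochner_Integration.integrable_bound[OF Hi]) (use le in \<open>auto intro!: AE_I2 order.trans[OF le]\<close>)
  have "(\<integral>x. \<bar>cd_cross n x\<bar> \<partial>unif) \<le> (\<integral>x. H x \<partial>unif)" by (rule integral_mono[OF i Hi le])
  also have "\<dots> \<le> r / 2 * (4 * real n + 4 * real n) + 1 / (2 * r) * ((real n)\<^sup>2 + (real n)\<^sup>2)"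
    unfolding Hv using r g0v by (intro add_mono mult_left_mono) auto
  also have "\<dots> = 5 * (real n * r)"
    using r by (simp add: field_simps power2_eq_square)
  finally show "(\<integral>x. \<bar>cd_cross n x\<bar> \<partial>unif) \<le> 5 * (real n * sqrt (real n))" by (simp add: r_def)
qed

text \<open>The logarithm is bounded through \<open>minus_ln_le_edge\<close> with M = n^4. The part
  4 ln n multiplies two integrals of order n sqrt n, and the factor n^(-2) before
  \<open>edge\<close> compensates the pointwise bound 2 n^3. The total order n^3 ln n is below that
  of N, which is n^4.\<close>

lemma cd_cross2_integral:
  assumes "n > 0"
  shows "\<bar>\<integral>z. cd_cross n (fst z) * cd_cross n (snd z) * ln (1 - fst z * snd z) \<partial>unif2\<bar> \<le>
    5 * (real n * sqrt (real n)) * ((1 + 4 * ln (real n)) * (5 * (real n * sqrt (real n))) + 6 * real n)"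
proof -
  have n: "real n \<ge> 1" using assms by simp
  define D where "D = (\<lambda>x. \<bar>cd_cross n x\<bar>)"
  define a where "a = 1 + 4 * ln (real n)"
  have a: "a \<ge> 0" using n by (simp add: a_def)
  have Dm [measurable]: "D \<in> borel_measurable borel" unfolding D_def by measurable
  have D0: "D x \<ge> 0" for x by (simp add: D_def)
  define \<delta> where "\<delta> = (\<integral>x. D x \<partial>unif)"
  have Di: "integrable unif D" and \<delta>: "\<delta> \<le> 5 * (real n * sqrt (real n))"
    using cd_cross_integral[OF assms] by (auto simp: D_def \<delta>_def)
  have \<delta>0: "\<delta> \<ge> 0" unfolding \<delta>_def by (rule integral_nonneg_AE) (simp add: D0)
  have DeAE: "AE x in unif. D x * edge x \<le> (real n)\<^sup>2 * (2 * real n) * edge x"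
    using unif_AE by eventually_elim (use cd_cross_abs_le edge_nonneg in \<open>auto simp: D_def intro!: mult_right_mono\<close>)
  have Dei: "integrable unif (\<lambda>x. D x * edge x)"
  proof (rule Bochner_Integration.integrable_bound)
    show "integrable unif (\<lambda>x. (real n)\<^sup>2 * (2 * real n) * edge x)" using edge_integral(1) by simp
    show "AE x in unif. norm (D x * edge x) \<le> norm ((real n)\<^sup>2 * (2 * real n) * edge x)"
      using DeAE by eventually_elim (use D0 edge_nonneg in \<open>simp add: abs_mult\<close>)
  qed measurable
  have "(\<integral>x. D x * edge x \<partial>unif) \<le> (\<integral>x. (real n)\<^sup>2 * (2 * real n) * edge x \<partial>unif)"
    by (rule integral_mono_AE[OF Dei _ DeAE]) (use edge_integral(1) in simp)
  also have "\<dots> \<le> (real n)\<^sup>2 * (2 * real n) * 3"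
    using edge_integral(2) n by (simp add: mult_left_mono)
  finally have De: "(\<integral>x. D x * edge x \<partial>unif) \<le> (real n)\<^sup>2 * (6 * real n)" by simp
  define h where "h = (\<lambda>x y. (a * D x + D x * edge x / (real n)\<^sup>2) * D y)"
  have bD: "D x \<le> (real n)\<^sup>2 * (2 * real n)" if "\<bar>x\<bar> < 1" for x using cd_cross_abs_le[OF that] by (simp add: D_def)
  have hi: "integrable unif2 (\<lambda>z. h (fst z) (snd z))"
  proof (rule unif2_integrable_bound)
    fix x y :: real assume xy: "\<bar>x\<bar> < 1" "\<bar>y\<bar> < 1"
    define B where "B = (real n)\<^sup>2 * (2 * real n)"
    have B: "0 \<le> B" "D x \<le> B" "D y \<le> B" using bD xy by (auto simp: B_def)
    have "D x * edge x / (real n)\<^sup>2 \<le> B * edge x / 1"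
      using B D0 edge_nonneg n by (intro frac_le mult_right_mono) (auto simp: power2_eq_square intro: mult_ge1_I)
    hence "(a * D x + D x * edge x / (real n)\<^sup>2) * D y \<le> (a * B + B * edge x) * B"
      using B D0 edge_nonneg[of x] a by (intro mult_mono add_mono mult_left_mono) auto
    moreover have "0 \<le> (a * D x + D x * edge x / (real n)\<^sup>2) * D y" using a D0 edge_nonneg[of x] by simp
    ultimately show "\<bar>h (fst (x, y)) (snd (x, y))\<bar> \<le> a * B * B + B * B * edge x" by (simp add: h_def algebra_simps)
  qed (auto simp: h_def)
  have ci: "integrable unif2 (\<lambda>z. cd_cross n (fst z) * cd_cross n (snd z) * ln (1 - fst z * snd z))"
  proof (rule integrable_times_ln)
    fix x y :: real assume xy: "\<bar>x\<bar> < 1" "\<bar>y\<bar> < 1"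
    show "\<bar>cd_cross n (fst (x, y)) * cd_cross n (snd (x, y))\<bar> \<le> (real n)\<^sup>2 * (2 * real n) * ((real n)\<^sup>2 * (2 * real n))"
      unfolding fst_conv snd_conv abs_mult by (intro mult_mono cd_cross_abs_le xy) auto
  qed measurable
  have "\<bar>\<integral>z. cd_cross n (fst z) * cd_cross n (snd z) * ln (1 - fst z * snd z) \<partial>unif2\<bar> \<le> (\<integral>z. h (fst z) (snd z) \<partial>unif2)"
  proof (rule order.trans[OF integral_abs_bound integral_mono_AE])
    show "AE z in unif2. \<bar>cd_cross n (fst z) * cd_cross n (snd z) * ln (1 - fst z * snd z)\<bar> \<le> h (fst z) (snd z)"
      using unif2_AE
    proof eventually_elim
      case (elim z)
      obtain x y where z: "z = (x, y)" by (cases z)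
      have xy: "\<bar>x\<bar> < 1" "\<bar>y\<bar> < 1" using elim by (auto simp: z)
      have M: "(real n) ^ 4 > 0" using n by simp
      have "sqrt ((real n) ^ 4) = (real n)\<^sup>2" by (rule real_sqrt_unique) (auto simp flip: power_mult)
      moreover have "ln ((real n) ^ 4) = 4 * ln (real n)" using n by (subst ln_realpow) auto
      ultimately have "\<bar>ln (1 - x * y)\<bar> \<le> a + edge x / (real n)\<^sup>2"
        using abs_ln_one_minus_mult_le[OF xy] minus_ln_le_edge[OF xy(1) M] by (simp add: a_def)
      hence "D x * D y * \<bar>ln (1 - x * y)\<bar> \<le> D x * D y * (a + edge x / (real n)\<^sup>2)"
        using D0 by (intro mult_left_mono) auto
      thus ?case by (simp add: z h_def D_def abs_mult algebra_simps)
    qed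
  qed (use ci hi in auto)
  also have "\<dots> = (\<integral>x. (\<integral>y. h x y \<partial>unif) \<partial>unif)"
    using unif2.integral_fst[of h] hi by (simp add: case_prod_beta')
  also have "\<dots> = (\<integral>x. (a * D x + D x * edge x / (real n)\<^sup>2) * \<delta> \<partial>unif)"
    by (simp add: h_def \<delta>_def)
  also have "\<dots> = (a * \<delta> + (\<integral>x. D x * edge x \<partial>unif) / (real n)\<^sup>2) * \<delta>"
    using Di Dei by (simp add: \<delta>_def)
  also have "\<dots> \<le> (a * (5 * (real n * sqrt (real n))) + (real n)\<^sup>2 * (6 * real n) / (real n)\<^sup>2) * (5 * (real n * sqrt (real n)))"
    using \<delta> \<delta>0 De a n by (intro mult_mono add_mono mult_left_mono divide_right_mono add_nonneg_nonneg mult_nonneg_nonneg) auto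
  also have "\<dots> = 5 * (real n * sqrt (real n)) * (a * (5 * (real n * sqrt (real n))) + 6 * real n)"
    using n by (simp add: mult.commute)
  finally show ?thesis by (simp only: a_def)
qed

text \<open>The terms of the square that belong to (x, y) and (- x, - y) have equal integrals,
  because \<open>unif2\<close> and ln (1 - x y) are invariant under the common sign change.\<close>

lemma harm_kernel_square_integral:
  assumes "n > 0"
  shows "integrable unif2 (\<lambda>z. (harm_kernel n (fst z) (snd z))\<^sup>2 * ln (1 - fst z * snd z))"
    and "(\<integral>z. (harm_kernel n (fst z) (snd z))\<^sup>2 * ln (1 - fst z * snd z) \<partial>unif2) =
      (real n) ^ 4 / 2 * (\<integral>z. ln (1 - fst z * snd z) \<partial>cd_measure2 n)
      + (\<integral>z. cd_cross n (fst z) * cd_cross n (snd z) * ln (1 - fst z * snd z) \<partial>unif2) / 2"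
proof -
  have n: "real n > 0" using assms by simp
  define A where "A = (\<lambda>z::real \<times> real. (poly (cd n) (fst z))\<^sup>2 * (poly (cd n) (snd z))\<^sup>2)"
  define l where "l = (\<lambda>z::real \<times> real. ln (1 - fst z * snd z))"
  define C where "C = (\<lambda>z::real \<times> real. cd_cross n (fst z) * cd_cross n (snd z))"
  have Am [measurable]: "A \<in> borel_measurable (borel \<Otimes>\<^sub>M borel)" "l \<in> borel_measurable (borel \<Otimes>\<^sub>M borel)"
    unfolding A_def l_def by measurable
  have Ai: "integrable unif2 (\<lambda>z. A z * l z)"
    unfolding l_def
  proof (rule integrable_times_ln)
    fix x y :: real assume "\<bar>x\<bar> < 1" "\<bar>y\<bar> < 1"
    hence "\<bar>poly (cd n) x\<bar>\<^sup>2 * \<bar>poly (cd n) y\<bar>\<^sup>2 \<le> ((real n)\<^sup>2)\<^sup>2 * ((real n)\<^sup>2)\<^sup>2"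
      by (intro mult_mono power_mono cd_abs_le) auto
    thus "\<bar>A (x, y)\<bar> \<le> ((real n)\<^sup>2)\<^sup>2 * ((real n)\<^sup>2)\<^sup>2" by (simp add: A_def)
  qed measurable
  have Ai': "integrable unif2 (\<lambda>z. A (- fst z, - snd z) * l z)"
    and Av': "(\<integral>z. A (- fst z, - snd z) * l z \<partial>unif2) = (\<integral>z. A z * l z \<partial>unif2)"
    using unif2_integral_uminus[of "\<lambda>z. A z * l z"] Ai by (simp_all add: l_def)
  have Ci: "integrable unif2 (\<lambda>z. C z * l z)"
    unfolding l_def C_def
  proof (rule integrable_times_ln)
    fix x y :: real assume xy: "\<bar>x\<bar> < 1" "\<bar>y\<bar> < 1"
    show "\<bar>cd_cross n (fst (x, y)) * cd_cross n (snd (x, y))\<bar> \<le> (real n)\<^sup>2 * (2 * real n) * ((real n)\<^sup>2 * (2 * real n))"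
      unfolding fst_conv snd_conv abs_mult by (intro mult_mono cd_cross_abs_le xy) auto
  qed measurable
  have e: "(harm_kernel n (fst z) (snd z))\<^sup>2 * ln (1 - fst z * snd z) =
      1 / 4 * (A z * l z) + 1 / 4 * (A (- fst z, - snd z) * l z) + 1 / 2 * (C z * l z)" for z
    by (simp add: harm_kernel_def A_def l_def C_def cd_cross_def power2_eq_square field_simps)
  show "integrable unif2 (\<lambda>z. (harm_kernel n (fst z) (snd z))\<^sup>2 * ln (1 - fst z * snd z))"
    unfolding e using Ai Ai' Ci by (intro Bochner_Integration.integrable_add integrable_mult_right)
  have "(\<integral>z. l z \<partial>cd_measure2 n) = (\<integral>z. A z / (real n) ^ 4 * l z \<partial>unif2)"
    unfolding A_def by (rule cd_measure2_integral(1)[OF assms]) measurable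
  hence "(\<integral>z. A z * l z \<partial>unif2) = (real n) ^ 4 * (\<integral>z. l z \<partial>cd_measure2 n)" using n by simp
  moreover have "(\<integral>z. (harm_kernel n (fst z) (snd z))\<^sup>2 * ln (1 - fst z * snd z) \<partial>unif2) =
     1 / 4 * (\<integral>z. A z * l z \<partial>unif2) + 1 / 4 * (\<integral>z. A (- fst z, - snd z) * l z \<partial>unif2) + 1 / 2 * (\<integral>z. C z * l z \<partial>unif2)"
    unfolding e using Ai Ai' Ci
    by (subst Bochner_Integration.integral_add, simp, simp, subst Bochner_Integration.integral_add) auto
  ultimately show "(\<integral>z. (harm_kernel n (fst z) (snd z))\<^sup>2 * ln (1 - fst z * snd z) \<partial>unif2) =
      (real n) ^ 4 / 2 * (\<integral>z. ln (1 - fst z * snd z) \<partial>cd_measure2 n)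
      + (\<integral>z. cd_cross n (fst z) * cd_cross n (snd z) * ln (1 - fst z * snd z) \<partial>unif2) / 2"
    unfolding Av' by (simp add: l_def C_def)
qed

text \<open>Everything is divided by N. With n = k + 1 the factor a = n^4 / (4 N) tends to 1 / 2, so
  - a ln (2 n^2) cancels against ln N / 4 up to - (3 / 4) ln 2. The term ln 2 in L / 2 then leaves
  the ln 2 / 4 of the constant.\<close>

lemma harm_kernel_energy_asymp:
  defines "N \<equiv> \<lambda>k. real (harmonic_dim k)"
    and "C_log \<equiv> (1 + 2 * catalan_const) / pi + 1 / 4 - euler_mascheroni + ln 2 / 4"
  shows "(\<lambda>k. 1 / 2 * (\<integral>z. (harm_kernel (Suc k) (fst z) (snd z))\<^sup>2 * ln (1 - fst z * snd z) \<partial>unif2)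
     - (- 1 / 4 * N k * ln (N k) + C_log * N k)) \<in> o(\<lambda>k. N k)"
proof (rule smalloI_tendsto)
  have N: "N k = (real k + 1)\<^sup>2 * ((real k + 1)\<^sup>2 + 1) / 2" for k
    unfolding N_def harmonic_dim_eq by (simp add: add.commute)
  have Npos: "N k > 0" for k unfolding N by (intro divide_pos_pos mult_pos_pos add_nonneg_pos) auto
  define L where "L = 2 * (1 + 2 * catalan_const) / pi + 1 / 2 - 2 * euler_mascheroni + 2 * ln 2"
  define \<Lambda> where "\<Lambda> = (\<lambda>k. \<integral>z. ln (2 * (real (Suc k))\<^sup>2 * (2 - fst z - snd z)) \<partial>cd_measure2 (Suc k))"
  define E where "E = (\<lambda>k. \<integral>z. ln (1 - fst z * snd z) \<partial>cd_measure2 (Suc k))"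
  define X where "X = (\<lambda>k. \<integral>z. cd_cross (Suc k) (fst z) * cd_cross (Suc k) (snd z) * ln (1 - fst z * snd z) \<partial>unif2)"
  define \<rho> where "\<rho> = (\<lambda>k. E k - (- ln (2 * (real (Suc k))\<^sup>2) + \<Lambda> k))"
  define b where "b = (\<lambda>k. 5 * (real (Suc k) * sqrt (real (Suc k))) * ((1 + 4 * ln (real (Suc k))) * (5 * (real (Suc k) * sqrt (real (Suc k)))) + 6 * real (Suc k)))"
  define a where "a = (\<lambda>k. (real k + 1)\<^sup>2 / (2 * ((real k + 1)\<^sup>2 + 1)))"
  have \<Lambda>: "\<Lambda> \<longlonglongrightarrow> L" unfolding \<Lambda>_def L_def by (rule cd_measure2_ln_sum_tendsto)
  have \<rho>: "\<rho> \<longlonglongrightarrow> 0"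
  proof (rule Lim_null_comparison)
    show "\<forall>\<^sub>F k in sequentially. norm (\<rho> k) \<le> 72 / real (Suc k)"
      unfolding \<rho>_def E_def \<Lambda>_def using cd_measure2_ln[of "Suc k" for k] by (intro always_eventually) auto
    show "(\<lambda>k. 72 / real (Suc k)) \<longlonglongrightarrow> 0" by real_asymp
  qed
  have X: "(\<lambda>k. X k / (4 * N k)) \<longlonglongrightarrow> 0"
  proof (rule Lim_null_comparison)
    show "\<forall>\<^sub>F k in sequentially. norm (X k / (4 * N k)) \<le> b k / (4 * N k)"
    proof (intro always_eventually allI)
      fix k
      have "\<bar>X k\<bar> \<le> b k" unfolding X_def b_def by (rule cd_cross2_integral) simp
      thus "norm (X k / (4 * N k)) \<le> b k / (4 * N k)" using Npos[of k] by (simp add: divide_right_mono)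
    qed
    show "(\<lambda>k. b k / (4 * N k)) \<longlonglongrightarrow> 0" unfolding b_def N by real_asymp
  qed
  have a: "a \<longlonglongrightarrow> 1 / 2" unfolding a_def by real_asymp
  have "(\<lambda>k. - a k * ln (2 * (real (Suc k))\<^sup>2) + ln (N k) / 4) \<longlonglongrightarrow> ln (1 / 2) / 4 - ln 2 / 2"
    unfolding a_def N by real_asymp
  moreover have "ln (1 / 2) / 4 - ln 2 / 2 = - (3 / 4) * ln (2 :: real)" by (simp add: ln_div)
  ultimately have m: "(\<lambda>k. - a k * ln (2 * (real (Suc k))\<^sup>2) + ln (N k) / 4) \<longlonglongrightarrow> - (3 / 4) * ln 2"
    by (simp only:)
  have "(\<lambda>k. a k * (\<Lambda> k + \<rho> k) + (- a k * ln (2 * (real (Suc k))\<^sup>2) + ln (N k) / 4) + X k / (4 * N k) - C_log) \<longlonglongrightarrow> 1 / 2 * (L + 0) + - (3 / 4) * ln 2 + 0 - C_log"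
    by (intro tendsto_intros \<Lambda> \<rho> X a m)
  moreover have "1 / 2 * (L + 0) + - (3 / 4) * ln 2 + 0 - C_log = 0"
    by (simp add: L_def C_log_def field_simps)
  moreover have "(1 / 2 * (\<integral>z. (harm_kernel (Suc k) (fst z) (snd z))\<^sup>2 * ln (1 - fst z * snd z) \<partial>unif2)
     - (- 1 / 4 * N k * ln (N k) + C_log * N k)) / N k =
     a k * (\<Lambda> k + \<rho> k) + (- a k * ln (2 * (real (Suc k))\<^sup>2) + ln (N k) / 4) + X k / (4 * N k) - C_log" for k
  proof -
    have J: "1 / 2 * (\<integral>z. (harm_kernel (Suc k) (fst z) (snd z))\<^sup>2 * ln (1 - fst z * snd z) \<partial>unif2) = (real k + 1) ^ 4 / 4 * E k + X k / 4"
      using harm_kernel_square_integral(2)[of "Suc k"] by (simp add: E_def X_def add.commute)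
    have "(real k + 1) ^ 4 / 4 = a k * N k"
    proof -
      have "K / (2 * (K + 1)) * (K * (K + 1) / 2) = K * K / 4" if "K + 1 > 0" for K :: real
        using that by (simp add: divide_simps)
      moreover have "(real k + 1)\<^sup>2 + 1 > 0" by (intro add_nonneg_pos) auto
      moreover have "(real k + 1) ^ 4 = (real k + 1)\<^sup>2 * (real k + 1)\<^sup>2" by (simp flip: power_add)
      ultimately show ?thesis by (simp only: a_def N)
    qed
    hence "(1 / 2 * (\<integral>z. (harm_kernel (Suc k) (fst z) (snd z))\<^sup>2 * ln (1 - fst z * snd z) \<partial>unif2)
     - (- 1 / 4 * N k * ln (N k) + C_log * N k)) / N k = (a k * N k * E k + X k / 4 + 1 / 4 * N k * ln (N k) - C_log * N k) / N k"
      unfolding J by simp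
    also have "\<dots> = a k * E k + X k / (4 * N k) + ln (N k) / 4 - C_log"
      using Npos[of k] by (simp add: field_simps)
    also have "E k = - ln (2 * (real (Suc k))\<^sup>2) + \<Lambda> k + \<rho> k" by (simp add: \<rho>_def)
    finally show ?thesis by (simp add: algebra_simps)
  qed
  ultimately show "((\<lambda>k. (1 / 2 * (\<integral>z. (harm_kernel (Suc k) (fst z) (snd z))\<^sup>2 * ln (1 - fst z * snd z) \<partial>unif2)
     - (- 1 / 4 * N k * ln (N k) + C_log * N k)) / N k) \<longlongrightarrow> 0) sequentially"
    by simp
  show "\<forall>\<^sub>F k in sequentially. N k \<noteq> 0" using Npos by (intro always_eventually allI) (simp add: less_imp_neq[symmetric])
qed

section \<open>Planes in four-space and pairs of unit vectors in three-space\<close>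

definition orthonormal_pair :: "'a::real_inner \<Rightarrow> 'a \<Rightarrow> bool" where
  "orthonormal_pair g h \<longleftrightarrow> g \<bullet> g = 1 \<and> h \<bullet> h = 1 \<and> g \<bullet> h = 0"

lemma orthonormal_pair_expand:
  assumes "orthonormal_pair g h" "v \<in> span {g, h}"
  shows "v = (v \<bullet> g) *\<^sub>R g + (v \<bullet> h) *\<^sub>R h"
proof -
  obtain s t where v: "v = s *\<^sub>R g + t *\<^sub>R h"
    using assms(2) by (auto simp: span_insert span_singleton algebra_simps)
  show ?thesis using assms(1) unfolding v by (simp add: orthonormal_pair_def inner_add_left inner_add_right inner_commute)
qed

lemma orthonormal_pair_independent:
  assumes "orthonormal_pair g h"
  shows "g \<noteq> h" "independent {g, h}"
proof -
  show gh: "g \<noteq> h" using assms by (auto simp: orthonormal_pair_def)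
  have "pairwise orthogonal {g, h}" using assms
    by (auto simp: pairwise_def Linear_Algebra.orthogonal_def orthonormal_pair_def inner_commute)
  moreover have "0 \<notin> {g, h}" using assms by (auto simp: orthonormal_pair_def)
  ultimately show "independent {g, h}" by (rule pairwise_orthogonal_independent)
qed

lemma span_orthonormal_pair_Gr24:
  "orthonormal_pair g h \<Longrightarrow> span {g, h} \<in> Gr24"
  using orthonormal_pair_independent[of g h] by (simp add: Gr24_def dim_eq_card_independent)

lemma Gr24_obtain_pair:
  assumes "P \<in> Gr24"
  obtains g h where "orthonormal_pair g h" "P = span {g, h}"
proof -
  have P: "subspace P" "dim P = 2" using assms by (auto simp: Gr24_def)
  obtain B where B: "B \<subseteq> P" "pairwise orthogonal B" "\<And>x. x \<in> B \<Longrightarrow> norm x = 1" "independent B" "card B = dim P" "span B = P"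
    using orthonormal_basis_subspace[OF P(1)] by metis
  from B(5) P(2) have "card B = 2" by simp
  then obtain g h where gh: "B = {g, h}" "g \<noteq> h" by (auto simp: card_2_iff)
  have "orthonormal_pair g h"
    using B(2,3) gh by (auto simp: orthonormal_pair_def pairwise_def Linear_Algebra.orthogonal_def norm_eq_1)
  thus ?thesis using that gh(1) B(6) by blast
qed

text \<open>The difference to the claimed point is orthogonal to the plane, and Pythagoras gives
  minimality.\<close>

lemma closest_point_pair:
  assumes "orthonormal_pair g h"
  shows "closest_point (span {g, h}) v = (v \<bullet> g) *\<^sub>R g + (v \<bullet> h) *\<^sub>R (h :: 'a::euclidean_space)"
proof (rule sym, rule closest_point_unique)
  let ?w = "(v \<bullet> g) *\<^sub>R g + (v \<bullet> h) *\<^sub>R h"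
  show "convex (span {g, h})" "closed (span {g, h})" by (auto intro: subspace_imp_convex)
  show w: "?w \<in> span {g, h}" by (intro span_add span_scale span_base) auto
  show "\<forall>z\<in>span {g, h}. dist v ?w \<le> dist v z"
  proof
    fix z assume z: "z \<in> span {g, h}"
    have o1: "(v - ?w) \<bullet> g = 0" "(v - ?w) \<bullet> h = 0"
      using assms by (auto simp: orthonormal_pair_def inner_diff_left inner_diff_right inner_add_left inner_add_right inner_commute)
    have "(v - ?w) \<bullet> u = 0" if "u \<in> span {g, h}" for u
    proof -
      have "(v - ?w) \<bullet> (c *\<^sub>R g + d *\<^sub>R h) = c * ((v - ?w) \<bullet> g) + d * ((v - ?w) \<bullet> h)" for c d
        by (simp only: inner_add_right inner_scaleR_right)
      hence "(v - ?w) \<bullet> (c *\<^sub>R g + d *\<^sub>R h) = 0" for c d by (simp only: o1 mult_zero_right add_0_left)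
      thus ?thesis using orthonormal_pair_expand[OF assms that] by metis
    qed
    hence "orthogonal (v - ?w) (?w - z)" using span_diff[OF w z] by (simp add: Linear_Algebra.orthogonal_def)
    hence "(norm ((v - ?w) + (?w - z)))\<^sup>2 = (norm (v - ?w))\<^sup>2 + (norm (?w - z))\<^sup>2"
      by (rule norm_add_Pythagorean)
    hence "(norm (v - ?w))\<^sup>2 \<le> (norm (v - z))\<^sup>2" by simp
    thus "dist v ?w \<le> dist v z" by (simp add: dist_norm power2_le_iff_abs_le)
  qed
qed

lemma proj_matrix_pair:
  assumes "orthonormal_pair g h"
  shows "proj_matrix (span {g, h}) $ i $ j = g $ i * g $ j + h $ i * h $ j"
  by (simp add: proj_matrix_def matrix_def closest_point_pair[OF assms] inner_axis inner_axis' mult.commute)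

text \<open>Twice the self-dual and anti-self-dual parts of the bivector \<open>g \<and> h\<close>.\<close>

definition sd_part :: "real^4 \<Rightarrow> real^4 \<Rightarrow> real^3" where
  "sd_part g h = vector
     [(g$1 * h$2 - g$2 * h$1) + (g$3 * h$4 - g$4 * h$3),
      (g$1 * h$3 - g$3 * h$1) - (g$2 * h$4 - g$4 * h$2),
      (g$1 * h$4 - g$4 * h$1) + (g$2 * h$3 - g$3 * h$2)]"

definition asd_part :: "real^4 \<Rightarrow> real^4 \<Rightarrow> real^3" where
  "asd_part g h = vector
     [(g$1 * h$2 - g$2 * h$1) - (g$3 * h$4 - g$4 * h$3),
      (g$1 * h$3 - g$3 * h$1) + (g$2 * h$4 - g$4 * h$2),
      (g$1 * h$4 - g$4 * h$1) - (g$2 * h$3 - g$3 * h$2)]"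

lemma inner_real3: "x \<bullet> (y :: real^3) = x$1 * y$1 + x$2 * y$2 + x$3 * y$3"
  by (simp add: inner_vec_def sum_3)

lemma inner_real4: "x \<bullet> (y :: real^4) = x$1 * y$1 + x$2 * y$2 + x$3 * y$3 + x$4 * y$4"
  by (simp add: inner_vec_def sum_4)

text \<open>Adding the two inner products cancels the mixed terms and leaves twice the inner product
  of the bivectors, a Gram determinant.\<close>

lemma sd_asd_parts_inner_add:
  "sd_part g h \<bullet> sd_part g' h' + asd_part g h \<bullet> asd_part g' h' =
     2 * ((g \<bullet> g') * (h \<bullet> h') - (g \<bullet> h') * (h \<bullet> g'))"
  by (simp add: sd_part_def asd_part_def inner_real3 inner_real4 algebra_simps)

text \<open>Lagrange's identity. The mixed terms in the squared norm of either part add up to the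
  Pluecker relation, which holds identically for a wedge of two vectors.\<close>

lemma parts_unit:
  assumes "orthonormal_pair g h"
  shows "sd_part g h \<bullet> sd_part g h = 1" "asd_part g h \<bullet> asd_part g h = 1"
proof -
  have "sd_part g h \<bullet> sd_part g h = (g \<bullet> g) * (h \<bullet> h) - (g \<bullet> h)\<^sup>2"
    by (simp add: sd_part_def inner_real3 inner_real4 algebra_simps power2_eq_square)
  thus "sd_part g h \<bullet> sd_part g h = 1" using assms by (simp add: orthonormal_pair_def)
  have "asd_part g h \<bullet> asd_part g h = (g \<bullet> g) * (h \<bullet> h) - (g \<bullet> h)\<^sup>2"
    by (simp add: asd_part_def inner_real3 inner_real4 algebra_simps power2_eq_square)
  thus "asd_part g h \<bullet> asd_part g h = 1" using assms by (simp add: orthonormal_pair_def)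
qed

text \<open>Twice the matrix of the projection onto the plane with the given unit parts.\<close>

definition parts_matrix :: "real^3 \<Rightarrow> real^3 \<Rightarrow> real^4^4" where
  "parts_matrix a b = vector
    [vector [1 + a \<bullet> b, a$3 * b$2 - a$2 * b$3, a$1 * b$3 - a$3 * b$1, a$2 * b$1 - a$1 * b$2],
     vector [a$3 * b$2 - a$2 * b$3, 1 + a$1 * b$1 - a$2 * b$2 - a$3 * b$3, a$1 * b$2 + a$2 * b$1, a$1 * b$3 + a$3 * b$1],
     vector [a$1 * b$3 - a$3 * b$1, a$1 * b$2 + a$2 * b$1, 1 - a$1 * b$1 + a$2 * b$2 - a$3 * b$3, a$2 * b$3 + a$3 * b$2],
     vector [a$2 * b$1 - a$1 * b$2, a$1 * b$3 + a$3 * b$1, a$2 * b$3 + a$3 * b$2, 1 - a$1 * b$1 - a$2 * b$2 + a$3 * b$3]]"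

lemma vector_4 [simp]:
  "(vector [w, x, y, z] :: 'a::zero^4) $ 1 = w" "(vector [w, x, y, z] :: 'a::zero^4) $ 2 = x"
  "(vector [w, x, y, z] :: 'a::zero^4) $ 3 = y" "(vector [w, x, y, z] :: 'a::zero^4) $ 4 = z"
  by (simp_all add: vector_def)

text \<open>The antisymmetric matrix with Pluecker coordinates p12, p13, p14, p23, p24, p34 in this
  order.\<close>

definition bivector_matrix :: "real \<Rightarrow> real \<Rightarrow> real \<Rightarrow> real \<Rightarrow> real \<Rightarrow> real \<Rightarrow> real^4^4" where
  "bivector_matrix p q r s t u = vector
     [vector [0, p, q, r], vector [-p, 0, s, t], vector [-q, -s, 0, u], vector [-r, -t, -u, 0]]"

lemma parts_matrix_bivector:
  assumes "p\<^sup>2 + q\<^sup>2 + r\<^sup>2 + s\<^sup>2 + t\<^sup>2 + u\<^sup>2 = 1"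
  defines "B \<equiv> bivector_matrix p q r s t u"
  shows "parts_matrix (vector [p + u, q - t, r + s]) (vector [p - u, q + t, r - s]) $ i $ k =
    2 * (\<Sum>j\<in>UNIV. B $ i $ j * B $ k $ j)"
proof -
  have p: "p * p = 1 - q * q - r * r - s * s - t * t - u * u" using assms(1) by (simp add: power2_eq_square)
  show ?thesis
    using exhaust_4[of i] exhaust_4[of k]
    by (elim disjE; simp add: B_def bivector_matrix_def parts_matrix_def sum_4 inner_real3 p algebra_simps)
qed

text \<open>The antisymmetric matrix B of the wedge of g and h has B B^T = g g^T + h h^T for
  orthonormal g, h; \<open>parts_matrix_bivector\<close> expresses B B^T through the parts.\<close>

lemma parts_matrix_pair:
  assumes "orthonormal_pair g h"
  shows "parts_matrix (sd_part g h) (asd_part g h) $ i $ k = 2 * (g$i * g$k + h$i * h$k)"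
proof -
  define p where "p = (\<lambda>i j. g$i * h$j - g$j * h$i)"
  define B where "B = bivector_matrix (p 1 2) (p 1 3) (p 1 4) (p 2 3) (p 2 4) (p 3 4)"
  have B: "B $ i $ j = p i j" for i j
    using exhaust_4[of i] exhaust_4[of j] by (elim disjE; simp add: B_def p_def bivector_matrix_def)
  have "(p 1 2)\<^sup>2 + (p 1 3)\<^sup>2 + (p 1 4)\<^sup>2 + (p 2 3)\<^sup>2 + (p 2 4)\<^sup>2 + (p 3 4)\<^sup>2 = (g \<bullet> g) * (h \<bullet> h) - (g \<bullet> h)\<^sup>2"
    by (simp add: p_def inner_real4 algebra_simps power2_eq_square)
  also have "\<dots> = 1" using assms by (simp add: orthonormal_pair_def)
  finally have "parts_matrix (vector [p 1 2 + p 3 4, p 1 3 - p 2 4, p 1 4 + p 2 3]) (vector [p 1 2 - p 3 4, p 1 3 + p 2 4, p 1 4 - p 2 3]) $ i $ k =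
    2 * (\<Sum>j\<in>UNIV. B $ i $ j * B $ k $ j)"
    unfolding B_def by (rule parts_matrix_bivector)
  moreover have "(\<Sum>j\<in>UNIV. p i j * p k j) =
     g$i * g$k * (h \<bullet> h) + h$i * h$k * (g \<bullet> g) - (g$i * h$k + g$k * h$i) * (g \<bullet> h)"
    by (simp add: p_def inner_vec_def algebra_simps sum.distrib sum_subtractf sum_distrib_left)
  ultimately show ?thesis using assms unfolding B
    by (simp add: orthonormal_pair_def) (simp add: p_def sd_part_def asd_part_def)
qed

text \<open>\<open>parts_matrix a b\<close> minus the identity is the traceless symmetric matrix
  that corresponds to the tensor of a and b, which is why the trace form factorises.\<close>

lemma parts_matrix_inner:
  "(\<Sum>i\<in>UNIV. \<Sum>j\<in>UNIV. parts_matrix a b $ i $ j * parts_matrix c d $ i $ j) = 4 + 4 * (a \<bullet> c) * (b \<bullet> d)"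
  by (simp add: parts_matrix_def sum_4 inner_real3 algebra_simps)

text \<open>The left side is the trace of the product of the two projections. Each is half of a
  \<open>parts_matrix\<close>, and \<open>parts_matrix_inner\<close> evaluates the trace.\<close>

lemma sd_asd_parts_inner_mult:
  assumes "orthonormal_pair g h" "orthonormal_pair g' h'"
  shows "(g \<bullet> g')\<^sup>2 + (g \<bullet> h')\<^sup>2 + (h \<bullet> g')\<^sup>2 + (h \<bullet> h')\<^sup>2 =
     1 + (sd_part g h \<bullet> sd_part g' h') * (asd_part g h \<bullet> asd_part g' h')"
proof -
  have "(\<Sum>i\<in>UNIV. \<Sum>j\<in>UNIV. (g$i * g$j + h$i * h$j) * (g'$i * g'$j + h'$i * h'$j)) =
    (g \<bullet> g')\<^sup>2 + (g \<bullet> h')\<^sup>2 + (h \<bullet> g')\<^sup>2 + (h \<bullet> h')\<^sup>2"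
    by (simp add: inner_real4 sum_4 algebra_simps power2_eq_square)
  with parts_matrix_inner[of "sd_part g h" "asd_part g h" "sd_part g' h'" "asd_part g' h'"]
  moreover have "(2 * x) * (2 * y) = 4 * (x * y)" for x y :: real by simp
  ultimately have "4 * ((g \<bullet> g')\<^sup>2 + (g \<bullet> h')\<^sup>2 + (h \<bullet> g')\<^sup>2 + (h \<bullet> h')\<^sup>2) = 4 + 4 * ((sd_part g h \<bullet> sd_part g' h') * (asd_part g h \<bullet> asd_part g' h'))"
    unfolding parts_matrix_pair[OF assms(1)] parts_matrix_pair[OF assms(2)] by (simp only: sum_distrib_left[symmetric] mult.assoc[of 4])
  moreover have "4 * A = 4 + 4 * B \<Longrightarrow> A = 1 + B" for A B :: real by linarith
  ultimately show ?thesis by blast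
qed

text \<open>Decomposes an antisymmetric matrix B under the Pluecker relation: \<open>h\<close> is
  its first row (0, p, q, r), normalised, and g = B h.\<close>

lemma ex_orthonormal_pair_bivector_aux:
  assumes "p\<^sup>2 + q\<^sup>2 + r\<^sup>2 + s\<^sup>2 + t\<^sup>2 + u\<^sup>2 = 1" "p * u - q * t + r * s = 0" "p\<^sup>2 + q\<^sup>2 + r\<^sup>2 \<noteq> (0 :: real)"
  shows "\<exists>g h :: real^4. orthonormal_pair g h \<and>
    g$1 * h$2 - g$2 * h$1 = p \<and> g$1 * h$3 - g$3 * h$1 = q \<and> g$1 * h$4 - g$4 * h$1 = r \<and>
    g$2 * h$3 - g$3 * h$2 = s \<and> g$2 * h$4 - g$4 * h$2 = t \<and> g$3 * h$4 - g$4 * h$3 = u"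
proof -
  define w where "w = p\<^sup>2 + q\<^sup>2 + r\<^sup>2"
  have w: "w \<noteq> 0" using assms(3) by (simp add: w_def)
  have w0: "w > 0" using w by (simp add: w_def order_less_le)
  define g where "g = (1 / sqrt w) *\<^sub>R (vector [w, q * s + r * t, - p * s + r * u, - p * t - q * u] :: real^4)"
  define h where "h = (1 / sqrt w) *\<^sub>R (vector [0, p, q, r] :: real^4)"
  have sw: "x / sqrt w * (y / sqrt w) = x * y / w" "1 / sqrt w * x * (1 / sqrt w * y) = x * y / w" for x y using w0 by (simp_all add: field_simps)
  show ?thesis
  proof (intro exI conjI)
    have "w * w + (q * s + r * t) * (q * s + r * t) + (- p * s + r * u) * (- p * s + r * u) + (- p * t - q * u) * (- p * t - q * u) = w * (p\<^sup>2 + q\<^sup>2 + r\<^sup>2 + s\<^sup>2 + t\<^sup>2 + u\<^sup>2) - (p * u - q * t + r * s)\<^sup>2"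
      unfolding w_def by (simp add: algebra_simps power2_eq_square)
    also have "\<dots> = w" using assms(1,2) by simp
    finally have "w * w + (q * s + r * t) * (q * s + r * t) + (- p * s + r * u) * (- p * s + r * u) + (- p * t - q * u) * (- p * t - q * u) = w" .
    hence "(vector [w, q * s + r * t, - p * s + r * u, - p * t - q * u] :: real^4) \<bullet> vector [w, q * s + r * t, - p * s + r * u, - p * t - q * u] = w"
      by (simp add: inner_real4)
    hence "g \<bullet> g = 1" using w0 by (simp add: g_def)
    moreover have "h \<bullet> h = 1" using w0 by (simp add: h_def inner_real4 sw flip: add_divide_distrib) (simp add: w_def power2_eq_square)
    moreover have "g \<bullet> h = 0" by (simp add: g_def h_def inner_real4 sw algebra_simps flip: add_divide_distrib)
    ultimately show "orthonormal_pair g h" by (simp add: orthonormal_pair_def)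
    show "g$1 * h$2 - g$2 * h$1 = p" "g$1 * h$3 - g$3 * h$1 = q" "g$1 * h$4 - g$4 * h$1 = r"
      using w0 by (simp_all add: g_def h_def sw flip: diff_divide_distrib)
    have "(q * s + r * t) * q - (- p * s + r * u) * p = s * w - r * (p * u - q * t + r * s)"
      unfolding w_def by (simp add: algebra_simps power2_eq_square)
    hence "(q * s + r * t) * q - (- p * s + r * u) * p = s * w" using assms(2) by simp
    thus "g$2 * h$3 - g$3 * h$2 = s" using w0 by (simp add: g_def h_def sw flip: diff_divide_distrib)
    have "(q * s + r * t) * r - (- p * t - q * u) * p = t * w + q * (p * u - q * t + r * s)"
      unfolding w_def by (simp add: algebra_simps power2_eq_square)
    hence "(q * s + r * t) * r - (- p * t - q * u) * p = t * w" using assms(2) by simp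
    thus "g$2 * h$4 - g$4 * h$2 = t" using w0 by (simp add: g_def h_def sw flip: diff_divide_distrib)
    have "(- p * s + r * u) * r - (- p * t - q * u) * q = u * w - p * (p * u - q * t + r * s)"
      unfolding w_def by (simp add: algebra_simps power2_eq_square)
    hence "(- p * s + r * u) * r - (- p * t - q * u) * q = u * w" using assms(2) by simp
    thus "g$3 * h$4 - g$4 * h$3 = u" using w0 by (simp add: g_def h_def sw flip: diff_divide_distrib)
  qed
qed

text \<open>The construction needs a nonzero first row. If that row vanishes but the second does
  not, the first two axes are exchanged; if both vanish, only u = \<plusminus>1 is left.\<close>

lemma ex_orthonormal_pair_bivector:
  assumes "p\<^sup>2 + q\<^sup>2 + r\<^sup>2 + s\<^sup>2 + t\<^sup>2 + u\<^sup>2 = 1" "p * u - q * t + r * s = (0 :: real)"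
  shows "\<exists>g h :: real^4. orthonormal_pair g h \<and>
    g$1 * h$2 - g$2 * h$1 = p \<and> g$1 * h$3 - g$3 * h$1 = q \<and> g$1 * h$4 - g$4 * h$1 = r \<and>
    g$2 * h$3 - g$3 * h$2 = s \<and> g$2 * h$4 - g$4 * h$2 = t \<and> g$3 * h$4 - g$4 * h$3 = u"
proof -
  consider "p\<^sup>2 + q\<^sup>2 + r\<^sup>2 \<noteq> 0" | "p\<^sup>2 + s\<^sup>2 + t\<^sup>2 \<noteq> 0" | "p = 0" "q = 0" "r = 0" "s = 0" "t = 0"
    by (auto simp: add_nonneg_eq_0_iff)
  thus ?thesis
  proof cases
    case 1
    thus ?thesis using ex_orthonormal_pair_bivector_aux[OF assms] by blast
  next
    case 2
    \<comment> \<open>Exchanging the axes 1 and 2 changes the sign of p, swaps (q, r) with (s, t)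
      and keeps u.\<close>
    have "(-p)\<^sup>2 + s\<^sup>2 + t\<^sup>2 + q\<^sup>2 + r\<^sup>2 + u\<^sup>2 = 1" "(-p) * u - s * r + t * q = 0" "(-p)\<^sup>2 + s\<^sup>2 + t\<^sup>2 \<noteq> 0"
      using assms 2 by (auto simp: algebra_simps)
    from ex_orthonormal_pair_bivector_aux[OF this] obtain g h :: "real^4" where gh: "orthonormal_pair g h"
      "g$1 * h$2 - g$2 * h$1 = -p" "g$1 * h$3 - g$3 * h$1 = s" "g$1 * h$4 - g$4 * h$1 = t"
      "g$2 * h$3 - g$3 * h$2 = q" "g$2 * h$4 - g$4 * h$2 = r" "g$3 * h$4 - g$4 * h$3 = u" by blast
    show ?thesis
      by (rule exI[of _ "vector [g$2, g$1, g$3, g$4]"], rule exI[of _ "vector [h$2, h$1, h$3, h$4]"])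
        (use gh in \<open>auto simp: orthonormal_pair_def inner_real4\<close>)
  next
    case 3
    hence "u = 1 \<or> u = -1" using assms(1) by (simp add: power2_eq_1_iff)
    thus ?thesis
      by (intro exI[of _ "vector [0, 0, 1, 0]"] exI[of _ "vector [0, 0, 0, u]"]) (use 3 in \<open>auto simp: orthonormal_pair_def inner_real4\<close>)
  qed
qed

text \<open>Inverts the linear map from Pluecker coordinates to parts. In terms of the parts the
  norm condition reads |a|^2 + |b|^2 = 2 and the Pluecker relation |a|^2 = |b|^2.\<close>

lemma ex_orthonormal_pair_parts:
  assumes "a \<bullet> a = 1" "b \<bullet> b = 1"
  obtains g h where "orthonormal_pair g h" "sd_part g h = a" "asd_part g h = b"
proof -
  define p q r s t u where "p = (a$1 + b$1) / 2" "q = (a$2 + b$2) / 2" "r = (a$3 + b$3) / 2"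
    and "s = (a$3 - b$3) / 2" and "t = (b$2 - a$2) / 2" and "u = (a$1 - b$1) / 2"
  note d = this
  have "p\<^sup>2 + q\<^sup>2 + r\<^sup>2 + s\<^sup>2 + t\<^sup>2 + u\<^sup>2 = 1" "p * u - q * t + r * s = 0"
    using assms by (simp_all add: inner_real3 d power2_eq_square field_simps)
  from ex_orthonormal_pair_bivector[OF this] obtain g h :: "real^4" where gh: "orthonormal_pair g h"
      "g$1 * h$2 - g$2 * h$1 = p" "g$1 * h$3 - g$3 * h$1 = q" "g$1 * h$4 - g$4 * h$1 = r"
      "g$2 * h$3 - g$3 * h$2 = s" "g$2 * h$4 - g$4 * h$2 = t" "g$3 * h$4 - g$4 * h$3 = u" by blast
  have "sd_part g h = a" "asd_part g h = b"
    unfolding sd_part_def asd_part_def gh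
    by (simp_all add: d field_simps) (simp_all add: Finite_Cartesian_Product.vec_eq_iff forall_3)
  with gh(1) that show ?thesis by blast
qed

section \<open>Principal angles in terms of the two unit vectors\<close>

lemma orthonormal_frameD:
  assumes "orthonormal_frame P A"
  shows "orthonormal_pair (column 1 A) (column 2 A)" "P = span {column 1 A, column 2 A}"
proof -
  have "(transpose A ** A) $ i $ j = column i A \<bullet> column j A" for i j
    by (simp add: matrix_matrix_mult_def transpose_def column_def inner_vec_def)
  hence c: "column i A \<bullet> column j A = (if i = j then 1 else 0)" for i j
    using assms by (simp add: orthonormal_frame_def Finite_Cartesian_Product.mat_def)
  show "orthonormal_pair (column 1 A) (column 2 A)" by (simp add: orthonormal_pair_def c)
  have "columns A = {column 1 A, column 2 A}" by (auto simp: columns_def UNIV_2)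
  thus "P = span {column 1 A, column 2 A}" using assms by (simp add: orthonormal_frame_def)
qed

lemma orthonormal_frameI:
  assumes "orthonormal_pair g h"
  defines "A \<equiv> (\<chi> i j. if j = 1 then g $ i else h $ i) :: real^2^4"
  shows "orthonormal_frame (span {g, h}) A" "column 1 A = g" "column 2 A = h"
proof -
  show c: "column 1 A = g" "column 2 A = h" by (simp_all add: A_def column_def)
  have "(transpose A ** A) $ i $ j = column i A \<bullet> column j A" for i j
    by (simp add: matrix_matrix_mult_def transpose_def column_def inner_vec_def)
  hence "transpose A ** A = Finite_Cartesian_Product.mat 1"
    using assms(1) by (simp add: Finite_Cartesian_Product.vec_eq_iff forall_2 c Finite_Cartesian_Product.mat_def orthonormal_pair_def inner_commute)
  moreover have "columns A = {column 1 A, column 2 A}" by (auto simp: columns_def UNIV_2)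
  ultimately show "orthonormal_frame (span {g, h}) A" by (simp add: orthonormal_frame_def c)
qed

text \<open>Vieta's relations for the characteristic polynomial of M^T M, whose trace is the sum of
  the squared entries and whose determinant is the squared determinant of \<open>M\<close>.\<close>

lemma singular_values_iff:
  "singular_values M s t \<longleftrightarrow> t \<le> s \<and> 0 \<le> t \<and>
     s\<^sup>2 + t\<^sup>2 = (M$1$1)\<^sup>2 + (M$1$2)\<^sup>2 + (M$2$1)\<^sup>2 + (M$2$2)\<^sup>2 \<and>
     s\<^sup>2 * t\<^sup>2 = (M$1$1 * M$2$2 - M$1$2 * M$2$1)\<^sup>2"
proof -
  define E D where "E = (M$1$1)\<^sup>2 + (M$1$2)\<^sup>2 + (M$2$1)\<^sup>2 + (M$2$2)\<^sup>2" and "D = (M$1$1 * M$2$2 - M$1$2 * M$2$1)\<^sup>2"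
  have "Determinants.det (Finite_Cartesian_Product.mat z - transpose M ** M) = z\<^sup>2 - E * z + D" for z
    by (simp add: det_2 matrix_matrix_mult_def transpose_def sum_2 Finite_Cartesian_Product.mat_def E_def D_def algebra_simps power2_eq_square)
  moreover have "(\<forall>z. z\<^sup>2 - E * z + D = (z - s\<^sup>2) * (z - t\<^sup>2)) \<longleftrightarrow> s\<^sup>2 + t\<^sup>2 = E \<and> s\<^sup>2 * t\<^sup>2 = D"
  proof
    assume *: "\<forall>z. z\<^sup>2 - E * z + D = (z - s\<^sup>2) * (z - t\<^sup>2)"
    show "s\<^sup>2 + t\<^sup>2 = E \<and> s\<^sup>2 * t\<^sup>2 = D" using *[rule_format, of 0] *[rule_format, of 1] by (simp add: algebra_simps)
  next
    assume "s\<^sup>2 + t\<^sup>2 = E \<and> s\<^sup>2 * t\<^sup>2 = D"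
    thus "\<forall>z. z\<^sup>2 - E * z + D = (z - s\<^sup>2) * (z - t\<^sup>2)" by (auto simp: algebra_simps power2_eq_square)
  qed
  ultimately show ?thesis by (auto simp: singular_values_def E_def D_def)
qed

text \<open>Both sides are the inner product with \<open>v\<close> of the projection of
  \<open>u\<close>, which depends on the plane alone.\<close>

lemma span_pair_quadratic:
  assumes "orthonormal_pair g h" "orthonormal_pair k l" "span {g, h} = span {k, l}"
  shows "(g \<bullet> u) * (g \<bullet> v) + (h \<bullet> u) * (h \<bullet> v) = (k \<bullet> u) * (k \<bullet> v) + (l \<bullet> u) * (l \<bullet> (v :: 'a::euclidean_space))"
proof -
  have "closest_point (span {g, h}) u \<bullet> v = closest_point (span {k, l}) u \<bullet> v" by (simp add: assms(3))
  thus ?thesis using assms(1,2) by (simp add: closest_point_pair inner_add_left inner_commute[of u])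
qed

text \<open>Both quantities are polynomials in the form of \<open>span_pair_quadratic\<close>; for
  the squared minor this is Lagrange's identity.\<close>

lemma span_pair_gram:
  assumes "orthonormal_pair g h" "orthonormal_pair k l" "span {g, h} = span {k, l}"
  shows "(g \<bullet> u)\<^sup>2 + (g \<bullet> v)\<^sup>2 + (h \<bullet> u)\<^sup>2 + (h \<bullet> v)\<^sup>2 = (k \<bullet> u)\<^sup>2 + (k \<bullet> v)\<^sup>2 + (l \<bullet> u)\<^sup>2 + (l \<bullet> v)\<^sup>2"
    "((g \<bullet> u) * (h \<bullet> v) - (g \<bullet> v) * (h \<bullet> u))\<^sup>2 = ((k \<bullet> u) * (l \<bullet> v) - (k \<bullet> v) * (l \<bullet> (u :: 'a::euclidean_space)))\<^sup>2"
proof -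
  note q = span_pair_quadratic[OF assms]
  show "(g \<bullet> u)\<^sup>2 + (g \<bullet> v)\<^sup>2 + (h \<bullet> u)\<^sup>2 + (h \<bullet> v)\<^sup>2 = (k \<bullet> u)\<^sup>2 + (k \<bullet> v)\<^sup>2 + (l \<bullet> u)\<^sup>2 + (l \<bullet> v)\<^sup>2"
    using q[of u u] q[of v v] by (simp add: power2_eq_square)
  have *: "(a * d - b * c)\<^sup>2 = (a * a + c * c) * (b * b + d * d) - (a * b + c * d)\<^sup>2" for a b c d :: real
    by (simp add: algebra_simps power2_eq_square)
  show "((g \<bullet> u) * (h \<bullet> v) - (g \<bullet> v) * (h \<bullet> u))\<^sup>2 = ((k \<bullet> u) * (l \<bullet> v) - (k \<bullet> v) * (l \<bullet> u))\<^sup>2"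
    unfolding * by (simp add: q)
qed

text \<open>The conditions of \<open>singular_values_iff\<close> do not change with the frame, by
  \<open>span_pair_gram\<close> in each plane, so they may be evaluated at the given pairs.\<close>

lemma principal_angles_iff:
  assumes "orthonormal_pair g h" "orthonormal_pair k l"
  shows "(\<exists>A B. orthonormal_frame (span {g, h}) A \<and> orthonormal_frame (span {k, l}) B \<and>
        singular_values (transpose A ** B) s t) \<longleftrightarrow>
     t \<le> s \<and> 0 \<le> t \<and> s\<^sup>2 + t\<^sup>2 = (g \<bullet> k)\<^sup>2 + (g \<bullet> l)\<^sup>2 + (h \<bullet> k)\<^sup>2 + (h \<bullet> l)\<^sup>2 \<and>
     s\<^sup>2 * t\<^sup>2 = ((g \<bullet> k) * (h \<bullet> l) - (g \<bullet> l) * (h \<bullet> k))\<^sup>2" (is "?L \<longleftrightarrow> ?R")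
proof -
  have M: "(transpose A ** B) $ i $ j = column i A \<bullet> column j B" for A B :: "real^2^4" and i j
    by (simp add: matrix_matrix_mult_def transpose_def column_def inner_vec_def)
  show ?thesis
  proof
    assume ?L
    then obtain A B where AB: "orthonormal_frame (span {g, h}) A" "orthonormal_frame (span {k, l}) B"
      "singular_values (transpose A ** B) s t" by blast
    note a = orthonormal_frameD[OF AB(1)] and b = orthonormal_frameD[OF AB(2)]
    note 1 = span_pair_gram[OF assms(1) a(1) a(2)] and 2 = span_pair_gram[OF assms(2) b(1) b(2)]
    have e: "(g \<bullet> k)\<^sup>2 + (g \<bullet> l)\<^sup>2 + (h \<bullet> k)\<^sup>2 + (h \<bullet> l)\<^sup>2 =
      (column 1 A \<bullet> column 1 B)\<^sup>2 + (column 1 A \<bullet> column 2 B)\<^sup>2 + (column 2 A \<bullet> column 1 B)\<^sup>2 + (column 2 A \<bullet> column 2 B)\<^sup>2"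
      using 1(1)[of k l] 2(1)[of "column 1 A" "column 2 A"] by (simp add: inner_commute)
    have d: "((g \<bullet> k) * (h \<bullet> l) - (g \<bullet> l) * (h \<bullet> k))\<^sup>2 =
      ((column 1 A \<bullet> column 1 B) * (column 2 A \<bullet> column 2 B) - (column 1 A \<bullet> column 2 B) * (column 2 A \<bullet> column 1 B))\<^sup>2"
      using 1(2)[of k l] 2(2)[of "column 1 A" "column 2 A"] by (simp add: inner_commute mult.commute)
    show ?R using AB(3) unfolding singular_values_iff M e d .
  next
    assume ?R
    hence "singular_values (transpose (\<chi> i j. if j = 1 then g $ i else h $ i) ** (\<chi> i j. if j = 1 then k $ i else l $ i)) s t"
      unfolding singular_values_iff M orthonormal_frameI[OF assms(1)] orthonormal_frameI[OF assms(2)] .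
    thus ?L using orthonormal_frameI(1)[OF assms(1)] orthonormal_frameI(1)[OF assms(2)] by blast
  qed
qed

lemma sum_prod_unique:
  fixes s t s' t' :: real
  assumes "0 \<le> t" "t \<le> s" "0 \<le> t'" "t' \<le> s'" "s\<^sup>2 + t\<^sup>2 = s'\<^sup>2 + t'\<^sup>2" "s\<^sup>2 * t\<^sup>2 = s'\<^sup>2 * t'\<^sup>2"
  shows "s = s'" "t = t'"
proof -
  have st: "s * t = s' * t'"
    using assms by (intro power2_eq_imp_eq[of "s * t"]) (auto simp: power_mult_distrib)
  have "s + t = s' + t'"
    using assms st by (intro power2_eq_imp_eq[of "s + t"]) (auto simp: power2_sum)
  moreover have "s - t = s' - t'"
    using assms st by (intro power2_eq_imp_eq[of "s - t"]) (auto simp: power2_diff)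
  ultimately show "s = s'" "t = t'" by linarith+
qed

text \<open>\<beta> is the sum and \<alpha> the difference of the angles. The product of the cosines
  is |x + y| / 2 by the Gram determinant and the sum of their squares is 1 + x y by the trace; the
  two arguments of arccos are the resulting values of cos (\<theta>2 - \<theta>1) and cos (\<theta>1
  + \<theta>2).\<close>

lemma principal_angles_parts:
  assumes "orthonormal_pair g h" "orthonormal_pair k l"
  defines "x \<equiv> sd_part g h \<bullet> sd_part k l" and "y \<equiv> asd_part g h \<bullet> asd_part k l"
  defines "\<alpha> \<equiv> arccos ((\<bar>x + y\<bar> + \<bar>x - y\<bar>) / 2)" and "\<beta> \<equiv> arccos ((\<bar>x + y\<bar> - \<bar>x - y\<bar>) / 2)"
  shows "principal_angles (span {g, h}) (span {k, l}) = ((\<beta> - \<alpha>) / 2, (\<beta> + \<alpha>) / 2)"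
    "\<bar>x\<bar> \<le> 1" "\<bar>y\<bar> \<le> 1"
proof -
  have "\<bar>u \<bullet> v\<bar> \<le> 1" if "u \<bullet> u = 1" "v \<bullet> v = 1" for u v :: "real^3"
    using Cauchy_Schwarz_ineq2[of u v] that[folded norm_eq_1] by simp
  thus xy: "\<bar>x\<bar> \<le> 1" "\<bar>y\<bar> \<le> 1"
    unfolding x_def y_def using parts_unit[OF assms(1)] parts_unit[OF assms(2)] by auto
  define m p where "m = (\<bar>x + y\<bar> + \<bar>x - y\<bar>) / 2" and "p = (\<bar>x + y\<bar> - \<bar>x - y\<bar>) / 2"
  have mp: "p \<le> m" "- m \<le> p" "m \<le> 1" "-1 \<le> p" "0 \<le> m"
    using xy unfolding m_def p_def by (simp_all add: field_simps)
  have c: "cos \<alpha> = m" "cos \<beta> = p" "0 \<le> \<alpha>" "\<beta> \<le> pi" "\<alpha> \<le> \<beta>"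
    using mp unfolding \<alpha>_def \<beta>_def m_def[symmetric] p_def[symmetric]
    by (auto intro!: arccos_lbound arccos_ubound arccos_le_arccos)
  \<comment> \<open>Guarantees \<theta>2 \<le> pi / 2: the inequality p \<ge> - m forces \<alpha> +
    \<beta> \<le> pi.\<close>
  have "\<beta> \<le> arccos (- m)" using mp unfolding \<beta>_def p_def[symmetric] by (intro arccos_le_arccos) auto
  also have "\<dots> = pi - \<alpha>" unfolding \<alpha>_def m_def[symmetric] using mp by (intro arccos_minus) auto
  finally have ab: "\<beta> + \<alpha> \<le> pi" by simp
  define \<theta>1 \<theta>2 where "\<theta>1 = (\<beta> - \<alpha>) / 2" and "\<theta>2 = (\<beta> + \<alpha>) / 2"
  have th: "0 \<le> \<theta>1" "\<theta>1 \<le> \<theta>2" "\<theta>2 \<le> pi / 2" using c ab by (auto simp: \<theta>1_def \<theta>2_def)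
  have d: "\<theta>1 + \<theta>2 = \<beta>" "\<theta>2 - \<theta>1 = \<alpha>" by (auto simp: \<theta>1_def \<theta>2_def field_simps)
  have cc: "cos \<theta>1 * cos \<theta>2 = (m + p) / 2"
    using cos_times_cos[of \<theta>2 \<theta>1] d c by (simp add: add.commute mult.commute)
  have ss: "sin \<theta>1 * sin \<theta>2 = (m - p) / 2"
    using sin_times_sin[of \<theta>2 \<theta>1] d c by (simp add: add.commute mult.commute)
  have sq: "(cos \<theta>1)\<^sup>2 + (cos \<theta>2)\<^sup>2 = 1 + m * p"
  proof -
    have "((cos \<theta>1)\<^sup>2 + (cos \<theta>2)\<^sup>2) = 1 + (cos \<theta>1 * cos \<theta>2)\<^sup>2 - (sin \<theta>1 * sin \<theta>2)\<^sup>2"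
      by (simp add: power_mult_distrib sin_squared_eq algebra_simps)
    thus ?thesis unfolding cc ss by (simp add: power2_eq_square field_simps)
  qed
  have e: "(g \<bullet> k)\<^sup>2 + (g \<bullet> l)\<^sup>2 + (h \<bullet> k)\<^sup>2 + (h \<bullet> l)\<^sup>2 = (cos \<theta>1)\<^sup>2 + (cos \<theta>2)\<^sup>2"
  proof -
    have "m * p = (\<bar>x + y\<bar>\<^sup>2 - \<bar>x - y\<bar>\<^sup>2) / 4" unfolding m_def p_def
      by (simp only: power2_eq_square times_divide_times_eq square_diff_square_factored mult.commute)
    also have "\<dots> = x * y" unfolding power2_abs by (simp add: power2_eq_square field_simps)
    finally show ?thesis unfolding sq using sd_asd_parts_inner_mult[OF assms(1,2)] by (simp add: x_def y_def)
  qed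
  have f: "((g \<bullet> k) * (h \<bullet> l) - (g \<bullet> l) * (h \<bullet> k))\<^sup>2 = (cos \<theta>1)\<^sup>2 * (cos \<theta>2)\<^sup>2"
  proof -
    have "m + p = \<bar>x + y\<bar>" by (simp add: m_def p_def field_simps)
    hence "(cos \<theta>1)\<^sup>2 * (cos \<theta>2)\<^sup>2 = ((x + y) / 2)\<^sup>2" unfolding power_mult_distrib[symmetric] cc by (simp add: power_divide)
    also have "(x + y) / 2 = (g \<bullet> k) * (h \<bullet> l) - (g \<bullet> l) * (h \<bullet> k)"
      using sd_asd_parts_inner_add[of g h k l] by (simp add: x_def y_def)
    finally show ?thesis by simp
  qed
  have cm: "cos \<theta>2' \<le> cos \<theta>1'" "0 \<le> cos \<theta>2'" if "0 \<le> \<theta>1'" "\<theta>1' \<le> \<theta>2'" "\<theta>2' \<le> pi / 2" for \<theta>1' \<theta>2'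
    using that by (auto intro!: cos_monotone_0_pi_le cos_ge_zero)
  show "principal_angles (span {g, h}) (span {k, l}) = ((\<beta> - \<alpha>) / 2, (\<beta> + \<alpha>) / 2)"
    unfolding principal_angles_def principal_angles_iff[OF assms(1,2)] \<theta>1_def[symmetric] \<theta>2_def[symmetric]
  proof (rule the_equality, goal_cases)
    case 1
    thus ?case using th cm[OF th] e f by simp
  next
    case (2 z)
    obtain \<theta>1' \<theta>2' where z: "z = (\<theta>1', \<theta>2')" by (cases z)
    have th': "0 \<le> \<theta>1'" "\<theta>1' \<le> \<theta>2'" "\<theta>2' \<le> pi / 2" using 2 by (auto simp: z)
    have "cos \<theta>1' = cos \<theta>1" "cos \<theta>2' = cos \<theta>2"
      using 2 sum_prod_unique[OF cm(2)[OF th'] cm(1)[OF th'] cm(2)[OF th] cm(1)[OF th]] by (auto simp: z e f)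
    hence "\<theta>1' = \<theta>1" "\<theta>2' = \<theta>2" using th th' by (auto intro!: cos_inj_pi)
    thus ?case by (simp add: z)
  qed
qed

text \<open>The larger of |x| and |y| becomes \<xi>_-, and \<xi>_+ is the smaller one with the sign
  of x y.\<close>

lemma xi_parts:
  assumes "orthonormal_pair g h" "orthonormal_pair k l"
  defines "x \<equiv> sd_part g h \<bullet> sd_part k l" and "y \<equiv> asd_part g h \<bullet> asd_part k l"
  shows "xi_minus (span {g, h}) (span {k, l}) = (\<bar>x + y\<bar> + \<bar>x - y\<bar>) / 2"
    "xi_plus (span {g, h}) (span {k, l}) = (\<bar>x + y\<bar> - \<bar>x - y\<bar>) / 2"
proof -
  note pa = principal_angles_parts[OF assms(1,2), folded x_def y_def]
  define m p where "m = (\<bar>x + y\<bar> + \<bar>x - y\<bar>) / 2" and "p = (\<bar>x + y\<bar> - \<bar>x - y\<bar>) / 2"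
  have mp: "-1 \<le> m" "m \<le> 1" "-1 \<le> p" "p \<le> 1" using pa(2,3) unfolding m_def p_def by (simp_all add: field_simps)
  have "(arccos p - arccos m) / 2 - (arccos p + arccos m) / 2 = - arccos m"
    "(arccos p - arccos m) / 2 + (arccos p + arccos m) / 2 = arccos p" by (simp_all add: field_simps)
  thus "xi_minus (span {g, h}) (span {k, l}) = (\<bar>x + y\<bar> + \<bar>x - y\<bar>) / 2"
    "xi_plus (span {g, h}) (span {k, l}) = (\<bar>x + y\<bar> - \<bar>x - y\<bar>) / 2"
    using mp unfolding xi_minus_def xi_plus_def pa(1) m_def[symmetric] p_def[symmetric] by simp_all
qed

lemma xi_parts_cases:
  assumes "orthonormal_pair g h" "orthonormal_pair k l"
  defines "x \<equiv> sd_part g h \<bullet> sd_part k l" and "y \<equiv> asd_part g h \<bullet> asd_part k l"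
    and "p \<equiv> xi_plus (span {g, h}) (span {k, l})" and "m \<equiv> xi_minus (span {g, h}) (span {k, l})"
  shows "p = x \<and> m = y \<or> p = y \<and> m = x \<or> p = - x \<and> m = - y \<or> p = - y \<and> m = - x"
  unfolding p_def m_def xi_parts[OF assms(1,2), folded x_def y_def] by (simp add: field_simps abs_if)

text \<open>Up to the symmetries of the kernels, the pair of cosines is the pair of inner products on
  the two spheres.\<close>

lemma xi_symmetric_fun:
  assumes "\<And>x y. f x y = f y x" "\<And>x y. f (- x) (- y) = f x y"
    and "orthonormal_pair g h" "orthonormal_pair k l"
  shows "f (xi_plus (span {g, h}) (span {k, l})) (xi_minus (span {g, h}) (span {k, l})) =
    f (sd_part g h \<bullet> sd_part k l) (asd_part g h \<bullet> asd_part k l)"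
  using xi_parts_cases[OF assms(3,4)] assms(1,2) by metis

lemma chordal_dist_xi: "chordal_dist P Q = sqrt (1 - xi_plus P Q * xi_minus P Q)"
proof -
  obtain s t where st: "principal_angles P Q = (s, t)" by (cases "principal_angles P Q")
  have "cos (s + t) * cos (s - t) = (cos s * cos t)\<^sup>2 - (sin s * sin t)\<^sup>2"
    by (simp add: cos_add cos_diff algebra_simps power2_eq_square)
  also have "\<dots> = 1 - ((sin s)\<^sup>2 + (sin t)\<^sup>2)" by (simp add: power_mult_distrib cos_squared_eq algebra_simps)
  finally show ?thesis by (simp add: chordal_dist_def xi_plus_def xi_minus_def st)
qed

lemma xi_le_1: "\<bar>xi_plus P Q\<bar> \<le> 1" "\<bar>xi_minus P Q\<bar> \<le> 1"
  by (auto simp: xi_plus_def xi_minus_def split: prod.splits)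

lemma xi_prod_le_1: "\<bar>xi_plus P Q * xi_minus P Q\<bar> \<le> 1"
  unfolding abs_mult using xi_le_1[of P Q] by (intro mult_le_one) auto

lemma ln_chordal_dist: "ln (chordal_dist P Q) = 1 / 2 * ln (1 - xi_plus P Q * xi_minus P Q)"
  using xi_prod_le_1[of P Q] by (cases "xi_plus P Q * xi_minus P Q = 1") (auto simp: chordal_dist_xi ln_sqrt)

text \<open>Places the Grassmannian on the unit sphere of a Euclidean space whose inner product is
  \<xi>_+ \<xi>_-, so that the powers of this product are positive definite kernels.\<close>

definition traceless :: "(real^4) set \<Rightarrow> real^4^4" where
  "traceless P = proj_matrix P - (1 / 2) *\<^sub>R Finite_Cartesian_Product.mat 1"

lemma xi_prod_traceless:
  assumes "P \<in> Gr24" "Q \<in> Gr24"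
  shows "xi_plus P Q * xi_minus P Q = traceless P \<bullet> traceless Q"
proof -
  obtain g h where P: "orthonormal_pair g h" "P = span {g, h}" using Gr24_obtain_pair[OF assms(1)] .
  obtain k l where Q: "orthonormal_pair k l" "Q = span {k, l}" using Gr24_obtain_pair[OF assms(2)] .
  have "traceless P \<bullet> traceless Q = (\<Sum>i\<in>UNIV. \<Sum>j\<in>UNIV. (g$i * g$j + h$i * h$j) * (k$i * k$j + l$i * l$j))
    - 1 / 2 * (g \<bullet> g + h \<bullet> h) - 1 / 2 * (k \<bullet> k + l \<bullet> l) + 1"
    by (simp add: inner_vec_def traceless_def P(2) Q(2) proj_matrix_pair[OF P(1)] proj_matrix_pair[OF Q(1)]
        Finite_Cartesian_Product.mat_def sum_4 algebra_simps)
  also have "\<dots> = (g \<bullet> k)\<^sup>2 + (g \<bullet> l)\<^sup>2 + (h \<bullet> k)\<^sup>2 + (h \<bullet> l)\<^sup>2 - 1 / 2 * (g \<bullet> g + h \<bullet> h) - 1 / 2 * (k \<bullet> k + l \<bullet> l) + 1"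
    by (simp add: inner_real4 sum_4 algebra_simps power2_eq_square)
  also have "\<dots> = (sd_part g h \<bullet> sd_part k l) * (asd_part g h \<bullet> asd_part k l)"
    using P(1) Q(1) sd_asd_parts_inner_mult[OF P(1) Q(1)] by (simp add: orthonormal_pair_def)
  also have "\<dots> = xi_plus P Q * xi_minus P Q"
    unfolding P(2) Q(2) by (rule xi_symmetric_fun[OF _ _ P(1) Q(1), symmetric]) (auto simp: mult.commute)
  finally show ?thesis ..
qed

lemma xi_commute:
  assumes "P \<in> Gr24" "Q \<in> Gr24"
  shows "xi_plus P Q = xi_plus Q P" "xi_minus P Q = xi_minus Q P"
proof -
  obtain g h where P: "orthonormal_pair g h" "P = span {g, h}" using Gr24_obtain_pair[OF assms(1)] .
  obtain k l where Q: "orthonormal_pair k l" "Q = span {k, l}" using Gr24_obtain_pair[OF assms(2)] .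
  show "xi_plus P Q = xi_plus Q P" "xi_minus P Q = xi_minus Q P"
    unfolding P(2) Q(2) xi_parts[OF P(1) Q(1)] xi_parts[OF Q(1) P(1)] by (simp_all add: inner_commute)
qed

lemma xi_self:
  assumes "P \<in> Gr24"
  shows "xi_plus P P = 1" "xi_minus P P = 1"
proof -
  obtain g h where P: "orthonormal_pair g h" "P = span {g, h}" using Gr24_obtain_pair[OF assms(1)] .
  show "xi_plus P P = 1" "xi_minus P P = 1"
    unfolding P(2) xi_parts[OF P(1) P(1)] by (simp_all add: parts_unit[OF P(1)])
qed

text \<open>\<xi>_+ and \<xi>_- are the roots of X^2 - 2 s X + e - 1. Unlike the two parts, s and e
  are visibly preserved by orthogonal maps.\<close>

lemma xi_frame:
  assumes "orthonormal_pair g h" "orthonormal_pair k l"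
  defines "s \<equiv> \<bar>(g \<bullet> k) * (h \<bullet> l) - (g \<bullet> l) * (h \<bullet> k)\<bar>"
    and "e \<equiv> (g \<bullet> k)\<^sup>2 + (g \<bullet> l)\<^sup>2 + (h \<bullet> k)\<^sup>2 + (h \<bullet> l)\<^sup>2"
  shows "xi_minus (span {g, h}) (span {k, l}) = s + sqrt (s\<^sup>2 + 1 - e)"
    "xi_plus (span {g, h}) (span {k, l}) = s - sqrt (s\<^sup>2 + 1 - e)"
proof -
  define x y where "x = sd_part g h \<bullet> sd_part k l" and "y = asd_part g h \<bullet> asd_part k l"
  have xy: "x + y = 2 * ((g \<bullet> k) * (h \<bullet> l) - (g \<bullet> l) * (h \<bullet> k))"
    using sd_asd_parts_inner_add[of g h k l] by (simp add: x_def y_def)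
  have s: "s = \<bar>x + y\<bar> / 2" unfolding xy s_def abs_mult by simp
  have e: "e = 1 + x * y" using sd_asd_parts_inner_mult[OF assms(1,2)] by (simp add: e_def x_def y_def)
  have "s\<^sup>2 + 1 - e = ((x - y) / 2)\<^sup>2" unfolding s e power_divide power2_abs by (simp add: power2_eq_square field_simps)
  hence "sqrt (s\<^sup>2 + 1 - e) = \<bar>x - y\<bar> / 2" by simp
  thus "xi_minus (span {g, h}) (span {k, l}) = s + sqrt (s\<^sup>2 + 1 - e)"
    "xi_plus (span {g, h}) (span {k, l}) = s - sqrt (s\<^sup>2 + 1 - e)"
    unfolding xi_parts[OF assms(1,2), folded x_def y_def] s by (simp_all add: field_simps)
qed

section \<open>The action of the orthogonal group\<close>

lemma orthogonal_transformation_pair: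
  assumes "orthogonal_transformation U" "orthonormal_pair g h"
  shows "orthonormal_pair (U g) (U h)" "U ` span {g, h} = span {U g, U h}"
  using assms by (auto simp: orthogonal_transformation_def orthonormal_pair_def linear_span_image[symmetric])

lemma orthogonal_transformation_Gr24:
  assumes "orthogonal_transformation U" "P \<in> Gr24"
  shows "U ` P \<in> Gr24"
proof -
  obtain g h where P: "orthonormal_pair g h" "P = span {g, h}" using Gr24_obtain_pair[OF assms(2)] .
  show ?thesis unfolding P(2) orthogonal_transformation_pair(2)[OF assms(1) P(1)]
    by (rule span_orthonormal_pair_Gr24[OF orthogonal_transformation_pair(1)[OF assms(1) P(1)]])
qed

lemma xi_orthogonal_transformation:
  assumes "orthogonal_transformation U" "P \<in> Gr24" "Q \<in> Gr24"
  shows "xi_plus (U ` P) (U ` Q) = xi_plus P Q" "xi_minus (U ` P) (U ` Q) = xi_minus P Q"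
proof -
  obtain g h where P: "orthonormal_pair g h" "P = span {g, h}" using Gr24_obtain_pair[OF assms(2)] .
  obtain k l where Q: "orthonormal_pair k l" "Q = span {k, l}" using Gr24_obtain_pair[OF assms(3)] .
  note U = orthogonal_transformation_pair[OF assms(1)]
  have "U v \<bullet> U w = v \<bullet> w" for v w using assms(1) by (simp add: orthogonal_transformation_def)
  thus "xi_plus (U ` P) (U ` Q) = xi_plus P Q" "xi_minus (U ` P) (U ` Q) = xi_minus P Q"
    unfolding P(2) Q(2) U(2)[OF P(1)] U(2)[OF Q(1)] xi_frame[OF P(1) Q(1)] xi_frame[OF U(1)[OF P(1)] U(1)[OF Q(1)]]
    by simp_all
qed

definition householder :: "'a::euclidean_space \<Rightarrow> 'a \<Rightarrow> 'a" where
  "householder u x = x - (2 * (x \<bullet> u) / (u \<bullet> u)) *\<^sub>R u"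

lemma orthogonal_transformation_householder: "orthogonal_transformation (householder u)"
  unfolding orthogonal_transformation_def
proof (intro conjI allI)
  show "linear (householder u)"
    by (rule linearI) (auto simp: householder_def inner_add_left algebra_simps add_divide_distrib)
  show "householder u v \<bullet> householder u w = v \<bullet> w" for v w
    by (cases "u = 0") (auto simp: householder_def inner_diff_left inner_diff_right inner_commute field_simps)
qed

lemma householder_swap:
  assumes "norm x = norm y"
  shows "householder (x - y) x = y"
proof (cases "x = y")
  case False
  have "x \<bullet> x = y \<bullet> y" using assms by (simp add: dot_square_norm)
  hence "2 * (x \<bullet> (x - y)) = (x - y) \<bullet> (x - y)" by (simp add: inner_diff_left inner_diff_right inner_commute)
  thus ?thesis using False by (simp add: householder_def)
qed (simp add: householder_def)

lemma householder_fix: "x \<bullet> u = 0 \<Longrightarrow> householder u x = x"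
  by (simp add: householder_def)

text \<open>Two reflections suffice: the first takes g to k; the second takes the image of h to l
  and fixes k, which is orthogonal to both.\<close>

lemma orthogonal_transitive_Gr24:
  assumes "P \<in> Gr24" "Q \<in> Gr24"
  obtains U where "orthogonal_transformation U" "U ` P = Q"
proof -
  obtain g h where P: "orthonormal_pair g h" "P = span {g, h}" using Gr24_obtain_pair[OF assms(1)] .
  obtain k l where Q: "orthonormal_pair k l" "Q = span {k, l}" using Gr24_obtain_pair[OF assms(2)] .
  define R where "R = householder (g - k)"
  have R: "orthogonal_transformation R" "R g = k"
    unfolding R_def using P(1) Q(1)
    by (auto intro!: orthogonal_transformation_householder householder_swap simp: orthonormal_pair_def norm_eq_sqrt_inner)
  define S where "S = householder (R h - l)"
  have Rp: "orthonormal_pair k (R h)" using orthogonal_transformation_pair(1)[OF R(1) P(1)] by (simp add: R)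
  have S: "orthogonal_transformation S" "S (R h) = l" "S k = k"
    unfolding S_def using Rp Q(1)
    by (auto intro!: orthogonal_transformation_householder householder_swap householder_fix
        simp: orthonormal_pair_def norm_eq_sqrt_inner inner_diff_right)
  have U: "orthogonal_transformation (S \<circ> R)" by (intro orthogonal_transformation_compose S R)
  show ?thesis
    by (rule that[OF U], unfold P(2) Q(2) orthogonal_transformation_pair(2)[OF U P(1)]) (simp add: R S)
qed

section \<open>The distribution of the principal angles\<close>

lemma space_Gr24_borel [simp]: "space Gr24_borel = Gr24"
  by (simp add: Gr24_borel_def)

lemma measurable_proj_matrix [measurable]: "proj_matrix \<in> Gr24_borel \<rightarrow>\<^sub>M borel"
  unfolding Gr24_borel_def by (rule measurable_vimage_algebra1) simp

lemma borel_measurable_matrixI: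
  fixes f :: "'b \<Rightarrow> real^'n^'m"
  assumes "\<And>i j. (\<lambda>x. f x $ i $ j) \<in> borel_measurable M"
  shows "f \<in> borel_measurable M"
  unfolding borel_measurable_euclidean_space[of f] using assms by (auto simp: Basis_vec_def inner_axis)

lemma borel_measurable_nth [measurable (raw)]:
  fixes f :: "'b \<Rightarrow> 'a::euclidean_space^'n"
  assumes "f \<in> borel_measurable M"
  shows "(\<lambda>x. f x $ i) \<in> borel_measurable M"
  by (rule borel_measurable_continuous_on[OF _ assms]) (intro continuous_intros)

lemma measurable_traceless [measurable]: "traceless \<in> Gr24_borel \<rightarrow>\<^sub>M borel"
  unfolding traceless_def by measurable

lemma measurable_into_Gr24:
  assumes "\<And>x. x \<in> space M \<Longrightarrow> f x \<in> Gr24"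
    and "\<And>i j. (\<lambda>x. proj_matrix (f x) $ i $ j) \<in> borel_measurable M"
  shows "f \<in> M \<rightarrow>\<^sub>M Gr24_borel"
  unfolding Gr24_borel_def
  using assms by (intro measurable_vimage_algebra2 borel_measurable_matrixI) auto

text \<open>\<open>s\<close> and \<open>e\<close> of \<open>xi_frame\<close> rewritten through the
  entries and 2 by 2 minors of the projection matrices, a form that is manifestly measurable in the
  two planes. The quadruple sum is the square of twice the Gram determinant, hence the division by
  2.\<close>

lemma xi_proj_matrix:
  assumes "P \<in> Gr24" "Q \<in> Gr24"
  defines "p \<equiv> \<lambda>i j. proj_matrix P $ i $ j" and "q \<equiv> \<lambda>i j. proj_matrix Q $ i $ j"
  defines "s \<equiv> sqrt (\<Sum>i\<in>UNIV. \<Sum>j\<in>UNIV. \<Sum>m\<in>UNIV. \<Sum>n\<in>UNIV. (p i m * p j n - p i n * p j m) * (q i m * q j n - q i n * q j m)) / 2"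
    and "e \<equiv> \<Sum>i\<in>UNIV. \<Sum>j\<in>UNIV. p i j * q i j"
  shows "xi_minus P Q = s + sqrt (s\<^sup>2 + 1 - e)" "xi_plus P Q = s - sqrt (s\<^sup>2 + 1 - e)"
proof -
  obtain g h where P: "orthonormal_pair g h" "P = span {g, h}" using Gr24_obtain_pair[OF assms(1)] .
  obtain k l where Q: "orthonormal_pair k l" "Q = span {k, l}" using Gr24_obtain_pair[OF assms(2)] .
  have p: "p i j = g$i * g$j + h$i * h$j" and q: "q i j = k$i * k$j + l$i * l$j" for i j
    by (simp_all add: p_def q_def P(2) Q(2) proj_matrix_pair[OF P(1)] proj_matrix_pair[OF Q(1)])
  have e: "e = (g \<bullet> k)\<^sup>2 + (g \<bullet> l)\<^sup>2 + (h \<bullet> k)\<^sup>2 + (h \<bullet> l)\<^sup>2"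
    by (simp add: e_def p q inner_real4 sum_4 algebra_simps power2_eq_square)
  define u where "u = (\<lambda>i j. (g$i * h$j - g$j * h$i) * (k$i * l$j - k$j * l$i))"
  have m: "p i m * p j n - p i n * p j m = (g$i * h$j - g$j * h$i) * (g$m * h$n - g$n * h$m)"
    "q i m * q j n - q i n * q j m = (k$i * l$j - k$j * l$i) * (k$m * l$n - k$n * l$m)" for i j m n
    unfolding p q by (simp_all add: algebra_simps)
  have "(\<Sum>i\<in>UNIV. \<Sum>j\<in>UNIV. \<Sum>m\<in>UNIV. \<Sum>n\<in>UNIV. (p i m * p j n - p i n * p j m) * (q i m * q j n - q i n * q j m)) =
     (\<Sum>i\<in>UNIV. \<Sum>j\<in>UNIV. \<Sum>m\<in>UNIV. \<Sum>n\<in>UNIV. u i j * u m n)"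
    unfolding m u_def by (simp add: mult_ac)
  also have "\<dots> = (\<Sum>i\<in>UNIV. \<Sum>j\<in>UNIV. u i j)\<^sup>2"
    by (simp only: power2_eq_square sum_distrib_left[symmetric] sum_distrib_right[symmetric])
  also have "(\<Sum>i\<in>UNIV. \<Sum>j\<in>UNIV. u i j) = 2 * ((g \<bullet> k) * (h \<bullet> l) - (g \<bullet> l) * (h \<bullet> k))"
    by (simp add: u_def sum_4 inner_real4 algebra_simps)
  finally have s: "s = \<bar>(g \<bullet> k) * (h \<bullet> l) - (g \<bullet> l) * (h \<bullet> k)\<bar>" unfolding s_def by (simp only: real_sqrt_abs abs_mult) simp
  show "xi_minus P Q = s + sqrt (s\<^sup>2 + 1 - e)" "xi_plus P Q = s - sqrt (s\<^sup>2 + 1 - e)"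
    unfolding P(2) Q(2) xi_frame[OF P(1) Q(1)] s e by simp_all
qed

lemma measurable_xi [measurable]:
  assumes "f \<in> M \<rightarrow>\<^sub>M Gr24_borel" "g \<in> M \<rightarrow>\<^sub>M Gr24_borel"
  shows "(\<lambda>x. xi_plus (f x) (g x)) \<in> borel_measurable M" "(\<lambda>x. xi_minus (f x) (g x)) \<in> borel_measurable M"
proof -
  note [measurable] = assms
  have *: "f x \<in> Gr24" "g x \<in> Gr24" if "x \<in> space M" for x
    using that measurable_space[OF assms(1)] measurable_space[OF assms(2)] by auto
  show "(\<lambda>x. xi_plus (f x) (g x)) \<in> borel_measurable M"
    by (subst measurable_cong[OF xi_proj_matrix(2)[OF *]]) measurable
  show "(\<lambda>x. xi_minus (f x) (g x)) \<in> borel_measurable M"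
    by (subst measurable_cong[OF xi_proj_matrix(1)[OF *]]) measurable
qed

text \<open>The projection onto the image has the matrix M p M^T, whose entries are linear in those
  of the projection matrix p.\<close>

lemma measurable_orthogonal_image:
  assumes "orthogonal_transformation U"
  shows "(`) U \<in> Gr24_borel \<rightarrow>\<^sub>M Gr24_borel"
proof (rule measurable_into_Gr24)
  show "U ` P \<in> Gr24" if "P \<in> space Gr24_borel" for P
    using orthogonal_transformation_Gr24[OF assms] that by simp
  fix i j :: 4
  define M where "M = matrix U"
  have U: "U v $ n = (\<Sum>m\<in>UNIV. M $ n $ m * v $ m)" for v n
  proof -
    have "U v = M *v v" unfolding M_def using matrix_vector_mul(2)[OF orthogonal_transformation_linear[OF assms]] by metis
    thus ?thesis by (simp add: matrix_vector_mult_def)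
  qed
  have "proj_matrix (U ` P) $ i $ j = (\<Sum>m\<in>UNIV. \<Sum>n\<in>UNIV. M $ i $ m * M $ j $ n * proj_matrix P $ m $ n)"
    if "P \<in> space Gr24_borel" for P
  proof -
    have "P \<in> Gr24" using that by simp
    then obtain g h where P: "orthonormal_pair g h" "P = span {g, h}" by (rule Gr24_obtain_pair)
    show ?thesis
      unfolding P(2) orthogonal_transformation_pair(2)[OF assms P(1)] proj_matrix_pair[OF P(1)]
        proj_matrix_pair[OF orthogonal_transformation_pair(1)[OF assms P(1)]] U
      by (simp add: sum_product sum.distrib algebra_simps)
  qed
  thus "(\<lambda>P. proj_matrix (U ` P) $ i $ j) \<in> borel_measurable Gr24_borel"
    by (subst measurable_cong) measurable
qed

section \<open>Archimedes' theorem: a coordinate on the sphere is uniform\<close>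

text \<open>The tails of the uniform law at levels in (0, 1), the form in which volumes of caps
  deliver them. Together with monotonicity they determine the distribution function.\<close>

definition symmetric_tails :: "real measure \<Rightarrow> bool" where
  "symmetric_tails M \<longleftrightarrow> (\<forall>t. 0 < t \<longrightarrow> t < 1 \<longrightarrow> measure M {t<..} = (1 - t) / 2 \<and> measure M {..<- t} = (1 - t) / 2)"

lemma dense_nonzero: "a < b \<Longrightarrow> \<exists>s. a < s \<and> s < b \<and> s \<noteq> (0 :: real)"
  by (metis dense order.strict_trans order_less_irrefl)

lemma symmetric_tails_cdf:
  assumes "real_distribution M" "symmetric_tails M"
  shows "cdf M t = max 0 (min 1 ((1 + t) / 2))"
proof -
  interpret real_distribution M by fact
  have tails: "measure M {t<..} = (1 - t) / 2" "measure M {..<- t} = (1 - t) / 2" if "0 < t" "t < 1" for t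
    using assms(2) that by (auto simp: symmetric_tails_def)
  have c: "measure M {..s} = (1 + s) / 2" if "0 < s" "s < 1" for s
  proof -
    have "{..s} = space M - {s<..}" by auto
    thus ?thesis using tails(1)[OF that] by (simp only: prob_compl[of "{s<..}"]) (simp add: prob_compl[of "{s<..}", simplified] field_simps)
  qed
  \<comment> \<open>Monotonicity sandwiches the distribution function between values at nearby
    levels \<open>s\<close>; the level 0 is avoided because the tails do not reach it.\<close>
  have up: "cdf M t \<le> (1 + s) / 2" if "t < s" "-1 < s" "s < 1" "s \<noteq> 0" for s t
  proof (cases "s > 0")
    case True
    have "cdf M t \<le> measure M {..s}" unfolding cdf_def by (rule finite_measure_mono) (use that in auto)
    thus ?thesis using c[of s] that True by simp
  next
    case False
    have "cdf M t \<le> measure M {..<s}" unfolding cdf_def by (rule finite_measure_mono) (use that in auto)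
    thus ?thesis using tails(2)[of "- s"] that False by simp
  qed
  have lo: "(1 + s) / 2 \<le> cdf M t" if "s < t" "-1 < s" "s < 1" "s \<noteq> 0" for s t
  proof (cases "s > 0")
    case True
    have "measure M {..s} \<le> cdf M t" unfolding cdf_def by (rule finite_measure_mono) (use that in auto)
    thus ?thesis using c[of s] that True by simp
  next
    case False
    have "measure M {..<s} \<le> cdf M t" unfolding cdf_def by (rule finite_measure_mono) (use that in auto)
    thus ?thesis using tails(2)[of "- s"] that False by simp
  qed
  have c01: "0 \<le> cdf M t" "cdf M t \<le> 1" by (auto simp: cdf_def)
  have "cdf M t \<le> max 0 (min 1 ((1 + t) / 2))"
  proof (cases "t < 1")
    case True
    have "cdf M t \<le> max 0 ((1 + t) / 2) + e" if "e > 0" for e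
    proof -
      define r where "r = max (-1) t"
      have "r < min 1 (r + 2 * e)" using True that by (auto simp: r_def)
      then obtain s where s: "r < s" "s < min 1 (r + 2 * e)" "s \<noteq> 0"
        using dense_nonzero by blast
      have "cdf M t \<le> (1 + s) / 2" using s by (intro up) (auto simp: r_def)
      also have "\<dots> \<le> (1 + r) / 2 + e" using s by (simp add: field_simps)
      also have "(1 + r) / 2 = max 0 ((1 + t) / 2)" by (auto simp: r_def max_def)
      finally show ?thesis .
    qed
    hence "cdf M t \<le> max 0 ((1 + t) / 2)" by (rule field_le_epsilon)
    thus ?thesis using True by (simp add: min_def)
  qed (use c01 in auto)
  moreover have "max 0 (min 1 ((1 + t) / 2)) \<le> cdf M t"
  proof (cases "t > -1")
    case True
    have "min 1 ((1 + t) / 2) \<le> cdf M t + e" if "e > 0" for e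
    proof -
      define r where "r = min 1 t"
      have "max (-1) (r - 2 * e) < r" using True that by (auto simp: r_def)
      then obtain s where s: "max (-1) (r - 2 * e) < s" "s < r" "s \<noteq> 0"
        using dense_nonzero by blast
      have "min 1 ((1 + t) / 2) = (1 + r) / 2" by (auto simp: r_def min_def)
      also have "\<dots> \<le> (1 + s) / 2 + e" using s by (simp add: field_simps)
      also have "(1 + s) / 2 \<le> cdf M t" using s by (intro lo) (auto simp: r_def)
      finally show ?thesis by simp
    qed
    hence "min 1 ((1 + t) / 2) \<le> cdf M t" by (rule field_le_epsilon)
    thus ?thesis using c01 by simp
  qed (use c01 in auto)
  ultimately show ?thesis by (rule antisym)
qed

lemma symmetric_tails_unif: "symmetric_tails unif"
proof -
  have e: "emeasure unif A = ennreal (measure lborel (A \<inter> {-1..1}) / 2)" if "A \<in> sets borel" for A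
  proof -
    have "emeasure unif A = (\<integral>\<^sup>+x. ennreal (1 / 2) * indicator (A \<inter> {-1..1}) x \<partial>lborel)"
      unfolding unif_def using that by (subst emeasure_density) (auto intro!: nn_integral_cong simp: indicator_def)
    also have "\<dots> = ennreal (1 / 2) * emeasure lborel (A \<inter> {-1..1})"
      using that by (subst nn_integral_cmult_indicator) auto
    also have "emeasure lborel (A \<inter> {-1..1}) = ennreal (measure lborel (A \<inter> {-1..1}))"
    proof -
      have "emeasure lborel (A \<inter> {-1..1}) \<le> emeasure lborel {-1..1::real}" by (rule emeasure_mono) auto
      thus ?thesis by (intro emeasure_eq_ennreal_measure) (auto simp: top_unique)
    qed
    also have "ennreal (1 / 2) * ennreal (measure lborel (A \<inter> {-1..1})) = ennreal (1 / 2 * measure lborel (A \<inter> {-1..1}))"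
      by (rule ennreal_mult'[symmetric]) simp
    finally show ?thesis by simp
  qed
  have "measure unif {t<..} = (1 - t) / 2" "measure unif {..<- t} = (1 - t) / 2" if "0 < t" "t < 1" for t
  proof -
    have "{t<..} \<inter> {-1..1} = {t<..1}" "{..<- t} \<inter> {-1..1} = {-1..<- t}" using that by auto
    thus "measure unif {t<..} = (1 - t) / 2" "measure unif {..<- t} = (1 - t) / 2"
      using that by (auto simp: measure_def[of unif] e)
  qed
  thus ?thesis by (simp add: symmetric_tails_def)
qed

lemma eq_unif:
  assumes "prob_space M" "sets M = sets borel" "symmetric_tails M"
  shows "M = unif"
proof (rule cdf_unique)
  show 1: "real_distribution M" using assms by (simp add: real_distribution_def real_distribution_axioms_def)
  show 2: "real_distribution unif"
    by (simp add: real_distribution_def real_distribution_axioms_def unif.prob_space_axioms)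
  show "cdf M = cdf unif"
    using symmetric_tails_cdf[OF 1 assms(3)] symmetric_tails_cdf[OF 2 symmetric_tails_unif] by auto
qed

lemma prod_Basis_vec:
  fixes f :: "real^'n \<Rightarrow> 'a::comm_monoid_mult"
  shows "(\<Prod>b\<in>Basis. f b) = (\<Prod>i\<in>UNIV. f (axis i 1))"
proof -
  have B: "Basis = range (\<lambda>i::'n. axis i (1::real))" by (auto simp: Basis_vec_def)
  show ?thesis unfolding B by (subst prod.reindex) (auto simp: inj_on_def axis_eq_axis)
qed

lemma borel_measurable_vecI:
  fixes f :: "'b \<Rightarrow> real^'n"
  assumes "\<And>i. (\<lambda>x. f x $ i) \<in> borel_measurable M"
  shows "f \<in> borel_measurable M"
  unfolding borel_measurable_euclidean_space[of f] using assms by (auto simp: Basis_vec_def inner_axis)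

definition vec3 :: "(real^2) \<times> real \<Rightarrow> real^3" where
  "vec3 p = vector [fst p $ 1, fst p $ 2, snd p]"

lemma measurable_vec3 [measurable]: "vec3 \<in> borel_measurable (lborel \<Otimes>\<^sub>M lborel)"
proof (rule borel_measurable_vecI)
  fix i :: 3
  show "(\<lambda>x. vec3 x $ i) \<in> borel_measurable (lborel \<Otimes>\<^sub>M lborel)"
    using exhaust_3[of i] unfolding vec3_def by (elim disjE; hypsubst; simp)
qed

text \<open>Splits off the last coordinate, so that volumes in three-space can be computed by
  horizontal slices.\<close>

lemma lborel_vec3: "(lborel :: (real^3) measure) = distr (lborel \<Otimes>\<^sub>M lborel) borel vec3"
proof (rule lborel_eqI)
  fix l u :: "real^3"
  assume "\<And>b. b \<in> Basis \<Longrightarrow> l \<bullet> b \<le> u \<bullet> b"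
  hence lu: "l $ i \<le> u $ i" for i by (force simp: Basis_vec_def inner_axis)
  define l2 u2 :: "real^2" where "l2 = vector [l $ 1, l $ 2]" and "u2 = vector [u $ 1, u $ 2]"
  have box3: "x \<in> box a b \<longleftrightarrow> (\<forall>i. a $ i < x $ i \<and> x $ i < b $ i)" for a b x :: "real^'n"
    by (force simp: mem_box Basis_vec_def inner_axis)
  have "vec3 -` box l u = box l2 u2 \<times> box (l $ 3) (u $ 3)"
    by (auto simp: vec3_def box3 forall_2 forall_3 l2_def u2_def)
  hence "emeasure (distr (lborel \<Otimes>\<^sub>M lborel) borel vec3) (box l u) = emeasure lborel (box l2 u2) * emeasure lborel (box (l $ 3) (u $ 3))"
    by (subst emeasure_distr) (auto simp: space_pair_measure lborel.emeasure_pair_measure_Times)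
  also have "emeasure lborel (box l2 u2) = (\<Prod>b\<in>Basis. (u2 - l2) \<bullet> b)"
    proof (rule emeasure_lborel_box)
    have "l2 $ i \<le> u2 $ i" for i using lu exhaust_2[of i] by (auto simp: l2_def u2_def)
    thus "l2 \<bullet> b \<le> u2 \<bullet> b" if "b \<in> Basis" for b using that by (auto simp: Basis_vec_def inner_axis)
  qed
  also have "\<dots> = (u $ 1 - l $ 1) * (u $ 2 - l $ 2)"
    unfolding prod_Basis_vec by (simp add: UNIV_2 inner_axis u2_def l2_def)
  also have "emeasure lborel (box (l $ 3) (u $ 3)) = ennreal (u $ 3 - l $ 3)"
    using lu by simp
  also have "ennreal ((u $ 1 - l $ 1) * (u $ 2 - l $ 2)) * ennreal (u $ 3 - l $ 3) = ennreal ((u $ 1 - l $ 1) * (u $ 2 - l $ 2) * (u $ 3 - l $ 3))"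
    by (rule ennreal_mult''[symmetric]) (use lu in simp)
  also have "(u $ 1 - l $ 1) * (u $ 2 - l $ 2) * (u $ 3 - l $ 3) = (\<Prod>b\<in>Basis. (u - l) \<bullet> b)"
  proof -
    have "(\<Prod>i\<in>UNIV. f i) = f 1 * f 2 * f 3" for f :: "3 \<Rightarrow> real"
      unfolding UNIV_3 by (simp add: mult.assoc)
    moreover have "(u - l) \<bullet> axis i 1 = u $ i - l $ i" for i by (simp add: inner_axis)
    ultimately show ?thesis unfolding prod_Basis_vec by simp
  qed
  finally show "emeasure (distr (lborel \<Otimes>\<^sub>M lborel) borel vec3) (box l u) = ennreal (\<Prod>b\<in>Basis. (u - l) \<bullet> b)" .
qed simp

text \<open>The cone over a spherical cap inside the unit ball; its share of the volume is the share
  of the cap in the area of the sphere.\<close>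

definition cap :: "real \<Rightarrow> real^3 \<Rightarrow> (real^3) set" where
  "cap t c = {u \<in> ball 0 1. t * norm u < c \<bullet> u}"

lemma sets_cap [measurable]: "cap t c \<in> sets borel"
proof -
  have "cap t c = ball 0 1 \<inter> {u \<in> space borel. t * norm u < c \<bullet> u}" by (auto simp: cap_def)
  thus ?thesis by simp
qed

text \<open>At height z the ball bounds the squared radius by 1 - z^2 and the cone bounds it by z^2
  (1 / t^2 - 1).\<close>

lemma cap_slice:
  assumes "0 < t" "t < 1"
  defines "m \<equiv> \<lambda>z. min (1 - z\<^sup>2) (z\<^sup>2 * (1 / t\<^sup>2 - 1))"
  shows "{w. vec3 (w, z) \<in> cap t (axis 3 1)} = (if 0 < z \<and> z < 1 then ball 0 (sqrt (m z)) else {})"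
proof -
  have n: "norm (vec3 (w, z)) = sqrt ((norm w)\<^sup>2 + z\<^sup>2)" for w
    by (simp add: norm_eq_sqrt_inner inner_real3 vec3_def inner_vec_def[of w] sum_2 power2_eq_square)
  have c: "axis 3 1 \<bullet> vec3 (w, z) = z" for w by (simp add: inner_axis' vec3_def)
  have mem: "vec3 (w, z) \<in> cap t (axis 3 1) \<longleftrightarrow> 0 < z \<and> z < 1 \<and> (norm w)\<^sup>2 < m z" for w
  proof -
    have s1: "sqrt ((norm w)\<^sup>2 + z\<^sup>2) < 1 \<longleftrightarrow> (norm w)\<^sup>2 < 1 - z\<^sup>2" by (simp add: algebra_simps)
    have s2: "t * sqrt ((norm w)\<^sup>2 + z\<^sup>2) < z \<longleftrightarrow> (norm w)\<^sup>2 < z\<^sup>2 * (1 / t\<^sup>2 - 1)" if z: "0 < z"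
    proof -
      have "t * sqrt ((norm w)\<^sup>2 + z\<^sup>2) < z \<longleftrightarrow> sqrt (t\<^sup>2 * ((norm w)\<^sup>2 + z\<^sup>2)) < sqrt (z\<^sup>2)"
        using assms z by (simp add: real_sqrt_mult)
      also have "\<dots> \<longleftrightarrow> t\<^sup>2 * ((norm w)\<^sup>2 + z\<^sup>2) < z\<^sup>2" by (rule real_sqrt_less_iff)
      also have "\<dots> \<longleftrightarrow> (norm w)\<^sup>2 < z\<^sup>2 * (1 / t\<^sup>2 - 1)" using assms by (simp add: field_simps)
      finally show ?thesis .
    qed
    have "0 \<le> t * sqrt ((norm w)\<^sup>2 + z\<^sup>2)" using assms by simp
    hence zp: "t * sqrt ((norm w)\<^sup>2 + z\<^sup>2) < z \<Longrightarrow> 0 < z" by linarith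
    have z1: "z < 1" if "(norm w)\<^sup>2 < 1 - z\<^sup>2"
    proof -
      have "z\<^sup>2 < 1" using that zero_le_power2[of "norm w"] by linarith
      thus ?thesis by (simp add: abs_square_less_1)
    qed
    show ?thesis using s1 s2 zp z1 by (auto simp: cap_def n c m_def)
  qed
  have "norm w < sqrt a \<longleftrightarrow> (norm w)\<^sup>2 < a" if "0 \<le> a" for w :: "real^2" and a
    using real_less_rsqrt[of "norm w" a] power_strict_mono[of "norm w" "sqrt a" 2] that by auto
  moreover have "0 \<le> m z" if "0 < z" "z < 1"
  proof -
    have "t\<^sup>2 \<le> 1" "z\<^sup>2 \<le> 1" using assms that by (auto simp: power_le_one)
    moreover have "0 < t\<^sup>2" using assms(1) by simp
    ultimately show ?thesis unfolding m_def by (simp add: le_divide_eq)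
  qed
  ultimately show ?thesis by (auto simp: mem)
qed

text \<open>The bounding surface of the slices changes from the cone to the ball at z = t. That the
  integrated areas are linear in t is Archimedes' theorem.\<close>

lemma emeasure_cap_axis:
  assumes "0 < t" "t < 1"
  shows "emeasure lborel (cap t (axis 3 1)) = ennreal (2 * pi / 3 * (1 - t))"
proof -
  define m where "m = (\<lambda>z. min (1 - z\<^sup>2) (z\<^sup>2 * (1 / t\<^sup>2 - 1)))"
  have tt: "t\<^sup>2 < 1" "0 < t\<^sup>2" using assms by (auto simp: power_less_one_iff)
  have mz: "m z = (if z \<le> t then z\<^sup>2 * (1 / t\<^sup>2 - 1) else 1 - z\<^sup>2)" if "0 < z" for z
  proof -
    have "z\<^sup>2 * (1 / t\<^sup>2 - 1) \<le> 1 - z\<^sup>2 \<longleftrightarrow> z\<^sup>2 \<le> t\<^sup>2" using assms by (simp add: field_simps)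
    also have "\<dots> \<longleftrightarrow> z \<le> t" using assms that by (simp add: power2_le_iff_abs_le)
    finally show ?thesis
      by (cases "z \<le> t") (simp_all add: m_def min_absorb2 min_absorb1)
  qed
  have "emeasure lborel (cap t (axis 3 1)) = emeasure (lborel \<Otimes>\<^sub>M lborel) (vec3 -` cap t (axis 3 1))"
    by (subst lborel_vec3, subst emeasure_distr) (auto simp: space_pair_measure)
  also have "\<dots> = (\<integral>\<^sup>+z. emeasure lborel ((\<lambda>w. (w, z)) -` (vec3 -` cap t (axis 3 1))) \<partial>lborel)"
    by (rule lborel_pair.emeasure_pair_measure_alt2)
      (use measurable_sets[OF measurable_vec3 sets_cap] in \<open>simp add: space_pair_measure\<close>)
  also have "\<dots> = (\<integral>\<^sup>+z. ennreal (pi * z\<^sup>2 * (1 / t\<^sup>2 - 1)) * indicator {0..t} z + ennreal (pi * (1 - z\<^sup>2)) * indicator {t..1} z \<partial>lborel)"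
  proof (rule nn_integral_cong_AE)
    have "AE z in lborel. z \<noteq> t" "AE z in lborel. z \<noteq> (0::real)" by (rule AE_lborel_singleton)+
    thus "AE z in lborel. emeasure lborel ((\<lambda>w. (w, z)) -` (vec3 -` cap t (axis 3 1))) =
      ennreal (pi * z\<^sup>2 * (1 / t\<^sup>2 - 1)) * indicator {0..t} z + ennreal (pi * (1 - z\<^sup>2)) * indicator {t..1} z"
    proof eventually_elim
      case (elim z)
      have "(\<lambda>w. (w, z)) -` (vec3 -` cap t (axis 3 1)) = {w. vec3 (w, z) \<in> cap t (axis 3 1)}" by auto
      also have "\<dots> = (if 0 < z \<and> z < 1 then ball 0 (sqrt (m z)) else {})"
        unfolding m_def by (rule cap_slice[OF assms])
      finally have E: "(\<lambda>w. (w, z)) -` (vec3 -` cap t (axis 3 1)) = (if 0 < z \<and> z < 1 then ball 0 (sqrt (m z)) else {})" .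
      have "emeasure lborel ((\<lambda>w. (w, z)) -` (vec3 -` cap t (axis 3 1))) = (if 0 < z \<and> z < 1 then ennreal (pi * m z) else 0)"
      proof (cases "0 < z \<and> z < 1")
        case z: True
        hence "0 \<le> m z" using elim mz[of z] tt by (auto simp: power_le_one)
        thus ?thesis unfolding E if_P[OF z] by (subst emeasure_ball) (auto simp: unit_ball_vol_2)
      next
        case False
        thus ?thesis unfolding E by (simp only: if_False emeasure_empty)
      qed
      also have "\<dots> = ennreal (pi * z\<^sup>2 * (1 / t\<^sup>2 - 1)) * indicator {0..t} z + ennreal (pi * (1 - z\<^sup>2)) * indicator {t..1} z"
        using elim mz[of z] assms by (auto simp: indicator_def mult.assoc)
      finally show ?case .
    qed
  qed
  also have "\<dots> = (\<integral>\<^sup>+z. ennreal (pi * z\<^sup>2 * (1 / t\<^sup>2 - 1)) * indicator {0..t} z \<partial>lborel) +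
    (\<integral>\<^sup>+z. ennreal (pi * (1 - z\<^sup>2)) * indicator {t..1} z \<partial>lborel)"
    by (rule nn_integral_add) auto
  also have "(\<integral>\<^sup>+z. ennreal (pi * z\<^sup>2 * (1 / t\<^sup>2 - 1)) * indicator {0..t} z \<partial>lborel) =
    ennreal (pi * t ^ 3 / 3 * (1 / t\<^sup>2 - 1) - pi * 0 ^ 3 / 3 * (1 / t\<^sup>2 - 1))"
  proof (rule nn_integral_FTC_Icc)
    show "((\<lambda>z. pi * z ^ 3 / 3 * (1 / t\<^sup>2 - 1)) has_real_derivative pi * z\<^sup>2 * (1 / t\<^sup>2 - 1)) (at z)" for z
      by (auto intro!: derivative_eq_intros)
    show "0 \<le> pi * z\<^sup>2 * (1 / t\<^sup>2 - 1)" for z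
      using tt by (intro mult_nonneg_nonneg) (auto simp: le_divide_eq)
  qed (use assms in auto)
  also have "(\<integral>\<^sup>+z. ennreal (pi * (1 - z\<^sup>2)) * indicator {t..1} z \<partial>lborel) =
    ennreal (pi * (1 - 1 ^ 3 / 3) - pi * (t - t ^ 3 / 3))"
  proof (rule nn_integral_FTC_Icc[where F = "\<lambda>z. pi * (z - z ^ 3 / 3)"])
    show "((\<lambda>z. pi * (z - z ^ 3 / 3)) has_real_derivative pi * (1 - z\<^sup>2)) (at z)" for z
      by (auto intro!: derivative_eq_intros)
    show "0 \<le> pi * (1 - z\<^sup>2)" if "z \<in> {t..1}" for z using assms that by (auto simp: power_le_one)
  qed (use assms in auto)
  also have "ennreal (pi * t ^ 3 / 3 * (1 / t\<^sup>2 - 1) - pi * 0 ^ 3 / 3 * (1 / t\<^sup>2 - 1)) + ennreal (pi * (1 - 1 ^ 3 / 3) - pi * (t - t ^ 3 / 3)) =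
    ennreal ((pi * t ^ 3 / 3 * (1 / t\<^sup>2 - 1) - pi * 0 ^ 3 / 3 * (1 / t\<^sup>2 - 1)) + (pi * (1 - 1 ^ 3 / 3) - pi * (t - t ^ 3 / 3)))"
  proof (rule ennreal_plus[symmetric])
    show "0 \<le> pi * t ^ 3 / 3 * (1 / t\<^sup>2 - 1) - pi * 0 ^ 3 / 3 * (1 / t\<^sup>2 - 1)" using assms tt by (simp add: field_simps)
    have "3 * t - t ^ 3 = 2 - (1 - t) * (1 - t) * (2 + t)" by (simp add: algebra_simps power3_eq_cube)
    moreover have "0 \<le> (1 - t) * (1 - t) * (2 + t)" using assms by simp
    ultimately have "t - t ^ 3 / 3 \<le> 1 - 1 ^ 3 / 3" by simp
    thus "0 \<le> pi * (1 - 1 ^ 3 / 3) - pi * (t - t ^ 3 / 3)"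
      by (metis diff_ge_0_iff_ge mult_left_mono pi_ge_zero)
  qed
  also have "(pi * t ^ 3 / 3 * (1 / t\<^sup>2 - 1) - pi * 0 ^ 3 / 3 * (1 / t\<^sup>2 - 1)) + (pi * (1 - 1 ^ 3 / 3) - pi * (t - t ^ 3 / 3)) = 2 * pi / 3 * (1 - t)"
    using assms by (simp add: field_simps power2_eq_square power3_eq_cube)
  finally show ?thesis .
qed

lemma measure_cap:
  assumes "0 < t" "t < 1" "norm c = 1"
  shows "measure lborel (cap t c) = 2 * pi / 3 * (1 - t)"
proof -
  have "norm c = norm (axis 3 1 :: real^3)" using assms by simp
  then obtain f where f: "orthogonal_transformation f" "f c = (axis 3 1 :: real^3)"
    by (rule orthogonal_transformation_exists)
  have "f ` cap t c = cap t (f c)"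
  proof (rule Set.set_eqI, rule iffI)
    fix v assume "v \<in> f ` cap t c"
    thus "v \<in> cap t (f c)" using f(1)
      by (auto simp: cap_def orthogonal_transformation_norm) (auto simp: orthogonal_transformation_def)
  next
    fix v assume v: "v \<in> cap t (f c)"
    obtain u where u: "v = f u" using orthogonal_transformation_surj[OF f(1)] by (metis surjD)
    have "u \<in> cap t c" using v f(1) unfolding u
      by (auto simp: cap_def orthogonal_transformation_norm) (auto simp: orthogonal_transformation_def)
    thus "v \<in> f ` cap t c" by (simp add: u)
  qed
  moreover have "cap t c \<in> lmeasurable"
    by (rule bounded_set_imp_lmeasurable) (use sets_cap[of t c] in \<open>auto simp: cap_def intro: bounded_subset[OF bounded_ball[of 0 1]]\<close>)
  ultimately have "measure lebesgue (cap t c) = measure lebesgue (cap t (axis 3 1))"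
    using measure_orthogonal_image[OF f(1), of "cap t c"] by (simp add: f(2))
  also have "\<dots> = 2 * pi / 3 * (1 - t)"
    using emeasure_cap_axis[OF assms(1,2)] assms by (simp add: measure_def)
  finally show ?thesis by simp
qed

text \<open>The uniform law on the sphere, realised by normalising a uniform point of the ball; this
  reduces areas of caps to Lebesgue measure.\<close>

definition sphere_law :: "(real^3) measure" where
  "sphere_law = distr (uniform_measure lborel (ball 0 1)) borel (\<lambda>u. u /\<^sub>R norm u)"

lemma emeasure_unit_ball3: "emeasure lborel (ball 0 1 :: (real^3) set) = ennreal (4 / 3 * pi)"
  by (simp add: emeasure_ball unit_ball_vol_3)

lemma prob_space_ball_law: "prob_space (uniform_measure lborel (ball 0 1 :: (real^3) set))"
  by (rule prob_space_uniform_measure) (auto simp: emeasure_unit_ball3)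

lemma prob_space_sphere_law: "prob_space sphere_law"
  unfolding sphere_law_def by (rule prob_space.prob_space_distr[OF prob_space_ball_law]) measurable

lemma sets_sphere_law [simp, measurable_cong]: "sets sphere_law = sets borel"
  by (simp add: sphere_law_def)

lemma AE_sphere_law: "AE a in sphere_law. a \<bullet> a = 1"
proof -
  have "AE u in lborel. u \<noteq> (0 :: real^3)" by (rule AE_lborel_singleton)
  hence "AE u in uniform_measure lborel (ball 0 1). u \<noteq> (0 :: real^3)"
    by (intro AE_uniform_measureI) (auto elim: eventually_mono)
  hence "AE u in uniform_measure lborel (ball 0 1 :: (real^3) set). (u /\<^sub>R norm u) \<bullet> (u /\<^sub>R norm u) = 1"
    by eventually_elim (simp add: dot_square_norm power2_eq_square)
  thus ?thesis unfolding sphere_law_def by (subst AE_distr_iff) auto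
qed

lemma measure_sphere_law_greater:
  assumes "norm c = 1" "0 < t" "t < 1"
  shows "measure sphere_law {a. t < c \<bullet> a} = (1 - t) / 2"
proof -
  have *: "t < c \<bullet> (u /\<^sub>R norm u) \<longleftrightarrow> t * norm u < c \<bullet> u" for u
    using assms by (cases "u = 0") (auto simp: field_simps)
  have "measure sphere_law {a. t < c \<bullet> a} = measure (uniform_measure lborel (ball 0 1)) {u. t * norm u < c \<bullet> u}"
    unfolding sphere_law_def by (subst measure_distr) (auto simp del: inner_scaleR_right simp add: * vimage_def)
  also have "\<dots> = measure lborel (cap t c) / (4 / 3 * pi)"
  proof (subst measure_uniform_measure)
    have "ball 0 1 \<inter> {u. t * norm u < c \<bullet> u} = cap t c" by (auto simp: cap_def)
    moreover have "measure lborel (ball 0 1 :: (real^3) set) = 4 / 3 * pi" by (simp add: measure_def emeasure_unit_ball3)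
    ultimately show "measure lborel (ball 0 1 \<inter> {u. t * norm u < c \<bullet> u}) / measure lborel (ball 0 1 :: (real^3) set) = measure lborel (cap t c) / (4 / 3 * pi)"
      by (simp only:)
  qed (auto simp: emeasure_unit_ball3)
  also have "\<dots> = (1 - t) / 2" using assms by (simp add: measure_cap field_simps)
  finally show ?thesis .
qed

lemma distr_sphere_law_inner:
  assumes "norm c = 1"
  shows "distr sphere_law borel (\<lambda>a. c \<bullet> a) = unif"
proof (rule eq_unif)
  interpret prob_space sphere_law by (rule prob_space_sphere_law)
  show "prob_space (distr sphere_law borel (\<lambda>a. c \<bullet> a))" by (rule prob_space_distr) measurable
  have sp: "space sphere_law = UNIV" by (simp add: sphere_law_def)
  have "measure (distr sphere_law borel (\<lambda>a. c \<bullet> a)) {t<..} = (1 - t) / 2"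
    "measure (distr sphere_law borel (\<lambda>a. c \<bullet> a)) {..<- t} = (1 - t) / 2" if t: "0 < t" "t < 1" for t
  proof -
    show "measure (distr sphere_law borel (\<lambda>a. c \<bullet> a)) {t<..} = (1 - t) / 2"
      using measure_sphere_law_greater[OF assms t] by (subst measure_distr) (auto simp: vimage_def sp)
    have "{a. c \<bullet> a < - t} = {a. t < - c \<bullet> a}" by auto
    thus "measure (distr sphere_law borel (\<lambda>a. c \<bullet> a)) {..<- t} = (1 - t) / 2"
      using measure_sphere_law_greater[of "- c", OF _ t] assms by (subst measure_distr) (auto simp: vimage_def sp)
  qed
  thus "symmetric_tails (distr sphere_law borel (\<lambda>a. c \<bullet> a))" by (simp add: symmetric_tails_def)
qed simp

lemma nn_integral_sphere_law2:
  assumes "norm c = 1" "norm d = 1" and [measurable]: "f \<in> borel_measurable (borel \<Otimes>\<^sub>M borel)"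
  shows "(\<integral>\<^sup>+z. f (c \<bullet> fst z, d \<bullet> snd z) \<partial>(sphere_law \<Otimes>\<^sub>M sphere_law)) = (\<integral>\<^sup>+z. f z \<partial>unif2)"
proof -
  have "unif2 = distr sphere_law borel (\<lambda>a. c \<bullet> a) \<Otimes>\<^sub>M distr sphere_law borel (\<lambda>a. d \<bullet> a)"
    by (simp add: distr_sphere_law_inner assms)
  also have "\<dots> = distr (sphere_law \<Otimes>\<^sub>M sphere_law) (borel \<Otimes>\<^sub>M borel) (\<lambda>(a, b). (c \<bullet> a, d \<bullet> b))"
    by (rule pair_measure_distr)
      (auto simp: distr_sphere_law_inner assms intro!: unif.sigma_finite_measure)
  finally have "(\<integral>\<^sup>+z. f z \<partial>unif2) = (\<integral>\<^sup>+z. f z \<partial>distr (sphere_law \<Otimes>\<^sub>M sphere_law) (borel \<Otimes>\<^sub>M borel) (\<lambda>(a, b). (c \<bullet> a, d \<bullet> b)))"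
    by simp
  also have "\<dots> = (\<integral>\<^sup>+z. f (c \<bullet> fst z, d \<bullet> snd z) \<partial>(sphere_law \<Otimes>\<^sub>M sphere_law))"
    by (subst nn_integral_distr) (auto simp: case_prod_beta')
  finally show ?thesis ..
qed

section \<open>The uniform distribution of the pair of cosines\<close>

text \<open>Recovers a plane from its two unit vectors. The default plane outside the product of the
  spheres makes the function total with values in \<open>Gr24\<close>, as measurability into
  \<open>Gr24_borel\<close> requires.\<close>

definition plane_of_parts :: "real^3 \<Rightarrow> real^3 \<Rightarrow> (real^4) set" where
  "plane_of_parts a b = (if a \<bullet> a = 1 \<and> b \<bullet> b = 1
     then SOME P. \<exists>g h. orthonormal_pair g h \<and> P = span {g, h} \<and> sd_part g h = a \<and> asd_part g h = b
     else span {axis 1 1, axis 2 1})"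

lemma plane_of_parts:
  assumes "a \<bullet> a = 1" "b \<bullet> b = 1"
  obtains g h where "orthonormal_pair g h" "plane_of_parts a b = span {g, h}" "sd_part g h = a" "asd_part g h = b"
proof -
  have "\<exists>P g h. orthonormal_pair g h \<and> P = span {g, h} \<and> sd_part g h = a \<and> asd_part g h = b"
    using ex_orthonormal_pair_parts[OF assms] by metis
  from someI_ex[OF this] show ?thesis using that assms by (auto simp: plane_of_parts_def)
qed

lemma plane_of_parts_default: "orthonormal_pair (axis 1 1 :: real^4) (axis 2 1)"
  by (simp add: orthonormal_pair_def inner_axis_axis)

lemma plane_of_parts_Gr24: "plane_of_parts a b \<in> Gr24"
proof (cases "a \<bullet> a = 1 \<and> b \<bullet> b = 1")
  case True
  thus ?thesis by (metis plane_of_parts span_orthonormal_pair_Gr24)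
next
  case False
  thus ?thesis using span_orthonormal_pair_Gr24[OF plane_of_parts_default] by (simp only: plane_of_parts_def if_False)
qed

lemma measurable_parts_matrix: "(\<lambda>z. parts_matrix (fst z) (snd z) $ i $ j) \<in> borel_measurable (borel \<Otimes>\<^sub>M borel)"
  using exhaust_4[of i] exhaust_4[of j] unfolding parts_matrix_def inner_real3
  by (elim disjE; hypsubst; simp)

text \<open>Although the plane is picked by \<open>SOME\<close>, its projection matrix is half of
  \<open>parts_matrix\<close> on pairs of unit vectors, a polynomial in the parts.\<close>

lemma measurable_plane_of_parts:
  "(\<lambda>z. plane_of_parts (fst z) (snd z)) \<in> sphere_law \<Otimes>\<^sub>M sphere_law \<rightarrow>\<^sub>M Gr24_borel"
proof (rule measurable_into_Gr24)
  fix i j :: 4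
  have "proj_matrix (plane_of_parts a b) $ i $ j = (if a \<bullet> a = 1 \<and> b \<bullet> b = 1 then parts_matrix a b $ i $ j / 2
      else proj_matrix (span {axis 1 1, axis 2 1}) $ i $ j)" for a b
  proof (cases "a \<bullet> a = 1 \<and> b \<bullet> b = 1")
    case True
    then obtain g h where gh: "orthonormal_pair g h" "plane_of_parts a b = span {g, h}" "sd_part g h = a" "asd_part g h = b"
      using plane_of_parts by blast
    show ?thesis using True parts_matrix_pair[OF gh(1), of i j] by (simp add: gh(2-4) proj_matrix_pair[OF gh(1)])
  qed (auto simp: plane_of_parts_def)
  thus "(\<lambda>z. proj_matrix (plane_of_parts (fst z) (snd z)) $ i $ j) \<in> borel_measurable (sphere_law \<Otimes>\<^sub>M sphere_law)"
    using measurable_parts_matrix[of i j] by simp measurable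
qed (rule plane_of_parts_Gr24)

lemma sets_invariant_prob: "invariant_prob_Gr24 \<sigma> \<Longrightarrow> sets \<sigma> = sets Gr24_borel"
  and prob_space_invariant_prob: "invariant_prob_Gr24 \<sigma> \<Longrightarrow> prob_space \<sigma>"
  by (auto simp: invariant_prob_Gr24_def borel_prob_Gr24_def)

text \<open>By invariance and transitivity the integral is the same for every \<open>P\<close>, so
  it may be averaged over planes with independent uniform parts. After an exchange of integrals the
  plane drawn from \<sigma> is fixed, and the average is computed by Archimedes' theorem on each
  sphere. The symmetries of \<open>f\<close> absorb the order and the common sign of the
  cosines.\<close>

lemma nn_integral_xi:
  assumes inv: "invariant_prob_Gr24 \<sigma>" and P: "P \<in> Gr24"
    and f [measurable]: "f \<in> borel_measurable (borel \<Otimes>\<^sub>M borel)"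
    and sym: "\<And>x y. f (x, y) = f (y, x)" "\<And>x y. f (- x, - y) = (f (x, y) :: ennreal)"
  shows "(\<integral>\<^sup>+Q. f (xi_plus P Q, xi_minus P Q) \<partial>\<sigma>) = (\<integral>\<^sup>+z. f z \<partial>unif2)"
proof -
  interpret prob_space \<sigma> by (rule prob_space_invariant_prob) fact
  note sets [measurable_cong, simp] = sets_invariant_prob[OF inv]
  have sp: "space \<sigma> = Gr24" using sets_eq_imp_space_eq[OF sets] by simp
  interpret S: prob_space sphere_law by (rule prob_space_sphere_law)
  interpret SS: pair_prob_space sphere_law sphere_law ..
  interpret SG: pair_sigma_finite "sphere_law \<Otimes>\<^sub>M sphere_law" \<sigma> ..
  define c where "c = (\<lambda>P. \<integral>\<^sup>+Q. f (xi_plus P Q, xi_minus P Q) \<partial>\<sigma>)"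
  have c_inv: "c (U ` R) = c R" if U: "orthogonal_transformation U" and R: "R \<in> Gr24" for U R
  proof -
    have UR: "U ` R \<in> Gr24" by (rule orthogonal_transformation_Gr24) fact+
    note [measurable] = measurable_orthogonal_image[OF U]
    have [measurable]: "(\<lambda>Q. U ` R) \<in> Gr24_borel \<rightarrow>\<^sub>M Gr24_borel" using UR by (intro measurable_const) simp
    have "c (U ` R) = (\<integral>\<^sup>+Q. f (xi_plus (U ` R) Q, xi_minus (U ` R) Q) \<partial>distr \<sigma> Gr24_borel (\<lambda>P. U ` P))"
      using inv U by (simp add: c_def invariant_prob_Gr24_def)
    also have "\<dots> = (\<integral>\<^sup>+Q. f (xi_plus (U ` R) (U ` Q), xi_minus (U ` R) (U ` Q)) \<partial>\<sigma>)"
      by (subst nn_integral_distr) (auto simp: measurable_cong_sets[OF sets refl])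
    also have "\<dots> = c R" unfolding c_def
      by (intro nn_integral_cong) (simp add: sp xi_orthogonal_transformation[OF U R])
    finally show ?thesis .
  qed
  have c_const: "c R = c P" if "R \<in> Gr24" for R
    using orthogonal_transitive_Gr24[OF P that] c_inv[OF _ P] by metis
  define Q where "Q = (\<lambda>z. plane_of_parts (fst z) (snd z))"
  have [measurable]: "Q \<in> sphere_law \<Otimes>\<^sub>M sphere_law \<rightarrow>\<^sub>M Gr24_borel" unfolding Q_def by (rule measurable_plane_of_parts)
  have "c P = (\<integral>\<^sup>+z. c (Q z) \<partial>(sphere_law \<Otimes>\<^sub>M sphere_law))"
    by (simp add: c_const plane_of_parts_Gr24 Q_def SS.P.emeasure_space_1)
  also have "\<dots> = (\<integral>\<^sup>+R. \<integral>\<^sup>+z. f (xi_plus (Q z) R, xi_minus (Q z) R) \<partial>(sphere_law \<Otimes>\<^sub>M sphere_law) \<partial>\<sigma>)"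
    unfolding c_def by (rule SG.Fubini'[symmetric]) measurable
  also have "\<dots> = (\<integral>\<^sup>+R. \<integral>\<^sup>+z. f z \<partial>unif2 \<partial>\<sigma>)"
  proof (rule nn_integral_cong)
    fix R assume "R \<in> space \<sigma>"
    then obtain k l where R: "orthonormal_pair k l" "R = span {k, l}" using Gr24_obtain_pair[of R] by (auto simp: sp)
    have "AE z in sphere_law \<Otimes>\<^sub>M sphere_law. fst z \<bullet> fst z = 1 \<and> snd z \<bullet> snd z = 1"
    proof (rule SS.AE_pair_measure)
      show "AE x in sphere_law. AE y in sphere_law. fst (x, y) \<bullet> fst (x, y) = 1 \<and> snd (x, y) \<bullet> snd (x, y) = 1"
        using AE_sphere_law by eventually_elim (use AE_sphere_law in \<open>auto elim: eventually_mono\<close>)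
    qed measurable
    hence "AE z in sphere_law \<Otimes>\<^sub>M sphere_law. f (xi_plus (Q z) R, xi_minus (Q z) R) = f (sd_part k l \<bullet> fst z, asd_part k l \<bullet> snd z)"
    proof eventually_elim
      case (elim z)
      then obtain g h where gh: "orthonormal_pair g h" "plane_of_parts (fst z) (snd z) = span {g, h}" "sd_part g h = fst z" "asd_part g h = snd z"
        using plane_of_parts by blast
      show ?case
        using xi_symmetric_fun[of "\<lambda>x y. f (x, y)", OF sym gh(1) R(1)] by (simp add: Q_def gh R(2) inner_commute)
    qed
    hence "(\<integral>\<^sup>+z. f (xi_plus (Q z) R, xi_minus (Q z) R) \<partial>(sphere_law \<Otimes>\<^sub>M sphere_law)) =
      (\<integral>\<^sup>+z. f (sd_part k l \<bullet> fst z, asd_part k l \<bullet> snd z) \<partial>(sphere_law \<Otimes>\<^sub>M sphere_law))"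
      by (rule nn_integral_cong_AE)
    also have "\<dots> = (\<integral>\<^sup>+z. f z \<partial>unif2)"
      by (rule nn_integral_sphere_law2) (use parts_unit[OF R(1)] in \<open>auto simp: norm_eq_1\<close>)
    finally show "(\<integral>\<^sup>+z. f (xi_plus (Q z) R, xi_minus (Q z) R) \<partial>(sphere_law \<Otimes>\<^sub>M sphere_law)) = (\<integral>\<^sup>+z. f z \<partial>unif2)" .
  qed
  also have "\<dots> = (\<integral>\<^sup>+z. f z \<partial>unif2)" by (simp add: emeasure_space_1)
  finally show ?thesis by (simp add: c_def)
qed

section \<open>Second factorial moments of point processes\<close>

lemma sets_imp_space_Gr24: "sets \<mu> = sets Gr24_borel \<Longrightarrow> space \<mu> = Gr24"
  using sets_eq_imp_space_eq[of \<mu> Gr24_borel] by simp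

lemma proj_matrix_inj:
  assumes "P \<in> Gr24" "Q \<in> Gr24" "proj_matrix P = proj_matrix Q"
  shows "P = Q"
proof -
  have mem: "v \<in> P \<longleftrightarrow> proj_matrix P *v v = v" if PG: "P \<in> Gr24" for P v
  proof -
    obtain g h where P: "orthonormal_pair g h" "P = span {g, h}" using Gr24_obtain_pair[OF PG] .
    have "proj_matrix P *v v = (v \<bullet> g) *\<^sub>R g + (v \<bullet> h) *\<^sub>R h"
      unfolding P(2) by (simp add: Finite_Cartesian_Product.vec_eq_iff matrix_vector_mult_def proj_matrix_pair[OF P(1)]
          sum_4 inner_real4 algebra_simps)
    moreover have "(v \<bullet> g) *\<^sub>R g + (v \<bullet> h) *\<^sub>R h \<in> span {g, h}" by (intro span_add span_scale span_base) auto
    ultimately show ?thesis using orthonormal_pair_expand[OF P(1), of v] by (auto simp: P(2))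
  qed
  show ?thesis using mem[OF assms(1)] mem[OF assms(2)] assms(3) by auto
qed

text \<open>Preimages of a countable base of the matrix space. The rectangles of such a set and its
  complement will cover the off-diagonal pairs.\<close>

lemma Gr24_separating:
  "\<exists>A :: nat \<Rightarrow> _. (\<forall>i. A i \<in> sets Gr24_borel) \<and> (\<forall>P\<in>Gr24. \<forall>Q\<in>Gr24. P \<noteq> Q \<longrightarrow> (\<exists>i. P \<in> A i \<and> Q \<notin> A i))"
proof -
  obtain B :: "(real^4^4) set set" where B: "countable B" "topological_basis B"
    using ex_countable_basis by blast
  define A where "A = (\<lambda>i. proj_matrix -` from_nat_into B i \<inter> space Gr24_borel)"
  have ne: "B \<noteq> {}" using topological_basisE[OF B(2) open_UNIV UNIV_I] by blast
  show ?thesis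
  proof (intro exI[of _ A] conjI allI ballI impI)
    fix i
    have "open (from_nat_into B i)" using topological_basis_open[OF B(2)] from_nat_into[OF ne] by blast
    thus "A i \<in> sets Gr24_borel" unfolding A_def by (intro measurable_sets[OF measurable_proj_matrix]) auto
  next
    fix P Q assume PQ: "P \<in> Gr24" "Q \<in> Gr24" "P \<noteq> Q"
    hence "proj_matrix P \<noteq> proj_matrix Q" using proj_matrix_inj by blast
    hence "open (- {proj_matrix Q})" "proj_matrix P \<in> - {proj_matrix Q}" by auto
    then obtain U where U: "U \<in> B" "proj_matrix P \<in> U" "U \<subseteq> - {proj_matrix Q}"
      using topological_basisE[OF B(2)] by metis
    then obtain i where "U = from_nat_into B i" using from_nat_into_surj[OF B(1)] by metis
    thus "\<exists>i. P \<in> A i \<and> Q \<notin> A i" using U PQ by (intro exI[of _ i]) (auto simp: A_def)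
  qed
qed

lemma point_process_space:
  assumes "point_process \<X>" "x \<in> space \<X>"
  shows "finite x" "x \<subseteq> Gr24"
proof -
  have "space \<X> = space config_space" using assms(1) sets_eq_imp_space_eq by (auto simp: point_process_def)
  thus "finite x" "x \<subseteq> Gr24" using assms(2) by (auto simp: config_space_def space_measure_of_conv)
qed

lemma point_process_card_measurable:
  assumes "point_process \<X>" "A \<in> sets Gr24_borel"
  shows "(\<lambda>x. card (x \<inter> A)) \<in> \<X> \<rightarrow>\<^sub>M count_space UNIV"
proof -
  have s: "sets \<X> = sets config_space" using assms(1) by (simp add: point_process_def)
  have sp: "space \<X> = {x. finite x \<and> x \<subseteq> Gr24}"
    using sets_eq_imp_space_eq[OF s] by (simp add: config_space_def space_measure_of_conv)
  have "{x. finite x \<and> x \<subseteq> Gr24 \<and> card (x \<inter> A) = n} \<in> sets \<X>" for n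
    unfolding s config_space_def by (subst sets_measure_of) (use assms(2) in auto)
  moreover have "(\<lambda>x. card (x \<inter> A)) -` {n} \<inter> space \<X> = {x. finite x \<and> x \<subseteq> Gr24 \<and> card (x \<inter> A) = n}" for n
    by (auto simp: sp)
  ultimately show ?thesis by (simp add: measurable_count_space_eq2_countable)
qed

text \<open>An integral over the counting measure rather than a finite sum, so that linearity and
  monotone convergence of \<open>nn_integral\<close> apply. Diagonal pairs are included;
  \<open>f\<close> has to vanish on them where they should not count.\<close>

definition pair_sum :: "('a \<times> 'a \<Rightarrow> ennreal) \<Rightarrow> 'a set \<Rightarrow> ennreal" where
  "pair_sum f x = (\<integral>\<^sup>+z. f z \<partial>count_space (x \<times> x))"

lemma pair_sum_finite: "finite x \<Longrightarrow> pair_sum f x = (\<Sum>P\<in>x. \<Sum>Q\<in>x. f (P, Q))"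
  unfolding pair_sum_def by (subst nn_integral_count_space_finite) (simp_all add: sum.cartesian_product)

lemma pair_sum_rectangle:
  assumes "finite x"
  shows "pair_sum (indicator (C \<times> D)) x = ennreal (real (card (x \<inter> C)) * real (card (x \<inter> D)))"
proof -
  have "pair_sum (indicator (C \<times> D)) x = (\<Sum>P\<in>x. indicator C P * (\<Sum>Q\<in>x. indicator D Q))"
    unfolding pair_sum_finite[OF assms] by (simp add: indicator_times sum_distrib_left)
  also have "\<dots> = (\<Sum>P\<in>x. indicator C P) * (\<Sum>Q\<in>x. indicator D Q)" by (simp add: sum_distrib_right)
  finally have e: "pair_sum (indicator (C \<times> D)) x = (\<Sum>P\<in>x. indicator C P) * (\<Sum>Q\<in>x. indicator D Q)" .
  have "(\<Sum>P\<in>x. indicator A P) = ennreal (real (card (x \<inter> A)))" for A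
  proof -
    have "(\<Sum>P\<in>x. indicator A P) = (\<Sum>P\<in>x \<inter> A. 1 :: ennreal)"
      by (rule sum.mono_neutral_cong_right) (use assms in \<open>auto simp: indicator_def\<close>)
    thus ?thesis by (simp add: ennreal_of_nat_eq_real_of_nat)
  qed
  thus ?thesis unfolding e by (simp add: ennreal_mult)
qed

text \<open>\<open>\<rho>\<close> is the density of the second factorial moment measure, known on products of disjoint
  sets, which generate the Borel sets off the diagonal.\<close>

locale pair_intensity =
  fixes \<X> :: "(real^4) set set measure" and \<sigma> :: "(real^4) set measure"
    and \<rho> :: "(real^4) set \<times> (real^4) set \<Rightarrow> ennreal"
  assumes pp: "point_process \<X>"
    and \<sigma>: "prob_space \<sigma>" "sets \<sigma> = sets Gr24_borel"
    and \<rho> [measurable]: "\<rho> \<in> borel_measurable (\<sigma> \<Otimes>\<^sub>M \<sigma>)"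
    and fin: "(\<integral>\<^sup>+z. \<rho> z \<partial>(\<sigma> \<Otimes>\<^sub>M \<sigma>)) \<noteq> \<infinity>"
    and diag: "\<And>P. P \<in> Gr24 \<Longrightarrow> \<rho> (P, P) = 0"
    and rect: "\<And>C D. C \<in> sets \<sigma> \<Longrightarrow> D \<in> sets \<sigma> \<Longrightarrow> C \<inter> D = {} \<Longrightarrow>
      (\<integral>\<^sup>+x. ennreal (real (card (x \<inter> C)) * real (card (x \<inter> D))) \<partial>\<X>) =
      (\<integral>\<^sup>+z. indicator (C \<times> D) z * \<rho> z \<partial>(\<sigma> \<Otimes>\<^sub>M \<sigma>))"
begin

sublocale prob_space \<sigma> by (rule \<sigma>)
sublocale pair_prob_space \<sigma> \<sigma> ..

text \<open>Campbell's formula for \<open>f\<close>. Measurability of the pair sum is carried along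
  in the inductions, since the configuration space is generated by counts alone.\<close>

definition good :: "((real^4) set \<times> (real^4) set \<Rightarrow> ennreal) \<Rightarrow> bool" where
  "good f \<longleftrightarrow> pair_sum f \<in> borel_measurable \<X> \<and> (\<integral>\<^sup>+x. pair_sum f x \<partial>\<X>) = (\<integral>\<^sup>+z. f z * \<rho> z \<partial>(\<sigma> \<Otimes>\<^sub>M \<sigma>))"

lemma good_cong:
  assumes "\<And>z. z \<in> Gr24 \<times> Gr24 \<Longrightarrow> f z = g z" "good f"
  shows "good g"
proof -
  have 1: "pair_sum f x = pair_sum g x" if "x \<in> space \<X>" for x
    unfolding pair_sum_def using point_process_space[OF pp that] by (intro nn_integral_cong assms(1)) auto
  have 2: "(\<integral>\<^sup>+z. f z * \<rho> z \<partial>(\<sigma> \<Otimes>\<^sub>M \<sigma>)) = (\<integral>\<^sup>+z. g z * \<rho> z \<partial>(\<sigma> \<Otimes>\<^sub>M \<sigma>))"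
    using sets_imp_space_Gr24[OF \<sigma>(2)] by (intro nn_integral_cong) (auto simp: space_pair_measure assms(1))
  show ?thesis using assms(2) 1 2 nn_integral_cong[of \<X> "pair_sum f" "pair_sum g"] measurable_cong[of \<X> "pair_sum f" "pair_sum g"]
    by (auto simp: good_def)
qed

lemma good_suminf:
  assumes "\<And>i. good (F i)" "\<And>i. F i \<in> borel_measurable (\<sigma> \<Otimes>\<^sub>M \<sigma>)"
  shows "good (\<lambda>z. \<Sum>i. F i z)"
proof -
  note [measurable] = assms(2)
  have ps: "pair_sum (\<lambda>z. \<Sum>i. F i z) = (\<lambda>x. \<Sum>i. pair_sum (F i) x)"
    unfolding pair_sum_def by (intro ext nn_integral_suminf) simp
  have [measurable]: "pair_sum (F i) \<in> borel_measurable \<X>" for i using assms(1) by (simp add: good_def)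
  have "(\<integral>\<^sup>+x. (\<Sum>i. pair_sum (F i) x) \<partial>\<X>) = (\<Sum>i. \<integral>\<^sup>+z. F i z * \<rho> z \<partial>(\<sigma> \<Otimes>\<^sub>M \<sigma>))"
    using assms(1) by (subst nn_integral_suminf) (auto simp: good_def)
  also have "\<dots> = (\<integral>\<^sup>+z. (\<Sum>i. F i z) * \<rho> z \<partial>(\<sigma> \<Otimes>\<^sub>M \<sigma>))"
    by (subst nn_integral_suminf[symmetric]) (auto simp: ennreal_suminf_multc)
  finally show ?thesis by (simp add: good_def ps)
qed

lemma good_rectangle:
  assumes "C \<in> sets \<sigma>" "D \<in> sets \<sigma>" "C \<inter> D = {}"
  shows "good (indicator (C \<times> D))"
proof -
  have CD: "C \<in> sets Gr24_borel" "D \<in> sets Gr24_borel" using assms \<sigma>(2) by auto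
  have e: "pair_sum (indicator (C \<times> D)) x = ennreal (real (card (x \<inter> C)) * real (card (x \<inter> D)))" if "x \<in> space \<X>" for x
    by (rule pair_sum_rectangle) (rule point_process_space[OF pp that])
  have [measurable]: "(\<lambda>x. card (x \<inter> C)) \<in> \<X> \<rightarrow>\<^sub>M count_space UNIV" "(\<lambda>x. card (x \<inter> D)) \<in> \<X> \<rightarrow>\<^sub>M count_space UNIV"
    using point_process_card_measurable[OF pp] CD by auto
  have "pair_sum (indicator (C \<times> D)) \<in> borel_measurable \<X>" by (subst measurable_cong[OF e]) measurable
  moreover have "(\<integral>\<^sup>+x. pair_sum (indicator (C \<times> D)) x \<partial>\<X>) = (\<integral>\<^sup>+x. ennreal (real (card (x \<inter> C)) * real (card (x \<inter> D))) \<partial>\<X>)"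
    by (rule nn_integral_cong) (rule e)
  ultimately show ?thesis unfolding good_def using rect[OF assms] by metis
qed

text \<open>Dynkin's argument inside the fixed rectangle A \<times> (Gr24 - A): the two sides of
  each of its subrectangles are disjoint, so \<open>rect\<close> applies to them.\<close>

lemma good_off_rectangle:
  assumes A: "A \<in> sets \<sigma>" and B: "B \<in> sets (\<sigma> \<Otimes>\<^sub>M \<sigma>)"
  shows "good (indicator (B \<inter> A \<times> (Gr24 - A)))"
proof -
  note sp = sets_imp_space_Gr24[OF \<sigma>(2)]
  have Ac: "Gr24 - A \<in> sets \<sigma>" using sets.compl_sets[OF A] by (simp add: sp)
  have R: "A \<times> (Gr24 - A) \<in> sets (\<sigma> \<Otimes>\<^sub>M \<sigma>)" using A Ac by simp
  have goodR: "good (indicator (A \<times> (Gr24 - A)))" by (rule good_rectangle[OF A Ac]) auto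
  show ?thesis
    using Int_stable_pair_measure_generator pair_measure_closed B unfolding sets_pair_measure
  proof (induct rule: sigma_sets_induct_disjoint)
    case (basic B)
    then obtain C D where CD: "B = C \<times> D" "C \<in> sets \<sigma>" "D \<in> sets \<sigma>" by auto
    have "B \<inter> A \<times> (Gr24 - A) = (C \<inter> A) \<times> (D \<inter> (Gr24 - A))" by (auto simp: CD(1))
    moreover have "good (indicator ((C \<inter> A) \<times> (D \<inter> (Gr24 - A))))"
      using CD A Ac by (intro good_rectangle) auto
    ultimately show ?case by simp
  next
    case empty
    have "pair_sum (\<lambda>_ :: (real^4) set \<times> (real^4) set. 0) = (\<lambda>_. 0)" by (auto simp: pair_sum_def)
    thus ?case by (simp add: good_def)
  next
    \<comment> \<open>Complements require subtraction: the pair sums are finite because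
      configurations are, and the integrals because \<rho> has finite mass.\<close>
    case (compl B)
    have Bs: "B \<in> sets (\<sigma> \<Otimes>\<^sub>M \<sigma>)" using compl(1) by (simp add: sets_pair_measure)
    define f g h where "f = (indicator (B \<inter> A \<times> (Gr24 - A)) :: _ \<Rightarrow> ennreal)"
      and "g = (indicator ((space \<sigma> \<times> space \<sigma> - B) \<inter> A \<times> (Gr24 - A)) :: _ \<Rightarrow> ennreal)"
      and "h = (indicator (A \<times> (Gr24 - A)) :: _ \<Rightarrow> ennreal)"
    have gs: "(space \<sigma> \<times> space \<sigma> - B) \<inter> A \<times> (Gr24 - A) \<in> sets (\<sigma> \<Otimes>\<^sub>M \<sigma>)"
      using sets.compl_sets[OF Bs] R by (auto simp: space_pair_measure)
    have fgh: "h z = f z + g z" for z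
      using sets.sets_into_space[OF A] by (auto simp: f_def g_def h_def sp indicator_def)
    have fm [measurable]: "f \<in> borel_measurable (\<sigma> \<Otimes>\<^sub>M \<sigma>)" "g \<in> borel_measurable (\<sigma> \<Otimes>\<^sub>M \<sigma>)"
      using Bs R gs by (auto simp: f_def g_def)
    have ps: "pair_sum h x = pair_sum f x + pair_sum g x" for x
      unfolding pair_sum_def fgh by (rule nn_integral_add) auto
    have gf: "good f" "good h" using compl(2) goodR by (simp_all add: f_def h_def)
    have [measurable]: "pair_sum f \<in> borel_measurable \<X>" "pair_sum h \<in> borel_measurable \<X>" using gf by (auto simp: good_def)
    have "pair_sum g x = pair_sum h x - pair_sum f x" if "x \<in> space \<X>" for x
    proof -
      have "pair_sum f x \<le> (\<integral>\<^sup>+z. 1 \<partial>count_space (x \<times> x))"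
        unfolding pair_sum_def by (intro nn_integral_mono) (simp add: f_def indicator_def)
      also have "\<dots> = of_nat (card (x \<times> x))"
        using point_process_space(1)[OF pp that] by (simp add: emeasure_count_space_finite)
      finally have "pair_sum f x \<noteq> \<infinity>" by (auto simp: top_unique)
      thus ?thesis by (simp add: ps ennreal_add_diff_cancel_left)
    qed
    hence gm [measurable]: "pair_sum g \<in> borel_measurable \<X>" by (subst measurable_cong) auto
    have "(\<integral>\<^sup>+z. f z * \<rho> z \<partial>(\<sigma> \<Otimes>\<^sub>M \<sigma>)) + (\<integral>\<^sup>+x. pair_sum g x \<partial>\<X>) = (\<integral>\<^sup>+x. pair_sum h x \<partial>\<X>)"
      using gf(1) unfolding ps by (subst nn_integral_add) (auto simp: good_def)
    also have "\<dots> = (\<integral>\<^sup>+z. f z * \<rho> z \<partial>(\<sigma> \<Otimes>\<^sub>M \<sigma>)) + (\<integral>\<^sup>+z. g z * \<rho> z \<partial>(\<sigma> \<Otimes>\<^sub>M \<sigma>))"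
      using gf(2) by (simp add: good_def fgh distrib_right nn_integral_add)
    finally have "(\<integral>\<^sup>+x. pair_sum g x \<partial>\<X>) = (\<integral>\<^sup>+z. g z * \<rho> z \<partial>(\<sigma> \<Otimes>\<^sub>M \<sigma>))"
    proof (subst (asm) ennreal_add_left_cancel)
      have "(\<integral>\<^sup>+z. f z * \<rho> z \<partial>(\<sigma> \<Otimes>\<^sub>M \<sigma>)) \<le> (\<integral>\<^sup>+z. \<rho> z \<partial>(\<sigma> \<Otimes>\<^sub>M \<sigma>))"
        by (intro nn_integral_mono) (auto simp: f_def indicator_def)
      hence "(\<integral>\<^sup>+z. f z * \<rho> z \<partial>(\<sigma> \<Otimes>\<^sub>M \<sigma>)) \<noteq> \<infinity>" using fin by (auto simp: top_unique)
      thus "(\<integral>\<^sup>+z. f z * \<rho> z \<partial>(\<sigma> \<Otimes>\<^sub>M \<sigma>)) = \<infinity> \<or> (\<integral>\<^sup>+x. pair_sum g x \<partial>\<X>) = (\<integral>\<^sup>+z. g z * \<rho> z \<partial>(\<sigma> \<Otimes>\<^sub>M \<sigma>)) \<Longrightarrow> ?thesis" by simp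
    qed
    thus ?case using gm by (simp add: good_def g_def)
  next
    case (union F)
    have Fs: "F i \<in> sets (\<sigma> \<Otimes>\<^sub>M \<sigma>)" for i using union(2) by (auto simp: sets_pair_measure)
    have "good (\<lambda>z. \<Sum>i. indicator (F i \<inter> A \<times> (Gr24 - A)) z)"
      by (rule good_suminf) (use union(3) Fs R in auto)
    moreover have "(\<Sum>i. indicator (F i \<inter> A \<times> (Gr24 - A)) z) = (indicator ((\<Union>i. F i) \<inter> A \<times> (Gr24 - A)) z :: ennreal)" for z
    proof -
      have "disjoint_family (\<lambda>i. F i \<inter> A \<times> (Gr24 - A))" using union(1) by (auto simp: disjoint_family_on_def)
      from suminf_indicator[OF this, of z] show ?thesis by simp
    qed
    ultimately show ?case by (rule good_cong[rotated])
  qed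
qed

text \<open>The standard induction from indicators to nonnegative measurable functions, with the
  indicator of the rectangle kept as a factor throughout.\<close>

lemma good_off_set:
  assumes A: "A \<in> sets \<sigma>" and f: "f \<in> borel_measurable (\<sigma> \<Otimes>\<^sub>M \<sigma>)"
  shows "good (\<lambda>z. f z * indicator (A \<times> (Gr24 - A)) z)"
proof -
  define h where "h = (indicator (A \<times> (Gr24 - A)) :: _ \<Rightarrow> ennreal)"
  have R: "A \<times> (Gr24 - A) \<in> sets (\<sigma> \<Otimes>\<^sub>M \<sigma>)"
    using A sets.compl_sets[OF A] by (simp add: sets_imp_space_Gr24[OF \<sigma>(2)])
  have hm [measurable]: "h \<in> borel_measurable (\<sigma> \<Otimes>\<^sub>M \<sigma>)" using R by (simp add: h_def)
  show ?thesis unfolding h_def[symmetric]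
    using f
  proof (induct rule: borel_measurable_induct)
    case (cong f g)
    show ?case by (rule good_cong[OF _ cong(4)])
      (use cong(3) sets_imp_space_Gr24[OF \<sigma>(2)] in \<open>auto simp: space_pair_measure\<close>)
  next
    case (set B)
    show ?case by (rule good_cong[OF _ good_off_rectangle[OF A set]]) (simp add: h_def indicator_inter_arith)
  next
    case (mult u c)
    have ps: "pair_sum (\<lambda>z. c * u z * h z) x = c * pair_sum (\<lambda>z. u z * h z) x" for x
      unfolding pair_sum_def mult.assoc by (rule nn_integral_cmult) simp
    note [measurable] = mult(2)
    have [measurable]: "pair_sum (\<lambda>z. u z * h z) \<in> borel_measurable \<X>" using mult(4) by (simp add: good_def)
    have "(\<integral>\<^sup>+x. c * pair_sum (\<lambda>z. u z * h z) x \<partial>\<X>) = c * (\<integral>\<^sup>+z. u z * h z * \<rho> z \<partial>(\<sigma> \<Otimes>\<^sub>M \<sigma>))"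
      using mult(4) by (subst nn_integral_cmult) (auto simp: good_def)
    also have "\<dots> = (\<integral>\<^sup>+z. c * u z * h z * \<rho> z \<partial>(\<sigma> \<Otimes>\<^sub>M \<sigma>))"
      unfolding mult.assoc by (rule nn_integral_cmult[symmetric]) measurable
    finally show ?case unfolding good_def ps[abs_def] by (intro conjI) measurable
  next
    case (add u v)
    have ps: "pair_sum (\<lambda>z. (v z + u z) * h z) x = pair_sum (\<lambda>z. v z * h z) x + pair_sum (\<lambda>z. u z * h z) x" for x
      unfolding pair_sum_def distrib_right by (rule nn_integral_add) auto
    note [measurable] = add(1,4)
    have [measurable]: "pair_sum (\<lambda>z. u z * h z) \<in> borel_measurable \<X>" "pair_sum (\<lambda>z. v z * h z) \<in> borel_measurable \<X>"
      using add(3,7) by (auto simp: good_def)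
    have "(\<integral>\<^sup>+x. pair_sum (\<lambda>z. v z * h z) x + pair_sum (\<lambda>z. u z * h z) x \<partial>\<X>) =
      (\<integral>\<^sup>+z. v z * h z * \<rho> z \<partial>(\<sigma> \<Otimes>\<^sub>M \<sigma>)) + (\<integral>\<^sup>+z. u z * h z * \<rho> z \<partial>(\<sigma> \<Otimes>\<^sub>M \<sigma>))"
      using add(3,7) by (subst nn_integral_add) (auto simp: good_def)
    also have "\<dots> = (\<integral>\<^sup>+z. (v z + u z) * h z * \<rho> z \<partial>(\<sigma> \<Otimes>\<^sub>M \<sigma>))"
      by (simp add: distrib_right nn_integral_add)
    finally show ?case unfolding good_def ps[abs_def] by (intro conjI) measurable
  next
    case (seq U)
    note [measurable] = seq(1)
    have inc: "incseq (\<lambda>i z. U i z * h z)" "incseq (\<lambda>i z. U i z * h z * \<rho> z)"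
      using seq(4) by (auto simp: incseq_def le_fun_def intro!: mult_right_mono)
    have sup: "(SUP i. U i) z * h z = (SUP i. U i z * h z)" "(SUP i. U i) z * h z * \<rho> z = (SUP i. U i z * h z * \<rho> z)" for z
      by (simp_all add: image_comp SUP_mult_right_ennreal)
    have ps: "pair_sum (\<lambda>z. (SUP i. U i) z * h z) x = (SUP i. pair_sum (\<lambda>z. U i z * h z) x)" for x
      unfolding pair_sum_def sup by (rule nn_integral_monotone_convergence_SUP[OF inc(1)]) simp
    have inc2: "incseq (\<lambda>i x. pair_sum (\<lambda>z. U i z * h z) x)"
      using inc(1) by (auto simp: incseq_def le_fun_def pair_sum_def intro!: nn_integral_mono)
    have [measurable]: "(\<lambda>x. pair_sum (\<lambda>z. U i z * h z) x) \<in> borel_measurable \<X>" for i using seq(3) by (simp add: good_def)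
    have "(\<integral>\<^sup>+x. (SUP i. pair_sum (\<lambda>z. U i z * h z) x) \<partial>\<X>) = (SUP i. \<integral>\<^sup>+z. U i z * h z * \<rho> z \<partial>(\<sigma> \<Otimes>\<^sub>M \<sigma>))"
      using seq(3) by (subst nn_integral_monotone_convergence_SUP[OF inc2]) (auto simp: good_def)
    also have "\<dots> = (\<integral>\<^sup>+z. (SUP i. U i) z * h z * \<rho> z \<partial>(\<sigma> \<Otimes>\<^sub>M \<sigma>))"
      unfolding sup(2) by (rule nn_integral_monotone_convergence_SUP[OF inc(2), symmetric]) measurable
    finally show ?case unfolding good_def ps[abs_def] by (intro conjI) measurable
  qed
qed

text \<open>The rectangles given by a separating family cover exactly the off-diagonal pairs; made
  disjoint, they reduce the claim to \<open>good_off_set\<close>. On the diagonal \<rho> vanishes,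
  so the right side is unaffected.\<close>

lemma good_off_diagonal:
  assumes f [measurable]: "f \<in> borel_measurable (\<sigma> \<Otimes>\<^sub>M \<sigma>)"
  shows "pair_sum (\<lambda>z. if fst z = snd z then 0 else f z) \<in> borel_measurable \<X>"
    "(\<integral>\<^sup>+x. pair_sum (\<lambda>z. if fst z = snd z then 0 else f z) x \<partial>\<X>) = (\<integral>\<^sup>+z. f z * \<rho> z \<partial>(\<sigma> \<Otimes>\<^sub>M \<sigma>))"
proof -
  note sp = sets_imp_space_Gr24[OF \<sigma>(2)]
  obtain A :: "nat \<Rightarrow> (real^4) set set" where A0: "(\<forall>i. A i \<in> sets Gr24_borel) \<and> (\<forall>P\<in>Gr24. \<forall>Q\<in>Gr24. P \<noteq> Q \<longrightarrow> (\<exists>i. P \<in> A i \<and> Q \<notin> A i))"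
    using Gr24_separating by (rule exE)
  have A: "A i \<in> sets Gr24_borel" "P \<in> Gr24 \<Longrightarrow> Q \<in> Gr24 \<Longrightarrow> P \<noteq> Q \<Longrightarrow> \<exists>i. P \<in> A i \<and> Q \<notin> A i" for i P Q
    using A0 by simp_all
  have A\<sigma>: "A i \<in> sets \<sigma>" for i using A(1) \<sigma>(2) by simp
  define R where "R = (\<lambda>i. A i \<times> (Gr24 - A i))"
  have R: "R i \<in> sets (\<sigma> \<Otimes>\<^sub>M \<sigma>)" for i
    unfolding R_def using A\<sigma>[of i] sets.compl_sets[OF A\<sigma>[of i]] by (simp add: sp)
  have D: "disjointed R i \<in> sets (\<sigma> \<Otimes>\<^sub>M \<sigma>)" for i
    using sets.range_disjointed_sets[of R "\<sigma> \<Otimes>\<^sub>M \<sigma>"] R by auto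
  have "good (\<lambda>z. f z * indicator (disjointed R i) z)" for i
  proof -
    have "(\<lambda>z. f z * indicator (disjointed R i) z) \<in> borel_measurable (\<sigma> \<Otimes>\<^sub>M \<sigma>)" using D by measurable
    note g = good_off_set[OF A\<sigma>[of i] this]
    have "R i = A i \<times> (Gr24 - A i)" by (simp add: R_def)
    hence sub: "disjointed R i \<subseteq> A i \<times> (Gr24 - A i)" using disjointed_subset[of R i] by simp
    show ?thesis
    proof (rule good_cong[OF _ g])
      fix z :: "(real^4) set \<times> (real^4) set"
      show "f z * indicator (disjointed R i) z * indicator (A i \<times> (Gr24 - A i)) z = f z * indicator (disjointed R i) z"
      proof (cases "z \<in> disjointed R i")
        case True
        hence "z \<in> A i \<times> (Gr24 - A i)" using sub by blast
        thus ?thesis by (simp only: indicator_simps mult_1_right)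
      next
        case False
        thus ?thesis by (simp only: indicator_simps mult_zero_left mult_zero_right not_False_eq_True)
      qed
    qed
  qed
  hence "good (\<lambda>z. \<Sum>i. f z * indicator (disjointed R i) z)"
  proof (rule good_suminf)
    show "(\<lambda>z. f z * indicator (disjointed R i) z) \<in> borel_measurable (\<sigma> \<Otimes>\<^sub>M \<sigma>)" for i
      using D by measurable
  qed
  hence "good (\<lambda>z. if fst z = snd z then 0 else f z)"
  proof (rule good_cong[rotated])
    fix z assume z: "z \<in> Gr24 \<times> Gr24"
    have "(\<Sum>i. f z * indicator (disjointed R i) z) = f z * indicator (\<Union>i. disjointed R i) z"
      using suminf_indicator[OF disjoint_family_disjointed, of R z] by simp
    also have "(\<Union>i. disjointed R i) = (\<Union>i. R i)" by (rule UN_disjointed_eq)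
    also have "f z * indicator (\<Union>i. R i) z = (if fst z = snd z then 0 else f z)"
    proof -
      obtain P Q where PQ: "z = (P, Q)" "P \<in> Gr24" "Q \<in> Gr24" using z by blast
      have "z \<in> (\<Union>i. R i) \<longleftrightarrow> (\<exists>i. P \<in> A i \<and> Q \<notin> A i)" using PQ by (simp add: R_def)
      also have "\<dots> \<longleftrightarrow> P \<noteq> Q" using A(2)[OF PQ(2,3)] by blast
      finally show ?thesis by (simp add: PQ(1) indicator_def del: UN_iff)
    qed
    finally show "(\<Sum>i. f z * indicator (disjointed R i) z) = (if fst z = snd z then 0 else f z)" .
  qed
  moreover have "(\<integral>\<^sup>+z. (if fst z = snd z then 0 else f z) * \<rho> z \<partial>(\<sigma> \<Otimes>\<^sub>M \<sigma>)) = (\<integral>\<^sup>+z. f z * \<rho> z \<partial>(\<sigma> \<Otimes>\<^sub>M \<sigma>))"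
    by (intro nn_integral_cong) (auto simp: space_pair_measure sp diag)
  ultimately show "pair_sum (\<lambda>z. if fst z = snd z then 0 else f z) \<in> borel_measurable \<X>"
    "(\<integral>\<^sup>+x. pair_sum (\<lambda>z. if fst z = snd z then 0 else f z) x \<partial>\<X>) = (\<integral>\<^sup>+z. f z * \<rho> z \<partial>(\<sigma> \<Otimes>\<^sub>M \<sigma>))"
    by (auto simp: good_def)
qed

text \<open>Applies \<open>good_off_diagonal\<close> to the positive and the negative part of
  \<open>l\<close> separately; both expectations are finite because \<open>l\<close> times the
  intensity is integrable.\<close>

lemma expectation_pair_sum:
  fixes l :: "(real^4) set \<times> (real^4) set \<Rightarrow> real"
  assumes l [measurable]: "l \<in> borel_measurable (\<sigma> \<Otimes>\<^sub>M \<sigma>)"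
    and int: "integrable (\<sigma> \<Otimes>\<^sub>M \<sigma>) (\<lambda>z. l z * enn2real (\<rho> z))" and \<rho>f: "\<And>z. \<rho> z \<noteq> \<infinity>"
  shows "(\<integral>x. (\<Sum>P\<in>x. \<Sum>Q\<in>x - {P}. l (P, Q)) \<partial>\<X>) = (\<integral>z. l z * enn2real (\<rho> z) \<partial>(\<sigma> \<Otimes>\<^sub>M \<sigma>))"
proof -
  define S where "S = (\<lambda>(g :: real \<Rightarrow> real) x. pair_sum (\<lambda>z. if fst z = snd z then 0 else ennreal (g (l z))) x)"
  have \<rho>r: "ennreal (enn2real (\<rho> z)) = \<rho> z" for z using \<rho>f[of z] by (simp add: less_top)
  have S: "S g \<in> borel_measurable \<X>" "(\<integral>\<^sup>+x. S g x \<partial>\<X>) = (\<integral>\<^sup>+z. ennreal (g (l z)) * \<rho> z \<partial>(\<sigma> \<Otimes>\<^sub>M \<sigma>))"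
    if [measurable]: "g \<in> borel_measurable borel" for g
    unfolding S_def by (rule good_off_diagonal; measurable)+
  define p n where "p = S (\<lambda>x. x)" and "n = S uminus"
  have c: "ennreal (u * enn2real (\<rho> z)) = ennreal u * \<rho> z" for u z
    using ennreal_mult''[of "enn2real (\<rho> z)" u] \<rho>r[of z] by simp
  have pn1: "p \<in> borel_measurable \<X>" unfolding p_def by (rule S(1)) simp
  have pn2: "n \<in> borel_measurable \<X>" unfolding n_def by (rule S(1)) simp
  have pn3: "(\<integral>\<^sup>+x. p x \<partial>\<X>) = (\<integral>\<^sup>+z. ennreal (l z * enn2real (\<rho> z)) \<partial>(\<sigma> \<Otimes>\<^sub>M \<sigma>))"
    unfolding p_def c by (rule S(2)) simp
  have pn4: "(\<integral>\<^sup>+x. n x \<partial>\<X>) = (\<integral>\<^sup>+z. ennreal (- (l z * enn2real (\<rho> z))) \<partial>(\<sigma> \<Otimes>\<^sub>M \<sigma>))"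
    unfolding n_def mult_minus_left[symmetric] c by (rule S(2)) simp
  note pn = pn1 pn2 pn3 pn4
  have f: "(\<integral>\<^sup>+x. p x \<partial>\<X>) \<noteq> \<infinity>" "(\<integral>\<^sup>+x. n x \<partial>\<X>) \<noteq> \<infinity>"
    using int[unfolded real_integrable_def] unfolding pn(3,4) by blast+
  have e: "S g x = ennreal (\<Sum>P\<in>x. \<Sum>Q\<in>x - {P}. max 0 (g (l (P, Q))))" if "x \<in> space \<X>" for g x
  proof -
    have x: "finite x" by (rule point_process_space[OF pp that])
    have "S g x = (\<Sum>P\<in>x. \<Sum>Q\<in>x. if P = Q then 0 else ennreal (g (l (P, Q))))"
      unfolding S_def pair_sum_finite[OF x] by simp
    also have "\<dots> = (\<Sum>P\<in>x. \<Sum>Q\<in>x - {P}. ennreal (max 0 (g (l (P, Q)))))"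
      using x by (intro sum.cong refl sum.mono_neutral_cong_right) (auto simp: max_def ennreal_neg)
    also have "\<dots> = ennreal (\<Sum>P\<in>x. \<Sum>Q\<in>x - {P}. max 0 (g (l (P, Q))))"
      by (simp only: sum_ennreal sum_nonneg max.cobounded1)
    finally show ?thesis .
  qed
  have d: "(\<Sum>P\<in>x. \<Sum>Q\<in>x - {P}. l (P, Q)) = enn2real (p x) - enn2real (n x)" "p x \<noteq> \<infinity>" "n x \<noteq> \<infinity>"
    if "x \<in> space \<X>" for x
  proof -
    have "l z = max 0 (l z) - max 0 (- l z)" for z by auto
    hence "(\<Sum>P\<in>x. \<Sum>Q\<in>x - {P}. l (P, Q)) = (\<Sum>P\<in>x. \<Sum>Q\<in>x - {P}. max 0 (l (P, Q)) - max 0 (- l (P, Q)))" by simp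
    thus "(\<Sum>P\<in>x. \<Sum>Q\<in>x - {P}. l (P, Q)) = enn2real (p x) - enn2real (n x)" "p x \<noteq> \<infinity>" "n x \<noteq> \<infinity>"
      unfolding p_def n_def e[OF that] by (simp_all add: sum_nonneg sum_subtractf)
  qed
  have i: "integrable \<X> (\<lambda>x. enn2real (q x))" "(\<integral>x. enn2real (q x) \<partial>\<X>) = enn2real (\<integral>\<^sup>+x. q x \<partial>\<X>)"
    if [measurable]: "q \<in> borel_measurable \<X>" and fi: "(\<integral>\<^sup>+x. q x \<partial>\<X>) \<noteq> \<infinity>" and qf: "\<And>x. x \<in> space \<X> \<Longrightarrow> q x \<noteq> \<infinity>" for q
  proof -
    have "(\<integral>\<^sup>+x. ennreal (enn2real (q x)) \<partial>\<X>) = (\<integral>\<^sup>+x. q x \<partial>\<X>)"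
      by (rule nn_integral_cong) (use qf in \<open>simp add: less_top\<close>)
    thus "integrable \<X> (\<lambda>x. enn2real (q x))" "(\<integral>x. enn2real (q x) \<partial>\<X>) = enn2real (\<integral>\<^sup>+x. q x \<partial>\<X>)"
      using fi by (auto simp: integrable_iff_bounded integral_eq_nn_integral less_top)
  qed
  have "(\<integral>x. (\<Sum>P\<in>x. \<Sum>Q\<in>x - {P}. l (P, Q)) \<partial>\<X>) = (\<integral>x. enn2real (p x) - enn2real (n x) \<partial>\<X>)"
    by (rule Bochner_Integration.integral_cong) (use d in auto)
  also have "\<dots> = enn2real (\<integral>\<^sup>+x. p x \<partial>\<X>) - enn2real (\<integral>\<^sup>+x. n x \<partial>\<X>)"
    using i[OF pn(1) f(1) d(2)] i[OF pn(2) f(2) d(3)] by simp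
  also have "\<dots> = (\<integral>z. l z * enn2real (\<rho> z) \<partial>(\<sigma> \<Otimes>\<^sub>M \<sigma>))"
    unfolding pn(3,4) using real_lebesgue_integral_def[OF int] by simp
  finally show ?thesis .
qed

end

section \<open>The minimal logarithmic energy\<close>

abbreviation xi_pair :: "(real^4) set \<times> (real^4) set \<Rightarrow> real \<times> real" where
  "xi_pair z \<equiv> (xi_plus (fst z) (snd z), xi_minus (fst z) (snd z))"

lemma measurable_xi_pair:
  assumes "sets \<mu> = sets Gr24_borel" "sets \<nu> = sets Gr24_borel"
  shows "xi_pair \<in> \<mu> \<Otimes>\<^sub>M \<nu> \<rightarrow>\<^sub>M borel \<Otimes>\<^sub>M borel"
proof -
  note [measurable_cong] = assms
  show ?thesis by measurable
qed

text \<open>The inner integral over \<sigma> is the same for every plane, so the first factor may be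
  any probability measure: potentials of \<sigma> are constant.\<close>

lemma nn_integral_xi2:
  assumes inv: "invariant_prob_Gr24 \<sigma>" and \<mu>: "prob_space \<mu>" "sets \<mu> = sets Gr24_borel"
    and f [measurable]: "f \<in> borel_measurable (borel \<Otimes>\<^sub>M borel)"
    and sym: "\<And>x y. f (x, y) = f (y, x)" "\<And>x y. f (- x, - y) = (f (x, y) :: ennreal)"
  shows "(\<integral>\<^sup>+z. f (xi_pair z) \<partial>(\<mu> \<Otimes>\<^sub>M \<sigma>)) = (\<integral>\<^sup>+z. f z \<partial>unif2)"
proof -
  interpret \<mu>: prob_space \<mu> by fact
  interpret \<sigma>: prob_space \<sigma> by (rule prob_space_invariant_prob) fact
  note [measurable] = measurable_xi_pair[OF \<mu>(2) sets_invariant_prob[OF inv]]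
  have "(\<integral>\<^sup>+z. f (xi_pair z) \<partial>(\<mu> \<Otimes>\<^sub>M \<sigma>)) = (\<integral>\<^sup>+P. \<integral>\<^sup>+Q. f (xi_pair (P, Q)) \<partial>\<sigma> \<partial>\<mu>)"
    by (rule \<sigma>.nn_integral_fst[symmetric]) measurable
  also have "\<dots> = (\<integral>\<^sup>+P. \<integral>\<^sup>+z. f z \<partial>unif2 \<partial>\<mu>)"
    by (intro nn_integral_cong) (use nn_integral_xi[OF inv _ f sym] sets_imp_space_Gr24[OF \<mu>(2)] in simp)
  also have "\<dots> = (\<integral>\<^sup>+z. f z \<partial>unif2)" by (simp add: \<mu>.emeasure_space_1)
  finally show ?thesis .
qed

lemma integral_xi2:
  assumes inv: "invariant_prob_Gr24 \<sigma>" and \<mu>: "prob_space \<mu>" "sets \<mu> = sets Gr24_borel"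
    and f [measurable]: "f \<in> borel_measurable (borel \<Otimes>\<^sub>M borel)"
    and sym: "\<And>x y. f (x, y) = f (y, x)" "\<And>x y. f (- x, - y) = (f (x, y) :: real)"
  shows "integrable (\<mu> \<Otimes>\<^sub>M \<sigma>) (\<lambda>z. f (xi_pair z)) \<longleftrightarrow> integrable unif2 f"
    "(\<integral>z. f (xi_pair z) \<partial>(\<mu> \<Otimes>\<^sub>M \<sigma>)) = (\<integral>z. f z \<partial>unif2)"
proof -
  have f2 [measurable]: "f \<in> borel_measurable unif2" by measurable
  have m [measurable]: "(\<lambda>z. f (xi_pair z)) \<in> borel_measurable (\<mu> \<Otimes>\<^sub>M \<sigma>)"
    by (rule measurable_compose[OF measurable_xi_pair[OF \<mu>(2) sets_invariant_prob[OF inv]] f])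
  have tr: "(\<integral>\<^sup>+z. g (f (xi_pair z)) \<partial>(\<mu> \<Otimes>\<^sub>M \<sigma>)) = (\<integral>\<^sup>+z. g (f z) \<partial>unif2)"
    if [measurable]: "g \<in> borel_measurable borel" for g :: "real \<Rightarrow> ennreal"
    by (rule nn_integral_xi2[OF inv \<mu>]) (measurable, metis sym(1), metis sym(2))
  show i: "integrable (\<mu> \<Otimes>\<^sub>M \<sigma>) (\<lambda>z. f (xi_pair z)) \<longleftrightarrow> integrable unif2 f"
    using tr[of "\<lambda>x. ennreal (norm x)"] m f2 by (simp add: integrable_iff_bounded)
  show "(\<integral>z. f (xi_pair z) \<partial>(\<mu> \<Otimes>\<^sub>M \<sigma>)) = (\<integral>z. f z \<partial>unif2)"
  proof (cases "integrable unif2 f")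
    case True
    thus ?thesis using i tr[of ennreal] tr[of "\<lambda>x. ennreal (- x)"] by (simp add: real_lebesgue_integral_def)
  next
    case False
    thus ?thesis using i by (simp add: not_integrable_integral_eq)
  qed
qed

lemma norm_traceless:
  assumes "P \<in> Gr24"
  shows "norm (traceless P) = 1"
  using xi_prod_traceless[OF assms assms] xi_self[OF assms] by (simp add: norm_eq_sqrt_inner)

section \<open>Positive definiteness of the powers of the cosine product\<close>

text \<open>The weight \<open>h\<close> makes induction on \<open>m\<close> possible: expanding one
  factor of the inner product in coordinates multiplies \<open>h\<close> by a coordinate of
  \<open>traceless\<close>.\<close>

definition bilin :: "(real^4) set measure \<Rightarrow> (real^4) set measure \<Rightarrow> nat \<Rightarrow> ((real^4) set \<Rightarrow> real) \<Rightarrow> real" where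
  "bilin \<mu> \<nu> m h = (\<integral>z. h (fst z) * h (snd z) * (traceless (fst z) \<bullet> traceless (snd z)) ^ m \<partial>(\<mu> \<Otimes>\<^sub>M \<nu>))"

lemma bilin_integrable:
  assumes "prob_space \<mu>" "prob_space \<nu>" "sets \<mu> = sets Gr24_borel" "sets \<nu> = sets Gr24_borel"
    and [measurable]: "h \<in> borel_measurable Gr24_borel" and b: "\<And>P. P \<in> Gr24 \<Longrightarrow> \<bar>h P\<bar> \<le> B"
  shows "integrable (\<mu> \<Otimes>\<^sub>M \<nu>) (\<lambda>z. h (fst z) * h (snd z) * (traceless (fst z) \<bullet> traceless (snd z)) ^ m)"
proof -
  interpret \<mu>: prob_space \<mu> by fact
  interpret \<nu>: prob_space \<nu> by fact
  interpret pair_prob_space \<mu> \<nu> ..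
  note [measurable_cong] = assms(3,4)
  show ?thesis
  proof (rule P.integrable_const_bound[where B = "B * B"])
    show "AE z in \<mu> \<Otimes>\<^sub>M \<nu>. norm (h (fst z) * h (snd z) * (traceless (fst z) \<bullet> traceless (snd z)) ^ m) \<le> B * B"
    proof (rule AE_I2)
      fix z assume "z \<in> space (\<mu> \<Otimes>\<^sub>M \<nu>)"
      hence z: "fst z \<in> Gr24" "snd z \<in> Gr24"
        using sets_imp_space_Gr24[OF assms(3)] sets_imp_space_Gr24[OF assms(4)] by (auto simp: space_pair_measure)
      have "\<bar>traceless (fst z) \<bullet> traceless (snd z)\<bar> \<le> 1"
        using Cauchy_Schwarz_ineq2[of "traceless (fst z)" "traceless (snd z)"] by (simp add: norm_traceless z)
      hence "\<bar>traceless (fst z) \<bullet> traceless (snd z)\<bar> ^ m \<le> 1" by (intro power_le_one) auto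
      moreover have "\<bar>h (fst z)\<bar> * \<bar>h (snd z)\<bar> \<le> B * B" using b[OF z(1)] b[OF z(2)] by (intro mult_mono) auto
      moreover have "0 \<le> B" using b[OF z(1)] by linarith
      ultimately have "\<bar>h (fst z)\<bar> * \<bar>h (snd z)\<bar> * \<bar>traceless (fst z) \<bullet> traceless (snd z)\<bar> ^ m \<le> B * B * 1"
        using mult_mono[of "\<bar>h (fst z)\<bar> * \<bar>h (snd z)\<bar>" "B * B" "\<bar>traceless (fst z) \<bullet> traceless (snd z)\<bar> ^ m" 1] by simp
      thus "norm (h (fst z) * h (snd z) * (traceless (fst z) \<bullet> traceless (snd z)) ^ m) \<le> B * B"
        by (simp add: abs_mult power_abs)
    qed
  qed measurable
qed

text \<open>The kernel \<open>(\<xi>\<^sub>+ \<xi>\<^sub>-) ^ m\<close> is a power of a Gram kernel, hence positive definite.\<close>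

lemma bilin_nonneg:
  assumes "prob_space \<mu>" "prob_space \<nu>" "sets \<mu> = sets Gr24_borel" "sets \<nu> = sets Gr24_borel"
    and "h \<in> borel_measurable Gr24_borel" "\<And>P. P \<in> Gr24 \<Longrightarrow> \<bar>h P\<bar> \<le> B"
  shows "0 \<le> bilin \<mu> \<mu> m h - 2 * bilin \<mu> \<nu> m h + bilin \<nu> \<nu> m h"
  using assms(5,6)
proof (induction m arbitrary: h B)
  case 0
  note [measurable] = 0(1)
  have ih: "integrable \<mu> h" if "prob_space \<mu>" "sets \<mu> = sets Gr24_borel" for \<mu>
  proof -
    interpret prob_space \<mu> by fact
    note [measurable_cong] = that(2)
    show ?thesis by (rule integrable_const_bound[where B = B])
      (use 0(2) sets_imp_space_Gr24[OF that(2)] in \<open>auto intro!: AE_I2\<close>)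
  qed
  have pr: "bilin \<mu> \<nu> 0 h = (\<integral>P. h P \<partial>\<mu>) * (\<integral>P. h P \<partial>\<nu>)"
    if "prob_space \<mu>" "prob_space \<nu>" "sets \<mu> = sets Gr24_borel" "sets \<nu> = sets Gr24_borel" for \<mu> \<nu>
  proof -
    interpret \<mu>: prob_space \<mu> by fact
    interpret \<nu>: prob_space \<nu> by fact
    interpret pair_prob_space \<mu> \<nu> ..
    have "(\<integral>z. h (fst z) * h (snd z) \<partial>(\<mu> \<Otimes>\<^sub>M \<nu>)) = (\<integral>P. (\<integral>Q. h P * h Q \<partial>\<nu>) \<partial>\<mu>)"
      using integral_fst[of "\<lambda>P Q. h P * h Q"] bilin_integrable[OF that 0(1) 0(2), of 0]
      by (simp add: case_prod_beta')
    thus ?thesis by (simp add: bilin_def)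
  qed
  have "bilin \<mu> \<mu> 0 h - 2 * bilin \<mu> \<nu> 0 h + bilin \<nu> \<nu> 0 h = ((\<integral>P. h P \<partial>\<mu>) - (\<integral>P. h P \<partial>\<nu>))\<^sup>2"
    by (simp add: pr assms power2_eq_square algebra_simps)
  thus ?case by simp
next
  case (Suc m)
  define k where "k = (\<lambda>b P. h P * (traceless P \<bullet> b))"
  note [measurable] = Suc.prems(1)
  have km: "k b \<in> borel_measurable Gr24_borel" for b unfolding k_def by measurable
  have kb: "\<bar>k b P\<bar> \<le> B" if "b \<in> Basis" "P \<in> Gr24" for b P
  proof -
    have "\<bar>traceless P \<bullet> b\<bar> \<le> 1" using Basis_le_norm[OF that(1), of "traceless P"] norm_traceless[OF that(2)] by simp
    hence "\<bar>h P\<bar> * \<bar>traceless P \<bullet> b\<bar> \<le> B * 1" using Suc.prems(2)[OF that(2)] by (intro mult_mono) auto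
    thus ?thesis by (simp add: k_def abs_mult)
  qed
  have e: "bilin \<mu> \<nu> (Suc m) h = (\<Sum>b\<in>Basis. bilin \<mu> \<nu> m (k b))"
    if "prob_space \<mu>" "prob_space \<nu>" "sets \<mu> = sets Gr24_borel" "sets \<nu> = sets Gr24_borel" for \<mu> \<nu>
  proof -
    have "h P * h Q * (traceless P \<bullet> traceless Q) ^ Suc m = (\<Sum>b\<in>Basis. k b P * k b Q * (traceless P \<bullet> traceless Q) ^ m)" for P Q
    proof -
      have "h P * h Q * (traceless P \<bullet> traceless Q) ^ Suc m = (h P * h Q * (traceless P \<bullet> traceless Q) ^ m) * (\<Sum>b\<in>Basis. (traceless P \<bullet> b) * (traceless Q \<bullet> b))"
        by (subst euclidean_inner[symmetric]) simp
      thus ?thesis by (simp add: sum_distrib_left k_def mult_ac)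
    qed
    hence "bilin \<mu> \<nu> (Suc m) h = (\<integral>z. (\<Sum>b\<in>Basis. k b (fst z) * k b (snd z) * (traceless (fst z) \<bullet> traceless (snd z)) ^ m) \<partial>(\<mu> \<Otimes>\<^sub>M \<nu>))"
      by (simp add: bilin_def)
    also have "\<dots> = (\<Sum>b\<in>Basis. bilin \<mu> \<nu> m (k b))"
      unfolding bilin_def by (rule Bochner_Integration.integral_sum) (rule bilin_integrable[OF that km kb])
    finally show ?thesis .
  qed
  have "bilin \<mu> \<mu> (Suc m) h - 2 * bilin \<mu> \<nu> (Suc m) h + bilin \<nu> \<nu> (Suc m) h =
     (\<Sum>b\<in>Basis. bilin \<mu> \<mu> m (k b) - 2 * bilin \<mu> \<nu> m (k b) + bilin \<nu> \<nu> m (k b))"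
    by (simp add: e assms sum.distrib sum_subtractf sum_distrib_left)
  also have "0 \<le> \<dots>" by (intro sum_nonneg Suc.IH[OF km kb])
  finally show ?case .
qed

text \<open>Positive definiteness applied to \<mu> - \<sigma>. Both terms that involve \<sigma>
  equal the integral over \<open>unif2\<close>, since potentials of \<sigma> are constant, and they
  combine to minus that integral.\<close>

lemma xi_power_integral_ge:
  assumes inv: "invariant_prob_Gr24 \<sigma>" and \<mu>: "prob_space \<mu>" "sets \<mu> = sets Gr24_borel"
  shows "(\<integral>z. (fst z * snd z) ^ m \<partial>unif2) \<le> (\<integral>z. (xi_plus (fst z) (snd z) * xi_minus (fst z) (snd z)) ^ m \<partial>(\<mu> \<Otimes>\<^sub>M \<mu>))"
proof -
  note \<sigma> = prob_space_invariant_prob[OF inv] sets_invariant_prob[OF inv]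
  have b: "bilin \<mu> \<nu> m (\<lambda>_. 1) = (\<integral>z. (xi_plus (fst z) (snd z) * xi_minus (fst z) (snd z)) ^ m \<partial>(\<mu> \<Otimes>\<^sub>M \<nu>))"
    if "sets \<mu> = sets Gr24_borel" "sets \<nu> = sets Gr24_borel" for \<mu> \<nu>
    unfolding bilin_def using sets_imp_space_Gr24[OF that(1)] sets_imp_space_Gr24[OF that(2)]
    by (intro Bochner_Integration.integral_cong) (auto simp: space_pair_measure xi_prod_traceless)
  have u: "(\<integral>z. (xi_plus (fst z) (snd z) * xi_minus (fst z) (snd z)) ^ m \<partial>(\<nu> \<Otimes>\<^sub>M \<sigma>)) = (\<integral>z. (fst z * snd z) ^ m \<partial>unif2)"
    if "prob_space \<nu>" "sets \<nu> = sets Gr24_borel" for \<nu>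
    using integral_xi2(2)[OF inv that, of "\<lambda>z. (fst z * snd z) ^ m"] by (simp add: mult.commute)
  have "0 \<le> bilin \<mu> \<mu> m (\<lambda>_. 1) - 2 * bilin \<mu> \<sigma> m (\<lambda>_. 1) + bilin \<sigma> \<sigma> m (\<lambda>_. 1)"
    by (rule bilin_nonneg[where B = 1]) (use \<mu> \<sigma> in auto)
  thus ?thesis using u[OF \<mu>] u[OF \<sigma>] by (simp add: b \<mu> \<sigma>)
qed

section \<open>Damped logarithmic kernels and the minimality of the invariant measure\<close>

text \<open>Partial sums of the series of - ln (1 - r t). The coefficients are positive, so
  inequalities for powers add up, and the damping r < 1 keeps the sums uniformly bounded on |t|
  \<le> 1.\<close>

definition ln_partial :: "real \<Rightarrow> nat \<Rightarrow> real \<Rightarrow> real" where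
  "ln_partial r n t = (\<Sum>m<n. r ^ Suc m / real (Suc m) * t ^ Suc m)"

lemma ln_partial_sums:
  assumes "0 < r" "r < 1" "\<bar>t\<bar> \<le> 1"
  shows "(\<lambda>n. ln_partial r n t) \<longlonglongrightarrow> - ln (1 - r * t)"
proof -
  have "\<bar>r * t\<bar> \<le> r * 1" unfolding abs_mult using assms by (intro mult_mono) auto
  hence "\<bar>- (r * t)\<bar> < 1" using assms by simp
  hence "(\<lambda>n. - ((- (- (r * t))) ^ n) / of_nat n) sums ln (1 + - (r * t))" by (rule ln_series')
  hence "(\<lambda>n. - ((r * t) ^ n / real n)) sums ln (1 - r * t)" by simp
  hence "(\<lambda>n. (r * t) ^ n / real n) sums - ln (1 - r * t)" using sums_minus by force
  hence "(\<lambda>n. (r * t) ^ Suc n / real (Suc n)) sums - ln (1 - r * t)"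
    by (subst sums_Suc_iff) simp
  moreover have "ln_partial r n t = (\<Sum>m<n. (r * t) ^ Suc m / real (Suc m))" for n
    by (simp add: ln_partial_def power_mult_distrib del: power_Suc of_nat_Suc)
  ultimately show ?thesis by (simp only: sums_def)
qed

lemma ln_partial_bound:
  assumes "0 < r" "r < 1" "\<bar>t\<bar> \<le> 1"
  shows "\<bar>ln_partial r n t\<bar> \<le> - ln (1 - r)"
proof -
  have "\<bar>ln_partial r n t\<bar> \<le> (\<Sum>m<n. \<bar>r ^ Suc m / real (Suc m) * t ^ Suc m\<bar>)" unfolding ln_partial_def by (rule sum_abs)
  also have "\<dots> \<le> ln_partial r n 1" unfolding ln_partial_def
  proof (rule sum_mono)
    fix m
    have "\<bar>t\<bar> ^ Suc m \<le> 1" using assms by (intro power_le_one) auto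
    hence "r ^ Suc m / real (Suc m) * \<bar>t\<bar> ^ Suc m \<le> r ^ Suc m / real (Suc m) * 1" using assms by (intro mult_left_mono) auto
    thus "\<bar>r ^ Suc m / real (Suc m) * t ^ Suc m\<bar> \<le> r ^ Suc m / real (Suc m) * 1 ^ Suc m"
      using assms by (simp add: abs_mult power_abs)
  qed
  also have "\<dots> \<le> - ln (1 - r * 1)"
  proof (rule incseq_le[OF _ ln_partial_sums])
    show "incseq (\<lambda>n. ln_partial r n 1)" by (rule incseq_SucI) (use assms in \<open>simp add: ln_partial_def\<close>)
  qed (use assms in auto)
  finally show ?thesis by simp
qed

lemma ln_partial_integral_tendsto:
  assumes "prob_space M" and [measurable]: "T \<in> borel_measurable M" and T: "AE x in M. \<bar>T x\<bar> \<le> 1"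
    and r: "0 < r" "r < 1"
  shows "(\<lambda>n. \<integral>x. ln_partial r n (T x) \<partial>M) \<longlonglongrightarrow> (\<integral>x. - ln (1 - r * T x) \<partial>M)"
proof -
  interpret prob_space M by fact
  have [measurable]: "(\<lambda>x. ln_partial r n (T x)) \<in> borel_measurable M" for n unfolding ln_partial_def by measurable
  show ?thesis
  proof (rule integral_dominated_convergence[where w = "\<lambda>_. - ln (1 - r)"])
    show "AE x in M. (\<lambda>n. ln_partial r n (T x)) \<longlonglongrightarrow> - ln (1 - r * T x)"
      using T by eventually_elim (rule ln_partial_sums[OF r])
    show "AE x in M. norm (ln_partial r n (T x)) \<le> - ln (1 - r)" for n
      using T by eventually_elim (simp add: ln_partial_bound[OF r])
  qed auto
qed

text \<open>Follows from 1 - t \<le> (1 - r t) (2 - r) and ln (2 - r) \<le> 1 - r: damping raises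
  the kernel by at most 1 - r, a bound uniform in t.\<close>

lemma ln_scaled_upper:
  assumes "0 < r" "r < 1" "-1 \<le> t" "t < (1::real)"
  shows "- ln (1 - r * t) \<le> - ln (1 - t) + (1 - r)"
proof -
  have rt: "r * t < 1"
  proof (cases "t > 0")
    case True
    have "r * t < 1 * 1" using assms True by (intro mult_strict_mono) auto
    thus ?thesis by simp
  next
    case False
    hence "r * t \<le> 0" using assms by (intro mult_nonneg_nonpos) auto
    thus ?thesis by simp
  qed
  have "(1 - r) * (1 - r) \<le> 1 - r" using assms by (simp add: mult_left_le)
  moreover have "0 \<le> (1 + t) * ((1 - r) * (1 - r))" using assms by simp
  moreover have "(1 - r * t) * (2 - r) - (1 - t) = (1 - r) - (1 - r) * (1 - r) + (1 + t) * ((1 - r) * (1 - r))"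
    by (simp add: algebra_simps)
  ultimately have "1 - t \<le> (1 - r * t) * (2 - r)" by linarith
  hence "ln (1 - t) \<le> ln ((1 - r * t) * (2 - r))" using assms by (intro ln_mono) auto
  also have "\<dots> = ln (1 - r * t) + ln (2 - r)" using rt assms by (intro ln_mult_pos) auto
  also have "ln (2 - r) \<le> 1 - r" using ln_le_minus_one[of "2 - r"] assms by simp
  finally show ?thesis by simp
qed

text \<open>1 - r t lies between 1 and 1 - t, so the undamped logarithm is a majorant.\<close>

lemma abs_ln_scaled_le:
  assumes "0 \<le> r" "r \<le> 1" "\<bar>t\<bar> < (1::real)"
  shows "\<bar>ln (1 - r * t)\<bar> \<le> \<bar>ln (1 - t)\<bar>"
proof (cases "t \<ge> 0")
  case True
  have "r * t \<le> 1 * t" using True assms by (intro mult_right_mono) auto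
  hence "ln (1 - t) \<le> ln (1 - r * t)" using assms by (intro ln_mono) auto
  moreover have "ln (1 - r * t) \<le> 0" using True assms \<open>r * t \<le> 1 * t\<close> by (intro ln_le_zero_iff[THEN iffD2]) auto
  ultimately show ?thesis by linarith
next
  case False
  have "1 * t \<le> r * t" using False assms by (intro mult_right_mono_neg) auto
  moreover have "r * t \<le> 0" using False assms by (intro mult_nonneg_nonpos) auto
  ultimately have "ln (1 - r * t) \<le> ln (1 - t)" "0 \<le> ln (1 - r * t)" by (auto intro!: ln_mono)
  thus ?thesis by linarith
qed

lemma integrable_ln_unif2: "integrable unif2 (\<lambda>z. ln (1 - fst z * snd z))"
  using integrable_times_ln[of "\<lambda>_. 1" 1] by simp

text \<open>Compares the damped energies, where the series may be integrated term by term, and lets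
  r tend to 1: by dominated convergence on the side of \<open>unif2\<close>, by the one-sided bound
  \<open>ln_scaled_upper\<close> on the side of \<mu>.\<close>

lemma ln_energy_ge:
  assumes inv: "invariant_prob_Gr24 \<sigma>" and \<mu>: "prob_space \<mu>" "sets \<mu> = sets Gr24_borel"
  defines "t \<equiv> \<lambda>z. xi_plus (fst z) (snd z) * xi_minus (fst z) (snd z)"
  assumes ae: "AE z in \<mu> \<Otimes>\<^sub>M \<mu>. t z < 1" and int: "integrable (\<mu> \<Otimes>\<^sub>M \<mu>) (\<lambda>z. ln (1 - t z))"
  shows "(\<integral>z. - ln (1 - fst z * snd z) \<partial>unif2) \<le> (\<integral>z. - ln (1 - t z) \<partial>(\<mu> \<Otimes>\<^sub>M \<mu>))"
proof -
  interpret \<mu>: prob_space \<mu> by fact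
  interpret MM: pair_prob_space \<mu> \<mu> ..
  note [measurable_cong] = \<mu>(2)
  have tm [measurable]: "t \<in> borel_measurable (\<mu> \<Otimes>\<^sub>M \<mu>)" unfolding t_def by measurable
  have t1: "\<bar>t z\<bar> \<le> 1" for z unfolding t_def by (rule xi_prod_le_1)
  have u1: "AE z in unif2. \<bar>fst z * snd z\<bar> < 1"
    using unif2_AE
  proof eventually_elim
    case (elim z)
    hence "\<bar>fst z\<bar> * \<bar>snd z\<bar> \<le> \<bar>fst z\<bar> * 1" by (intro mult_left_mono) auto
    thus ?case using elim by (simp add: abs_mult)
  qed
  have step: "(\<integral>z. - ln (1 - r * (fst z * snd z)) \<partial>unif2) \<le> (\<integral>z. - ln (1 - t z) \<partial>(\<mu> \<Otimes>\<^sub>M \<mu>)) + (1 - r)" if r: "0 < r" "r < 1" for r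
  proof -
    have "(\<integral>z. - ln (1 - r * (fst z * snd z)) \<partial>unif2) \<le> (\<integral>z. - ln (1 - r * t z) \<partial>(\<mu> \<Otimes>\<^sub>M \<mu>))"
    proof (rule LIMSEQ_le)
      show "(\<lambda>n. \<integral>z. ln_partial r n (fst z * snd z) \<partial>unif2) \<longlonglongrightarrow> (\<integral>z. - ln (1 - r * (fst z * snd z)) \<partial>unif2)"
        by (rule ln_partial_integral_tendsto[OF unif2.prob_space_axioms _ _ r]) (use u1 in \<open>auto elim: eventually_mono\<close>)
      show "(\<lambda>n. \<integral>z. ln_partial r n (t z) \<partial>(\<mu> \<Otimes>\<^sub>M \<mu>)) \<longlonglongrightarrow> (\<integral>z. - ln (1 - r * t z) \<partial>(\<mu> \<Otimes>\<^sub>M \<mu>))"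
        by (rule ln_partial_integral_tendsto[OF MM.prob_space_axioms _ _ r]) (use t1 in auto)
      have "(\<integral>z. ln_partial r n (fst z * snd z) \<partial>unif2) \<le> (\<integral>z. ln_partial r n (t z) \<partial>(\<mu> \<Otimes>\<^sub>M \<mu>))" for n
      proof -
        have i1: "integrable unif2 (\<lambda>z. (fst z * snd z) ^ m)" for m
        proof (rule unif2.integrable_const_bound[where B = 1])
          show "AE z in unif2. norm ((fst z * snd z) ^ m) \<le> 1"
            using u1 by eventually_elim (simp only: real_norm_def power_abs power_le_one abs_ge_zero less_imp_le)
        qed measurable
        have i2: "integrable (\<mu> \<Otimes>\<^sub>M \<mu>) (\<lambda>z. t z ^ m)" for m
          by (rule MM.integrable_const_bound[where B = 1]) (use t1 in \<open>auto simp: power_abs power_le_one\<close>)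
        have "(\<integral>z. ln_partial r n (fst z * snd z) \<partial>unif2) = (\<Sum>m<n. r ^ Suc m / real (Suc m) * (\<integral>z. (fst z * snd z) ^ Suc m \<partial>unif2))"
          unfolding ln_partial_def using i1 by (subst Bochner_Integration.integral_sum) (auto simp del: power_Suc)
        also have "\<dots> \<le> (\<Sum>m<n. r ^ Suc m / real (Suc m) * (\<integral>z. t z ^ Suc m \<partial>(\<mu> \<Otimes>\<^sub>M \<mu>)))"
          using r unfolding t_def by (intro sum_mono mult_left_mono xi_power_integral_ge[OF inv \<mu>]) auto
        also have "\<dots> = (\<integral>z. ln_partial r n (t z) \<partial>(\<mu> \<Otimes>\<^sub>M \<mu>))"
          unfolding ln_partial_def using i2 by (subst Bochner_Integration.integral_sum) (auto simp del: power_Suc)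
        finally show ?thesis .
      qed
      thus "\<exists>N. \<forall>n\<ge>N. (\<integral>z. ln_partial r n (fst z * snd z) \<partial>unif2) \<le> (\<integral>z. ln_partial r n (t z) \<partial>(\<mu> \<Otimes>\<^sub>M \<mu>))" by blast
    qed
    also have "\<dots> \<le> (\<integral>z. - ln (1 - t z) + (1 - r) \<partial>(\<mu> \<Otimes>\<^sub>M \<mu>))"
    proof (rule integral_mono_AE)
      show "AE z in \<mu> \<Otimes>\<^sub>M \<mu>. - ln (1 - r * t z) \<le> - ln (1 - t z) + (1 - r)"
        using ae
      proof eventually_elim
        case (elim z)
        thus ?case using t1[of z] by (intro ln_scaled_upper[OF r]) auto
      qed
      show "integrable (\<mu> \<Otimes>\<^sub>M \<mu>) (\<lambda>z. - ln (1 - r * t z))"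
      proof (rule Bochner_Integration.integrable_bound[OF int[THEN integrable_norm, THEN Bochner_Integration.integrable_add, OF MM.integrable_const[of 1]]])
        show "AE z in \<mu> \<Otimes>\<^sub>M \<mu>. norm (- ln (1 - r * t z)) \<le> norm (norm (ln (1 - t z)) + 1)"
          using ae
        proof eventually_elim
          case (elim z)
          show ?case
          proof (cases "t z = - 1")
            \<comment> \<open>The value -1 lies outside the range of
              \<open>abs_ln_scaled_le\<close>, but there the damped logarithm is at most ln
              2.\<close>
            case True
            have "ln (1 + r) \<le> ln 2" "0 \<le> ln (1 + r)" using r by (auto intro!: ln_mono)
            thus ?thesis using True by simp
          next
            case False
            hence "\<bar>t z\<bar> < 1" using elim t1[of z] by linarith
            from abs_ln_scaled_le[OF _ _ this, of r] r show ?thesis by simp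
          qed
        qed
      qed measurable
      show "integrable (\<mu> \<Otimes>\<^sub>M \<mu>) (\<lambda>z. - ln (1 - t z) + (1 - r))" using int by simp
    qed
    also have "\<dots> = (\<integral>z. - ln (1 - t z) \<partial>(\<mu> \<Otimes>\<^sub>M \<mu>)) + (1 - r)"
      using int MM.prob_space by simp
    finally show ?thesis .
  qed
  define r where "r = (\<lambda>n. 1 - 1 / (real n + 2))"
  have r: "0 < r n" "r n < 1" for n by (auto simp: r_def field_simps)
  have rlim: "r \<longlonglongrightarrow> 1" unfolding r_def by real_asymp
  show ?thesis
  proof (rule LIMSEQ_le)
    show "(\<lambda>n. \<integral>z. - ln (1 - r n * (fst z * snd z)) \<partial>unif2) \<longlonglongrightarrow> (\<integral>z. - ln (1 - fst z * snd z) \<partial>unif2)"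
    proof (rule integral_dominated_convergence[where w = "\<lambda>z. \<bar>ln (1 - fst z * snd z)\<bar>"])
      show "integrable unif2 (\<lambda>z. \<bar>ln (1 - fst z * snd z)\<bar>)" using integrable_ln_unif2 by (rule integrable_abs)
      show "AE z in unif2. (\<lambda>n. - ln (1 - r n * (fst z * snd z))) \<longlonglongrightarrow> - ln (1 - fst z * snd z)"
        using u1
      proof eventually_elim
        case (elim z)
        have "(\<lambda>n. - ln (1 - r n * (fst z * snd z))) \<longlonglongrightarrow> - ln (1 - 1 * (fst z * snd z))"
          using elim by (intro tendsto_intros rlim) auto
        thus ?case by simp
      qed
      show "AE z in unif2. norm (- ln (1 - r n * (fst z * snd z))) \<le> \<bar>ln (1 - fst z * snd z)\<bar>" for n
        using u1
      proof eventually_elim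
        case (elim z)
        thus ?case using abs_ln_scaled_le[OF _ _ elim, of "r n"] r[of n] by simp
      qed
    qed measurable
    have "(\<lambda>n. (\<integral>z. - ln (1 - t z) \<partial>(\<mu> \<Otimes>\<^sub>M \<mu>)) + (1 - r n)) \<longlonglongrightarrow> (\<integral>z. - ln (1 - t z) \<partial>(\<mu> \<Otimes>\<^sub>M \<mu>)) + (1 - 1)"
      by (intro tendsto_intros rlim)
    thus "(\<lambda>n. (\<integral>z. - ln (1 - t z) \<partial>(\<mu> \<Otimes>\<^sub>M \<mu>)) + (1 - r n)) \<longlonglongrightarrow> (\<integral>z. - ln (1 - t z) \<partial>(\<mu> \<Otimes>\<^sub>M \<mu>))" by simp
    show "\<exists>N. \<forall>n\<ge>N. (\<integral>z. - ln (1 - r n * (fst z * snd z)) \<partial>unif2) \<le> (\<integral>z. - ln (1 - t z) \<partial>(\<mu> \<Otimes>\<^sub>M \<mu>)) + (1 - r n)"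
      using step[OF r] by blast
  qed
qed

lemma e2ennreal_log_kernel:
  "e2ennreal (log_kernel P Q) = (if xi_plus P Q * xi_minus P Q = 1 then \<infinity> else ennreal (- 1 / 2 * ln (1 - xi_plus P Q * xi_minus P Q)))"
  "e2ennreal (- log_kernel P Q) = ennreal (1 / 2 * ln (1 - xi_plus P Q * xi_minus P Q))"
  by (auto simp: log_kernel_def ln_chordal_dist) (auto simp: chordal_dist_xi e2ennreal_neg)

text \<open>The infimum is attained at \<sigma>, for which pairs with \<xi>_+ \<xi>_- = 1 are a null
  set, as seen from \<open>unif2\<close>. A measure with infinite positive part of the energy lies
  above trivially; otherwise \<xi>_+ \<xi>_- < 1 almost everywhere, as \<open>ln_energy_ge\<close>
  asks.\<close>

lemma W_log_eq:
  assumes inv: "invariant_prob_Gr24 \<sigma>"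
  shows "W_log = - 1 / 2 * (\<integral>z. ln (1 - fst z * snd z) \<partial>unif2)"
proof -
  define w where "w = - 1 / 2 * (\<integral>z. ln (1 - fst z * snd z) \<partial>unif2)"
  define t where "t = (\<lambda>z. xi_plus (fst z) (snd z) * xi_minus (fst z) (snd z))"
  have finite_case: "continuous_log_energy \<mu> = ereal (- 1 / 2 * (\<integral>z. ln (1 - t z) \<partial>(\<mu> \<Otimes>\<^sub>M \<mu>)))"
    if "AE z in \<mu> \<Otimes>\<^sub>M \<mu>. t z < 1" and int: "integrable (\<mu> \<Otimes>\<^sub>M \<mu>) (\<lambda>z. ln (1 - t z))" for \<mu>
  proof -
    have "(\<integral>\<^sup>+ (P, Q). e2ennreal (log_kernel P Q) \<partial>(\<mu> \<Otimes>\<^sub>M \<mu>)) = (\<integral>\<^sup>+z. ennreal (- 1 / 2 * ln (1 - t z)) \<partial>(\<mu> \<Otimes>\<^sub>M \<mu>))"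
      by (rule nn_integral_cong_AE) (use that(1) in \<open>eventually_elim, auto simp: e2ennreal_log_kernel t_def\<close>)
    moreover have "(\<integral>\<^sup>+ (P, Q). e2ennreal (- log_kernel P Q) \<partial>(\<mu> \<Otimes>\<^sub>M \<mu>)) = (\<integral>\<^sup>+z. ennreal (- (- 1 / 2 * ln (1 - t z))) \<partial>(\<mu> \<Otimes>\<^sub>M \<mu>))"
      by (rule nn_integral_cong) (auto simp: e2ennreal_log_kernel t_def)
    moreover have i: "integrable (\<mu> \<Otimes>\<^sub>M \<mu>) (\<lambda>z. - 1 / 2 * ln (1 - t z))" using int by simp
    have fin: "(\<integral>\<^sup>+z. ennreal (- 1 / 2 * ln (1 - t z)) \<partial>(\<mu> \<Otimes>\<^sub>M \<mu>)) \<noteq> \<infinity>"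
      "(\<integral>\<^sup>+z. ennreal (- (- 1 / 2 * ln (1 - t z))) \<partial>(\<mu> \<Otimes>\<^sub>M \<mu>)) \<noteq> \<infinity>"
      using i[unfolded real_integrable_def] by blast+
    have "enn2ereal a - enn2ereal b = ereal (enn2real a - enn2real b)" if "a \<noteq> \<infinity>" "b \<noteq> \<infinity>" for a b
      using that by (cases a; cases b) (auto simp: enn2ereal_ennreal)
    ultimately have "continuous_log_energy \<mu> = ereal (enn2real (\<integral>\<^sup>+z. ennreal (- 1 / 2 * ln (1 - t z)) \<partial>(\<mu> \<Otimes>\<^sub>M \<mu>)) -
        enn2real (\<integral>\<^sup>+z. ennreal (- (- 1 / 2 * ln (1 - t z))) \<partial>(\<mu> \<Otimes>\<^sub>M \<mu>)))"
      unfolding continuous_log_energy_def using fin by simp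
    also have "\<dots> = ereal (\<integral>z. - 1 / 2 * ln (1 - t z) \<partial>(\<mu> \<Otimes>\<^sub>M \<mu>))"
      using real_lebesgue_integral_def[OF i] by simp
    finally show ?thesis by simp
  qed
  note \<sigma> = prob_space_invariant_prob[OF inv] sets_invariant_prob[OF inv]
  have w\<sigma>: "continuous_log_energy \<sigma> = ereal w"
  proof -
    have ae: "AE z in \<sigma> \<Otimes>\<^sub>M \<sigma>. t z < 1"
    proof -
      note [measurable_cong] = \<sigma>(2)
      have tm [measurable]: "t \<in> borel_measurable (\<sigma> \<Otimes>\<^sub>M \<sigma>)" unfolding t_def by measurable
      have "(\<integral>\<^sup>+z. indicator {1} (t z) \<partial>(\<sigma> \<Otimes>\<^sub>M \<sigma>)) = (\<integral>\<^sup>+z. indicator {1} (fst z * snd z) \<partial>unif2)"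
        using nn_integral_xi2[OF inv \<sigma>, of "\<lambda>z. indicator {1} (fst z * snd z)"] by (simp add: t_def mult.commute)
      also have "\<dots> = (\<integral>\<^sup>+z. 0 \<partial>unif2)"
      proof (rule nn_integral_cong_AE)
        show "AE z in unif2. indicator {1} (fst z * snd z) = (0 :: ennreal)"
          using unif2_AE
        proof eventually_elim
          case (elim z)
          hence "\<bar>fst z\<bar> * \<bar>snd z\<bar> \<le> \<bar>fst z\<bar> * 1" by (intro mult_left_mono) auto
          hence "\<bar>fst z * snd z\<bar> < 1" using elim by (simp add: abs_mult)
          thus ?case by (auto simp: indicator_def)
        qed
      qed
      finally have "(\<integral>\<^sup>+z. indicator {1} (t z) \<partial>(\<sigma> \<Otimes>\<^sub>M \<sigma>)) = 0" by simp
      moreover have "(\<lambda>z. indicator {1} (t z) :: ennreal) \<in> borel_measurable (\<sigma> \<Otimes>\<^sub>M \<sigma>)" by measurable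
      ultimately have "AE z in \<sigma> \<Otimes>\<^sub>M \<sigma>. indicator {1} (t z) = (0 :: ennreal)" using nn_integral_0_iff_AE by blast
      thus ?thesis
      proof eventually_elim
        case (elim z)
        thus ?case using xi_prod_le_1[of "fst z" "snd z"] by (auto simp: t_def indicator_def split: if_splits)
      qed
    qed
    have "integrable (\<sigma> \<Otimes>\<^sub>M \<sigma>) (\<lambda>z. ln (1 - t z))" "(\<integral>z. ln (1 - t z) \<partial>(\<sigma> \<Otimes>\<^sub>M \<sigma>)) = (\<integral>z. ln (1 - fst z * snd z) \<partial>unif2)"
      using integral_xi2[OF inv \<sigma>, of "\<lambda>z. ln (1 - fst z * snd z)"] integrable_ln_unif2 by (auto simp: t_def mult.commute)
    thus ?thesis using finite_case[OF ae] by (simp add: w_def)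
  qed
  have ge: "ereal w \<le> continuous_log_energy \<mu>" if "borel_prob_Gr24 \<mu>" for \<mu>
  proof -
    have \<mu>: "prob_space \<mu>" "sets \<mu> = sets Gr24_borel" using that by (auto simp: borel_prob_Gr24_def)
    interpret \<mu>: prob_space \<mu> by fact
    interpret MM: pair_prob_space \<mu> \<mu> ..
    note [measurable_cong] = \<mu>(2)
    have tm [measurable]: "t \<in> borel_measurable (\<mu> \<Otimes>\<^sub>M \<mu>)" unfolding t_def by measurable
    define kp where "kp = (\<lambda>z. if t z = 1 then \<infinity> else ennreal (- 1 / 2 * ln (1 - t z)))"
    have [measurable]: "kp \<in> borel_measurable (\<mu> \<Otimes>\<^sub>M \<mu>)" unfolding kp_def by measurable
    have kp: "(\<integral>\<^sup>+ (P, Q). e2ennreal (log_kernel P Q) \<partial>(\<mu> \<Otimes>\<^sub>M \<mu>)) = (\<integral>\<^sup>+z. kp z \<partial>(\<mu> \<Otimes>\<^sub>M \<mu>))"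
      by (rule nn_integral_cong) (auto simp: e2ennreal_log_kernel t_def kp_def)
    have km: "(\<integral>\<^sup>+ (P, Q). e2ennreal (- log_kernel P Q) \<partial>(\<mu> \<Otimes>\<^sub>M \<mu>)) = (\<integral>\<^sup>+z. ennreal (1 / 2 * ln (1 - t z)) \<partial>(\<mu> \<Otimes>\<^sub>M \<mu>))"
      by (rule nn_integral_cong) (auto simp: e2ennreal_log_kernel t_def)
    have "(\<integral>\<^sup>+z. ennreal (1 / 2 * ln (1 - t z)) \<partial>(\<mu> \<Otimes>\<^sub>M \<mu>)) \<le> (\<integral>\<^sup>+z. ennreal 1 \<partial>(\<mu> \<Otimes>\<^sub>M \<mu>))"
    proof (intro nn_integral_mono ennreal_leI)
      fix z
      have "1 / 2 * ln (1 - t z) \<le> 1 / 2 * ln 2 \<or> t z = 1"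
        using xi_prod_le_1[of "fst z" "snd z"] by (auto simp: t_def intro!: ln_mono)
      thus "1 / 2 * ln (1 - t z) \<le> 1" using ln_le_minus_one[of 2] by auto
    qed
    also have "\<dots> = 1" using MM.emeasure_space_1 by simp
    finally have kmf: "(\<integral>\<^sup>+z. ennreal (1 / 2 * ln (1 - t z)) \<partial>(\<mu> \<Otimes>\<^sub>M \<mu>)) \<noteq> \<infinity>" by (auto simp: top_unique)
    show ?thesis
    proof (cases "(\<integral>\<^sup>+z. kp z \<partial>(\<mu> \<Otimes>\<^sub>M \<mu>)) = \<infinity>")
      case True
      have "\<infinity> - enn2ereal b = \<infinity>" if "b \<noteq> \<infinity>" for b using that by (cases b) (auto simp: enn2ereal_ennreal)
      thus ?thesis using kmf unfolding continuous_log_energy_def kp km True by simp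
    next
      case False
      hence "AE z in \<mu> \<Otimes>\<^sub>M \<mu>. kp z \<noteq> \<infinity>" by (intro nn_integral_PInf_AE) auto
      hence ae: "AE z in \<mu> \<Otimes>\<^sub>M \<mu>. t z < 1"
      proof eventually_elim
        case (elim z)
        thus ?case using xi_prod_le_1[of "fst z" "snd z"] by (auto simp: kp_def t_def split: if_splits)
      qed
      have "(\<integral>\<^sup>+z. kp z \<partial>(\<mu> \<Otimes>\<^sub>M \<mu>)) = (\<integral>\<^sup>+z. ennreal (- 1 / 2 * ln (1 - t z)) \<partial>(\<mu> \<Otimes>\<^sub>M \<mu>))"
        by (rule nn_integral_cong_AE) (use ae in \<open>eventually_elim, auto simp: kp_def\<close>)
      hence "integrable (\<mu> \<Otimes>\<^sub>M \<mu>) (\<lambda>z. 1 / 2 * ln (1 - t z))"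
        using False kmf by (simp add: real_integrable_def)
      from integrable_mult_right[OF this, of 2] have int: "integrable (\<mu> \<Otimes>\<^sub>M \<mu>) (\<lambda>z. ln (1 - t z))" by simp
      show ?thesis unfolding finite_case[OF ae int]
        using ln_energy_ge[OF inv \<mu> ae[unfolded t_def] int[unfolded t_def]] by (simp add: w_def t_def)
    qed
  qed
  have "(INF \<mu>\<in>{\<mu>. borel_prob_Gr24 \<mu>}. continuous_log_energy \<mu>) = ereal w"
  proof (rule antisym)
    show "(INF \<mu>\<in>{\<mu>. borel_prob_Gr24 \<mu>}. continuous_log_energy \<mu>) \<le> ereal w"
      by (rule INF_lower2[of \<sigma>]) (use w\<sigma> \<sigma> in \<open>auto simp: borel_prob_Gr24_def\<close>)
    show "ereal w \<le> (INF \<mu>\<in>{\<mu>. borel_prob_Gr24 \<mu>}. continuous_log_energy \<mu>)"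
      by (rule INF_greatest) (use ge in auto)
  qed
  thus ?thesis by (simp add: W_log_def w_def)
qed

section \<open>The expected energy of the harmonic ensemble\<close>

lemma det_mat_2:
  "Determinant.det (Matrix.mat 2 2 f) = f (0, 0) * f (1, 1) - f (0, 1) * (f (1, 0) :: real)"
proof -
  have s: "{p. p permutes {0, Suc 0}} = {id, Transposition.transpose 0 (Suc 0)}"
    using permutes_doubleton_iff[of _ 0 "Suc 0"] by auto
  have "id \<noteq> Transposition.transpose 0 (1::nat)" by (metis id_apply transpose_apply_first zero_neq_one)
  moreover have "{0..<2::nat} = {0, 1}" by auto
  ultimately show ?thesis by (simp add: Determinant.det_def s sign_swap_id sign_id)
qed

lemma harmonic_kernel_xi: "harmonic_kernel k P Q = harm_kernel (Suc k) (xi_plus P Q) (xi_minus P Q)"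
  by (simp add: harmonic_kernel_def harmonic_sum_factor harm_kernel_def)

lemma harmonic_kernel_self: "P \<in> Gr24 \<Longrightarrow> harmonic_kernel k P P = real (harmonic_dim k)"
  by (simp add: harmonic_kernel_def xi_self P_tau_at_1 harmonic_dim_def)

lemma P_tau_abs_le_1:
  assumes "\<bar>x\<bar> \<le> 1" "\<bar>y\<bar> \<le> 1"
  shows "\<bar>P_tau \<tau> x y\<bar> \<le> 1"
proof -
  have l: "\<bar>legendre m x * legendre n y\<bar> \<le> 1" for m n
    unfolding abs_mult using assms by (intro mult_le_one legendre_abs_le_1) auto
  obtain a b where \<tau>: "\<tau> = (a, b)" by (cases \<tau>)
  have "\<bar>(u + v) / 2\<bar> \<le> 1" if "\<bar>u\<bar> \<le> 1" "\<bar>v\<bar> \<le> 1" for u v :: real using that by (simp add: abs_le_iff)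
  from this[OF l[of "a + b" "a - b"] l[of "a - b" "a + b"]] show ?thesis
    by (simp add: \<tau> P_tau_def mult.commute)
qed

lemma harmonic_kernel_abs_le: "\<bar>harmonic_kernel k P Q\<bar> \<le> real (harmonic_dim k)"
proof -
  have "\<bar>harmonic_kernel k P Q\<bar> \<le> (\<Sum>\<tau>\<in>taus k. \<bar>real (d_tau \<tau>) * P_tau \<tau> (xi_plus P Q) (xi_minus P Q)\<bar>)"
    unfolding harmonic_kernel_def by (rule sum_abs)
  also have "\<dots> \<le> (\<Sum>\<tau>\<in>taus k. real (d_tau \<tau>))"
    by (intro sum_mono) (auto simp: abs_mult intro!: mult_left_le P_tau_abs_le_1 xi_le_1)
  finally show ?thesis by (simp add: harmonic_dim_def)
qed

lemma harm_kernel_commute: "harm_kernel n x y = harm_kernel n y x"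
  and harm_kernel_uminus: "harm_kernel n (- x) (- y) = harm_kernel n x y"
  by (simp_all add: harm_kernel_def mult.commute add.commute)

lemma measurable_harm_kernel [measurable (raw)]:
  assumes [measurable]: "f \<in> borel_measurable M" "g \<in> borel_measurable M"
  shows "(\<lambda>x. harm_kernel n (f x) (g x)) \<in> borel_measurable M"
proof -
  have [measurable]: "poly (cd n) \<in> borel_measurable borel"
    by (intro borel_measurable_continuous_onI continuous_intros)
  show ?thesis unfolding harm_kernel_def by measurable
qed

text \<open>The 2 by 2 determinant is N^2 - K^2, because K is symmetric and constant on the
  diagonal; it is nonnegative since |K| is largest there. The almost sure number of points bounds
  the products of counts, so that their Bochner integral agrees with the nonnegative one.\<close>

lemma harmonic_ensemble_pair_intensity:
  assumes inv: "invariant_prob_Gr24 \<sigma>" and ens: "harmonic_ensemble \<sigma> k \<X>"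
  shows "pair_intensity \<X> \<sigma> (\<lambda>z. ennreal ((real (harmonic_dim k))\<^sup>2 - (harmonic_kernel k (fst z) (snd z))\<^sup>2))"
proof -
  define N where "N = real (harmonic_dim k)"
  define r where "r = (\<lambda>z. N\<^sup>2 - (harmonic_kernel k (fst z) (snd z))\<^sup>2)"
  note \<sigma> = prob_space_invariant_prob[OF inv] sets_invariant_prob[OF inv]
  note sp = sets_imp_space_Gr24[OF \<sigma>(2)]
  interpret prob_space \<sigma> by fact
  interpret SS: pair_prob_space \<sigma> \<sigma> ..
  note [measurable_cong] = \<sigma>(2)
  have pp: "point_process \<X>" and card: "AE x in \<X>. card x = harmonic_dim k"
    and ji: "joint_intensity \<sigma> \<X> 2 (\<lambda>p. Determinant.det (Matrix.mat 2 2 (\<lambda>(i, j). harmonic_kernel k (p i) (p j))))"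
    using ens by (auto simp: harmonic_ensemble_def)
  interpret X: prob_space \<X> using pp by (simp add: point_process_def)
  have r0: "0 \<le> r z" for z
    using harmonic_kernel_abs_le[of k "fst z" "snd z"] by (simp add: r_def N_def abs_le_square_iff[symmetric])
  have rm [measurable]: "r \<in> borel_measurable (\<sigma> \<Otimes>\<^sub>M \<sigma>)"
    unfolding r_def harmonic_kernel_xi by measurable
  have fin: "(\<integral>\<^sup>+z. ennreal (r z) \<partial>(\<sigma> \<Otimes>\<^sub>M \<sigma>)) \<noteq> \<infinity>"
  proof -
    have "(\<integral>\<^sup>+z. ennreal (r z) \<partial>(\<sigma> \<Otimes>\<^sub>M \<sigma>)) \<le> (\<integral>\<^sup>+z. ennreal (N\<^sup>2) \<partial>(\<sigma> \<Otimes>\<^sub>M \<sigma>))"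
      by (intro nn_integral_mono ennreal_leI) (simp add: r_def)
    also have "\<dots> = ennreal (N\<^sup>2)" by (simp add: SS.emeasure_space_1)
    finally show ?thesis by (auto simp: top_unique)
  qed
  have two: "{..<2::nat} = {0, 1}" by auto
  have "pair_intensity \<X> \<sigma> (\<lambda>z. ennreal (r z))"
  proof
    fix C D assume C: "C \<in> sets \<sigma>" and D: "D \<in> sets \<sigma>" and CD: "C \<inter> D = {}"
    have CDG: "C \<in> sets Gr24_borel" "D \<in> sets Gr24_borel" using C D \<sigma>(2) by auto
    have [measurable]: "(\<lambda>x. card (x \<inter> C)) \<in> \<X> \<rightarrow>\<^sub>M count_space UNIV" "(\<lambda>x. card (x \<inter> D)) \<in> \<X> \<rightarrow>\<^sub>M count_space UNIV"
      using point_process_card_measurable[OF pp] CDG by auto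
    define c where "c = (\<lambda>x. real (card (x \<inter> C)) * real (card (x \<inter> D)))"
    define A where "A = (\<lambda>i::nat. if i = 0 then C else D)"
    define G where "G = (\<lambda>P Q. indicat_real (C \<times> D) (P, Q) * r (P, Q))"
    have Gm [measurable]: "(\<lambda>z. G (fst z) (snd z)) \<in> borel_measurable (\<sigma> \<Otimes>\<^sub>M \<sigma>)"
      using C D by (simp add: G_def)
    have G0: "0 \<le> G P Q" for P Q using r0 by (simp add: G_def)
    have "integrable \<X> c"
    proof (rule X.integrable_const_bound[where B = "N * N"])
      show "AE x in \<X>. norm (c x) \<le> N * N"
        using card AE_space
      proof eventually_elim
        case (elim x)
        hence "finite x" using point_process_space[OF pp] by blast
        hence "card (x \<inter> C) \<le> card x" "card (x \<inter> D) \<le> card x" by (auto intro: card_mono)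
        thus ?case using elim by (auto simp: c_def N_def intro!: mult_mono)
      qed
    qed (simp add: c_def)
    hence "(\<integral>\<^sup>+x. ennreal (c x) \<partial>\<X>) = ennreal (\<integral>x. c x \<partial>\<X>)"
      by (intro nn_integral_eq_integral) (auto simp: c_def)
    also have "(\<integral>x. c x \<partial>\<X>) = (\<integral>x. (\<Prod>i<2. real (card (x \<inter> A i))) \<partial>\<X>)"
      by (simp add: two A_def c_def)
    also have "\<dots> = (LINT p:(\<Pi>\<^sub>E i\<in>{..<2}. A i)|(\<Pi>\<^sub>M i\<in>{..<2}. \<sigma>). Determinant.det (Matrix.mat 2 2 (\<lambda>(i, j). harmonic_kernel k (p i) (p j))))"
    proof (rule ji[unfolded joint_intensity_def, rule_format])
      show "disjoint_family_on A {..<2}" using CD by (auto simp: two A_def disjoint_family_on_def)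
    qed (simp add: A_def CDG)
    also have "\<dots> = (\<integral>p. G (p 0) (p 1) \<partial>(\<Pi>\<^sub>M i\<in>{0, 1::nat}. \<sigma>))"
      unfolding set_lebesgue_integral_def two
    proof (rule Bochner_Integration.integral_cong[OF refl])
      fix p assume p: "p \<in> space (\<Pi>\<^sub>M i\<in>{0, 1::nat}. \<sigma>)"
      hence p01: "p 0 \<in> Gr24" "p 1 \<in> Gr24" by (auto simp: space_PiM sp)
      have "p \<in> (\<Pi>\<^sub>E i\<in>{0, 1}. A i) \<longleftrightarrow> (p 0, p 1) \<in> C \<times> D"
        using p by (auto simp: space_PiM A_def PiE_iff)
      thus "indicat_real (\<Pi>\<^sub>E i\<in>{0, 1}. A i) p *\<^sub>R Determinant.det (Matrix.mat 2 2 (\<lambda>(i, j). harmonic_kernel k (p i) (p j))) = G (p 0) (p 1)"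
      proof -
        define P Q where "P = p 0" and "Q = p 1"
        have "harmonic_kernel k P P = N" "harmonic_kernel k Q Q = N" "harmonic_kernel k Q P = harmonic_kernel k P Q"
          unfolding P_def Q_def N_def using harmonic_kernel_self[OF p01(1)] harmonic_kernel_self[OF p01(2)] xi_commute[OF p01]
          by (auto simp only: harmonic_kernel_xi)
        hence "Determinant.det (Matrix.mat 2 2 (\<lambda>(i, j). harmonic_kernel k (p i) (p j))) = r (P, Q)"
          unfolding det_mat_2 r_def by (simp add: P_def Q_def power2_eq_square)
        moreover assume "p \<in> (\<Pi>\<^sub>E i\<in>{0, 1}. A i) \<longleftrightarrow> (p 0, p 1) \<in> C \<times> D"
        ultimately show ?thesis unfolding G_def P_def Q_def indicator_def by simp
      qed
    qed
    also have "\<dots> = enn2real (\<integral>\<^sup>+p. ennreal (G (p 0) (p 1)) \<partial>(\<Pi>\<^sub>M i\<in>{0, 1::nat}. \<sigma>))"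
    proof (rule integral_eq_nn_integral)
      have "(\<lambda>p. (p 0, p 1)) \<in> (\<Pi>\<^sub>M i\<in>{0, 1::nat}. \<sigma>) \<rightarrow>\<^sub>M \<sigma> \<Otimes>\<^sub>M \<sigma>"
        by (intro measurable_Pair measurable_component_singleton) auto
      from measurable_compose[OF this Gm] show "(\<lambda>p. G (p 0) (p 1)) \<in> borel_measurable (\<Pi>\<^sub>M i\<in>{0, 1::nat}. \<sigma>)" by simp
    qed (simp add: G0)
    also have "(\<integral>\<^sup>+p. ennreal (G (p 0) (p 1)) \<partial>(\<Pi>\<^sub>M i\<in>{0, 1::nat}. \<sigma>)) = (\<integral>\<^sup>+z. ennreal (G (fst z) (snd z)) \<partial>(\<sigma> \<Otimes>\<^sub>M \<sigma>))"
    proof -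
      interpret PS: product_sigma_finite "\<lambda>_::nat. \<sigma>" by unfold_locales
      show ?thesis by (rule PS.product_nn_integral_pair) (simp_all add: case_prod_beta')
    qed
    also have "\<dots> = (\<integral>\<^sup>+z. indicator (C \<times> D) z * ennreal (r z) \<partial>(\<sigma> \<Otimes>\<^sub>M \<sigma>))"
      by (intro nn_integral_cong) (auto simp: G_def indicator_def mem_Times_iff)
    also have "ennreal (enn2real \<dots>) = \<dots>"
    proof -
      have "(\<integral>\<^sup>+z. indicator (C \<times> D) z * ennreal (r z) \<partial>(\<sigma> \<Otimes>\<^sub>M \<sigma>)) \<le> (\<integral>\<^sup>+z. ennreal (r z) \<partial>(\<sigma> \<Otimes>\<^sub>M \<sigma>))"
        by (intro nn_integral_mono) (auto simp: indicator_def)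
      hence "(\<integral>\<^sup>+z. indicator (C \<times> D) z * ennreal (r z) \<partial>(\<sigma> \<Otimes>\<^sub>M \<sigma>)) \<noteq> \<infinity>" using fin by (auto simp: top_unique)
      thus ?thesis by (simp add: less_top)
    qed
    finally show "(\<integral>\<^sup>+x. ennreal (real (card (x \<inter> C)) * real (card (x \<inter> D))) \<partial>\<X>) =
      (\<integral>\<^sup>+z. indicator (C \<times> D) z * ennreal (r z) \<partial>(\<sigma> \<Otimes>\<^sub>M \<sigma>))" by (simp add: c_def)
  next
    show "ennreal (r (P, P)) = 0" if "P \<in> Gr24" for P
      by (simp add: r_def harmonic_kernel_self[OF that] N_def)
  qed (use pp \<sigma> fin rm in auto)
  thus ?thesis by (simp add: r_def N_def)
qed

text \<open>The integrand - ln d_c (N^2 - K^2) is a function of the two cosines, symmetric under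
  exchange and common sign change, so its integral moves to \<open>unif2\<close>. There the part
  with N^2 is the minimal energy.\<close>

lemma expected_log_energy:
  assumes inv: "invariant_prob_Gr24 \<sigma>" and ens: "harmonic_ensemble \<sigma> k \<X>"
  shows "(\<integral>x. log_energy x \<partial>\<X>) = W_log * (real (harmonic_dim k))\<^sup>2 +
    1 / 2 * (\<integral>z. (harm_kernel (Suc k) (fst z) (snd z))\<^sup>2 * ln (1 - fst z * snd z) \<partial>unif2)"
proof -
  define N where "N = real (harmonic_dim k)"
  define r where "r = (\<lambda>z. N\<^sup>2 - (harmonic_kernel k (fst z) (snd z))\<^sup>2)"
  note \<sigma> = prob_space_invariant_prob[OF inv] sets_invariant_prob[OF inv]
  note [measurable_cong] = \<sigma>(2)
  interpret PI: pair_intensity \<X> \<sigma> "\<lambda>z. ennreal (r z)"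
    unfolding r_def N_def by (rule harmonic_ensemble_pair_intensity[OF inv ens])
  have r0: "enn2real (ennreal (r z)) = r z" for z
    using harmonic_kernel_abs_le[of k "fst z" "snd z"] by (simp add: r_def N_def abs_le_square_iff[symmetric])
  define f where "f = (\<lambda>z. - 1 / 2 * N\<^sup>2 * ln (1 - fst z * snd z) + 1 / 2 * ((harm_kernel (Suc k) (fst z) (snd z))\<^sup>2 * ln (1 - fst z * snd z)))"
  define l where "l = (\<lambda>z. - ln (chordal_dist (fst z) (snd z)))"
  have lm [measurable]: "l \<in> borel_measurable (\<sigma> \<Otimes>\<^sub>M \<sigma>)" unfolding l_def ln_chordal_dist by measurable
  have lf: "l z * enn2real (ennreal (r z)) = f (xi_pair z)" for z
    unfolding r0 by (simp add: l_def r_def f_def ln_chordal_dist harmonic_kernel_xi algebra_simps)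
  have fm: "f \<in> borel_measurable (borel \<Otimes>\<^sub>M borel)" unfolding f_def by measurable
  have sym: "f (x, y) = f (y, x)" "f (- x, - y) = f (x, y)" for x y
    by (simp_all add: f_def mult.commute harm_kernel_commute[of _ y x] harm_kernel_uminus)
  note ih = harm_kernel_square_integral(1)[of "Suc k", simplified]
  have i1: "integrable unif2 (\<lambda>z. - 1 / 2 * N\<^sup>2 * ln (1 - fst z * snd z))"
    by (rule integrable_mult_right[OF integrable_ln_unif2])
  have i2: "integrable unif2 (\<lambda>z. 1 / 2 * ((harm_kernel (Suc k) (fst z) (snd z))\<^sup>2 * ln (1 - fst z * snd z)))"
    by (rule integrable_mult_right[OF ih])
  have fi: "integrable unif2 f" unfolding f_def by (rule Bochner_Integration.integrable_add[OF i1 i2])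
  have "(\<integral>x. log_energy x \<partial>\<X>) = (\<integral>x. (\<Sum>P\<in>x. \<Sum>Q\<in>x - {P}. l (P, Q)) \<partial>\<X>)"
    by (simp add: log_energy_def l_def sum_negf)
  also have "\<dots> = (\<integral>z. l z * enn2real (ennreal (r z)) \<partial>(\<sigma> \<Otimes>\<^sub>M \<sigma>))"
    by (rule PI.expectation_pair_sum[OF lm]) (use integral_xi2(1)[OF inv \<sigma> fm sym] fi in \<open>simp_all add: lf\<close>)
  also have "\<dots> = (\<integral>z. f z \<partial>unif2)" unfolding lf by (rule integral_xi2(2)[OF inv \<sigma> fm sym])
  also have "\<dots> = (\<integral>z. - 1 / 2 * N\<^sup>2 * ln (1 - fst z * snd z) \<partial>unif2) +
      (\<integral>z. 1 / 2 * ((harm_kernel (Suc k) (fst z) (snd z))\<^sup>2 * ln (1 - fst z * snd z)) \<partial>unif2)"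
    unfolding f_def by (rule Bochner_Integration.integral_add[OF i1 i2])
  also have "(\<integral>z. - 1 / 2 * N\<^sup>2 * ln (1 - fst z * snd z) \<partial>unif2) = W_log * N\<^sup>2"
    unfolding W_log_eq[OF inv] by simp
  finally show ?thesis by (simp add: N_def)
qed

theorem theorem2p8:
  fixes \<sigma> :: "(real^4) set measure"
    and \<X> :: "nat \<Rightarrow> (real^4) set set measure"
  assumes "invariant_prob_Gr24 \<sigma>"
    and "\<And>k. k \<ge> 1 \<Longrightarrow> harmonic_ensemble \<sigma> k (\<X> k)"
  defines "N \<equiv> \<lambda>k. real (harmonic_dim k)"
    and "C_log \<equiv> (1 + 2 * catalan_const) / pi + 1 / 4 - euler_mascheroni + ln 2 / 4"
  shows "(\<lambda>k. (\<integral>x. log_energy x \<partial>\<X> k)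
             - (W_log * (N k)\<^sup>2 - 1 / 4 * N k * ln (N k) + C_log * N k))
           \<in> o(\<lambda>k. N k)"
proof -
  \<comment> \<open>The ensembles are given for k \<ge> 1, so the two sides are compared eventually,
    which is enough for a little-o statement.\<close>
  have "\<forall>\<^sub>F k in sequentially. (\<integral>x. log_energy x \<partial>\<X> k) - (W_log * (N k)\<^sup>2 - 1 / 4 * N k * ln (N k) + C_log * N k) =
    1 / 2 * (\<integral>z. (harm_kernel (Suc k) (fst z) (snd z))\<^sup>2 * ln (1 - fst z * snd z) \<partial>unif2) - (- 1 / 4 * N k * ln (N k) + C_log * N k)"
    using eventually_ge_at_top[of 1]
  proof eventually_elim
    case (elim k)
    show ?case unfolding expected_log_energy[OF assms(1) assms(2)[OF elim]] N_def by simp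
  qed
  thus ?thesis
    using harm_kernel_energy_asymp unfolding N_def C_log_def
    by (subst landau_o.small.in_cong) auto
qed

end
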